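(* Let $\omega_0,\omega_1,\omega_2\in\mathscr P(\mathbf R^{2d})$ satisfy, for some constant $C$, $$\omega_0(X_1+X_2)\le C\,\omega_1(X_1)\,\omega_2(X_2),\qquad X_1,X_2\in\mathbf R^{2d},$$ and let $p,p_1,p_2\in[1,\infty]$ satisfy $p_1,p_2\le p$ and $$\max\Big(\frac1p,\frac1{p'}\Big)\le\frac1{p_1}+\frac1{p_2}-\frac1p\le 1 .$$ Then the map $(a_1,a_2)\mapsto a_1*_\sigma a_2$ from $\mathscr S(\mathbf R^{2d})\times\mathscr S(\mathbf R^{2d})$ to $\mathscr S(\mathbf R^{2d})$ extends uniquely to a continuous mapping from $L^{p_1}_{(\omega_1)}(\mathbf R^{2d})\times L^{p_2}_{(\omega_2)}(\mathbf R^{2d})$ to $L^p_{(\omega_0)}(\mathbf R^{2d})$. Furthermore, for some constant $C$, $$\|a_1*_\sigma a_2\|_{L^p_{(\omega_0)}}\le C\,\|a_1\|_{L^{p_1}_{(\omega_1)}}\|a_2\|_{L^{p_2}_{(\omega_2)}}$$ when $a_1\in L^{p_1}_{(\omega_1)}(\mathbf R^{2d})$ and $a_2\in L^{p_2}_{(\omega_2)}(\mathbf R^{2d})$.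
   Context: $\mathscr P(\mathbf R^n)$ is the set of positive measurable functions $\omega$ on $\mathbf R^n$ that are polynomially moderate: there are a constant $C$ and a polynomial $v$ (positive on $\mathbf R^n$) with $\omega(x+y)\le C\omega(x)v(y)$ for all $x,y\in\mathbf R^n$. $p'$ is the conjugate exponent of $p$, $1/p+1/p'=1$. $L^p_{(\omega)}(\mathbf R^{2d})$ is the weighted Lebesgue space with norm $\|f\|_{L^p_{(\omega)}}=\|f\omega\|_{L^p}$. The standard symplectic form on $\mathbf R^{2d}$ is $\sigma(X,Y)=\langle y,\xi\rangle-\langle x,\eta\rangle$ for $X=(x,\xi)$, $Y=(y,\eta)$, and the twisted convolution of $a,b\in\mathscr S(\mathbf R^{2d})$ is $(a*_\sigma b)(X)=(2/\pi)^{d/2}\int a(X-Y)b(Y)e^{2i\sigma(X,Y)}\,dY$.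
   Formalization: When p1 or p2 is infinite (so p is infinite and the other exponent is 1), uniqueness among norm-continuous extensions fails; there uniqueness is claimed among extensions that are also weak*-to-weak* continuous in the L^∞ argument, and the extension is shown to have this property. *)

theory Defs
  imports "HOL-Analysis.Analysis" "HOL-Probability.Essential_Supremum"
begin

text \<open>Polynomially moderate weights. Measurability is Lebesgue measurability throughout.\<close>

definition poly_moderate :: "('a::euclidean_space \<Rightarrow> real) \<Rightarrow> bool" where
  "poly_moderate \<omega> \<longleftrightarrow>
     \<omega> \<in> borel_measurable lebesgue \<and> (\<forall>x. 0 < \<omega> x) \<and>
     (\<exists>C v. real_polynomial_function v \<and> (\<forall>x. 0 < v x) \<and>
            (\<forall>x y. \<omega> (x + y) \<le> C * \<omega> x * v y))"

text \<open>Iterated partial derivatives along the basis vectors in a list. When all of them are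
  differentiable, the function is smooth and the list encodes a multi-index.\<close>

primrec iter_deriv :: "'a list \<Rightarrow> ('a::euclidean_space \<Rightarrow> complex) \<Rightarrow> 'a \<Rightarrow> complex" where
  "iter_deriv [] f = f"
| "iter_deriv (b # bs) f = (\<lambda>x. frechet_derivative (iter_deriv bs f) (at x) b)"

definition Schwartz :: "('a::euclidean_space \<Rightarrow> complex) set" where
  "Schwartz = {f. \<forall>bs. set bs \<subseteq> Basis \<longrightarrow>
      (\<forall>x. iter_deriv bs f differentiable (at x)) \<and>
      (\<forall>k. \<exists>C. \<forall>x. (1 + norm x) ^ k * cmod (iter_deriv bs f x) \<le> C)}"

text \<open>Exponents are extended reals in \<open>[1, \<infinity>]\<close>. Elements of the Lebesgue spaces are
  represented by functions, so the topologies below are not Hausdorff: they are pulled back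
  along the quotient by equality almost everywhere. A map between such function spaces that
  is continuous respects equality almost everywhere and is the same thing as a continuous
  map between the quotients.\<close>

definition Lp_space :: "ereal \<Rightarrow> ('a::euclidean_space \<Rightarrow> real) \<Rightarrow> ('a \<Rightarrow> complex) set" where
  "Lp_space p \<omega> = {f \<in> borel_measurable lebesgue.
      if p = \<infinity> then esssup lebesgue (\<lambda>x. ereal (cmod (f x * of_real (\<omega> x)))) < \<infinity>
      else integrable lebesgue (\<lambda>x. cmod (f x * of_real (\<omega> x)) powr real_of_ereal p)}"

definition Lp_norm :: "ereal \<Rightarrow> ('a::euclidean_space \<Rightarrow> real) \<Rightarrow> ('a \<Rightarrow> complex) \<Rightarrow> real" where
  "Lp_norm p \<omega> f =
     (if p = \<infinity> then real_of_ereal (esssup lebesgue (\<lambda>x. ereal (cmod (f x * of_real (\<omega> x)))))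
      else (LINT x|lebesgue. cmod (f x * of_real (\<omega> x)) powr real_of_ereal p)
             powr (1 / real_of_ereal p))"

definition Lp_topology :: "ereal \<Rightarrow> ('a::euclidean_space \<Rightarrow> real) \<Rightarrow> ('a \<Rightarrow> complex) topology" where
  "Lp_topology p \<omega> = topology_generated_by
     {{g \<in> Lp_space p \<omega>. Lp_norm p \<omega> (\<lambda>x. g x - f x) < r} | f r. f \<in> Lp_space p \<omega> \<and> 0 < r}"

text \<open>The weak* topology on the weighted \<open>L\<^sup>\<infinity>\<close> space, regarded as the dual of the \<open>L\<^sup>1\<close> space with
  the reciprocal weight.\<close>

definition weak_star_topology :: "('a::euclidean_space \<Rightarrow> real) \<Rightarrow> ('a \<Rightarrow> complex) topology" where
  "weak_star_topology \<omega> = topology_generated_by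
     {{f \<in> Lp_space \<infinity> \<omega>. (LINT x|lebesgue. f x * g x) \<in> U} | g U.
        g \<in> Lp_space 1 (\<lambda>x. 1 / \<omega> x) \<and> open U}"

text \<open>A point of phase space is a pair \<open>(x, \<xi>)\<close>; the dimension \<open>d\<close> is \<open>CARD('d)\<close>.\<close>

type_synonym 'd phase_space = "(real ^ 'd) \<times> (real ^ 'd)"

definition sympl :: "'d::finite phase_space \<Rightarrow> 'd phase_space \<Rightarrow> real" where
  "sympl X Y = fst Y \<bullet> snd X - fst X \<bullet> snd Y"

definition twisted_conv ::
  "('d::finite phase_space \<Rightarrow> complex) \<Rightarrow> ('d phase_space \<Rightarrow> complex) \<Rightarrow> 'd phase_space \<Rightarrow> complex"
  where
  "twisted_conv a b X = of_real ((2 / pi) powr (real CARD('d) / 2)) *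
     (LINT Y|lebesgue. a (X - Y) * b Y * exp (2 * \<i> * of_real (sympl X Y)))"

text \<open>Continuous extensions of the twisted convolution from Schwartz functions. If the first two
  exponents are finite, this is plain joint continuity in norm. Schwartz functions are not norm
  dense in \<open>L\<^sup>\<infinity>\<close>, and norm continuity alone does not determine an extension there;
  so an \<open>L\<^sup>\<infinity>\<close> argument is moreover required to act continuously for the weak* topologies,
  for which Schwartz functions are dense. Under the exponent conditions of the theorem,
  \<open>p\<^sub>1 = \<infinity>\<close> or \<open>p\<^sub>2 = \<infinity>\<close> forces \<open>p = \<infinity>\<close>, so that the weak* topology on the target makes sense.\<close>

definition twisted_conv_extension ::
  "ereal \<Rightarrow> ereal \<Rightarrow> ereal \<Rightarrow> ('d::finite phase_space \<Rightarrow> real) \<Rightarrow> ('d phase_space \<Rightarrow> real) \<Rightarrow>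
   ('d phase_space \<Rightarrow> real) \<Rightarrow>
   (('d phase_space \<Rightarrow> complex) \<times> ('d phase_space \<Rightarrow> complex) \<Rightarrow> 'd phase_space \<Rightarrow> complex) \<Rightarrow> bool"
  where
  "twisted_conv_extension p1 p2 p \<omega>1 \<omega>2 \<omega>0 T \<longleftrightarrow>
     (\<forall>a1 \<in> Schwartz. \<forall>a2 \<in> Schwartz. AE X in lebesgue. T (a1, a2) X = twisted_conv a1 a2 X) \<and>
     continuous_map (prod_topology (Lp_topology p1 \<omega>1) (Lp_topology p2 \<omega>2)) (Lp_topology p \<omega>0) T \<and>
     (p1 = \<infinity> \<longrightarrow> (\<forall>a2 \<in> Lp_space p2 \<omega>2.
        continuous_map (weak_star_topology \<omega>1) (weak_star_topology \<omega>0) (\<lambda>a1. T (a1, a2)))) \<and>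
     (p2 = \<infinity> \<longrightarrow> (\<forall>a1 \<in> Lp_space p1 \<omega>1.
        continuous_map (weak_star_topology \<omega>2) (weak_star_topology \<omega>0) (\<lambda>a2. T (a1, a2))))"

end

theory Submission
  imports Defs "HOL-Complex_Analysis.Conformal_Mappings" "HOL-Probability.Characteristic_Functions"
    "HOL-Probability.Sinc_Integral"
begin

text \<open>
The extension is the defining integral itself, which converges at almost every point. What has to be
shown is the norm estimate; continuity and uniqueness are soft.

Put \<open>x = 1/p\<^sub>1\<close>, \<open>y = 1/p\<^sub>2\<close> and \<open>w = 1 - 1/p\<close>. The hypotheses on the exponents say that \<open>x + w\<close>, \<open>y + w\<close>
and \<open>x + y\<close> are at least \<open>1\<close> and that \<open>x + y + w\<close> is at most \<open>2\<close>. This describes the tetrahedron with the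
vertices \<open>(1,0,1)\<close>, \<open>(0,1,1)\<close>, \<open>(1,1,0)\<close> and \<open>(1/2,1/2,1/2)\<close>. By duality the estimate is a bound for the
trilinear form \<open>\<integral>\<integral> K(X,Y) F(X-Y) G(Y) H(X) dX dY\<close>, where \<open>K\<close> is the oscillating factor times
\<open>\<omega>\<^sub>0(X) / (\<omega>\<^sub>1(X-Y) \<omega>\<^sub>2(Y))\<close>, and \<open>F\<close>, \<open>G\<close>, \<open>H\<close> have norm one in \<open>L\<^sup>1\<^sup>/\<^sup>x\<close>, \<open>L\<^sup>1\<^sup>/\<^sup>y\<close>, \<open>L\<^sup>1\<^sup>/\<^sup>w\<close>. The set of exponents
for which a given bound holds is convex (\<open>trilinear_bounded_convex\<close>, the Riesz-Thorin theorem, from the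
three lines theorem), so only the four vertices are needed. At the first three, boundedness of \<open>K\<close>
suffices (\<open>trilinear_bounded_vertex\<close>); they are corners of Young's inequality.

The vertex \<open>(1/2,1/2,1/2)\<close> is the weighted \<open>L\<^sup>2\<close> estimate (\<open>tconv_L2_bound\<close>), where the oscillation
matters. Without weights it says that the product of two Hilbert-Schmidt operators is Hilbert-Schmidt:
twisted convolution of symbols is composition of the operators \<open>\<integral> a(X) \<rho>(X) dX\<close>, with \<open>\<rho>\<close> a projective
representation of phase space. To carry weights along, these operators are written as matrices
\<open>M\<^sub>a(V,W)\<close> in the Gaussian coherent states \<open>\<rho>(W)g\<close>. Twisted convolution becomes matrix multiplication
(\<open>gabor_matrix_tconv\<close>). The square integral of \<open>M\<^sub>a(V,W) \<omega>(V-W)\<close> is a constant times that of \<open>a\<close>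
against a Gaussian average of \<open>\<omega>\<^sup>2\<close> (\<open>gabor_matrix_energy\<close>, from the Plancherel identity), and such an
average is comparable to \<open>\<omega>\<^sup>2\<close> because \<open>\<omega>\<close> is moderate (\<open>gaussian_average_weight\<close>). As
\<open>\<omega>\<^sub>0(V-W) \<le> C \<omega>\<^sub>1(V-Z) \<omega>\<^sub>2(Z-W)\<close>, the weights pass through the matrix product, and the Cauchy-Schwarz
inequality finishes the proof.

All exponents, including \<open>\<infinity>\<close>, are treated alike by writing the functions in the ball of radius \<open>r\<close> of \<open>L\<^sup>p\<close>
as those with \<open>|f| \<le> r u\<^sup>1\<^sup>/\<^sup>p\<close> for some \<open>u \<ge> 0\<close> with integral at most one.

Weak* continuity in an \<open>L\<^sup>\<infinity>\<close> argument \<open>B\<close> holds because, by Fubini's theorem, pairing the twisted convolution with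
\<open>g\<close> is pairing \<open>B\<close> with an integrable function (\<open>weak_star_adjoint\<close>). For uniqueness, one argument is
varied at a time. Every function in a weighted Lebesgue space is reached from Schwartz functions by
repeated limits almost everywhere under a fixed majorant (\<open>dominated_density\<close>), and such limits are limits
in norm if the exponent is finite and weak* limits if it is not.
\<close>

section \<open>Three lines theorem for exponential sums and Gaussian integrals\<close>

text \<open>In Riesz-Thorin interpolation of simple functions only exponential sums
\<open>h(s) = \<Sum> c\<^sub>q exp(l\<^sub>q + s m\<^sub>q)\<close> occur. They are bounded on the strip, so the maximum principle on a large
rectangle, applied after damping by a Gaussian factor, gives the bound on the line \<open>Re s = \<theta>\<close> from the two boundary lines.\<close>

lemma three_lines_exp_sum:
  fixes c :: "'q \<Rightarrow> complex" and l m :: "'q \<Rightarrow> real"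
  assumes "finite Q"
    and b0: "\<And>t. cmod (\<Sum>q\<in>Q. c q * of_real (exp (l q)) * cis (t * m q)) \<le> M"
    and b1: "\<And>t. cmod (\<Sum>q\<in>Q. c q * of_real (exp (l q + m q)) * cis (t * m q)) \<le> M"
    and th: "0 \<le> \<theta>" "\<theta> \<le> 1"
  shows "cmod (\<Sum>q\<in>Q. c q * of_real (exp (l q + \<theta> * m q))) \<le> M"
proof -
  define h where "h s = (\<Sum>q\<in>Q. c q * exp (of_real (l q) + s * of_real (m q)))" for s :: complex
  define B where "B = (\<Sum>q\<in>Q. cmod (c q) * exp (\<bar>l q\<bar> + \<bar>m q\<bar>))"
  have hB: "cmod (h s) \<le> B" if "0 \<le> Re s" "Re s \<le> 1" for s
    unfolding h_def B_def
  proof (rule order.trans[OF norm_sum] , rule sum_mono)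
    fix q assume "q \<in> Q"
    have "Re s * m q \<le> 1 * \<bar>m q\<bar>"
      using that by (meson abs_ge_self abs_ge_zero mult_mono' mult_left_mono order.trans mult_right_mono)
    then show "cmod (c q * exp (of_real (l q) + s * of_real (m q))) \<le> cmod (c q) * exp (\<bar>l q\<bar> + \<bar>m q\<bar>)"
      by (auto simp: norm_mult intro!: mult_left_mono)
  qed
  have B0: "0 \<le> B" unfolding B_def by (intro sum_nonneg) auto
  have M0: "0 \<le> M" using b0[of 0] norm_ge_zero order_trans by blast
  have hline: "cmod (h (Complex 0 t)) \<le> M" "cmod (h (Complex 1 t)) \<le> M" for t
  proof -
    have "exp (of_real (l q) + Complex 0 t * of_real (m q)) = of_real (exp (l q)) * cis (t * m q)" for q
      by (simp add: exp_eq_polar)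
    then show "cmod (h (Complex 0 t)) \<le> M" using b0[of t] by (simp add: h_def mult.assoc)
    have "exp (of_real (l q) + Complex 1 t * of_real (m q)) = of_real (exp (l q + m q)) * cis (t * m q)" for q
      by (simp add: exp_eq_polar)
    then show "cmod (h (Complex 1 t)) \<le> M" using b1[of t] by (simp add: h_def mult.assoc)
  qed
  have key: "cmod (h (of_real \<theta>)) * exp (\<epsilon> * (\<theta>\<^sup>2 - 1)) \<le> M + \<epsilon>" if e: "\<epsilon> > 0" for \<epsilon>
  proof -
    have "((\<lambda>R. B * exp (- \<epsilon> * R\<^sup>2)) \<longlongrightarrow> 0) at_top"
    proof -
      have "filterlim (\<lambda>R::real. \<epsilon> * R\<^sup>2) at_top at_top"
        by (intro filterlim_tendsto_pos_mult_at_top[OF tendsto_const e] filterlim_pow_at_top filterlim_ident) auto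
      then have "((\<lambda>R. exp (- (\<epsilon> * R\<^sup>2))) \<longlongrightarrow> 0) at_top"
        by (intro filterlim_compose[OF exp_at_bot]) (simp add: filterlim_uminus_at_top[symmetric])
      from tendsto_mult_left[OF this, of B] show ?thesis by simp
    qed
    then have "\<forall>\<^sub>F R in at_top. B * exp (- \<epsilon> * R\<^sup>2) < M + \<epsilon>"
      using M0 e by (intro order_tendstoD(2)) auto
    then obtain R where R: "R > 0" "B * exp (- \<epsilon> * R\<^sup>2) < M + \<epsilon>"
      by (metis (mono_tags, lifting) eventually_at_top_dense eventually_conj eventually_gt_at_top eventually_happens' trivial_limit_at_top_linorder)
    define S where "S = cbox (Complex 0 (-R)) (Complex 1 R)"
    \<comment> \<open>on the strip the damping factor has modulus at most one, and it decays in the imaginary direction\<close>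
    define f where "f s = h s * exp (of_real \<epsilon> * (s\<^sup>2 - 1))" for s
    have nf: "cmod (f s) = cmod (h s) * exp (\<epsilon> * ((Re s)\<^sup>2 - (Im s)\<^sup>2 - 1))" for s
      by (simp add: f_def norm_mult power2_eq_square)
    have "cmod (f (of_real \<theta>)) \<le> M + \<epsilon>"
    proof (rule maximum_modulus_frontier[where f = f and S = S])
      show "bounded S" by (simp add: S_def)
      show "of_real \<theta> \<in> S" using th R by (simp add: S_def in_cbox_complex_iff)
      have "f holomorphic_on UNIV" unfolding f_def h_def by (intro holomorphic_intros)
      then show "f holomorphic_on interior S" using holomorphic_on_subset by blast
      show "continuous_on (closure S) f" unfolding f_def h_def by (intro continuous_intros)
      fix z assume "z \<in> frontier S"
      then have z: "z \<in> S" "\<not> z \<in> box (Complex 0 (-R)) (Complex 1 R)"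
        by (auto simp: S_def frontier_def)
      then have Re: "0 \<le> Re z" "Re z \<le> 1" by (auto simp: S_def in_cbox_complex_iff)
      have re2: "(Re z)\<^sup>2 \<le> 1" using Re by (simp add: abs_square_le_1)
      have ex1: "exp (\<epsilon> * ((Re z)\<^sup>2 - (Im z)\<^sup>2 - 1)) \<le> 1"
      proof -
        have "(Re z)\<^sup>2 - (Im z)\<^sup>2 - 1 \<le> 0" using re2 zero_le_power2[of "Im z"] by linarith
        then show ?thesis using e by (simp add: mult_nonneg_nonpos)
      qed
      have zC: "z = Complex (Re z) (Im z)" by simp
      consider "Re z = 0" | "Re z = 1" | "\<bar>Im z\<bar> = R"
        using z R by (fastforce simp: S_def in_cbox_complex_iff in_box_complex_iff)
      then show "cmod (f z) \<le> M + \<epsilon>"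
      proof cases
        case 3
        have "cmod (f z) \<le> B * exp (- \<epsilon> * R\<^sup>2)"
          unfolding nf
        proof (rule mult_mono)
          have "(Im z)\<^sup>2 = R\<^sup>2" using 3 by (metis power2_abs)
          then show "exp (\<epsilon> * ((Re z)\<^sup>2 - (Im z)\<^sup>2 - 1)) \<le> exp (- \<epsilon> * R\<^sup>2)"
            using e re2 by (simp add: algebra_simps)
        qed (use hB Re B0 in auto)
        then show ?thesis using R by linarith
      next
        case 1
        have "cmod (f z) \<le> M * 1" unfolding nf
          using hline(1)[of "Im z"] 1 zC ex1 M0 by (intro mult_mono) auto
        then show ?thesis using e by simp
      next
        case 2
        have "cmod (f z) \<le> M * 1" unfolding nf
          using hline(2)[of "Im z"] 2 zC ex1 M0 by (intro mult_mono) auto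
        then show ?thesis using e by simp
      qed
    qed
    then show ?thesis by (simp add: nf)
  qed
  have "cmod (h (of_real \<theta>)) \<le> M"
  proof (rule tendsto_le)
    show "((\<lambda>\<epsilon>. M + \<epsilon>) \<longlongrightarrow> M) (at_right 0)" by (auto intro!: tendsto_eq_intros)
    show "((\<lambda>\<epsilon>. cmod (h (of_real \<theta>)) * exp (\<epsilon> * (\<theta>\<^sup>2 - 1))) \<longlongrightarrow> cmod (h (of_real \<theta>))) (at_right 0)"
      by (auto intro!: tendsto_eq_intros)
    show "\<forall>\<^sub>F \<epsilon> in at_right 0. cmod (h (of_real \<theta>)) * exp (\<epsilon> * (\<theta>\<^sup>2 - 1)) \<le> M + \<epsilon>"
      using key by (auto simp: eventually_at_right_field intro!: exI[of _ 1])
  qed auto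
  moreover have "h (of_real \<theta>) = (\<Sum>q\<in>Q. c q * of_real (exp (l q + \<theta> * m q)))"
    by (simp add: h_def exp_of_real[symmetric])
  ultimately show ?thesis by simp
qed

lemma borel_measurable_cis [measurable]: "cis \<in> borel_measurable borel"
  by (intro borel_measurable_continuous_onI) (auto simp: cis_conv_exp intro!: continuous_intros)

text \<open>Lebesgue measure on a Euclidean space is a product measure in coordinates. This reduces
integrals of products of functions of one coordinate each to the line.\<close>

lemma lborel_integral_prod_Basis:
  fixes f :: "'a::euclidean_space \<Rightarrow> real \<Rightarrow> 'b::{real_normed_field,banach,second_countable_topology}"
  assumes int: "\<And>b. b \<in> Basis \<Longrightarrow> integrable lborel (f b)"
  shows "integrable lborel (\<lambda>x::'a. \<Prod>b\<in>Basis. f b (x \<bullet> b))"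
    and "(LINT x|lborel. (\<Prod>b\<in>Basis. f b ((x::'a) \<bullet> b))) = (\<Prod>b\<in>Basis. LINT t|lborel. f b t)"
proof -
  interpret p: product_sigma_finite "\<lambda>b::'a. lborel :: real measure" ..
  define \<Phi> where "\<Phi> = (\<lambda>g. \<Sum>b\<in>(Basis::'a set). g b *\<^sub>R b :: 'a)"
  have lb: "(lborel :: 'a measure) = distr (\<Pi>\<^sub>M b\<in>Basis. lborel) borel \<Phi>"
    unfolding lborel_def[where 'a='a] \<Phi>_def lborel_eq_real ..
  have [measurable]: "\<Phi> \<in> measurable (\<Pi>\<^sub>M b\<in>Basis. lborel) borel"
    unfolding \<Phi>_def by measurable
  have [measurable]: "f b \<in> borel_measurable borel" if "b \<in> Basis" for b
    using int[OF that] by auto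
  have ip: "\<Phi> g \<bullet> b = g b" if "b \<in> Basis" for g b
    using that by (simp add: \<Phi>_def inner_sum_left inner_Basis if_distrib cong: if_cong)
  have m: "(\<lambda>x::'a. \<Prod>b\<in>Basis. f b (x \<bullet> b)) \<in> borel_measurable borel" by measurable
  show "integrable lborel (\<lambda>x::'a. \<Prod>b\<in>Basis. f b (x \<bullet> b))"
    unfolding lb by (subst integrable_distr_eq) (use m int in \<open>auto simp: ip intro!: p.product_integrable_prod\<close>)
  show "(LINT x|lborel. (\<Prod>b\<in>Basis. f b ((x::'a) \<bullet> b))) = (\<Prod>b\<in>Basis. LINT t|lborel. f b t)"
    unfolding lb by (subst integral_distr) (use m int in \<open>auto simp: ip p.product_integral_prod\<close>)
qed

text \<open>This is the characteristic function of the standard normal distribution after rescaling.\<close>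

lemma gaussian_fourier_real:
  fixes s \<xi> :: real
  assumes s: "s > 0"
  shows "integrable lborel (\<lambda>z::real. of_real (exp (- s * z\<^sup>2)) * cis (\<xi> * z))"
    and "(LINT z|lborel. of_real (exp (- s * z\<^sup>2)) * cis (\<xi> * z)) = of_real (sqrt (pi / s) * exp (- \<xi>\<^sup>2 / (4 * s)))"
proof -
  define k where "k = sqrt (2 * s)"
  have k: "k > 0" "k\<^sup>2 = 2 * s" using s by (auto simp: k_def)
  define G where "G x = of_real (std_normal_density x) * cis (\<xi> / k * x)" for x
  have GI: "integrable lborel G"
    unfolding G_def
    by (rule Bochner_Integration.integrable_bound[of _ std_normal_density])
       (use integrable_std_normal_moment[of 0] in \<open>auto simp: norm_mult norm_divide normal_density_def\<close>)
  have Gv: "integral\<^sup>L lborel G = of_real (exp (- (\<xi> / k)\<^sup>2 / 2))"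
  proof -
    have "char std_normal_distribution (\<xi> / k) = integral\<^sup>L lborel G"
      unfolding char_def G_def
      by (subst integral_density) (auto simp: normal_density_nonneg scaleR_conv_of_real cis_conv_exp)
    then show ?thesis by (simp add: char_std_normal_distribution)
  qed
  have eq: "of_real (exp (- s * z\<^sup>2)) * cis (\<xi> * z) = of_real (sqrt (2 * pi)) * G (0 + k * z)" for z
  proof -
    have "(k * z)\<^sup>2 / 2 = s * z\<^sup>2" by (simp add: power_mult_distrib k)
    then show ?thesis using k by (simp add: G_def normal_density_def)
  qed
  show "integrable lborel (\<lambda>z. of_real (exp (- s * z\<^sup>2)) * cis (\<xi> * z))"
    unfolding eq using lborel_integrable_real_affine[OF GI, of k 0] k
    by (intro integrable_mult_right) auto
  have "(LINT z|lborel. G (0 + k * z)) = of_real (1 / k) * integral\<^sup>L lborel G"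
    using lborel_integral_real_affine[of k G 0] k by (simp add: scaleR_conv_of_real field_simps)
  moreover have "(\<xi> / k)\<^sup>2 / 2 = \<xi>\<^sup>2 / (4 * s)" by (simp add: power_divide k)
  moreover have "sqrt (2 * pi) / k = sqrt (pi / s)" using s by (simp add: k_def real_sqrt_divide[symmetric])
  ultimately have v: "(LINT z|lborel. G (0 + k * z)) = of_real (exp (- \<xi>\<^sup>2 / (4 * s)) / k)"
    by (simp add: Gv)
  have "of_real (sqrt (2 * pi)) * (LINT z|lborel. G (0 + k * z))
      = of_real ((sqrt (2 * pi) / k) * exp (- \<xi>\<^sup>2 / (4 * s)))"
    unfolding v of_real_mult[symmetric] by (simp add: field_simps)
  then show "(LINT z|lborel. of_real (exp (- s * z\<^sup>2)) * cis (\<xi> * z)) = of_real (sqrt (pi / s) * exp (- \<xi>\<^sup>2 / (4 * s)))"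
    by (simp only: eq integral_mult_right_zero \<open>sqrt (2 * pi) / k = sqrt (pi / s)\<close>)
qed

lemma gaussian_fourier:
  fixes \<xi> :: "'a::euclidean_space"
  assumes s: "s > 0"
  shows "integrable lborel (\<lambda>z::'a. of_real (exp (- s * (norm z)\<^sup>2)) * cis (\<xi> \<bullet> z))"
    and "(LINT z|lborel. of_real (exp (- s * (norm z)\<^sup>2)) * cis (\<xi> \<bullet> z))
      = of_real (sqrt (pi / s) ^ DIM('a) * exp (- (norm \<xi>)\<^sup>2 / (4 * s)))"
proof -
  have eq: "of_real (exp (- s * (norm z)\<^sup>2)) * cis (\<xi> \<bullet> z)
     = (\<Prod>b\<in>Basis. of_real (exp (- s * (z \<bullet> b)\<^sup>2)) * cis ((\<xi> \<bullet> b) * (z \<bullet> b)))" for z :: 'a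
  proof -
    have "(norm z)\<^sup>2 = (\<Sum>b\<in>Basis. (z \<bullet> b)\<^sup>2)"
      by (subst power2_norm_eq_inner, subst euclidean_inner) (simp add: power2_eq_square)
    then have "exp (- s * (norm z)\<^sup>2) = (\<Prod>b\<in>Basis. exp (- s * (z \<bullet> b)\<^sup>2))"
      by (simp add: sum_distrib_left exp_sum[symmetric] sum_negf)
    moreover have "cis (\<xi> \<bullet> z) = (\<Prod>b\<in>Basis. cis ((\<xi> \<bullet> b) * (z \<bullet> b)))"
      by (subst euclidean_inner) (simp add: cis_conv_exp sum_distrib_left exp_sum)
    ultimately show ?thesis by (simp add: prod.distrib)
  qed
  show "integrable lborel (\<lambda>z::'a. of_real (exp (- s * (norm z)\<^sup>2)) * cis (\<xi> \<bullet> z))"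
    unfolding eq
    by (rule lborel_integral_prod_Basis(1)[where f = "\<lambda>b t. of_real (exp (- s * t\<^sup>2)) * cis ((\<xi> \<bullet> b) * t)"])
       (rule gaussian_fourier_real[OF s])
  have "(LINT z|lborel. of_real (exp (- s * (norm (z::'a))\<^sup>2)) * cis (\<xi> \<bullet> z))
     = (\<Prod>b\<in>(Basis::'a set). of_real (sqrt (pi / s) * exp (- (\<xi> \<bullet> b)\<^sup>2 / (4 * s))))"
    unfolding eq
    by (subst lborel_integral_prod_Basis(2)[where f = "\<lambda>b t. of_real (exp (- s * t\<^sup>2)) * cis ((\<xi> \<bullet> b) * t)"])
       (auto simp only: gaussian_fourier_real[OF s])
  also have "\<dots> = of_real (sqrt (pi / s) ^ DIM('a) * exp (- (norm \<xi>)\<^sup>2 / (4 * s)))"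
  proof -
    have "(norm \<xi>)\<^sup>2 = (\<Sum>b\<in>Basis. (\<xi> \<bullet> b)\<^sup>2)"
      by (subst power2_norm_eq_inner, subst euclidean_inner) (simp add: power2_eq_square)
    then show ?thesis
      by (simp add: prod.distrib exp_sum[symmetric] sum_negf sum_divide_distrib flip: of_real_prod)
  qed
  finally show "(LINT z|lborel. of_real (exp (- s * (norm z)\<^sup>2)) * cis (\<xi> \<bullet> z))
      = of_real (sqrt (pi / s) ^ DIM('a) * exp (- (norm \<xi>)\<^sup>2 / (4 * s)))" .
qed

section \<open>Weighted Lebesgue spaces\<close>

text \<open>The ball of radius \<open>r\<close> in \<open>L\<^sup>p\<close> for \<open>x = 1/p\<close>, in a form that makes sense for \<open>p = \<infinity>\<close> as well. Interpolation
becomes transparent: along a segment of exponents the density \<open>u\<close> stays fixed and only the power \<open>x\<close> moves.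
As \<open>0 powr 0 = 0\<close>, the case \<open>x = 0\<close> forces \<open>f\<close> to vanish almost everywhere that \<open>u\<close> does; a strictly positive \<open>u\<close> always serves.\<close>

definition in_Lball :: "real \<Rightarrow> real \<Rightarrow> ('a::euclidean_space \<Rightarrow> complex) \<Rightarrow> bool" where
  "in_Lball x r f \<longleftrightarrow> f \<in> borel_measurable lebesgue \<and>
     (\<exists>u. u \<in> borel_measurable lebesgue \<and> (\<forall>t. 0 \<le> u t) \<and> (\<integral>\<^sup>+ t. ennreal (u t) \<partial>lebesgue) \<le> 1 \<and>
        (AE t in lebesgue. cmod (f t) \<le> r * u t powr x))"

definition unit_gaussian :: "'a::euclidean_space \<Rightarrow> real" where
  "unit_gaussian z = exp (- pi * (norm z)\<^sup>2)"

lemma unit_gaussian_pos: "0 < unit_gaussian z"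
  by (simp add: unit_gaussian_def)

lemma borel_measurable_unit_gaussian [measurable]: "unit_gaussian \<in> borel_measurable borel"
  unfolding unit_gaussian_def by measurable

lemma nn_integral_unit_gaussian: "(\<integral>\<^sup>+ z. ennreal (unit_gaussian z) \<partial>lborel) = 1"
proof -
  have "integrable lborel (\<lambda>z::'a. complex_of_real (unit_gaussian z))"
    using gaussian_fourier(1)[of pi "0::'a"] by (simp add: unit_gaussian_def)
  then have i: "integrable lborel (unit_gaussian :: 'a \<Rightarrow> real)" by (simp only: complex_of_real_integrable_eq)
  have "complex_of_real (integral\<^sup>L lborel (unit_gaussian :: 'a \<Rightarrow> real)) = 1"
    using gaussian_fourier(2)[of pi "0::'a"] by (simp add: unit_gaussian_def flip: integral_complex_of_real)
  then have "integral\<^sup>L lborel (unit_gaussian :: 'a \<Rightarrow> real) = 1" by simp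
  then show ?thesis using i by (subst nn_integral_eq_integral) (auto simp: unit_gaussian_pos less_imp_le)
qed

text \<open>Borel versions of the densities in \<open>in_Lball\<close>. Bounds by them are going to hold at every point, so that they can be composed
with \<open>(X, Y) \<mapsto> X - Y\<close> and integrated by Fubini's theorem.\<close>

definition unit_density :: "('a::euclidean_space \<Rightarrow> real) \<Rightarrow> bool" where
  "unit_density u \<longleftrightarrow> u \<in> borel_measurable borel \<and> (\<forall>X. 0 \<le> u X) \<and> (\<integral>\<^sup>+X. ennreal (u X) \<partial>lborel) \<le> 1"

lemma unit_densityD:
  assumes "unit_density u"
  shows "u \<in> borel_measurable borel" "\<And>X. 0 \<le> u X" "(\<integral>\<^sup>+X. ennreal (u X) \<partial>lborel) \<le> 1"
  using assms by (auto simp: unit_density_def)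

lemma unit_density_gaussian: "unit_density unit_gaussian"
  by (simp add: unit_density_def unit_gaussian_pos less_imp_le nn_integral_unit_gaussian)

lemma in_Lball_mono:
  assumes f: "in_Lball x r f" and g: "g \<in> borel_measurable lebesgue"
    and le: "AE t in lebesgue. cmod (g t) \<le> c * cmod (f t)" and "0 \<le> c"
  shows "in_Lball x (c * r) g"
proof -
  obtain u where u: "u \<in> borel_measurable lebesgue" "\<And>t. 0 \<le> u t"
    "(\<integral>\<^sup>+ t. ennreal (u t) \<partial>lebesgue) \<le> 1" "AE t in lebesgue. cmod (f t) \<le> r * u t powr x"
    using f unfolding in_Lball_def by blast
  have "AE t in lebesgue. cmod (g t) \<le> (c * r) * u t powr x"
    using le u(4)
  proof eventually_elim
    case (elim t)
    then show ?case using mult_left_mono[OF elim(2) \<open>0 \<le> c\<close>] by (simp add: mult.assoc)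
  qed
  then show ?thesis using u g unfolding in_Lball_def by blast
qed

text \<open>Minkowski's inequality: the mean of the two densities with weights \<open>r/(r+s)\<close> and \<open>s/(r+s)\<close> is a density,
and \<open>t \<mapsto> t powr x\<close> is concave for \<open>x\<close> in \<open>[0, 1]\<close>.\<close>

lemma in_Lball_add:
  assumes f: "in_Lball x r f" and g: "in_Lball x s g" and "0 < r" "0 < s" "0 \<le> x" "x \<le> 1"
  shows "in_Lball x (r + s) (\<lambda>t. f t + g t)"
proof -
  obtain u where u: "u \<in> borel_measurable lebesgue" "\<And>t. 0 \<le> u t"
    "(\<integral>\<^sup>+ t. ennreal (u t) \<partial>lebesgue) \<le> 1" "AE t in lebesgue. cmod (f t) \<le> r * u t powr x"
    using f unfolding in_Lball_def by blast
  obtain v where v: "v \<in> borel_measurable lebesgue" "\<And>t. 0 \<le> v t"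
    "(\<integral>\<^sup>+ t. ennreal (v t) \<partial>lebesgue) \<le> 1" "AE t in lebesgue. cmod (g t) \<le> s * v t powr x"
    using g unfolding in_Lball_def by blast
  define \<theta> where "\<theta> = r / (r + s)"
  have \<theta>: "0 < \<theta>" "\<theta> < 1" "1 - \<theta> = s / (r + s)" using assms by (auto simp: \<theta>_def field_simps)
  define w where "w t = \<theta> * u t + (1 - \<theta>) * v t" for t
  \<comment> \<open>concavity including the end point \<open>0\<close>, where the derivative does not exist\<close>
  have conc: "\<theta> * a powr x + (1 - \<theta>) * b powr x \<le> (\<theta> * a + (1 - \<theta>) * b) powr x"
    if "0 \<le> a" "0 \<le> b" for a b
  proof (cases "a = 0 \<or> b = 0")
    case False
    then have ab: "a > 0" "b > 0" using that by auto
    show ?thesis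
    proof (cases "x = 0")
      case False
      have "concave_on {0<..} (\<lambda>t::real. t powr x)"
        unfolding concave_on_def
      proof (rule f''_ge0_imp_convex)
        show "((\<lambda>t. - (t powr x)) has_real_derivative - (x * t powr (x - 1))) (at t)" if "t \<in> {0<..}" for t
          using that by (auto intro!: derivative_eq_intros)
        show "((\<lambda>t. - (x * t powr (x - 1))) has_real_derivative - (x * ((x - 1) * t powr (x - 1 - 1)))) (at t)" if "t \<in> {0<..}" for t
          using that by (auto intro!: derivative_eq_intros)
        show "0 \<le> - (x * ((x - 1) * t powr (x - 1 - 1)))" if "t \<in> {0<..}" for t
          using that assms by (simp add: mult_nonneg_nonpos mult_nonpos_nonneg)
      qed simp
      from concave_onD[OF this, of "1 - \<theta>" a b] show ?thesis using \<theta>(1,2) ab by simp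
    next
      case True
      have "\<theta> * a + (1 - \<theta>) * b > 0" using ab \<theta>(1,2) by (intro add_pos_pos) auto
      then show ?thesis using ab True by simp
    qed
  next
    case True
    have pw: "c * d powr x \<le> (c * d) powr x" if "0 < c" "c < 1" "0 \<le> d" for c d :: real
    proof -
      have "c powr 1 \<le> c powr x" using that assms by (intro powr_mono') auto
      then show ?thesis using that by (simp add: powr_mult mult_right_mono)
    qed
    show ?thesis using True pw[of \<theta> a] pw[of "1-\<theta>" b] \<theta> that by auto
  qed
  have le: "AE t in lebesgue. cmod (f t + g t) \<le> (r + s) * w t powr x"
    using u(4) v(4)
  proof eventually_elim
    case (elim t)
    have "cmod (f t + g t) \<le> r * u t powr x + s * v t powr x"
      using norm_triangle_ineq[of "f t" "g t"] elim by linarith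
    also have "\<dots> = (r + s) * (\<theta> * u t powr x + (1 - \<theta>) * v t powr x)"
    proof -
      have "(r + s) * \<theta> = r" "(r + s) * (1 - \<theta>) = s" using assms \<theta>(3) by (auto simp: \<theta>_def)
      then show ?thesis by (simp only: distrib_left mult.assoc[symmetric])
    qed
    also have "\<dots> \<le> (r + s) * w t powr x"
      using conc[OF u(2) v(2)] assms unfolding w_def by (intro mult_left_mono) auto
    finally show ?case .
  qed
  have "(\<integral>\<^sup>+ t. ennreal (w t) \<partial>lebesgue) = (\<integral>\<^sup>+ t. ennreal \<theta> * ennreal (u t) + ennreal (1 - \<theta>) * ennreal (v t) \<partial>lebesgue)"
    unfolding w_def using \<theta>(1,2) u(2) v(2) by (intro nn_integral_cong) (simp add: ennreal_mult ennreal_plus)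
  also have "\<dots> = ennreal \<theta> * (\<integral>\<^sup>+ t. ennreal (u t) \<partial>lebesgue) + ennreal (1 - \<theta>) * (\<integral>\<^sup>+ t. ennreal (v t) \<partial>lebesgue)"
    using u(1) v(1) by (subst nn_integral_add) (auto simp: nn_integral_cmult)
  also have "\<dots> \<le> ennreal \<theta> * 1 + ennreal (1 - \<theta>) * 1"
    using u(3) v(3) by (intro add_mono mult_left_mono) auto
  also have "\<dots> = 1" using \<theta> by (simp flip: ennreal_plus)
  finally have w1: "(\<integral>\<^sup>+ t. ennreal (w t) \<partial>lebesgue) \<le> 1" .
  show ?thesis
    unfolding in_Lball_def
  proof (intro conjI exI[of _ w])
    show "(\<lambda>t. f t + g t) \<in> borel_measurable lebesgue" using f g by (auto simp: in_Lball_def)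
    show "w \<in> borel_measurable lebesgue" unfolding w_def using u(1) v(1) by measurable
    show "\<forall>t. 0 \<le> w t" unfolding w_def using \<theta>(1,2) u(2) v(2) by (simp add: add_nonneg_nonneg)
  qed (use w1 le in auto)
qed

lemma Lp_exponent_cases:
  fixes p :: ereal
  assumes "1 \<le> p"
  obtains "p = \<infinity>" "real_of_ereal (1 / p) = 0"
  | q where "p = ereal q" "1 \<le> q" "real_of_ereal (1 / p) = 1 / q"
  using assms by (cases p) (auto simp: one_ereal_def divide_ereal_def inverse_eq_divide)

lemma Lp_norm_nonneg: 
  assumes "1 \<le> p" shows "0 \<le> Lp_norm p \<omega> f"
proof (cases "p = \<infinity>")
  case True
  have "0 = esssup (lebesgue :: 'a measure) (\<lambda>x. 0::ereal)"
    by (subst esssup_const) (auto simp: emeasure_lborel_UNIV)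
  also have "\<dots> \<le> esssup lebesgue (\<lambda>x. ereal (cmod (f x * of_real (\<omega> x))))"
    by (rule esssup_mono) auto
  finally show ?thesis using True by (simp add: Lp_norm_def real_of_ereal_pos)
qed (simp add: Lp_norm_def)

text \<open>For finite \<open>p\<close> the density is \<open>|f \<omega> / r|\<^sup>p\<close>. For \<open>p = \<infinity>\<close> it is any strictly positive one; the Gaussian of mass one is taken.\<close>

lemma Lp_ball_iff:
  fixes f :: "'a::euclidean_space \<Rightarrow> complex"
  assumes p: "1 \<le> p" and w[measurable]: "\<omega> \<in> borel_measurable lebesgue" and wp: "\<And>x. 0 < \<omega> x" and r: "0 < r"
  shows "f \<in> Lp_space p \<omega> \<and> Lp_norm p \<omega> f \<le> r \<longleftrightarrow>
    in_Lball (real_of_ereal (1 / p)) r (\<lambda>t. f t * of_real (\<omega> t))" (is "?L \<longleftrightarrow> ?R")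
proof -
  define F where "F = (\<lambda>t. f t * of_real (\<omega> t))"
  have fm: "f \<in> borel_measurable lebesgue \<longleftrightarrow> F \<in> borel_measurable lebesgue"
  proof
    assume [measurable]: "F \<in> borel_measurable lebesgue"
    have "f = (\<lambda>t. F t / of_real (\<omega> t))"
      unfolding F_def using wp by (metis nonzero_mult_div_cancel_right of_real_eq_0_iff less_irrefl)
    also have "\<dots> \<in> borel_measurable lebesgue" by measurable
    finally show "f \<in> borel_measurable lebesgue" .
  qed (simp add: F_def)
  show ?thesis
    using p
  proof (cases rule: Lp_exponent_cases)
    case 1
    show ?thesis
    proof
      assume L: ?L
      then have [measurable]: "F \<in> borel_measurable lebesgue" using fm by (simp add: Lp_space_def)
      have "esssup lebesgue (\<lambda>x. ereal (cmod (F x))) \<le> ereal r"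
      proof -
        have "esssup lebesgue (\<lambda>x. ereal (cmod (F x))) < \<infinity>" using L 1 by (simp add: Lp_space_def F_def)
        moreover have "real_of_ereal (esssup lebesgue (\<lambda>x. ereal (cmod (F x)))) \<le> r"
          using L 1 by (simp add: Lp_norm_def F_def)
        ultimately show ?thesis by (cases "esssup lebesgue (\<lambda>x. ereal (cmod (F x)))") auto
      qed
      then have "AE t in lebesgue. ereal (cmod (F t)) \<le> ereal r"
        using esssup_AE[of "\<lambda>x. ereal (cmod (F x))" lebesgue] by (auto elim!: eventually_mono dest: order.trans)
      then have "AE t in lebesgue. cmod (F t) \<le> r * unit_gaussian t powr 0"
        using less_imp_neq[OF unit_gaussian_pos] by (auto elim!: eventually_mono)
      moreover have "(\<integral>\<^sup>+ t. ennreal (unit_gaussian (t::'a)) \<partial>lebesgue) \<le> 1"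
        by (subst nn_integral_completion) (auto simp: nn_integral_unit_gaussian)
      ultimately show ?R
        unfolding in_Lball_def 1 F_def[symmetric]
        by (intro conjI exI[of _ unit_gaussian]) (auto simp: unit_gaussian_pos less_imp_le intro: measurable_completion)
    next
      assume R: ?R
      then have [measurable]: "F \<in> borel_measurable lebesgue" by (simp add: in_Lball_def F_def)
      have "AE t in lebesgue. cmod (F t) \<le> r"
      proof -
        obtain u where "AE t in lebesgue. cmod (F t) \<le> r * u t powr 0"
          using R unfolding in_Lball_def 1(2) F_def[symmetric] by blast
        then show ?thesis
        proof eventually_elim
          case (elim t)
          then show ?case using r by (cases "u t = 0") auto
        qed
      qed
      then have e: "esssup lebesgue (\<lambda>x. ereal (cmod (F x))) \<le> ereal r"
        by (intro esssup_I) auto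
      have "f \<in> Lp_space p \<omega>"
        using e 1 fm \<open>F \<in> borel_measurable lebesgue\<close> by (auto simp: Lp_space_def F_def intro: le_less_trans)
      moreover have "Lp_norm p \<omega> f \<le> r"
      proof -
        have "Lp_norm p \<omega> f = real_of_ereal (esssup lebesgue (\<lambda>x. ereal (cmod (F x))))"
          using 1 by (simp add: Lp_norm_def F_def)
        then show ?thesis using e r by (cases "esssup lebesgue (\<lambda>x. ereal (cmod (F x)))") auto
      qed
      ultimately show ?L by simp
    qed
  next
    case (2 q)
    have q0: "q > 0" using 2 by simp
    show ?thesis
    proof
      assume L: ?L
      then have [measurable]: "F \<in> borel_measurable lebesgue" using fm by (simp add: Lp_space_def)
      have int: "integrable lebesgue (\<lambda>t. cmod (F t) powr q)"
        using L 2 by (simp add: Lp_space_def F_def)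
      define N where "N = (LINT t|lebesgue. cmod (F t) powr q)"
      have "N powr (1 / q) \<le> r" using L 2 by (simp add: Lp_norm_def F_def N_def)
      then have "(N powr (1 / q)) powr q \<le> r powr q" using q0 by (intro powr_mono2) auto
      moreover have N0: "0 \<le> N" unfolding N_def by (intro integral_nonneg_AE) auto
      ultimately have N: "N \<le> r powr q" using q0 by (simp add: powr_powr)
      define u where "u t = cmod (F t) powr q / r powr q" for t
      have [measurable]: "u \<in> borel_measurable lebesgue" unfolding u_def by measurable
      have "(\<integral>\<^sup>+ t. ennreal (u t) \<partial>lebesgue) = ennreal (N / r powr q)"
        unfolding u_def N_def using int by (subst nn_integral_eq_integral) auto
      also have "\<dots> \<le> 1" using N r by (simp add: divide_le_eq_1)
      finally have "(\<integral>\<^sup>+ t. ennreal (u t) \<partial>lebesgue) \<le> 1" .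
      moreover have "cmod (F t) \<le> r * u t powr (1 / q)" for t
        using q0 r by (simp add: u_def powr_divide powr_powr)
      ultimately show ?R
        unfolding in_Lball_def 2(3) F_def[symmetric]
        by (intro conjI exI[of _ u]) (auto simp: u_def)
    next
      assume R: ?R
      then have [measurable]: "F \<in> borel_measurable lebesgue" by (simp add: in_Lball_def F_def)
      obtain u where u[measurable]: "u \<in> borel_measurable lebesgue" and u0: "\<And>t. 0 \<le> u t" and
        u1: "(\<integral>\<^sup>+ t. ennreal (u t) \<partial>lebesgue) \<le> 1" and le: "AE t in lebesgue. cmod (F t) \<le> r * u t powr (1 / q)"
        using R unfolding in_Lball_def 2(3) F_def[symmetric] by blast
      have ui: "integrable lebesgue u"
        using u1 u0 by (intro integrableI_nonneg) (auto intro: le_less_trans)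
      have "ennreal (integral\<^sup>L lebesgue u) \<le> 1"
        using u1 ui u0 by (subst nn_integral_eq_integral[symmetric]) auto
      then have u1': "integral\<^sup>L lebesgue u \<le> 1" by simp
      have le': "AE t in lebesgue. cmod (F t) powr q \<le> r powr q * u t"
        using le
      proof eventually_elim
        case (elim t)
        have "cmod (F t) powr q \<le> (r * u t powr (1 / q)) powr q"
          using elim q0 by (intro powr_mono2) auto
        also have "\<dots> = r powr q * u t"
          using q0 r u0[of t] by (simp add: powr_mult powr_powr)
        finally show ?case .
      qed
      have int: "integrable lebesgue (\<lambda>t. cmod (F t) powr q)"
        by (rule Bochner_Integration.integrable_bound[of _ "\<lambda>t. r powr q * u t"]) (use ui le' u0 in auto)
      have "(LINT t|lebesgue. cmod (F t) powr q) \<le> (LINT t|lebesgue. r powr q * u t)"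
        using int ui le' by (intro integral_mono_AE) auto
      also have "\<dots> \<le> r powr q" using u1' by (simp add: mult_left_le)
      finally have "(LINT t|lebesgue. cmod (F t) powr q) powr (1 / q) \<le> (r powr q) powr (1 / q)"
        using q0 by (intro powr_mono2 integral_nonneg_AE) auto
      also have "\<dots> = r" using q0 r by (simp add: powr_powr)
      finally have "Lp_norm p \<omega> f \<le> r" using 2 by (simp add: Lp_norm_def F_def)
      moreover have "f \<in> Lp_space p \<omega>"
        using int 2 fm \<open>F \<in> borel_measurable lebesgue\<close> by (simp add: Lp_space_def F_def)
      ultimately show ?L by simp
    qed
  qed
qed

lemma Lp_space_measurable: "f \<in> Lp_space p \<omega> \<Longrightarrow> f \<in> borel_measurable lebesgue"
  by (simp add: Lp_space_def)

lemma Lp_exponent_bounds: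
  fixes p :: ereal
  assumes "1 \<le> p" shows "0 \<le> real_of_ereal (1 / p)" "real_of_ereal (1 / p) \<le> 1"
  using assms by (cases rule: Lp_exponent_cases; simp)+

text \<open>Comparison of two functions with different weights. The radius of the ball must be positive, whereas the norm
may vanish; hence the detour over \<open>norm + e\<close> here and below.\<close>

lemma Lp_space_bounded_mult:
  fixes f :: "'a::euclidean_space \<Rightarrow> complex"
  assumes p: "1 \<le> p" and w: "\<omega> \<in> borel_measurable lebesgue" "\<And>x. 0 < \<omega> x"
    and w': "\<omega>' \<in> borel_measurable lebesgue" "\<And>x. 0 < \<omega>' x"
    and f: "f \<in> Lp_space p \<omega>" and g: "g \<in> borel_measurable lebesgue" and "0 < c"
    and le: "AE x in lebesgue. cmod (g x) * \<omega>' x \<le> c * (cmod (f x) * \<omega> x)"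
  shows "g \<in> Lp_space p \<omega>'" "Lp_norm p \<omega>' g \<le> c * Lp_norm p \<omega> f"
proof -
  have *: "g \<in> Lp_space p \<omega>' \<and> Lp_norm p \<omega>' g \<le> c * (Lp_norm p \<omega> f + e)" if "e > 0" for e
  proof -
    define r where "r = Lp_norm p \<omega> f + e"
    have r: "0 < r" "Lp_norm p \<omega> f \<le> r" using that Lp_norm_nonneg[OF p, of \<omega> f] by (auto simp: r_def)
    have "in_Lball (real_of_ereal (1 / p)) r (\<lambda>t. f t * of_real (\<omega> t))"
      using Lp_ball_iff[OF p w r(1), of f] f r by blast
    then have "in_Lball (real_of_ereal (1 / p)) (c * r) (\<lambda>t. g t * of_real (\<omega>' t))"
    proof (rule in_Lball_mono)
      show "(\<lambda>t. g t * complex_of_real (\<omega>' t)) \<in> borel_measurable lebesgue" using g w' by measurable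
      show "AE t in lebesgue. cmod (g t * of_real (\<omega>' t)) \<le> c * cmod (f t * of_real (\<omega> t))"
        using le w w' by (auto elim!: eventually_mono simp: norm_mult less_imp_le)
    qed (use \<open>0 < c\<close> in simp)
    then show ?thesis
      using Lp_ball_iff[OF p w', of "c * r" g] r \<open>0 < c\<close> by (simp add: r_def)
  qed
  show "g \<in> Lp_space p \<omega>'" using *[of 1] by simp
  show "Lp_norm p \<omega>' g \<le> c * Lp_norm p \<omega> f"
  proof (rule field_le_epsilon)
    fix e :: real assume "0 < e"
    then show "Lp_norm p \<omega>' g \<le> c * Lp_norm p \<omega> f + e"
      using *[of "e / c"] \<open>0 < c\<close> by (simp add: distrib_left)
  qed
qed

lemma Lp_norm_triangle:
  fixes f :: "'a::euclidean_space \<Rightarrow> complex"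
  assumes p: "1 \<le> p" and w: "\<omega> \<in> borel_measurable lebesgue" "\<And>x. 0 < \<omega> x"
    and f: "f \<in> Lp_space p \<omega>" and g: "g \<in> Lp_space p \<omega>"
  shows "(\<lambda>x. f x + g x) \<in> Lp_space p \<omega>" "Lp_norm p \<omega> (\<lambda>x. f x + g x) \<le> Lp_norm p \<omega> f + Lp_norm p \<omega> g"
proof -
  have *: "(\<lambda>x. f x + g x) \<in> Lp_space p \<omega> \<and> Lp_norm p \<omega> (\<lambda>x. f x + g x) \<le> (Lp_norm p \<omega> f + e) + (Lp_norm p \<omega> g + e)"
    if "e > 0" for e
  proof -
    define r s where "r = Lp_norm p \<omega> f + e" and "s = Lp_norm p \<omega> g + e"
    have r: "0 < r" "Lp_norm p \<omega> f \<le> r" "0 < s" "Lp_norm p \<omega> g \<le> s"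
      using that Lp_norm_nonneg[OF p, of \<omega> f] Lp_norm_nonneg[OF p, of \<omega> g] by (auto simp: r_def s_def)
    have "in_Lball (real_of_ereal (1 / p)) r (\<lambda>t. f t * of_real (\<omega> t))"
      using Lp_ball_iff[OF p w r(1), of f] f r by blast
    moreover have "in_Lball (real_of_ereal (1 / p)) s (\<lambda>t. g t * of_real (\<omega> t))"
      using Lp_ball_iff[OF p w r(3), of g] g r by blast
    ultimately have "in_Lball (real_of_ereal (1 / p)) (r + s) (\<lambda>t. f t * of_real (\<omega> t) + g t * of_real (\<omega> t))"
      using r Lp_exponent_bounds[OF p] by (intro in_Lball_add)
    then show ?thesis
      using Lp_ball_iff[OF p w, of "r + s" "\<lambda>x. f x + g x"] r by (simp add: r_def s_def distrib_right)
  qed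
  show "(\<lambda>x. f x + g x) \<in> Lp_space p \<omega>" using *[of 1] by simp
  show "Lp_norm p \<omega> (\<lambda>x. f x + g x) \<le> Lp_norm p \<omega> f + Lp_norm p \<omega> g"
  proof (rule field_le_epsilon)
    fix e :: real assume "0 < e"
    then show "Lp_norm p \<omega> (\<lambda>x. f x + g x) \<le> Lp_norm p \<omega> f + Lp_norm p \<omega> g + e"
      using *[of "e / 2"] by simp
  qed
qed

lemma Lp_norm_minus:
  fixes f :: "'a::euclidean_space \<Rightarrow> complex"
  assumes "f \<in> Lp_space p \<omega>"
  shows "(\<lambda>x. - f x) \<in> Lp_space p \<omega>" "Lp_norm p \<omega> (\<lambda>x. - f x) = Lp_norm p \<omega> f"
  using assms by (auto simp: Lp_space_def Lp_norm_def)

lemma Lp_norm_diff: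
  fixes f :: "'a::euclidean_space \<Rightarrow> complex"
  assumes p: "1 \<le> p" and w: "\<omega> \<in> borel_measurable lebesgue" "\<And>x. 0 < \<omega> x"
    and f: "f \<in> Lp_space p \<omega>" and g: "g \<in> Lp_space p \<omega>"
  shows "(\<lambda>x. f x - g x) \<in> Lp_space p \<omega>" "Lp_norm p \<omega> (\<lambda>x. f x - g x) \<le> Lp_norm p \<omega> f + Lp_norm p \<omega> g"
  using Lp_norm_triangle[OF p w f Lp_norm_minus(1)[OF g]] by (auto simp: Lp_norm_minus(2)[OF g])

lemma Lp_norm_swap: 
  "Lp_norm p \<omega> (\<lambda>x. f x - g x) = Lp_norm p \<omega> (\<lambda>x. g x - f x)"
  by (simp add: Lp_norm_def norm_mult norm_minus_commute)

lemma Lp_norm_diff_triangle: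
  fixes f :: "'a::euclidean_space \<Rightarrow> complex"
  assumes p: "1 \<le> p" and w: "\<omega> \<in> borel_measurable lebesgue" "\<And>x. 0 < \<omega> x"
    and f: "f \<in> Lp_space p \<omega>" and g: "g \<in> Lp_space p \<omega>" and h: "h \<in> Lp_space p \<omega>"
  shows "Lp_norm p \<omega> (\<lambda>x. f x - h x) \<le> Lp_norm p \<omega> (\<lambda>x. f x - g x) + Lp_norm p \<omega> (\<lambda>x. g x - h x)"
  using Lp_norm_triangle(2)[OF p w Lp_norm_diff(1)[OF p w f g] Lp_norm_diff(1)[OF p w g h]] by simp

lemma Lp_space_0: 
  assumes "1 \<le> p"
  shows "(\<lambda>x. 0) \<in> Lp_space p \<omega>" "Lp_norm p \<omega> (\<lambda>x. 0) = 0"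
  using assms esssup_const[of "lebesgue :: 'a::euclidean_space measure" "0::ereal"]
  by (auto simp: Lp_space_def Lp_norm_def emeasure_lborel_UNIV zero_ereal_def)

lemma Lp_norm_eq_0:
  fixes f :: "'a::euclidean_space \<Rightarrow> complex"
  assumes p: "1 \<le> p" and w: "\<omega> \<in> borel_measurable lebesgue" "\<And>x. 0 < \<omega> x" and f: "f \<in> Lp_space p \<omega>"
  shows "Lp_norm p \<omega> f = 0 \<longleftrightarrow> (AE x in lebesgue. f x = 0)"
proof
  assume z: "Lp_norm p \<omega> f = 0"
  have "AE x in lebesgue. cmod (f x * of_real (\<omega> x)) = 0"
    using p
  proof (cases rule: Lp_exponent_cases)
    case 1
    have "esssup lebesgue (\<lambda>x. ereal (cmod (f x * of_real (\<omega> x)))) \<le> 0"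
      using z f 1 unfolding Lp_space_def Lp_norm_def
      by (cases "esssup lebesgue (\<lambda>x. ereal (cmod (f x * of_real (\<omega> x))))") auto
    then show ?thesis
      using esssup_AE[of "\<lambda>x. ereal (cmod (f x * of_real (\<omega> x)))" lebesgue]
      by (auto elim!: eventually_mono dest: order.trans)
  next
    case (2 q)
    have i: "integrable lebesgue (\<lambda>x. cmod (f x * of_real (\<omega> x)) powr q)"
      using f 2 by (simp add: Lp_space_def)
    have "(LINT x|lebesgue. cmod (f x * of_real (\<omega> x)) powr q) = 0"
      using z 2 by (simp add: Lp_norm_def)
    then have "AE x in lebesgue. cmod (f x * of_real (\<omega> x)) powr q = 0"
      using integral_nonneg_eq_0_iff_AE[OF i] by simp
    then show ?thesis by simp
  qed
  then show "AE x in lebesgue. f x = 0"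
    using w(2) by (auto elim!: eventually_mono) (metis less_irrefl)
next
  assume z: "AE x in lebesgue. f x = 0"
  have "Lp_norm p \<omega> f \<le> 1 * Lp_norm p \<omega> (\<lambda>x. 0)"
    by (rule Lp_space_bounded_mult(2)[OF p w w Lp_space_0(1)[OF p] Lp_space_measurable[OF f]])
       (use z in auto)
  then show "Lp_norm p \<omega> f = 0" using Lp_norm_nonneg[OF p, of \<omega> f] Lp_space_0(2)[OF p, of \<omega>] by simp
qed

lemma Lp_dominated_convergence:
  fixes f :: "'a::euclidean_space \<Rightarrow> complex"
  assumes p: "1 \<le> p" "p \<noteq> \<infinity>" and w[measurable]: "\<omega> \<in> borel_measurable lebesgue"
    and D: "D \<in> Lp_space p \<omega>" and s: "\<And>n. s n \<in> borel_measurable lebesgue"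
    and f: "f \<in> borel_measurable lebesgue"
    and lim: "AE x in lebesgue. (\<lambda>n. s n x) \<longlonglongrightarrow> f x"
    and dom: "\<And>n. AE x in lebesgue. cmod (s n x) \<le> cmod (D x)"
  shows "(\<lambda>n. Lp_norm p \<omega> (\<lambda>x. s n x - f x)) \<longlonglongrightarrow> 0"
  using p(1)
proof (cases rule: Lp_exponent_cases)
  case (2 q)
  note [measurable] = s f Lp_space_measurable[OF D]
  have Di: "integrable lebesgue (\<lambda>x. cmod (D x * of_real (\<omega> x)) powr q)"
    using D 2 by (simp add: Lp_space_def)
  have "(\<lambda>n. LINT x|lebesgue. cmod ((s n x - f x) * of_real (\<omega> x)) powr q) \<longlonglongrightarrow> (LINT (x::'a)|lebesgue. 0)"
  proof (rule integral_dominated_convergence)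
    show "integrable lebesgue (\<lambda>x. 2 powr q * cmod (D x * of_real (\<omega> x)) powr q)" using Di by simp
    show "AE x in lebesgue. (\<lambda>n. cmod ((s n x - f x) * of_real (\<omega> x)) powr q) \<longlonglongrightarrow> 0"
      using lim
    proof eventually_elim
      case (elim x)
      have "(\<lambda>n. cmod ((s n x - f x) * of_real (\<omega> x))) \<longlonglongrightarrow> cmod ((f x - f x) * of_real (\<omega> x))"
        by (intro tendsto_intros elim)
      then have "(\<lambda>n. cmod ((s n x - f x) * of_real (\<omega> x)) powr q) \<longlonglongrightarrow> 0 powr q"
        using 2 by (intro tendsto_powr'[where a = 0]) auto
      then show ?case by simp
    qed
    show "AE x in lebesgue. norm (cmod ((s n x - f x) * of_real (\<omega> x)) powr q) \<le> 2 powr q * cmod (D x * of_real (\<omega> x)) powr q" for n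
    proof -
      have "AE x in lebesgue. \<forall>n. cmod (s n x) \<le> cmod (D x)" using dom by (simp add: AE_all_countable)
      then show ?thesis
        using lim
      proof eventually_elim
        case (elim x)
        have "cmod (f x) \<le> cmod (D x)"
          using elim by (intro LIMSEQ_le_const2[OF tendsto_norm]) auto
        then have "cmod (s n x - f x) \<le> 2 * cmod (D x)"
          using norm_triangle_ineq4[of "s n x" "f x"] elim(1) by (smt (verit) spec)
        then have "cmod ((s n x - f x) * of_real (\<omega> x)) \<le> 2 * cmod (D x * of_real (\<omega> x))"
          by (simp add: norm_mult mult_right_mono flip: mult.assoc)
        then have "cmod ((s n x - f x) * of_real (\<omega> x)) powr q \<le> (2 * cmod (D x * of_real (\<omega> x))) powr q"
          using 2 by (intro powr_mono2) auto
        then show ?case by (simp add: powr_mult)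
      qed
    qed
  qed simp_all
  then have "(\<lambda>n. (LINT x|lebesgue. cmod ((s n x - f x) * of_real (\<omega> x)) powr q) powr (1 / q)) \<longlonglongrightarrow> 0 powr (1 / q)"
    using 2 by (intro tendsto_powr'[where a = 0]) (auto intro: integral_nonneg_AE)
  then show ?thesis using 2 by (simp add: Lp_norm_def)
qed (use p in auto)

section \<open>Regular weights\<close>

text \<open>The polynomial in the definition of moderate weights matters only through its growth.\<close>

lemma real_polynomial_function_bound:
  fixes v :: "'a::euclidean_space \<Rightarrow> real"
  assumes "real_polynomial_function v"
  shows "\<exists>K N. 0 \<le> K \<and> (\<forall>y. \<bar>v y\<bar> \<le> K * (1 + norm y) ^ N)"
  using assms
proof induction
  case (linear f)
  then obtain B where B: "B > 0" "\<And>y. norm (f y) \<le> norm y * B" using bounded_linear.pos_bounded by blast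
  have "\<bar>f y\<bar> \<le> B * (1 + norm y) ^ 1" for y
    using B(2)[of y] B(1) by (simp add: algebra_simps)
  then show ?case using B(1) less_imp_le by blast
next
  case (const c)
  then show ?case by (intro exI[of _ "\<bar>c\<bar>"] exI[of _ 0]) auto
next
  case (add f g)
  then obtain K N K' N' where *: "0 \<le> K" "\<And>y. \<bar>f y\<bar> \<le> K * (1 + norm y) ^ N"
     "0 \<le> K'" "\<And>y. \<bar>g y\<bar> \<le> K' * (1 + norm y) ^ N'" by blast
  have "\<bar>f y + g y\<bar> \<le> (K + K') * (1 + norm y) ^ (N + N')" for y
  proof -
    have "(1 + norm y) ^ N \<le> (1 + norm y) ^ (N + N')" "(1 + norm y) ^ N' \<le> (1 + norm y) ^ (N + N')"
      by (auto intro!: power_increasing)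
    then have "K * (1 + norm y) ^ N + K' * (1 + norm y) ^ N' \<le> (K + K') * (1 + norm y) ^ (N + N')"
      using * by (simp add: distrib_right add_mono mult_left_mono)
    then show ?thesis using *(2)[of y] *(4)[of y] by linarith
  qed
  then show ?case using * by (metis add_nonneg_nonneg)
next
  case (mult f g)
  then obtain K N K' N' where *: "0 \<le> K" "\<And>y. \<bar>f y\<bar> \<le> K * (1 + norm y) ^ N"
     "0 \<le> K'" "\<And>y. \<bar>g y\<bar> \<le> K' * (1 + norm y) ^ N'" by blast
  have "\<bar>f y * g y\<bar> \<le> (K * K') * (1 + norm y) ^ (N + N')" for y
    using mult_mono[OF *(2)[of y] *(4)[of y]] * by (simp add: abs_mult power_add mult_ac)
  then show ?case using * by (metis mult_nonneg_nonneg)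
qed

text \<open>Moderate weights are equivalent to such weights, for which integrals are Borel integrals and products with continuous
functions are continuous.\<close>

definition regular_weight :: "nat \<Rightarrow> ('a::euclidean_space \<Rightarrow> real) \<Rightarrow> bool" where
  "regular_weight N \<omega> \<longleftrightarrow> continuous_on UNIV \<omega> \<and> (\<forall>x. 0 < \<omega> x) \<and>
     (\<forall>x h. \<omega> (x + h) \<le> (1 + norm h) ^ N * \<omega> x)"

text \<open>A moderate weight need not be continuous, but it is equivalent to the infimal convolution
\<open>x \<mapsto> inf\<^sub>y \<omega>(y) (1 + |x - y|)\<^sup>N\<close>, which inherits the growth bound from the factor \<open>(1 + |x - y|)\<^sup>N\<close> and is
therefore continuous.\<close>

lemma regular_weight_exists:
  fixes \<omega> :: "'a::euclidean_space \<Rightarrow> real"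
  assumes "poly_moderate \<omega>"
  obtains \<omega>' N c where "regular_weight N \<omega>'" "1 \<le> c" "\<And>x. \<omega>' x \<le> \<omega> x" "\<And>x. \<omega> x \<le> c * \<omega>' x"
proof -
  obtain C v where wp: "\<And>x. 0 < \<omega> x" and v: "real_polynomial_function v" "\<And>x. 0 < v x"
    and Cv: "\<And>x y. \<omega> (x + y) \<le> C * \<omega> x * v y" using assms unfolding poly_moderate_def by blast
  obtain K N where K: "0 \<le> K" "\<And>y. \<bar>v y\<bar> \<le> K * (1 + norm y) ^ N"
    using real_polynomial_function_bound[OF v(1)] by blast
  have "0 < C * \<omega> 0 * v 0" using less_le_trans[OF wp[of 0] Cv[of 0 0, unfolded add_0]] .
  then have C: "0 < C" using wp[of 0] v(2)[of 0] by (simp add: zero_less_mult_iff not_less[symmetric])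
  define c where "c = max 1 (C * K)"
  have c: "1 \<le> c" by (simp add: c_def)
  have mod: "\<omega> (x + y) \<le> c * (1 + norm y) ^ N * \<omega> x" for x y
  proof -
    have "C * \<omega> x * v y \<le> C * \<omega> x * (K * (1 + norm y) ^ N)"
      using C wp[of x] K(2)[of y] by (intro mult_left_mono) auto
    also have "\<dots> = (C * K) * ((1 + norm y) ^ N * \<omega> x)" by (simp add: mult_ac)
    also have "\<dots> \<le> c * ((1 + norm y) ^ N * \<omega> x)"
      using wp[of x] by (intro mult_right_mono) (auto simp: c_def)
    finally show ?thesis using Cv[of x y] by (simp add: mult_ac)
  qed
  \<comment> \<open>the infimal convolution; its lower bound is moderateness of \<open>\<omega>\<close>\<close>
  define \<omega>' where "\<omega>' x = (INF y. \<omega> y * (1 + norm (x - y)) ^ N)" for x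
  have bb: "bdd_below (range (\<lambda>y. \<omega> y * (1 + norm (x - y)) ^ N))" for x
    using wp by (intro bdd_belowI[of _ 0]) (auto simp: less_imp_le)
  have up: "\<omega>' x \<le> \<omega> y * (1 + norm (x - y)) ^ N" for x y
    unfolding \<omega>'_def by (intro cINF_lower bb) auto
  have lo: "\<omega> x \<le> c * \<omega>' x" for x
  proof -
    have "\<omega> x / c \<le> \<omega>' x"
      unfolding \<omega>'_def
    proof (rule cINF_greatest)
      fix y show "\<omega> x / c \<le> \<omega> y * (1 + norm (x - y)) ^ N"
        using mod[of y "x - y"] c by (simp add: pos_divide_le_eq mult_ac)
    qed simp
    then show ?thesis using c by (simp add: pos_divide_le_eq mult_ac)
  qed
  have pos: "0 < \<omega>' x" for x
    using lo[of x] wp[of x] c by (meson less_le_trans zero_less_mult_pos zero_less_one)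
  have reg: "\<omega>' (x + h) \<le> (1 + norm h) ^ N * \<omega>' x" for x h
  proof -
    have "\<omega>' (x + h) / (1 + norm h) ^ N \<le> \<omega>' x"
      unfolding \<omega>'_def[of x]
    proof (rule cINF_greatest)
      fix y
      have "1 + norm (x + h - y) \<le> (1 + norm h) * (1 + norm (x - y))"
      proof -
        have "norm (x + h - y) \<le> norm (x - y) + norm h"
          using norm_triangle_ineq[of "x - y" h] by (simp add: algebra_simps)
        moreover have "0 \<le> norm h * norm (x - y)" by simp
        ultimately show ?thesis unfolding distrib_left distrib_right mult_1_left mult_1_right by linarith
      qed
      then have "(1 + norm (x + h - y)) ^ N \<le> ((1 + norm h) * (1 + norm (x - y))) ^ N"
        by (intro power_mono) auto
      then have "\<omega> y * (1 + norm (x + h - y)) ^ N \<le> \<omega> y * ((1 + norm h) ^ N * (1 + norm (x - y)) ^ N)"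
        using wp[of y] by (intro mult_left_mono) (auto simp: power_mult_distrib)
      then have "\<omega>' (x + h) \<le> \<omega> y * ((1 + norm h) ^ N * (1 + norm (x - y)) ^ N)"
        using up[of "x + h" y] by linarith
      moreover have "0 < (1 + norm h) ^ N" by (simp add: add_pos_nonneg)
      ultimately show "\<omega>' (x + h) / (1 + norm h) ^ N \<le> \<omega> y * (1 + norm (x - y)) ^ N"
        by (simp add: pos_divide_le_eq mult_ac)
    qed simp
    moreover have "0 < (1 + norm h) ^ N" by (simp add: add_pos_nonneg)
    ultimately show ?thesis by (simp add: pos_divide_le_eq mult_ac)
  qed
  have "isCont \<omega>' x" for x
  proof -
    have "((\<lambda>h. \<omega>' (x + h)) \<longlongrightarrow> \<omega>' x) (at 0)"
    proof (rule tendsto_sandwich)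
      show "((\<lambda>h. \<omega>' x / (1 + norm h) ^ N) \<longlongrightarrow> \<omega>' x) (at 0)" "((\<lambda>h. (1 + norm h) ^ N * \<omega>' x) \<longlongrightarrow> \<omega>' x) (at 0)"
        by (auto intro!: tendsto_eq_intros)
      show "\<forall>\<^sub>F h in at 0. \<omega>' x / (1 + norm h) ^ N \<le> \<omega>' (x + h)"
      proof (intro always_eventually allI)
        fix h :: 'a
        have "0 < (1 + norm h) ^ N" by (simp add: add_pos_nonneg)
        then show "\<omega>' x / (1 + norm h) ^ N \<le> \<omega>' (x + h)"
          using reg[of "x + h" "-h"] by (simp add: pos_divide_le_eq mult_ac)
      qed
    qed (use reg in auto)
    then show ?thesis unfolding isCont_iff .
  qed
  then have "regular_weight N \<omega>'"
    using pos reg by (simp add: regular_weight_def continuous_at_imp_continuous_on)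
  moreover have "\<omega>' x \<le> \<omega> x" for x using up[of x x] by simp
  ultimately show ?thesis using that c lo by blast
qed

section \<open>Lebesgue measure and products\<close>

lemma nn_integral_lborel_affine:
  fixes f :: "'a::euclidean_space \<Rightarrow> ennreal"
  assumes [measurable]: "f \<in> borel_measurable borel" and "c \<noteq> 0"
  shows "(\<integral>\<^sup>+x. f x \<partial>lborel) = ennreal (\<bar>c\<bar> ^ DIM('a)) * (\<integral>\<^sup>+x. f (t + c *\<^sub>R x) \<partial>lborel)"
  by (subst lborel_affine[OF \<open>c \<noteq> 0\<close>, of t]) (simp add: nn_integral_density nn_integral_distr nn_integral_cmult)

lemma integral_lborel_affine:
  fixes f :: "'a::euclidean_space \<Rightarrow> 'b::{banach, second_countable_topology}"
  assumes f: "f \<in> borel_measurable borel" and "c \<noteq> 0"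
  shows "(LINT x|lborel. f x) = (\<bar>c\<bar> ^ DIM('a)) *\<^sub>R (LINT x|lborel. f (t + c *\<^sub>R x))"
  using f by (subst lborel_affine[OF \<open>c \<noteq> 0\<close>, of t]) (simp add: integral_density integral_distr)

lemma integral_lborel_translate:
  fixes f :: "'a::euclidean_space \<Rightarrow> 'b::{banach, second_countable_topology}"
  assumes "f \<in> borel_measurable borel"
  shows "(LINT x|lborel. f (t + x)) = (LINT x|lborel. f x)"
  using integral_lborel_affine[OF assms, of 1 t] by simp

lemma integral_lborel_reflect:
  fixes f :: "'a::euclidean_space \<Rightarrow> 'b::{banach, second_countable_topology}"
  assumes "f \<in> borel_measurable borel"
  shows "(LINT x|lborel. f (t - x)) = (LINT x|lborel. f x)"
  using integral_lborel_affine[OF assms, of "-1" t] by simp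

lemma nn_integral_lborel_translate:
  fixes f :: "'a::euclidean_space \<Rightarrow> ennreal"
  assumes "f \<in> borel_measurable borel"
  shows "(\<integral>\<^sup>+x. f (t + x) \<partial>lborel) = (\<integral>\<^sup>+x. f x \<partial>lborel)"
  using nn_integral_lborel_affine[OF assms, of 1 t] by simp

lemma nn_integral_lborel_reflect:
  fixes f :: "'a::euclidean_space \<Rightarrow> ennreal"
  assumes "f \<in> borel_measurable borel"
  shows "(\<integral>\<^sup>+x. f (t - x) \<partial>lborel) = (\<integral>\<^sup>+x. f x \<partial>lborel)"
  using nn_integral_lborel_affine[OF assms, of "-1" t] by simp

lemma AE_lborel_obtain_null:
  fixes P :: "'a::euclidean_space \<Rightarrow> bool"
  assumes "AE x in lborel. P x"
  obtains N where "N \<in> sets borel" "N \<in> null_sets lborel" "\<And>x. x \<notin> N \<Longrightarrow> P x"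
proof -
  obtain N where N: "{x. \<not> P x} \<subseteq> N" "N \<in> null_sets lborel"
    using assms by (auto elim!: AE_E simp: null_sets_def)
  then have "N \<in> sets borel" by auto
  then show ?thesis using that N by blast
qed

lemma AE_lborel_reflect:
  fixes P :: "'a::euclidean_space \<Rightarrow> bool"
  assumes "AE x in lborel. P x"
  shows "AE y in lborel. P (t - y)"
proof -
  obtain N where N[measurable]: "N \<in> sets borel" and "N \<in> null_sets lborel" "\<And>x. x \<notin> N \<Longrightarrow> P x"
    using AE_lborel_obtain_null[OF assms] by blast
  have "(\<integral>\<^sup>+y. indicator N (t - y) \<partial>lborel) = (\<integral>\<^sup>+y. indicator N y \<partial>lborel)"
    by (rule nn_integral_lborel_reflect) measurable
  also have "\<dots> = 0" using \<open>N \<in> null_sets lborel\<close> by (simp add: null_setsD1)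
  finally have "AE y in lborel. indicator N (t - y) = (0::ennreal)"
    by (subst (asm) nn_integral_0_iff_AE) auto
  then show ?thesis
    by eventually_elim (use \<open>\<And>x. x \<notin> N \<Longrightarrow> P x\<close> in \<open>auto simp: indicator_def split: if_splits\<close>)
qed

lemma
  fixes f :: "'a::euclidean_space \<times> 'b::euclidean_space \<Rightarrow> 'c::{banach, second_countable_topology}"
  assumes f: "integrable lborel f"
  shows lborel_Fubini_fst: "(LINT z|lborel. f z) = (LINT x|lborel. LINT y|lborel. f (x, y))"
    and lborel_Fubini_snd: "(LINT z|lborel. f z) = (LINT y|lborel. LINT x|lborel. f (x, y))"
    and lborel_AE_integrable_fst: "AE x in lborel. integrable lborel (\<lambda>y. f (x, y))"
    and lborel_integrable_snd: "integrable lborel (\<lambda>y. LINT x|lborel. f (x, y))"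
proof -
  have g: "integrable (lborel \<Otimes>\<^sub>M lborel) f" using f by (simp add: lborel_prod)
  then have g': "integrable (lborel \<Otimes>\<^sub>M lborel) (\<lambda>(x, y). f (x, y))" by simp
  show "(LINT z|lborel. f z) = (LINT x|lborel. LINT y|lborel. f (x, y))"
    using lborel_pair.integral_fst'[OF g] by (simp add: lborel_prod)
  show "(LINT z|lborel. f z) = (LINT y|lborel. LINT x|lborel. f (x, y))"
    using lborel_pair.integral_snd[OF g'] by (simp add: lborel_prod)
  show "AE x in lborel. integrable lborel (\<lambda>y. f (x, y))" by (rule lborel_pair.AE_integrable_fst'[OF g])
  show "integrable lborel (\<lambda>y. LINT x|lborel. f (x, y))" by (rule lborel_pair.integrable_snd[OF g'])
qed

lemma
  fixes f :: "'a::euclidean_space \<times> 'b::euclidean_space \<Rightarrow> ennreal"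
  assumes f: "f \<in> borel_measurable borel"
  shows lborel_Tonelli_fst: "(\<integral>\<^sup>+z. f z \<partial>lborel) = (\<integral>\<^sup>+x. (\<integral>\<^sup>+y. f (x, y) \<partial>lborel) \<partial>lborel)"
    and lborel_Tonelli_snd: "(\<integral>\<^sup>+z. f z \<partial>lborel) = (\<integral>\<^sup>+y. (\<integral>\<^sup>+x. f (x, y) \<partial>lborel) \<partial>lborel)"
proof -
  have g: "f \<in> borel_measurable (lborel \<Otimes>\<^sub>M lborel)" using f by (simp add: lborel_prod)
  then have g': "(\<lambda>(x, y). f (x, y)) \<in> borel_measurable (lborel \<Otimes>\<^sub>M lborel)" by simp
  show "(\<integral>\<^sup>+z. f z \<partial>lborel) = (\<integral>\<^sup>+x. (\<integral>\<^sup>+y. f (x, y) \<partial>lborel) \<partial>lborel)"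
    using lborel.nn_integral_fst[OF g] by (simp add: lborel_prod)
  show "(\<integral>\<^sup>+z. f z \<partial>lborel) = (\<integral>\<^sup>+y. (\<integral>\<^sup>+x. f (x, y) \<partial>lborel) \<partial>lborel)"
    using lborel_pair.nn_integral_snd[OF g'] by (simp add: lborel_prod)
qed

lemma borel_measurable_fst [measurable]:
  "(fst :: 'a::euclidean_space \<times> 'b::euclidean_space \<Rightarrow> 'a) \<in> borel_measurable borel"
  by (intro borel_measurable_continuous_onI continuous_intros)

lemma borel_measurable_snd [measurable]:
  "(snd :: 'a::euclidean_space \<times> 'b::euclidean_space \<Rightarrow> 'b) \<in> borel_measurable borel"
  by (intro borel_measurable_continuous_onI continuous_intros)

lemma AE_lborel_snd:
  fixes P :: "'b::euclidean_space \<Rightarrow> bool"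
  assumes "AE y in lborel. P y"
  shows "AE z in (lborel :: ('a::euclidean_space \<times> 'b) measure). P (snd z)"
proof -
  obtain N where N[measurable]: "N \<in> sets borel" and N0: "N \<in> null_sets lborel" and NP: "\<And>x. x \<notin> N \<Longrightarrow> P x"
    using AE_lborel_obtain_null[OF assms] by blast
  have "(\<integral>\<^sup>+z. indicator N (snd z) \<partial>(lborel :: ('a \<times> 'b) measure)) = (\<integral>\<^sup>+x. (\<integral>\<^sup>+y. indicator N y \<partial>lborel) \<partial>(lborel :: 'a measure))"
    by (subst lborel_Tonelli_fst) simp_all
  also have "\<dots> = 0" using N0 by (simp add: null_setsD1)
  finally have "AE z in (lborel :: ('a \<times> 'b) measure). indicator N (snd z) = (0::ennreal)"
    by (subst (asm) nn_integral_0_iff_AE) auto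
  then show ?thesis by eventually_elim (use NP in \<open>auto simp: indicator_def split: if_splits\<close>)
qed

lemma AE_lborel_fst_diff_snd:
  fixes P :: "'a::euclidean_space \<Rightarrow> bool"
  assumes "AE y in lborel. P y"
  shows "AE z in (lborel :: ('a \<times> 'a) measure). P (fst z - snd z)"
proof -
  obtain N where N[measurable]: "N \<in> sets borel" and N0: "N \<in> null_sets lborel" and NP: "\<And>x. x \<notin> N \<Longrightarrow> P x"
    using AE_lborel_obtain_null[OF assms] by blast
  have "(\<integral>\<^sup>+z. indicator N (fst z - snd z) \<partial>(lborel :: ('a \<times> 'a) measure)) = (\<integral>\<^sup>+x. (\<integral>\<^sup>+y. indicator N (x - y) \<partial>lborel) \<partial>lborel)"
    by (subst lborel_Tonelli_fst) simp_all
  also have "\<dots> = (\<integral>\<^sup>+x. (\<integral>\<^sup>+y. indicator N y \<partial>lborel) \<partial>(lborel :: 'a measure))"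
    by (intro nn_integral_cong nn_integral_lborel_reflect) measurable
  also have "\<dots> = 0" using N0 by (simp add: null_setsD1)
  finally have "AE z in (lborel :: ('a \<times> 'a) measure). indicator N (fst z - snd z) = (0::ennreal)"
    by (subst (asm) nn_integral_0_iff_AE) auto
  then show ?thesis by eventually_elim (use NP in \<open>auto simp: indicator_def split: if_splits\<close>)
qed

lemma
  fixes f :: "'a::euclidean_space \<Rightarrow> 'c::{real_normed_field, banach, second_countable_topology}"
    and g :: "'b::euclidean_space \<Rightarrow> 'c"
  assumes f: "integrable lborel f" and g: "integrable lborel g"
  shows lborel_integrable_tensor: "integrable lborel (\<lambda>z. f (fst z) * g (snd z))"
    and lborel_integral_tensor: "(LINT z|lborel. f (fst z) * g (snd z)) = (LINT x|lborel. f x) * (LINT y|lborel. g y)"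
proof -
  have [measurable]: "f \<in> borel_measurable borel" "g \<in> borel_measurable borel" using f g by auto
  have "(\<integral>\<^sup>+z. ennreal (norm (f (fst z) * g (snd z))) \<partial>lborel)
      = (\<integral>\<^sup>+x. ennreal (norm (f x)) * (\<integral>\<^sup>+y. ennreal (norm (g y)) \<partial>lborel) \<partial>lborel)"
    by (subst lborel_Tonelli_fst) (simp_all add: norm_mult ennreal_mult nn_integral_cmult)
  also have "\<dots> < \<infinity>"
    using f g unfolding integrable_iff_bounded by (simp add: nn_integral_multc ennreal_mult_less_top)
  finally show i: "integrable lborel (\<lambda>z. f (fst z) * g (snd z))" unfolding integrable_iff_bounded by simp
  show "(LINT z|lborel. f (fst z) * g (snd z)) = (LINT x|lborel. f x) * (LINT y|lborel. g y)"
    by (subst lborel_Fubini_fst[OF i]) simp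
qed

lemma borel_measurable_cnj [measurable]: "cnj \<in> borel_measurable borel"
  by (rule borel_measurable_continuous_onI[OF linear_continuous_on[OF bounded_linear_cnj]])

text \<open>With integrals in \<open>[0, \<infinity>]\<close>, so that no integrability has to be checked where it is used. The proof integrates
\<open>f g \<le> (t/2) f\<^sup>2 + g\<^sup>2/(2t)\<close> and optimises \<open>t\<close>.\<close>

lemma Cauchy_Schwarz_nn_integral:
  fixes f g :: "'a \<Rightarrow> real"
  assumes [measurable]: "f \<in> borel_measurable M" "g \<in> borel_measurable M"
    and f0: "\<And>x. 0 \<le> f x" and g0: "\<And>x. 0 \<le> g x"
  shows "(\<integral>\<^sup>+x. ennreal (f x * g x) \<partial>M)\<^sup>2 \<le> (\<integral>\<^sup>+x. ennreal ((f x)\<^sup>2) \<partial>M) * (\<integral>\<^sup>+x. ennreal ((g x)\<^sup>2) \<partial>M)"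
    (is "?I\<^sup>2 \<le> ?A * ?B")
proof -
  have zero: "?I = 0" if "?A = 0 \<or> ?B = 0"
  proof -
    have "AE x in M. f x * g x = 0"
    proof (cases "?A = 0")
      case True
      then have "AE x in M. ennreal ((f x)\<^sup>2) = 0" by (subst (asm) nn_integral_0_iff_AE) auto
      then show ?thesis by eventually_elim simp
    next
      case False
      then have "?B = 0" using that by simp
      then have "AE x in M. ennreal ((g x)\<^sup>2) = 0" by (subst (asm) nn_integral_0_iff_AE) auto
      then show ?thesis by eventually_elim simp
    qed
    then have "AE x in M. ennreal (f x * g x) = 0" by eventually_elim (simp only: ennreal_0)
    then show ?thesis by (subst nn_integral_0_iff_AE) auto
  qed
  show ?thesis
  proof (cases "?A = 0 \<or> ?B = 0 \<or> ?A = \<infinity> \<or> ?B = \<infinity>")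
    case True
    then consider "?A = 0 \<or> ?B = 0" | "?A * ?B = \<infinity>" by (auto simp: ennreal_mult_eq_top_iff)
    then show ?thesis using zero by cases auto
  next
    case False
    then obtain a b where ab: "?A = ennreal a" "?B = ennreal b" "0 < a" "0 < b"
      by (cases ?A; cases ?B) (auto simp: less_le)
    define t where "t = sqrt (b / a)"
    have t: "t > 0" using ab by (simp add: t_def)
    have "?I \<le> (\<integral>\<^sup>+x. ennreal (t / 2) * ennreal ((f x)\<^sup>2) + ennreal (1 / (2 * t)) * ennreal ((g x)\<^sup>2) \<partial>M)"
    proof (rule nn_integral_mono)
      fix x
      have "0 \<le> (t * f x - g x)\<^sup>2" by simp
      then have "f x * g x \<le> t / 2 * (f x)\<^sup>2 + 1 / (2 * t) * (g x)\<^sup>2"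
        using t by (simp add: power2_eq_square field_simps)
      then show "ennreal (f x * g x) \<le> ennreal (t / 2) * ennreal ((f x)\<^sup>2) + ennreal (1 / (2 * t)) * ennreal ((g x)\<^sup>2)"
        using t by (simp add: ennreal_leI flip: ennreal_mult ennreal_plus)
    qed
    also have "\<dots> = ennreal (t / 2) * ennreal a + ennreal (1 / (2 * t)) * ennreal b"
      by (subst nn_integral_add) (simp_all add: nn_integral_cmult ab)
    also have "\<dots> = ennreal (t / 2 * a + 1 / (2 * t) * b)"
      using t ab by (simp flip: ennreal_mult ennreal_plus)
    also have "t / 2 * a + 1 / (2 * t) * b = sqrt (a * b)"
    proof -
      have a: "a = sqrt a * sqrt a" and b: "b = sqrt b * sqrt b" using ab by auto
      have t': "t = sqrt b / sqrt a" by (simp add: t_def real_sqrt_divide)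
      have "t * a = sqrt (a * b)"
        unfolding t' real_sqrt_mult using ab by (subst (2) a) (simp add: field_simps)
      moreover have "b / t = sqrt (a * b)"
        unfolding t' real_sqrt_mult using ab by (subst (1) b) (simp add: field_simps)
      ultimately show ?thesis using t by (simp add: field_simps)
    qed
    finally have "?I\<^sup>2 \<le> (ennreal (sqrt (a * b)))\<^sup>2" by (intro power_mono) auto
    also have "\<dots> = ?A * ?B" using ab by (simp add: ennreal_power ennreal_mult)
    finally show ?thesis .
  qed
qed

lemma integrable_bounded_support:
  fixes f :: "'a::euclidean_space \<Rightarrow> 'b::{banach, second_countable_topology}"
  assumes "f \<in> borel_measurable borel" "\<And>z. norm (f z) \<le> B" "\<And>z. f z \<noteq> 0 \<Longrightarrow> norm z \<le> R"
  shows "integrable lborel f"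
proof -
  have "emeasure lborel (cball (0::'a) R) < \<infinity>" using emeasure_lborel_cball_finite by auto
  then show ?thesis
    using assms by (intro integrableI_bounded_set[where A = "cball 0 R" and B = B]) (auto simp: less_top)
qed

lemma continuous_bounded_support_bounded:
  fixes f :: "'a::euclidean_space \<Rightarrow> complex"
  assumes "continuous_on UNIV f" "\<And>x. f x \<noteq> 0 \<Longrightarrow> norm x \<le> R"
  obtains B where "0 \<le> B" "\<And>x. cmod (f x) \<le> B"
proof -
  have "compact (f ` cball 0 R)"
    by (intro compact_continuous_image continuous_on_subset[OF assms(1)]) auto
  then obtain B where B: "\<And>x. norm x \<le> R \<Longrightarrow> cmod (f x) \<le> B"
    by (meson bounded_iff compact_imp_bounded image_eqI mem_cball_0)
  have "cmod (f x) \<le> max B 0" for x using assms(2)[of x] B[of x] by (cases "f x = 0") auto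
  then show ?thesis using that[of "max B 0"] by auto
qed

section \<open>The symplectic form and twisted convolution\<close>

lemma sympl_add_left: "sympl (X + Y) Z = sympl X Z + sympl Y Z"
  and sympl_add_right: "sympl X (Y + Z) = sympl X Y + sympl X Z"
  and sympl_diff_left: "sympl (X - Y) Z = sympl X Z - sympl Y Z"
  and sympl_diff_right: "sympl X (Y - Z) = sympl X Y - sympl X Z"
  and sympl_scale_right: "sympl X (c *\<^sub>R Z) = c * sympl X Z"
  and sympl_self: "sympl X X = 0"
  by (simp_all add: sympl_def inner_add inner_diff algebra_simps inner_commute)

lemma sympl_swap: "sympl Y X = - sympl X Y"
  by (simp add: sympl_def inner_commute)

text \<open>The complex structure that turns the symplectic form into the inner product.\<close>

definition sympl_J :: "'d::finite phase_space \<Rightarrow> 'd phase_space" where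
  "sympl_J X = (snd X, - fst X)"

lemma sympl_eq_inner: "sympl X Y = sympl_J X \<bullet> Y"
  by (simp add: sympl_def sympl_J_def inner_prod_def inner_commute)

lemma norm_sympl_J [simp]: "norm (sympl_J X) = norm X"
  by (simp add: sympl_J_def norm_prod_def add.commute)

lemma borel_measurable_sympl [measurable]:
  "f \<in> borel_measurable M \<Longrightarrow> g \<in> borel_measurable M \<Longrightarrow> (\<lambda>x. sympl (f x) (g x)) \<in> borel_measurable M"
  unfolding sympl_eq_inner
  by (intro borel_measurable_inner measurable_compose[where g = sympl_J, OF _ borel_measurable_continuous_onI])
     (auto simp: sympl_J_def intro!: continuous_intros)

definition gauss :: "'a::euclidean_space \<Rightarrow> real" where
  "gauss X = exp (- (norm X)\<^sup>2)"

lemma gauss_pos: "0 < gauss X" and gauss_le_1: "gauss X \<le> 1"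
  by (auto simp: gauss_def)

lemma continuous_on_gauss [continuous_intros]:
  "continuous_on S f \<Longrightarrow> continuous_on S (\<lambda>x. gauss (f x))"
  unfolding gauss_def by (intro continuous_intros)

lemma borel_measurable_gauss [measurable]: "gauss \<in> borel_measurable borel"
  unfolding gauss_def by measurable

text \<open>Completing squares in the coherent state overlaps leaves exactly this integral.\<close>

lemma gaussian_sympl_fourier:
  fixes S :: "'d::finite phase_space"
  assumes "s > 0"
  shows "integrable lborel (\<lambda>Z. of_real (exp (- s * (norm Z)\<^sup>2)) * cis (2 * sympl S Z))"
    and "(LINT Z|lborel. of_real (exp (- s * (norm Z)\<^sup>2)) * cis (2 * sympl S Z))
      = of_real (sqrt (pi / s) ^ DIM('d phase_space) * exp (- (norm S)\<^sup>2 / s))"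
  using gaussian_fourier[OF assms, of "2 *\<^sub>R sympl_J S"]
  by (simp_all add: sympl_eq_inner power_mult_distrib del: DIM_prod)

lemma integrable_gaussian: 
  assumes "s > 0"
  shows "integrable lborel (\<lambda>Z::'a::euclidean_space. exp (- s * (norm Z)\<^sup>2))"
proof -
  have "integrable lborel (\<lambda>Z::'a. complex_of_real (exp (- s * (norm Z)\<^sup>2)))"
    using gaussian_fourier(1)[OF assms, of "0::'a"] by simp
  then show ?thesis by (simp only: complex_of_real_integrable_eq)
qed

lemma integrable_gauss: "integrable lborel (gauss :: 'a::euclidean_space \<Rightarrow> real)"
  using integrable_gaussian[of 1] by (simp add: gauss_def[abs_def])

lemma integral_gauss: "(LINT Z|lborel. gauss (Z::'a::euclidean_space)) = sqrt pi ^ DIM('a)"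
proof -
  have "complex_of_real (LINT Z|lborel. gauss (Z::'a)) = of_real (sqrt pi ^ DIM('a))"
    using gaussian_fourier(2)[of 1 "0::'a"] by (simp add: gauss_def flip: integral_complex_of_real)
  then show ?thesis by (simp only: of_real_eq_iff)
qed

lemma power_div_fact_le_exp:
  fixes x :: real assumes "0 \<le> x" shows "x ^ k / fact k \<le> exp x"
proof -
  have "(\<Sum>i\<in>{k}. x ^ i /\<^sub>R fact i) \<le> (\<Sum>i. x ^ i /\<^sub>R fact i)"
    using assms by (intro sum_le_suminf summable_exp_generic) auto
  then show ?thesis by (simp add: exp_def divide_inverse mult.commute)
qed

text \<open>Twisted convolution without its normalising constant, with respect to Borel measure. The frequency is a parameter:
\<open>c = 2\<close> is the case of interest and \<open>c = 0\<close> is ordinary convolution, which is used for mollification.\<close>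

definition tconv :: "real \<Rightarrow> ('d::finite phase_space \<Rightarrow> complex) \<Rightarrow> ('d phase_space \<Rightarrow> complex) \<Rightarrow> 'd phase_space \<Rightarrow> complex" where
  "tconv c a b X = (LINT Y|lborel. a (X - Y) * b Y * cis (c * sympl X Y))"

section \<open>Plancherel identity for the symplectic Fourier transform\<close>

definition sympl_fourier :: "('d::finite phase_space \<Rightarrow> complex) \<Rightarrow> 'd phase_space \<Rightarrow> complex" where
  "sympl_fourier F W = (LINT X|lborel. F X * cis (2 * sympl X W))"

lemma borel_measurable_sympl_fourier:
  assumes [measurable]: "F \<in> borel_measurable borel"
  shows "sympl_fourier F \<in> borel_measurable borel"
proof -
  have "(\<lambda>(W, X). F X * cis (2 * sympl X W)) \<in> borel_measurable (borel \<Otimes>\<^sub>M lborel)"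
    by (simp add: borel_prod)
  then show ?thesis unfolding sympl_fourier_def by (intro lborel.borel_measurable_lebesgue_integral)
qed

text \<open>Proved by Gaussian regularisation. Inserting \<open>exp(- s |W|\<^sup>2)\<close> makes the integral over \<open>W\<close> absolutely convergent and
computable; after the substitution \<open>X' = X - sqrt(s) Y\<close> the remaining integral is a Gaussian average of translates
of \<open>F\<close>, which tends to the square norm as \<open>s \<rightarrow> 0\<close>. On the other side the limit is one of monotone convergence. Continuous functions with
bounded support are all that the \<open>L\<^sup>2\<close> estimate needs before approximation.\<close>

lemma sympl_Plancherel:
  fixes F :: "'d::finite phase_space \<Rightarrow> complex"
  assumes cont: "continuous_on UNIV F" and supp: "\<And>X. F X \<noteq> 0 \<Longrightarrow> norm X \<le> R"
  shows "(\<integral>\<^sup>+W. ennreal ((cmod (sympl_fourier F W))\<^sup>2) \<partial>lborel)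
    = ennreal (pi ^ DIM('d phase_space)) * (\<integral>\<^sup>+X. ennreal ((cmod (F X))\<^sup>2) \<partial>lborel)"
proof -
  let ?n = "DIM('d phase_space)"
  let ?f = "\<lambda>W. (cmod (sympl_fourier F W))\<^sup>2"
  let ?g = "\<lambda>s (D :: 'd phase_space). complex_of_real (sqrt (pi / s) ^ ?n * exp (- (norm D)\<^sup>2 / s))"
  let ?G = "\<lambda>s z. complex_of_real (sqrt pi ^ ?n) * (of_real (gauss (snd z)) * (F (fst z) * cnj (F (fst z - sqrt s *\<^sub>R snd z))))"
  let ?e = "\<lambda>m::nat. 1 / (real m + 1)"
  let ?c = "\<lambda>m Y. LINT X|lborel. F X * cnj (F (X - ?e m *\<^sub>R Y))"
  obtain B where B: "0 \<le> B" "\<And>X. cmod (F X) \<le> B" using continuous_bounded_support_bounded[OF cont supp] by blast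
  have [measurable]: "F \<in> borel_measurable borel" using cont by (rule borel_measurable_continuous_onI)
  have Fi: "integrable lborel F" by (rule integrable_bounded_support[OF _ B(2) supp]) auto
  note [measurable] = borel_measurable_sympl_fourier
  define N where "N = (LINT X|lborel. (cmod (F X))\<^sup>2)"
  have F2i: "integrable lborel (\<lambda>X. (cmod (F X))\<^sup>2)"
    by (rule integrable_bounded_support[where B = "B\<^sup>2" and R = R])
       (use supp B in \<open>auto intro!: power_mono\<close>)
  have Fhb: "cmod (sympl_fourier F W) \<le> (LINT X|lborel. cmod (F X))" for W
    unfolding sympl_fourier_def by (rule integral_norm_bound[THEN order.trans]) (simp add: norm_mult)
  define \<Phi> where "\<Phi> s = (LINT W|lborel. ?f W * exp (- s * (norm W)\<^sup>2))" for s
  have \<Phi>i: "integrable lborel (\<lambda>W. ?f W * exp (- s * (norm W)\<^sup>2))" if "s > 0" for s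
  proof (rule Bochner_Integration.integrable_bound)
    show "integrable lborel (\<lambda>W::'d phase_space. (LINT X|lborel. cmod (F X))\<^sup>2 * exp (- s * (norm W)\<^sup>2))"
      by (intro integrable_mult_right integrable_gaussian that)
    show "AE W in lborel. norm (?f W * exp (- s * (norm W)\<^sup>2)) \<le> norm ((LINT X|lborel. cmod (F X))\<^sup>2 * exp (- s * (norm W)\<^sup>2))"
      using Fhb by (auto intro!: mult_right_mono power_mono)
  qed measurable
  have \<Phi>: "of_real (\<Phi> s) = of_real (sqrt pi ^ ?n) * (LINT Y|lborel. of_real (gauss Y) * (LINT X|lborel. F X * cnj (F (X - sqrt s *\<^sub>R Y))))"
    if s: "s > 0" for s
  proof -
    define h where "h z = (F (fst (snd z)) * cnj (F (snd (snd z)))) * (of_real (exp (- s * (norm (fst z))\<^sup>2)) * cis (2 * sympl (fst (snd z) - snd (snd z)) (fst z)))"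
      for z :: "'d phase_space \<times> 'd phase_space \<times> 'd phase_space"
    have FFi: "integrable lborel (\<lambda>P. F (fst P) * cnj (F (snd P)))"
      by (rule lborel_integrable_tensor[of F "\<lambda>x. cnj (F x)"]) (use Fi in auto)
    have hi: "integrable lborel h"
    proof (rule Bochner_Integration.integrable_bound)
      show "integrable lborel (\<lambda>z :: 'd phase_space \<times> 'd phase_space \<times> 'd phase_space. complex_of_real (exp (- s * (norm (fst z))\<^sup>2)) * (F (fst (snd z)) * cnj (F (snd (snd z)))))"
        by (rule lborel_integrable_tensor[of "\<lambda>W::'d phase_space. complex_of_real (exp (- s * (norm W)\<^sup>2))" "\<lambda>P. F (fst P) * cnj (F (snd P))"])
           (simp_all only: complex_of_real_integrable_eq FFi integrable_gaussian[OF s])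
      have "h \<in> borel_measurable borel" unfolding h_def by measurable
      then show "h \<in> borel_measurable lborel" by simp
    qed (auto simp: h_def norm_mult)
    have "of_real (\<Phi> s) = (LINT W|lborel. complex_of_real (?f W * exp (- s * (norm W)\<^sup>2)))"
      unfolding \<Phi>_def integral_complex_of_real ..
    also have "\<dots> = (LINT W|lborel. LINT P|lborel. h (W, P))"
    proof (rule Bochner_Integration.integral_cong[OF refl])
      fix W
      have FW: "integrable lborel (\<lambda>X. F X * cis (2 * sympl X W))"
        using Fi by (rule Bochner_Integration.integrable_bound) (auto simp: norm_mult)
      have "complex_of_real (?f W) = (LINT X|lborel. F X * cis (2 * sympl X W)) * (LINT X|lborel. cnj (F X * cis (2 * sympl X W)))"
        unfolding complex_norm_square sympl_fourier_def by (simp only: Bochner_Integration.integral_cnj)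
      also have "\<dots> = (LINT P|lborel. (F (fst P) * cis (2 * sympl (fst P) W)) * cnj (F (snd P) * cis (2 * sympl (snd P) W)))"
        by (rule lborel_integral_tensor[OF FW integrable_bounded_linear[OF bounded_linear_cnj FW], symmetric])
      also have "\<dots> = (LINT P|lborel. (F (fst P) * cnj (F (snd P))) * cis (2 * sympl (fst P - snd P) W))"
      proof (intro Bochner_Integration.integral_cong refl)
        fix P
        have "cis (2 * sympl (fst P) W) * cnj (cis (2 * sympl (snd P) W)) = cis (2 * sympl (fst P - snd P) W)"
          by (simp add: cis_cnj cis_mult sympl_diff_left right_diff_distrib)
        then show "(F (fst P) * cis (2 * sympl (fst P) W)) * cnj (F (snd P) * cis (2 * sympl (snd P) W))
            = (F (fst P) * cnj (F (snd P))) * cis (2 * sympl (fst P - snd P) W)"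
          by (simp only: complex_cnj_mult mult.assoc mult.left_commute[of "cis _"])
      qed
      finally show "complex_of_real (?f W * exp (- s * (norm W)\<^sup>2)) = (LINT P|lborel. h (W, P))"
        by (simp add: h_def mult_ac flip: integral_mult_right_zero)
    qed
    also have "\<dots> = (LINT P|lborel. LINT W|lborel. h (W, P))"
      using lborel_Fubini_fst[OF hi] lborel_Fubini_snd[OF hi] by simp
    also have "\<dots> = (LINT P|lborel. (F (fst P) * cnj (F (snd P))) * ?g s (fst P - snd P))"
      unfolding h_def fst_conv snd_conv integral_mult_right_zero gaussian_sympl_fourier(2)[OF s] ..
    also have "\<dots> = (LINT X|lborel. LINT X'|lborel. (F X * cnj (F X')) * ?g s (X - X'))"
    proof (subst lborel_Fubini_fst)
      show "integrable lborel (\<lambda>P. F (fst P) * cnj (F (snd P)) * ?g s (fst P - snd P))"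
      proof (rule Bochner_Integration.integrable_bound)
        show "integrable lborel (\<lambda>P. complex_of_real (sqrt (pi / s) ^ ?n) * (F (fst P) * cnj (F (snd P))))" using FFi by simp
        show "AE P in lborel. cmod (F (fst P) * cnj (F (snd P)) * ?g s (fst P - snd P))
           \<le> cmod (complex_of_real (sqrt (pi / s) ^ ?n) * (F (fst P) * cnj (F (snd P))))"
        proof (rule AE_I2)
          fix P
          have e: "x * (q * exp (- t)) \<le> q * x" if "0 \<le> x" "0 \<le> q" "0 \<le> t" for x q t :: real
            using mult_left_le[of "exp (- t)" "q * x"] that by (simp add: mult_ac)
          have "0 \<le> sqrt (pi / s) ^ ?n" using s by simp
          with s show "cmod (F (fst P) * cnj (F (snd P)) * ?g s (fst P - snd P))
           \<le> cmod (complex_of_real (sqrt (pi / s) ^ ?n) * (F (fst P) * cnj (F (snd P))))"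
            using e[of "cmod (F (fst P)) * cmod (F (snd P))" "sqrt (pi / s) ^ ?n" "(norm (fst P - snd P))\<^sup>2 / s"]
            by (simp only: norm_mult norm_of_real complex_mod_cnj abs_mult abs_exp_cancel abs_of_nonneg minus_divide_left) simp
        qed
      qed simp
    qed simp
    also have "\<dots> = (LINT X|lborel. LINT Y|lborel. of_real (sqrt pi ^ ?n) * (of_real (gauss Y) * (F X * cnj (F (X - sqrt s *\<^sub>R Y)))))"
    proof (rule Bochner_Integration.integral_cong[OF refl])
      fix X
      have "(LINT X'|lborel. (F X * cnj (F X')) * ?g s (X - X'))
        = (\<bar>- sqrt s\<bar> ^ ?n) *\<^sub>R (LINT Y|lborel. (F X * cnj (F (X + (- sqrt s) *\<^sub>R Y))) * ?g s (X - (X + (- sqrt s) *\<^sub>R Y)))"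
        using s by (intro integral_lborel_affine) auto
      also have "\<dots> = (LINT Y|lborel. of_real (sqrt pi ^ ?n) * (of_real (gauss Y) * (F X * cnj (F (X - sqrt s *\<^sub>R Y)))))"
        unfolding scaleR_conv_of_real integral_mult_right_zero[symmetric]
      proof (rule Bochner_Integration.integral_cong[OF refl])
        fix Y
        have "sqrt s ^ ?n * sqrt (pi / s) ^ ?n = sqrt pi ^ ?n"
          using s by (simp add: power_mult_distrib[symmetric] real_sqrt_mult[symmetric] del: DIM_prod)
        moreover have "exp (- (norm (X - (X + (- sqrt s) *\<^sub>R Y)))\<^sup>2 / s) = gauss Y"
          using s by (simp add: gauss_def power_mult_distrib)
        ultimately show "of_real (\<bar>- sqrt s\<bar> ^ ?n) * (F X * cnj (F (X + (- sqrt s) *\<^sub>R Y)) * ?g s (X - (X + (- sqrt s) *\<^sub>R Y)))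
           = of_real (sqrt pi ^ ?n) * (of_real (gauss Y) * (F X * cnj (F (X - sqrt s *\<^sub>R Y))))"
          using s by (simp add: mult_ac del: DIM_prod flip: of_real_mult of_real_power)
      qed
      finally show "(LINT X'|lborel. (F X * cnj (F X')) * ?g s (X - X'))
         = (LINT Y|lborel. of_real (sqrt pi ^ ?n) * (of_real (gauss Y) * (F X * cnj (F (X - sqrt s *\<^sub>R Y)))))" .
    qed
    also have "\<dots> = (LINT Y|lborel. LINT X|lborel. of_real (sqrt pi ^ ?n) * (of_real (gauss Y) * (F X * cnj (F (X - sqrt s *\<^sub>R Y)))))"
    proof -
      have "integrable lborel (\<lambda>z. F (fst z) * of_real (gauss (snd z)))"
        by (rule lborel_integrable_tensor[OF Fi, of "\<lambda>y. of_real (gauss y)"]) (simp only: complex_of_real_integrable_eq integrable_gauss)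
      then have "integrable lborel (\<lambda>z. of_real (sqrt pi ^ ?n * B) * (F (fst z) * of_real (gauss (snd z))))"
        by (rule integrable_mult_right)
      then have "integrable lborel (\<lambda>z. ?G s z)"
      proof (rule Bochner_Integration.integrable_bound)
        have *: "cmod (F (fst z)) * cmod (F (fst z - sqrt s *\<^sub>R snd z)) \<le> B * cmod (F (fst z))" for z
          using mult_left_mono[OF B(2) norm_ge_zero] by (simp add: mult.commute)
        show "AE z in lborel. cmod (?G s z)
            \<le> cmod (of_real (sqrt pi ^ ?n * B) * (F (fst z) * of_real (gauss (snd z))))"
        proof (rule AE_I2)
          fix z
          have "gauss (snd z) * (cmod (F (fst z)) * cmod (F (fst z - sqrt s *\<^sub>R snd z))) \<le> gauss (snd z) * (B * cmod (F (fst z)))"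
            by (intro mult_left_mono * less_imp_le[OF gauss_pos])
          then show "cmod (?G s z)
            \<le> cmod (of_real (sqrt pi ^ ?n * B) * (F (fst z) * of_real (gauss (snd z))))"
            using B(1) less_imp_le[OF gauss_pos[of "snd z"]]
            unfolding of_real_mult norm_mult mult.assoc by (intro mult_left_mono) (simp_all add: mult_ac)
        qed
      qed simp
      from lborel_Fubini_fst[OF this] lborel_Fubini_snd[OF this] show ?thesis by simp
    qed
    also have "\<dots> = of_real (sqrt pi ^ ?n) * (LINT Y|lborel. of_real (gauss Y) * (LINT X|lborel. F X * cnj (F (X - sqrt s *\<^sub>R Y))))"
      by simp
    finally show ?thesis .
  qed
  \<comment> \<open>a sequence of parameters with simple square roots\<close>
  define \<sigma> where "\<sigma> m = 1 / (real m + 1)\<^sup>2" for m :: nat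
  have \<sigma>: "\<sigma> m > 0" "sqrt (\<sigma> m) = 1 / (real m + 1)" for m by (auto simp: \<sigma>_def real_sqrt_divide)
  have lim0: "(\<lambda>m. 1 / (real m + 1)) \<longlonglongrightarrow> 0" using LIMSEQ_inverse_real_of_nat by (simp add: inverse_eq_divide add.commute)
  have lim: "(\<lambda>m. complex_of_real (\<Phi> (\<sigma> m))) \<longlonglongrightarrow> of_real (sqrt pi ^ ?n) * (LINT Y|lborel. of_real (gauss (Y::'d phase_space)) * of_real N)"
    unfolding \<Phi>[OF \<sigma>(1)] \<sigma>(2)
  proof (intro tendsto_mult tendsto_const integral_dominated_convergence)
    have inner: "(\<lambda>m. LINT X|lborel. F X * cnj (F (X - ?e m *\<^sub>R Y))) \<longlonglongrightarrow> of_real N" for Y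
    proof -
      have "(\<lambda>m. LINT X|lborel. F X * cnj (F (X - ?e m *\<^sub>R Y))) \<longlonglongrightarrow> (LINT X|lborel. F X * cnj (F X))"
      proof (rule integral_dominated_convergence)
        show "integrable lborel (\<lambda>X. B * cmod (F X))" using Fi by simp
        show "AE X in lborel. (\<lambda>m. F X * cnj (F (X - ?e m *\<^sub>R Y))) \<longlonglongrightarrow> F X * cnj (F X)"
        proof (intro AE_I2 tendsto_intros)
          fix X
          have "(\<lambda>m. X - (1 / (real m + 1)) *\<^sub>R Y) \<longlonglongrightarrow> X - 0 *\<^sub>R Y" by (intro tendsto_intros lim0)
          then have "(\<lambda>m. X - (1 / (real m + 1)) *\<^sub>R Y) \<longlonglongrightarrow> X" by simp
          then show "(\<lambda>m. F (X - ?e m *\<^sub>R Y)) \<longlonglongrightarrow> F X"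
            by (rule isCont_tendsto_compose[OF continuous_on_eq_continuous_at[OF open_UNIV, THEN iffD1, OF cont, rule_format, OF UNIV_I]])
        qed
        show "AE X in lborel. cmod (F X * cnj (F (X - ?e m *\<^sub>R Y))) \<le> B * cmod (F X)" for m
          unfolding norm_mult complex_mod_cnj mult.commute[of B] by (intro AE_I2 mult_left_mono B norm_ge_zero)
      qed measurable
      moreover have "(LINT X|lborel. F X * cnj (F X)) = of_real N"
        unfolding N_def complex_norm_square[symmetric] integral_complex_of_real ..
      ultimately show ?thesis by simp
    qed
    show "AE Y in lborel. (\<lambda>m. of_real (gauss Y) * (?c m Y)) \<longlonglongrightarrow> of_real (gauss Y) * of_real N"
      by (intro AE_I2 tendsto_mult tendsto_const inner)
    show "integrable lborel (\<lambda>Y::'d phase_space. (LINT X|lborel. B * cmod (F X)) * gauss Y)"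
      by (intro integrable_mult_right integrable_gauss)
    show "AE Y in lborel. cmod (of_real (gauss Y) * (?c m Y)) \<le> (LINT X|lborel. B * cmod (F X)) * gauss Y" for m
    proof (rule AE_I2)
      fix Y
      have "cmod (?c m Y) \<le> (LINT X|lborel. B * cmod (F X))"
      proof -
        have FF: "cmod (F X * cnj (F (X - ?e m *\<^sub>R Y))) \<le> B * cmod (F X)" for X
          unfolding norm_mult complex_mod_cnj mult.commute[of B] by (intro mult_left_mono B norm_ge_zero)
        have i1: "integrable lborel (\<lambda>X. B * cmod (F X))" using Fi by simp
        then have i2: "integrable lborel (\<lambda>X. F X * cnj (F (X - ?e m *\<^sub>R Y)))"
          by (rule Bochner_Integration.integrable_bound) (use FF B(1) in auto)
        show ?thesis
          using integral_norm_bound[of lborel "\<lambda>X. F X * cnj (F (X - ?e m *\<^sub>R Y))"]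
            integral_mono[OF integrable_norm[OF i2] i1 FF] by (rule order.trans)
      qed
      then show "cmod (of_real (gauss Y) * (?c m Y)) \<le> (LINT X|lborel. B * cmod (F X)) * gauss Y"
        using gauss_pos[of Y] by (simp add: norm_mult mult.commute mult_left_mono)
    qed
    show "(\<lambda>Y. of_real (gauss Y) * (?c m Y)) \<in> borel_measurable lborel" for m
    proof -
      have "(\<lambda>(Y, X). F X * cnj (F (X - ?e m *\<^sub>R Y))) \<in> borel_measurable (lborel \<Otimes>\<^sub>M lborel)"
        by (simp add: lborel_prod)
      from lborel.borel_measurable_lebesgue_integral[OF this] show ?thesis by simp
    qed
  qed simp
  have "(LINT Y|lborel. complex_of_real (gauss (Y::'d phase_space)) * of_real N) = of_real (sqrt pi ^ ?n * N)"
    by (simp only: integral_mult_left_zero integral_complex_of_real integral_gauss of_real_mult)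
  then have "(\<lambda>m. complex_of_real (\<Phi> (\<sigma> m))) \<longlonglongrightarrow> of_real (sqrt pi ^ ?n * (sqrt pi ^ ?n * N))"
    using lim by (simp only: of_real_mult)
  moreover have "sqrt pi ^ ?n * (sqrt pi ^ ?n * N) = pi ^ ?n * N"
    by (simp add: mult.assoc[symmetric] power_mult_distrib[symmetric] del: DIM_prod)
  ultimately have limr: "(\<lambda>m. \<Phi> (\<sigma> m)) \<longlonglongrightarrow> pi ^ ?n * N"
    by (metis tendsto_of_real_iff)
  have "(\<lambda>m. \<integral>\<^sup>+W. ennreal (?f W * exp (- \<sigma> m * (norm W)\<^sup>2)) \<partial>lborel)
     \<longlonglongrightarrow> (\<integral>\<^sup>+W. ennreal (?f W) \<partial>lborel)"
  proof (rule nn_integral_LIMSEQ)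
    have "\<sigma> n \<le> \<sigma> m" if "m \<le> n" for m n using that by (auto simp: \<sigma>_def frac_le)
    then show "incseq (\<lambda>m W. ennreal (?f W * exp (- \<sigma> m * (norm W)\<^sup>2)))"
      by (auto simp: incseq_def le_fun_def intro!: ennreal_leI mult_left_mono mult_right_mono)
    show "(\<lambda>m. ennreal (?f W * exp (- \<sigma> m * (norm W)\<^sup>2))) \<longlonglongrightarrow> ennreal (?f W)" for W
    proof -
      have "(\<lambda>m. (1 / (real m + 1))\<^sup>2) \<longlonglongrightarrow> 0\<^sup>2" by (intro tendsto_intros lim0)
      then have s0: "\<sigma> \<longlonglongrightarrow> 0" by (simp add: \<sigma>_def[abs_def] power_divide)
      have "(\<lambda>m. ?f W * exp (- \<sigma> m * (norm W)\<^sup>2)) \<longlonglongrightarrow> ?f W * exp (- 0 * (norm W)\<^sup>2)"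
        by (intro tendsto_intros s0)
      then show ?thesis by (intro tendsto_ennrealI) simp
    qed
  qed simp
  moreover have "(\<integral>\<^sup>+W. ennreal (?f W * exp (- \<sigma> m * (norm W)\<^sup>2)) \<partial>lborel) = ennreal (\<Phi> (\<sigma> m))" for m
    unfolding \<Phi>_def using \<Phi>i[OF \<sigma>(1)] by (intro nn_integral_eq_integral) auto
  ultimately have "(\<lambda>m. ennreal (\<Phi> (\<sigma> m))) \<longlonglongrightarrow> (\<integral>\<^sup>+W. ennreal (?f W) \<partial>lborel)" by simp
  from LIMSEQ_unique[OF this tendsto_ennrealI[OF limr]]
  have "(\<integral>\<^sup>+W. ennreal (?f W) \<partial>lborel) = ennreal (pi ^ ?n * N)" .
  also have "\<dots> = ennreal (pi ^ ?n) * ennreal N"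
    by (intro ennreal_mult) (auto simp: N_def intro!: integral_nonneg_AE)
  also have "ennreal N = (\<integral>\<^sup>+X. ennreal ((cmod (F X))\<^sup>2) \<partial>lborel)"
    unfolding N_def using F2i by (intro nn_integral_eq_integral[symmetric]) auto
  finally show ?thesis .
qed

section \<open>Gabor matrices and the weighted square estimate\<close>

text \<open>Up to a constant the matrix coefficient of \<open>\<integral> a(X) \<rho>(X) dX\<close> between the coherent states at \<open>W\<close> and \<open>V\<close>: the
Gaussian is the overlap of the states moved to \<open>X + W\<close> and \<open>V\<close>, and the phase collects the cocycle of \<open>\<rho>\<close>.\<close>

definition gabor_matrix :: "('d::finite phase_space \<Rightarrow> complex) \<Rightarrow> 'd phase_space \<Rightarrow> 'd phase_space \<Rightarrow> complex" where
  "gabor_matrix a V W = (LINT X|lborel. a X * (of_real (gauss (X + W - V)) * cis (2 * (sympl X (W + V) - sympl V W))))"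

text \<open>Along a diagonal \<open>V = W + U\<close> the matrix is a windowed Fourier transform, centred at \<open>U\<close>; this is where
the Plancherel identity enters.\<close>

lemma norm_gabor_matrix:
  "cmod (gabor_matrix a (W + U) W) = cmod (sympl_fourier (\<lambda>X. a X * of_real (gauss (X - U))) (U + 2 *\<^sub>R W))"
proof -
  have "gabor_matrix a (W + U) W = (LINT X|lborel. cis (- 2 * sympl (W + U) W) * (a X * of_real (gauss (X - U)) * cis (2 * sympl X (U + 2 *\<^sub>R W))))"
    unfolding gabor_matrix_def
  proof (intro Bochner_Integration.integral_cong refl)
    fix X
    have "W + (W + U) = U + 2 *\<^sub>R W" by (simp add: scaleR_2)
    then have "cis (2 * (sympl X (W + (W + U)) - sympl (W + U) W)) = cis (- 2 * sympl (W + U) W) * cis (2 * sympl X (U + 2 *\<^sub>R W))"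
      by (simp add: cis_mult algebra_simps)
    then show "a X * (of_real (gauss (X + W - (W + U))) * cis (2 * (sympl X (W + (W + U)) - sympl (W + U) W)))
      = cis (- 2 * sympl (W + U) W) * (a X * of_real (gauss (X - U)) * cis (2 * sympl X (U + 2 *\<^sub>R W)))"
      by simp
  qed
  then show ?thesis by (simp add: norm_mult sympl_fourier_def)
qed

lemma borel_measurable_gabor_matrix:
  assumes [measurable]: "a \<in> borel_measurable borel"
  shows "(\<lambda>P. gabor_matrix a (fst P) (snd P)) \<in> borel_measurable borel"
proof -
  have "(\<lambda>Q. a (snd Q) * (of_real (gauss (snd Q + snd (fst Q) - fst (fst Q))) * cis (2 * (sympl (snd Q) (snd (fst Q) + fst (fst Q)) - sympl (fst (fst Q)) (snd (fst Q))))))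
     \<in> borel_measurable (borel :: (('a phase_space \<times> 'a phase_space) \<times> 'a phase_space) measure)"
    by measurable
  then have "(\<lambda>(P, X). a X * (of_real (gauss (X + snd P - fst P)) * cis (2 * (sympl X (snd P + fst P) - sympl (fst P) (snd P)))))
     \<in> borel_measurable (borel \<Otimes>\<^sub>M lborel)"
    by (simp add: borel_prod case_prod_beta)
  then show ?thesis unfolding gabor_matrix_def by (rule lborel.borel_measurable_lebesgue_integral)
qed

text \<open>Integrate along diagonals \<open>V = W + U\<close>, on which the weight is constant, and apply the Plancherel identity to each.\<close>

lemma gabor_matrix_energy:
  fixes a :: "'d::finite phase_space \<Rightarrow> complex"
  assumes cont: "continuous_on UNIV a" and supp: "\<And>X. a X \<noteq> 0 \<Longrightarrow> norm X \<le> R" and w: "continuous_on UNIV \<omega>"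
  shows "(\<integral>\<^sup>+W. (\<integral>\<^sup>+V. ennreal ((cmod (gabor_matrix a V W) * \<omega> (V - W))\<^sup>2) \<partial>lborel) \<partial>lborel)
    = ennreal ((pi / 2) ^ DIM('d phase_space)) * (\<integral>\<^sup>+X. ennreal ((cmod (a X))\<^sup>2) * (\<integral>\<^sup>+U. ennreal ((\<omega> U * gauss (X - U))\<^sup>2) \<partial>lborel) \<partial>lborel)"
proof -
  let ?n = "DIM('d phase_space)"
  let ?p = "ennreal ((pi / 2) ^ ?n)"
  let ?a = "\<lambda>X. ennreal ((cmod (a X))\<^sup>2)" and ?w = "\<lambda>U X. ennreal ((\<omega> U * gauss (X - U))\<^sup>2)"
  let ?m = "\<lambda>W U. ennreal ((cmod (gabor_matrix a (W + U) W))\<^sup>2)"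
  have [measurable]: "a \<in> borel_measurable borel" "\<omega> \<in> borel_measurable borel"
    using cont w by (auto intro: borel_measurable_continuous_onI)
  have mm[measurable]: "(\<lambda>P. gabor_matrix a (fst P) (snd P)) \<in> borel_measurable borel" by (rule borel_measurable_gabor_matrix) simp
  have m1[measurable]: "(\<lambda>V. gabor_matrix a V W) \<in> borel_measurable borel" for W
    using measurable_compose[OF _ mm, of "\<lambda>V. (V, W)" borel] by simp
  have m2[measurable]: "(\<lambda>Q. gabor_matrix a (snd Q + fst Q) (snd Q)) \<in> borel_measurable borel"
    using measurable_compose[OF _ mm, of "\<lambda>Q. (snd Q + fst Q, snd Q)" borel] by simp
  have inner: "(\<integral>\<^sup>+W. ?m W U \<partial>lborel)
     = ?p * (\<integral>\<^sup>+X. ?a X * ennreal ((gauss (X - U))\<^sup>2) \<partial>lborel)" for U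
  proof -
    let ?F = "\<lambda>X. a X * of_real (gauss (X - U))"
    have F: "continuous_on UNIV ?F" by (intro continuous_intros cont)
    have [measurable]: "sympl_fourier ?F \<in> borel_measurable borel" by (rule borel_measurable_sympl_fourier) simp
    have "ennreal (2 ^ ?n) * (\<integral>\<^sup>+W. ?m W U \<partial>lborel) = (\<integral>\<^sup>+W. ennreal ((cmod (sympl_fourier ?F W))\<^sup>2) \<partial>lborel)"
      unfolding norm_gabor_matrix
      by (subst nn_integral_lborel_affine[where c = 2 and t = U and f = "\<lambda>W. ennreal ((cmod (sympl_fourier ?F W))\<^sup>2)"])
         (simp_all del: DIM_prod)
    also have "\<dots> = ennreal (pi ^ ?n) * (\<integral>\<^sup>+X. ?a X * ennreal ((gauss (X - U))\<^sup>2) \<partial>lborel)"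
      using sympl_Plancherel[OF F, of R] supp
      by (simp add: norm_mult power_mult_distrib ennreal_mult del: DIM_prod)
    finally have e: "ennreal (2 ^ ?n) * (\<integral>\<^sup>+W. ?m W U \<partial>lborel) = \<dots>" .
    have "(\<integral>\<^sup>+W. ?m W U \<partial>lborel)
       = ennreal (1 / 2 ^ ?n) * (ennreal (2 ^ ?n) * (\<integral>\<^sup>+W. ?m W U \<partial>lborel))"
      by (simp add: mult.assoc[symmetric] del: DIM_prod flip: ennreal_mult)
    also have "\<dots> = ?p * (\<integral>\<^sup>+X. ?a X * ennreal ((gauss (X - U))\<^sup>2) \<partial>lborel)"
      unfolding e by (simp add: mult.assoc[symmetric] power_divide del: DIM_prod flip: ennreal_mult)
    finally show ?thesis .
  qed
  have "(\<integral>\<^sup>+W. (\<integral>\<^sup>+V. ennreal ((cmod (gabor_matrix a V W) * \<omega> (V - W))\<^sup>2) \<partial>lborel) \<partial>lborel)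
     = (\<integral>\<^sup>+W. (\<integral>\<^sup>+U. ennreal ((cmod (gabor_matrix a (W + U) W) * \<omega> U)\<^sup>2) \<partial>lborel) \<partial>lborel)"
  proof (rule nn_integral_cong)
    fix W
    show "(\<integral>\<^sup>+V. ennreal ((cmod (gabor_matrix a V W) * \<omega> (V - W))\<^sup>2) \<partial>lborel) = (\<integral>\<^sup>+U. ennreal ((cmod (gabor_matrix a (W + U) W) * \<omega> U)\<^sup>2) \<partial>lborel)"
      using nn_integral_lborel_translate[of "\<lambda>V. ennreal ((cmod (gabor_matrix a V W) * \<omega> (V - W))\<^sup>2)" W] by simp
  qed
  also have "\<dots> = (\<integral>\<^sup>+U. (\<integral>\<^sup>+W. ennreal ((cmod (gabor_matrix a (W + U) W) * \<omega> U)\<^sup>2) \<partial>lborel) \<partial>lborel)"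
    using lborel_Tonelli_fst[of "\<lambda>Q. ennreal ((cmod (gabor_matrix a (snd Q + fst Q) (snd Q)) * \<omega> (fst Q))\<^sup>2)"]
      lborel_Tonelli_snd[of "\<lambda>Q. ennreal ((cmod (gabor_matrix a (snd Q + fst Q) (snd Q)) * \<omega> (fst Q))\<^sup>2)"]
    by simp
  also have "\<dots> = (\<integral>\<^sup>+U. ennreal ((\<omega> U)\<^sup>2) * (?p * (\<integral>\<^sup>+X. ?a X * ennreal ((gauss (X - U))\<^sup>2) \<partial>lborel)) \<partial>lborel)"
  proof (rule nn_integral_cong)
    fix U
    have [measurable]: "(\<lambda>W. gabor_matrix a (W + U) W) \<in> borel_measurable borel"
      using measurable_compose[OF _ m2, of "\<lambda>W. (U, W)" borel] by simp
    have "(\<integral>\<^sup>+W. ennreal ((cmod (gabor_matrix a (W + U) W) * \<omega> U)\<^sup>2) \<partial>lborel) = (\<integral>\<^sup>+W. ennreal ((\<omega> U)\<^sup>2) * ?m W U \<partial>lborel)"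
      by (intro nn_integral_cong) (simp add: power_mult_distrib mult.commute flip: ennreal_mult)
    also have "\<dots> = ennreal ((\<omega> U)\<^sup>2) * (\<integral>\<^sup>+W. ?m W U \<partial>lborel)"
      by (intro nn_integral_cmult) simp
    finally show "(\<integral>\<^sup>+W. ennreal ((cmod (gabor_matrix a (W + U) W) * \<omega> U)\<^sup>2) \<partial>lborel)
       = ennreal ((\<omega> U)\<^sup>2) * (?p * (\<integral>\<^sup>+X. ?a X * ennreal ((gauss (X - U))\<^sup>2) \<partial>lborel))"
      unfolding inner .
  qed
  also have "\<dots> = (\<integral>\<^sup>+U. (\<integral>\<^sup>+X. ?p * (?a X * ?w U X) \<partial>lborel) \<partial>lborel)"
  proof (rule nn_integral_cong)
    fix U
    show "ennreal ((\<omega> U)\<^sup>2) * (?p * (\<integral>\<^sup>+X. ?a X * ennreal ((gauss (X - U))\<^sup>2) \<partial>lborel))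
      = (\<integral>\<^sup>+X. ?p * (?a X * ?w U X) \<partial>lborel)"
    proof -
      have "(\<integral>\<^sup>+X. ?p * (?a X * ?w U X) \<partial>lborel)
        = (\<integral>\<^sup>+X. (ennreal ((\<omega> U)\<^sup>2) * ?p) * (?a X * ennreal ((gauss (X - U))\<^sup>2)) \<partial>lborel)"
        by (intro nn_integral_cong) (simp add: power_mult_distrib ennreal_mult mult_ac del: DIM_prod)
      also have "\<dots> = (ennreal ((\<omega> U)\<^sup>2) * ?p) * (\<integral>\<^sup>+X. ?a X * ennreal ((gauss (X - U))\<^sup>2) \<partial>lborel)"
        by (intro nn_integral_cmult) measurable
      finally show ?thesis by (simp only: mult.assoc)
    qed
  qed
  also have "\<dots> = (\<integral>\<^sup>+X. (\<integral>\<^sup>+U. ?p * (?a X * ?w U X) \<partial>lborel) \<partial>lborel)"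
    using lborel_Tonelli_fst[of "\<lambda>Q. ?p * (ennreal ((cmod (a (fst Q)))\<^sup>2) * ennreal ((\<omega> (snd Q) * gauss (fst Q - snd Q))\<^sup>2))"]
      lborel_Tonelli_snd[of "\<lambda>Q. ?p * (ennreal ((cmod (a (fst Q)))\<^sup>2) * ennreal ((\<omega> (snd Q) * gauss (fst Q - snd Q))\<^sup>2))"]
    by (simp del: DIM_prod)
  also have "\<dots> = ?p * (\<integral>\<^sup>+X. ?a X * (\<integral>\<^sup>+U. ?w U X \<partial>lborel) \<partial>lborel)"
    by (simp add: nn_integral_cmult del: DIM_prod)
  finally show ?thesis .
qed

text \<open>Since \<open>(1 + t)\<^sup>k \<le> k! exp (1 + t)\<close> and \<open>1 + t - t\<^sup>2 \<le> 2\<close>.\<close>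

lemma poly_gauss_bound:
  "(1 + norm h) ^ k * gauss h \<le> fact k * exp 2"
proof -
  have "(1 + norm h) ^ k / fact k \<le> exp (1 + norm h)"
    by (rule power_div_fact_le_exp) simp
  then have "(1 + norm h) ^ k \<le> fact k * exp (1 + norm h)" by (simp add: divide_le_eq mult.commute)
  then have "(1 + norm h) ^ k * gauss h \<le> fact k * exp (1 + norm h) * gauss h"
    using gauss_pos by (intro mult_right_mono) (auto intro: less_imp_le)
  also have "\<dots> = fact k * exp (1 + norm h - (norm h)\<^sup>2)" by (simp add: gauss_def exp_diff exp_minus field_simps)
  also have "1 + norm h - (norm h)\<^sup>2 \<le> 2"
  proof -
    have "2 * norm h \<le> (norm h)\<^sup>2 + 1" using zero_le_power2[of "norm h - 1"] by (simp add: power2_diff)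
    then show ?thesis using norm_ge_zero[of h] by linarith
  qed
  finally show ?thesis by simp
qed

text \<open>A regular weight varies by at most a polynomial factor, which the Gaussian absorbs from above; from below the
unit ball around \<open>X\<close> already contributes a fixed multiple of \<open>\<omega>(X)\<^sup>2\<close>.\<close>

lemma gaussian_average_weight:
  fixes \<omega> :: "'a::euclidean_space \<Rightarrow> real"
  assumes "regular_weight N \<omega>"
  obtains m1 m2 where "0 < m1" "0 < m2"
    "\<And>X. ennreal (m1 * (\<omega> X)\<^sup>2) \<le> (\<integral>\<^sup>+U. ennreal ((\<omega> U * gauss (X - U))\<^sup>2) \<partial>lborel)"
    "\<And>X. (\<integral>\<^sup>+U. ennreal ((\<omega> U * gauss (X - U))\<^sup>2) \<partial>lborel) \<le> ennreal (m2 * (\<omega> X)\<^sup>2)"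
proof -
  have cont: "continuous_on UNIV \<omega>" and pos: "\<And>x. 0 < \<omega> x" and reg: "\<And>x h. \<omega> (x + h) \<le> (1 + norm h) ^ N * \<omega> x"
    using assms by (auto simp: regular_weight_def)
  have [measurable]: "\<omega> \<in> borel_measurable borel" using cont by (rule borel_measurable_continuous_onI)
  have refl: "(\<integral>\<^sup>+U. ennreal ((\<omega> U * gauss (X - U))\<^sup>2) \<partial>lborel) = (\<integral>\<^sup>+h. ennreal ((\<omega> (X - h) * gauss h)\<^sup>2) \<partial>lborel)" for X
    using nn_integral_lborel_reflect[of "\<lambda>U. ennreal ((\<omega> U * gauss (X - U))\<^sup>2)" X] by simp
  define m2 where "m2 = (fact (2 * N) * exp 2) * (LINT h|lborel. gauss (h::'a))"
  have Ig: "(LINT h|lborel. gauss (h::'a)) > 0" by (simp add: integral_gauss)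
  have m2: "m2 > 0" unfolding m2_def using Ig by simp
  have up: "(\<integral>\<^sup>+U. ennreal ((\<omega> U * gauss (X - U))\<^sup>2) \<partial>lborel) \<le> ennreal (m2 * (\<omega> X)\<^sup>2)" for X
  proof -
    have "(\<integral>\<^sup>+h. ennreal ((\<omega> (X - h) * gauss h)\<^sup>2) \<partial>lborel) \<le> (\<integral>\<^sup>+(h::'a). ennreal ((\<omega> X)\<^sup>2 * (fact (2 * N) * exp 2) * gauss h) \<partial>lborel)"
    proof (intro nn_integral_mono ennreal_leI)
      fix h :: 'a
      have "\<omega> (X - h) * gauss h \<le> ((1 + norm h) ^ N * \<omega> X) * gauss h"
        using reg[of X "-h"] gauss_pos[of h] by (intro mult_right_mono) (auto intro: less_imp_le)
      then have "(\<omega> (X - h) * gauss h)\<^sup>2 \<le> (((1 + norm h) ^ N * \<omega> X) * gauss h)\<^sup>2"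
        using pos[of "X - h"] gauss_pos[of h] by (intro power_mono) auto
      also have "\<dots> = (\<omega> X)\<^sup>2 * (((1 + norm h) ^ (2 * N) * gauss h) * gauss h)"
        by (simp add: power_mult_distrib power2_eq_square mult_2 mult_2_right power_add mult_ac)
      also have "\<dots> \<le> (\<omega> X)\<^sup>2 * ((fact (2 * N) * exp 2) * gauss h)"
        using poly_gauss_bound[of h "2 * N"] gauss_pos[of h] by (intro mult_left_mono mult_right_mono) (auto intro: less_imp_le)
      finally show "(\<omega> (X - h) * gauss h)\<^sup>2 \<le> (\<omega> X)\<^sup>2 * (fact (2 * N) * exp 2) * gauss h" by (simp add: mult.assoc)
    qed
    also have "\<dots> = ennreal (LINT h|lborel. (\<omega> X)\<^sup>2 * (fact (2 * N) * exp 2) * gauss (h::'a))"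
      by (intro nn_integral_eq_integral integrable_mult_right integrable_gauss AE_I2 mult_nonneg_nonneg less_imp_le[OF gauss_pos]) auto
    also have "(LINT h|lborel. (\<omega> X)\<^sup>2 * (fact (2 * N) * exp 2) * gauss (h::'a)) = m2 * (\<omega> X)\<^sup>2"
      by (simp add: m2_def)
    finally show ?thesis unfolding refl .
  qed
  define b where "b = measure lborel (ball (0::'a) 1)"
  have b: "b > 0" "emeasure lborel (ball (0::'a) 1) = ennreal b"
    using content_ball_pos[of 1 "0::'a"] emeasure_lborel_ball_finite[of "0::'a" 1]
    by (auto simp: b_def emeasure_eq_ennreal_measure)
  define k :: real where "k = (exp (- 1) / 2 ^ N)\<^sup>2"
  have k: "k > 0" by (simp add: k_def)
  have lo: "ennreal (k * b * (\<omega> X)\<^sup>2) \<le> (\<integral>\<^sup>+U. ennreal ((\<omega> U * gauss (X - U))\<^sup>2) \<partial>lborel)" for X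
  proof -
    have "ennreal (k * b * (\<omega> X)\<^sup>2) = (\<integral>\<^sup>+h. ennreal (k * (\<omega> X)\<^sup>2) * indicator (ball (0::'a) 1) h \<partial>lborel)"
      using k b by (subst nn_integral_cmult_indicator) (auto simp: b(2) mult_ac simp flip: ennreal_mult)
    also have "\<dots> \<le> (\<integral>\<^sup>+h. ennreal ((\<omega> (X - h) * gauss h)\<^sup>2) \<partial>lborel)"
    proof (intro nn_integral_mono)
      fix h :: 'a
      show "ennreal (k * (\<omega> X)\<^sup>2) * indicator (ball 0 1) h \<le> ennreal ((\<omega> (X - h) * gauss h)\<^sup>2)"
      proof (cases "h \<in> ball 0 1")
        case True
        then have h: "norm h \<le> 1" by simp
        have "\<omega> X \<le> (1 + norm h) ^ N * \<omega> (X - h)" using reg[of "X - h" h] by simp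
        also have "\<dots> \<le> 2 ^ N * \<omega> (X - h)" using h pos[of "X - h"] by (intro mult_right_mono power_mono) auto
        finally have 1: "\<omega> X / 2 ^ N \<le> \<omega> (X - h)" by (simp add: divide_le_eq mult.commute)
        have 2: "exp (-1) \<le> gauss h" using h by (simp add: gauss_def abs_square_le_1)
        have "exp (-1) / 2 ^ N * \<omega> X \<le> \<omega> (X - h) * gauss h"
          using mult_mono[OF 1 2] pos[of "X - h"] by (simp add: mult.commute)
        then have "(exp (-1) / 2 ^ N * \<omega> X)\<^sup>2 \<le> (\<omega> (X - h) * gauss h)\<^sup>2"
          using pos[of X] by (intro power_mono) auto
        then have "k * (\<omega> X)\<^sup>2 \<le> (\<omega> (X - h) * gauss h)\<^sup>2" by (simp only: k_def power_mult_distrib)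
        then show ?thesis using True by (simp add: ennreal_leI)
      qed simp
    qed
    finally show ?thesis unfolding refl .
  qed
  show ?thesis by (rule that[of "k * b" m2]) (use k b m2 lo up in auto)
qed

text \<open>The resolution of the identity for coherent states: integrating the intermediate state \<open>Z\<close> out of a product
of two elementary matrix coefficients gives the coefficient of \<open>\<rho>(X1) \<rho>(X2)\<close>, which is \<open>\<rho>(X1 + X2)\<close> up to the phase of the
twisted convolution. Centring \<open>Z\<close> at the midpoint \<open>m\<close> makes the Gaussians symmetric.\<close>

lemma gabor_matrix_kernel_product:
  fixes X1 X2 V W :: "'d::finite phase_space"
  shows "(LINT Z|lborel. of_real (gauss (X1 + Z - V) * gauss (X2 + W - Z)) *
      cis (2 * (sympl X1 (Z + V) - sympl V Z) + 2 * (sympl X2 (W + Z) - sympl Z W)))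
    = of_real (sqrt (pi / 2) ^ DIM('d phase_space)) * (of_real (gauss (X1 + X2 + W - V)) *
      cis (2 * (sympl X1 X2 + sympl (X1 + X2) (V + W) - sympl V W)))"
proof -
  define S where "S = X1 + X2 + W - V"
  \<comment> \<open>the midpoint of \<open>V - X1\<close> and \<open>X2 + W\<close>, where the two Gaussians are centred\<close>
  define m where "m = (1/2) *\<^sub>R (V - X1 + X2 + W)"
  define \<theta> where "\<theta> = 2 * (sympl X1 X2 + sympl (X1 + X2) (V + W) - sympl V W)"
  have 1: "X1 + (m + Z) - V = (1/2) *\<^sub>R S + Z" "X2 + W - (m + Z) = (1/2) *\<^sub>R S - Z" for Z
  proof -
    have "V = (1/2) *\<^sub>R V + (1/2) *\<^sub>R V" "X1 = (1/2) *\<^sub>R X1 + (1/2) *\<^sub>R X1" "X2 = (1/2) *\<^sub>R X2 + (1/2) *\<^sub>R X2"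
      "W = (1/2) *\<^sub>R W + (1/2) *\<^sub>R W" by (simp_all add: scaleR_half_double flip: scaleR_add_left)
    then show "X1 + (m + Z) - V = (1/2) *\<^sub>R S + Z" "X2 + W - (m + Z) = (1/2) *\<^sub>R S - Z"
      unfolding m_def S_def scaleR_add_right scaleR_diff_right by (simp_all add: algebra_simps)
  qed
  have gg: "gauss (X1 + (m + Z) - V) * gauss (X2 + W - (m + Z)) = exp (- (norm S)\<^sup>2 / 2) * exp (- 2 * (norm Z)\<^sup>2)" for Z
  proof -
    have "(norm ((1/2) *\<^sub>R S + Z))\<^sup>2 + (norm ((1/2) *\<^sub>R S - Z))\<^sup>2 = (norm S)\<^sup>2 / 2 + 2 * (norm Z)\<^sup>2"
      unfolding power2_norm_eq_inner by (simp add: inner_add inner_diff inner_commute algebra_simps)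
    then have "- (norm ((1/2) *\<^sub>R S + Z))\<^sup>2 + - (norm ((1/2) *\<^sub>R S - Z))\<^sup>2 = - (norm S)\<^sup>2 / 2 + - 2 * (norm Z)\<^sup>2" by simp
    then show ?thesis unfolding 1 gauss_def exp_add[symmetric] by simp
  qed
  have ph: "2 * (sympl X1 (m + Z + V) - sympl V (m + Z)) + 2 * (sympl X2 (W + (m + Z)) - sympl (m + Z) W) = \<theta> + 2 * sympl S Z" for Z
  proof -
    have "sympl Z W = - sympl W Z" "sympl m W = - sympl W m" by (simp_all add: sympl_swap[of Z W] sympl_swap[of m W])
    then have "2 * (sympl X1 (m + Z + V) - sympl V (m + Z)) + 2 * (sympl X2 (W + (m + Z)) - sympl (m + Z) W)
      = 2 * sympl S Z + (2 * sympl S m + 2 * sympl X1 V + 2 * sympl X2 W)"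
      unfolding S_def by (simp add: sympl_add_left sympl_add_right sympl_diff_left algebra_simps)
    moreover have "2 * sympl S m = sympl S (V - X1 + X2 + W)" by (simp add: m_def sympl_scale_right)
    moreover have "sympl S (V - X1 + X2 + W) + 2 * sympl X1 V + 2 * sympl X2 W = \<theta>"
      unfolding \<theta>_def S_def
      by (simp add: sympl_add_left sympl_add_right sympl_diff_left sympl_diff_right sympl_self
          sympl_swap[of X2 X1] sympl_swap[of W X1] sympl_swap[of W X2] sympl_swap[of V X1] sympl_swap[of V X2] sympl_swap[of W V] algebra_simps)
    ultimately show ?thesis by simp
  qed
  have "(LINT Z|lborel. of_real (gauss (X1 + Z - V) * gauss (X2 + W - Z)) *
      cis (2 * (sympl X1 (Z + V) - sympl V Z) + 2 * (sympl X2 (W + Z) - sympl Z W)))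
     = (LINT Z|lborel. of_real (gauss (X1 + (m + Z) - V) * gauss (X2 + W - (m + Z))) *
      cis (2 * (sympl X1 (m + Z + V) - sympl V (m + Z)) + 2 * (sympl X2 (W + (m + Z)) - sympl (m + Z) W)))"
    by (rule integral_lborel_translate[symmetric]) measurable
  also have "\<dots> = (LINT Z|lborel. (of_real (exp (- (norm S)\<^sup>2 / 2)) * cis \<theta>) * (of_real (exp (- 2 * (norm Z)\<^sup>2)) * cis (2 * sympl S Z)))"
    unfolding gg ph by (intro Bochner_Integration.integral_cong) (auto simp: cis_mult[symmetric])
  also have "\<dots> = (of_real (exp (- (norm S)\<^sup>2 / 2)) * cis \<theta>) * of_real (sqrt (pi / 2) ^ DIM('d phase_space) * exp (- (norm S)\<^sup>2 / 2))"
    using gaussian_sympl_fourier(2)[of 2 S] by simp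
  also have "\<dots> = of_real (sqrt (pi / 2) ^ DIM('d phase_space)) * (of_real (exp (- (norm S)\<^sup>2 / 2) * exp (- (norm S)\<^sup>2 / 2)) * cis \<theta>)"
    by (simp add: mult_ac)
  also have "exp (- (norm S)\<^sup>2 / 2) * exp (- (norm S)\<^sup>2 / 2) = gauss S" by (simp add: gauss_def flip: exp_add)
  finally show ?thesis by (simp add: S_def \<theta>_def)
qed

lemma tconv_continuous:
  fixes a b :: "'d::finite phase_space \<Rightarrow> complex"
  assumes a: "continuous_on UNIV a" "\<And>X. a X \<noteq> 0 \<Longrightarrow> norm X \<le> R"
    and b: "continuous_on UNIV b" "\<And>X. b X \<noteq> 0 \<Longrightarrow> norm X \<le> R"
  shows "continuous_on UNIV (tconv c a b)" "tconv c a b X \<noteq> 0 \<Longrightarrow> norm X \<le> 2 * R"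
proof -
  obtain A where A: "0 \<le> A" "\<And>X. cmod (a X) \<le> A" using continuous_bounded_support_bounded[OF a] by blast
  obtain B where B: "0 \<le> B" "\<And>X. cmod (b X) \<le> B" using continuous_bounded_support_bounded[OF b] by blast
  have [measurable]: "a \<in> borel_measurable borel" "b \<in> borel_measurable borel"
    using a b by (auto intro: borel_measurable_continuous_onI)
  have bi: "integrable lborel b" by (rule integrable_bounded_support[OF _ B(2) b(2)]) simp
  have ac: "isCont a X" for X
    by (rule continuous_on_eq_continuous_at[OF open_UNIV, THEN iffD1, OF a(1), rule_format, OF UNIV_I])
  have "isCont (tconv c a b) X" for X
    unfolding continuous_at_sequentially comp_def
  proof (intro allI impI)
    fix S assume S: "S \<longlonglongrightarrow> X"
    show "(\<lambda>n. tconv c a b (S n)) \<longlonglongrightarrow> tconv c a b X"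
      unfolding tconv_def
    proof (rule integral_dominated_convergence)
      show "integrable lborel (\<lambda>Y. A * cmod (b Y))" using bi by simp
      show "AE Y in lborel. (\<lambda>n. a (S n - Y) * b Y * cis (c * sympl (S n) Y)) \<longlonglongrightarrow> a (X - Y) * b Y * cis (c * sympl X Y)"
      proof (intro AE_I2 tendsto_mult tendsto_const)
        fix Y
        show "(\<lambda>n. a (S n - Y)) \<longlonglongrightarrow> a (X - Y)"
          by (rule isCont_tendsto_compose[OF ac]) (intro tendsto_intros S)
        have "(\<lambda>n. sympl (S n) Y) \<longlonglongrightarrow> sympl X Y"
          unfolding sympl_def by (intro tendsto_intros S)
        then show "(\<lambda>n. cis (c * sympl (S n) Y)) \<longlonglongrightarrow> cis (c * sympl X Y)"
          unfolding cis_conv_exp by (intro tendsto_intros)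
      qed
      show "AE Y in lborel. norm (a (S n - Y) * b Y * cis (c * sympl (S n) Y)) \<le> A * cmod (b Y)" for n
        by (intro AE_I2) (simp add: norm_mult mult_right_mono A)
    qed simp_all
  qed
  then show "continuous_on UNIV (tconv c a b)" by (simp add: continuous_at_imp_continuous_on)
  assume "tconv c a b X \<noteq> 0"
  then obtain Y where "a (X - Y) * b Y * cis (c * sympl X Y) \<noteq> 0"
    unfolding tconv_def by (metis (mono_tags, lifting) Bochner_Integration.integral_cong integral_zero)
  then have "norm (X - Y) \<le> R" "norm Y \<le> R" using a(2) b(2) by auto
  then show "norm X \<le> 2 * R" using norm_triangle_ineq[of "X - Y" Y] by simp
qed

text \<open>Both sides are integrals over \<open>(X1, X2)\<close> of \<open>a(X1) b(X2)\<close> against elementary kernels, and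
\<open>gabor_matrix_kernel_product\<close> says that the kernels agree.\<close>

lemma gabor_matrix_tconv:
  fixes a b :: "'d::finite phase_space \<Rightarrow> complex"
  assumes a: "continuous_on UNIV a" "\<And>X. a X \<noteq> 0 \<Longrightarrow> norm X \<le> R"
    and b: "continuous_on UNIV b" "\<And>X. b X \<noteq> 0 \<Longrightarrow> norm X \<le> R"
  shows "of_real (sqrt (pi / 2) ^ DIM('d phase_space)) * gabor_matrix (tconv 2 a b) V W = (LINT Z|lborel. gabor_matrix a V Z * gabor_matrix b Z W)"
proof -
  let ?\<kappa> = "complex_of_real (sqrt (pi / 2) ^ DIM('d phase_space))"
  obtain A where A: "0 \<le> A" "\<And>X. cmod (a X) \<le> A" using continuous_bounded_support_bounded[OF a] by blast
  obtain B where B: "0 \<le> B" "\<And>X. cmod (b X) \<le> B" using continuous_bounded_support_bounded[OF b] by blast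
  have am[measurable]: "a \<in> borel_measurable borel" and bm[measurable]: "b \<in> borel_measurable borel"
    using a b by (auto intro: borel_measurable_continuous_onI)
  have ai: "integrable lborel a" by (rule integrable_bounded_support[OF _ A(2) a(2)]) simp
  have bi: "integrable lborel b" by (rule integrable_bounded_support[OF _ B(2) b(2)]) simp
  define g where "g X = of_real (gauss (X + W - V)) * cis (2 * (sympl X (W + V) - sympl V W))" for X
  have gm[measurable]: "g \<in> borel_measurable borel" unfolding g_def by measurable
  have g1: "cmod (g X) \<le> 1" for X
    using gauss_le_1[of "X + W - V"] gauss_pos[of "X + W - V"] by (simp add: g_def norm_mult)
  \<comment> \<open>the matrix of the twisted convolution as an integral over \<open>(X1, X2)\<close>\<close>
  define l where "l z = a (fst z - snd z) * b (snd z) * cis (2 * sympl (fst z) (snd z)) * g (fst z)" for z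
  have li: "integrable lborel l"
  proof (rule integrable_bounded_support)
    show "l \<in> borel_measurable borel" unfolding l_def by measurable
    show "norm (l z) \<le> A * B * 1" for z
      unfolding l_def norm_mult norm_cis mult_1_right
      using mult_mono[OF mult_mono[OF A(2) B(2)] g1] A B by simp
    show "norm z \<le> 3 * R" if "l z \<noteq> 0" for z
    proof -
      have n: "norm (fst z - snd z) \<le> R" "norm (snd z) \<le> R" using that a(2) b(2) by (auto simp: l_def)
      then have "norm (fst z) \<le> 2 * R" using norm_triangle_ineq[of "fst z - snd z" "snd z"] by simp
      then show ?thesis using n norm_Pair_le[of "fst z" "snd z"] by simp
    qed
  qed
  have "gabor_matrix (tconv 2 a b) V W = (LINT X|lborel. LINT Y|lborel. l (X, Y))"
    unfolding gabor_matrix_def l_def fst_conv snd_conv tconv_def g_def[symmetric] by simp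
  also have "\<dots> = (LINT Y|lborel. LINT X|lborel. l (X, Y))"
    using lborel_Fubini_fst[OF li] lborel_Fubini_snd[OF li] by simp
  also have "\<dots> = (LINT Y|lborel. LINT X|lborel. a X * b Y * cis (2 * sympl X Y) * g (X + Y))"
  proof (rule Bochner_Integration.integral_cong[OF refl])
    fix Y
    have "(LINT X|lborel. l (Y + X, Y)) = (LINT X|lborel. l (X, Y))"
      by (rule integral_lborel_translate) (simp add: l_def)
    then show "(LINT X|lborel. l (X, Y)) = (LINT X|lborel. a X * b Y * cis (2 * sympl X Y) * g (X + Y))"
      by (simp add: l_def sympl_add_left sympl_self add.commute)
  qed
  also have "\<dots> = (LINT P|lborel. a (fst P) * b (snd P) * cis (2 * sympl (fst P) (snd P)) * g (fst P + snd P))"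
  proof -
    have "integrable lborel (\<lambda>P. a (fst P) * b (snd P) * cis (2 * sympl (fst P) (snd P)) * g (fst P + snd P))"
    proof (rule Bochner_Integration.integrable_bound[OF lborel_integrable_tensor[OF ai bi]])
      show "AE P in lborel. norm (a (fst P) * b (snd P) * cis (2 * sympl (fst P) (snd P)) * g (fst P + snd P)) \<le> norm (a (fst P) * b (snd P))"
        using g1 by (intro AE_I2) (simp add: norm_mult mult_left_le)
    qed simp
    from lborel_Fubini_snd[OF this] show ?thesis by simp
  qed
  finally have lhs: "gabor_matrix (tconv 2 a b) V W = (LINT P|lborel. a (fst P) * b (snd P) * cis (2 * sympl (fst P) (snd P)) * g (fst P + snd P))" .
  \<comment> \<open>the matrix product as an integral over \<open>(Z, (X1, X2))\<close>\<close>
  define q where "q z = (a (fst (snd z)) * b (snd (snd z))) * (of_real (gauss (fst (snd z) + fst z - V) * gauss (snd (snd z) + W - fst z)) *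
      cis (2 * (sympl (fst (snd z)) (fst z + V) - sympl V (fst z)) + 2 * (sympl (snd (snd z)) (W + fst z) - sympl (fst z) W)))"
    for z :: "'d phase_space \<times> 'd phase_space \<times> 'd phase_space"
  have qm[measurable]: "q \<in> borel_measurable borel" unfolding q_def by measurable
  have qi: "integrable lborel q"
    unfolding integrable_iff_bounded
  proof
    have "(\<integral>\<^sup>+z. ennreal (norm (q z)) \<partial>lborel)
      \<le> (\<integral>\<^sup>+z. ennreal (cmod (a (fst (snd z)) * b (snd (snd z)))) * ennreal (gauss (fst (snd z) - V + fst z)) \<partial>lborel)"
    proof (rule nn_integral_mono)
      fix z :: "'d phase_space \<times> 'd phase_space \<times> 'd phase_space"
      have "norm (q z) \<le> cmod (a (fst (snd z)) * b (snd (snd z))) * (gauss (fst (snd z) - V + fst z) * 1)"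
      proof -
        have e: "fst (snd z) + fst z - V = fst (snd z) - V + fst z" by simp
        have "norm (q z) = cmod (a (fst (snd z)) * b (snd (snd z))) * (gauss (fst (snd z) - V + fst z) * gauss (snd (snd z) + W - fst z))"
          unfolding q_def e norm_mult[of "a _ * b _"] norm_mult[of "of_real _"] norm_cis norm_of_real abs_mult abs_of_pos[OF gauss_pos] by simp
        then show ?thesis
          by (simp only:) (intro mult_left_mono gauss_le_1 less_imp_le[OF gauss_pos] norm_ge_zero)
      qed
      then show "ennreal (norm (q z)) \<le> ennreal (cmod (a (fst (snd z)) * b (snd (snd z)))) * ennreal (gauss (fst (snd z) - V + fst z))"
        by (simp add: ennreal_leI less_imp_le[OF gauss_pos] flip: ennreal_mult)
    qed
    also have "\<dots> = (\<integral>\<^sup>+P. (\<integral>\<^sup>+Z. ennreal (cmod (a (fst P) * b (snd P))) * ennreal (gauss (fst P - V + Z)) \<partial>lborel) \<partial>lborel)"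
      by (subst lborel_Tonelli_snd) simp_all
    also have "\<dots> = (\<integral>\<^sup>+P. ennreal (cmod (a (fst P) * b (snd P))) * (\<integral>\<^sup>+Z. ennreal (gauss (Z::'d phase_space)) \<partial>lborel) \<partial>lborel)"
    proof (rule nn_integral_cong)
      fix P :: "'d phase_space \<times> 'd phase_space"
      have "(\<integral>\<^sup>+Z. ennreal (gauss (fst P - V + Z)) \<partial>lborel) = (\<integral>\<^sup>+Z. ennreal (gauss (Z::'d phase_space)) \<partial>lborel)"
        by (rule nn_integral_lborel_translate[of "\<lambda>Z. ennreal (gauss Z)"]) simp
      then show "(\<integral>\<^sup>+Z. ennreal (cmod (a (fst P) * b (snd P))) * ennreal (gauss (fst P - V + Z)) \<partial>lborel)
         = ennreal (cmod (a (fst P) * b (snd P))) * (\<integral>\<^sup>+Z. ennreal (gauss (Z::'d phase_space)) \<partial>lborel)"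
        by (subst nn_integral_cmult) simp_all
    qed
    also have "\<dots> = (\<integral>\<^sup>+P. ennreal (cmod (a (fst P) * b (snd P))) \<partial>lborel) * (\<integral>\<^sup>+Z. ennreal (gauss (Z::'d phase_space)) \<partial>lborel)"
      by (rule nn_integral_multc) simp
    also have "\<dots> < \<infinity>"
    proof -
      have "(\<integral>\<^sup>+P. ennreal (cmod (a (fst P) * b (snd P))) \<partial>lborel) < \<infinity>"
        using lborel_integrable_tensor[OF ai bi] unfolding integrable_iff_bounded by blast
      moreover have "(\<integral>\<^sup>+Z. ennreal (gauss (Z::'d phase_space)) \<partial>lborel) < \<infinity>"
        by (subst nn_integral_eq_integral[OF integrable_gauss]) (auto intro: less_imp_le[OF gauss_pos])
      ultimately show ?thesis by (simp add: ennreal_mult_less_top)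
    qed
    finally show "(\<integral>\<^sup>+z. ennreal (norm (q z)) \<partial>lborel) < \<infinity>" .
  qed simp
  have "(LINT Z|lborel. gabor_matrix a V Z * gabor_matrix b Z W) = (LINT Z|lborel. LINT P|lborel. q (Z, P))"
  proof (rule Bochner_Integration.integral_cong[OF refl])
    fix Z
    have bnd: "cmod (of_real (gauss u) * cis t) \<le> 1" for u :: "'d phase_space" and t
      using gauss_le_1[of u] gauss_pos[of u] by (simp add: norm_mult)
    have 1: "integrable lborel (\<lambda>X. a X * (of_real (gauss (X + Z - V)) * cis (2 * (sympl X (Z + V) - sympl V Z))))"
    proof (rule Bochner_Integration.integrable_bound[OF ai])
      show "AE X in lborel. norm (a X * (of_real (gauss (X + Z - V)) * cis (2 * (sympl X (Z + V) - sympl V Z)))) \<le> norm (a X)"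
        unfolding norm_mult[of "a _"] by (intro AE_I2 mult_left_le bnd norm_ge_zero)
    qed simp
    have 2: "integrable lborel (\<lambda>X. b X * (of_real (gauss (X + W - Z)) * cis (2 * (sympl X (W + Z) - sympl Z W))))"
    proof (rule Bochner_Integration.integrable_bound[OF bi])
      show "AE X in lborel. norm (b X * (of_real (gauss (X + W - Z)) * cis (2 * (sympl X (W + Z) - sympl Z W)))) \<le> norm (b X)"
        unfolding norm_mult[of "b _"] by (intro AE_I2 mult_left_le bnd norm_ge_zero)
    qed simp
    have "gabor_matrix a V Z * gabor_matrix b Z W = (LINT P|lborel. (a (fst P) * (of_real (gauss (fst P + Z - V)) * cis (2 * (sympl (fst P) (Z + V) - sympl V Z)))) *
        (b (snd P) * (of_real (gauss (snd P + W - Z)) * cis (2 * (sympl (snd P) (W + Z) - sympl Z W)))))"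
      unfolding gabor_matrix_def by (rule lborel_integral_tensor[OF 1 2, symmetric])
    also have "\<dots> = (LINT P|lborel. q (Z, P))"
      by (intro Bochner_Integration.integral_cong refl) (simp add: q_def mult_ac flip: cis_mult)
    finally show "gabor_matrix a V Z * gabor_matrix b Z W = (LINT P|lborel. q (Z, P))" .
  qed
  also have "\<dots> = (LINT P|lborel. LINT Z|lborel. q (Z, P))"
    using lborel_Fubini_fst[OF qi] lborel_Fubini_snd[OF qi] by simp
  also have "\<dots> = (LINT P|lborel. ?\<kappa> * (a (fst P) * b (snd P) * cis (2 * sympl (fst P) (snd P)) * g (fst P + snd P)))"
  proof (rule Bochner_Integration.integral_cong[OF refl])
    fix P :: "'d phase_space \<times> 'd phase_space"
    have "(LINT Z|lborel. q (Z, P)) = (a (fst P) * b (snd P)) * (?\<kappa> * (of_real (gauss (fst P + snd P + W - V)) *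
      cis (2 * (sympl (fst P) (snd P) + sympl (fst P + snd P) (V + W) - sympl V W))))"
      unfolding q_def fst_conv snd_conv integral_mult_right_zero gabor_matrix_kernel_product ..
    also have "cis (2 * (sympl (fst P) (snd P) + sympl (fst P + snd P) (V + W) - sympl V W))
       = cis (2 * sympl (fst P) (snd P)) * cis (2 * (sympl (fst P + snd P) (W + V) - sympl V W))"
      by (simp add: cis_mult algebra_simps)
    finally show "(LINT Z|lborel. q (Z, P)) = ?\<kappa> * (a (fst P) * b (snd P) * cis (2 * sympl (fst P) (snd P)) * g (fst P + snd P))"
      by (simp add: g_def mult_ac)
  qed
  also have "\<dots> = ?\<kappa> * gabor_matrix (tconv 2 a b) V W" unfolding lhs by simp
  finally show ?thesis ..
qed

text \<open>An entry of the matrix of the twisted convolution is bounded by the square norms of a row of one matrix and of a column of the other,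
with weights distributed by \<open>\<omega>\<^sub>0(V-W) \<le> C \<omega>\<^sub>1(V-Z) \<omega>\<^sub>2(Z-W)\<close>. The energies of the three matrices are comparable to the
weighted square norms of the three functions.\<close>

lemma tconv_L2_bound:
  fixes \<omega>0 \<omega>1 \<omega>2 :: "'d::finite phase_space \<Rightarrow> real"
  assumes w: "regular_weight N0 \<omega>0" "regular_weight N1 \<omega>1" "regular_weight N2 \<omega>2"
    and C: "0 \<le> C" "\<And>X Y. \<omega>0 (X + Y) \<le> C * \<omega>1 X * \<omega>2 Y"
  obtains M where "0 \<le> M" "\<And>a b R. continuous_on UNIV a \<Longrightarrow> (\<And>X. a X \<noteq> 0 \<Longrightarrow> norm X \<le> R) \<Longrightarrow>
    continuous_on UNIV b \<Longrightarrow> (\<And>X. b X \<noteq> 0 \<Longrightarrow> norm X \<le> R) \<Longrightarrow>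
    (\<integral>\<^sup>+X. ennreal ((cmod (tconv 2 a b X) * \<omega>0 X)\<^sup>2) \<partial>lborel)
      \<le> ennreal M * ((\<integral>\<^sup>+X. ennreal ((cmod (a X) * \<omega>1 X)\<^sup>2) \<partial>lborel) * (\<integral>\<^sup>+X. ennreal ((cmod (b X) * \<omega>2 X)\<^sup>2) \<partial>lborel))"
proof -
  let ?n = "DIM('d phase_space)"
  let ?p = "(pi / 2) ^ ?n"
  let ?I = "\<lambda>(f :: 'd phase_space \<Rightarrow> complex) (\<omega> :: 'd phase_space \<Rightarrow> real). \<integral>\<^sup>+X. ennreal ((cmod (f X) * \<omega> X)\<^sup>2) \<partial>lborel"
  let ?E = "\<lambda>(f :: 'd phase_space \<Rightarrow> complex) (\<omega> :: 'd phase_space \<Rightarrow> real). \<integral>\<^sup>+W. (\<integral>\<^sup>+V. ennreal ((cmod (gabor_matrix f V W) * \<omega> (V - W))\<^sup>2) \<partial>lborel) \<partial>lborel"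
  let ?A = "\<lambda>(\<omega> :: 'd phase_space \<Rightarrow> real) X. \<integral>\<^sup>+U. ennreal ((\<omega> U * gauss (X - U))\<^sup>2) \<partial>lborel"
  have p0: "0 < ?p" by simp
  obtain m where m: "0 < m" "\<And>X. ennreal (m * (\<omega>0 X)\<^sup>2) \<le> (?A \<omega>0 X)"
    by (rule gaussian_average_weight[OF w(1)]) blast
  obtain m1 where m1: "0 < m1" "\<And>X. (?A \<omega>1 X) \<le> ennreal (m1 * (\<omega>1 X)\<^sup>2)"
    by (rule gaussian_average_weight[OF w(2)]) blast
  obtain m2 where m2: "0 < m2" "\<And>X. (?A \<omega>2 X) \<le> ennreal (m2 * (\<omega>2 X)\<^sup>2)"
    by (rule gaussian_average_weight[OF w(3)]) blast
  have cw: "continuous_on UNIV \<omega>0" "continuous_on UNIV \<omega>1" "continuous_on UNIV \<omega>2"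
    and pw: "\<And>X. 0 < \<omega>0 X" "\<And>X. 0 < \<omega>1 X" "\<And>X. 0 < \<omega>2 X"
    using w by (auto simp: regular_weight_def)
  have wm[measurable]: "\<omega>0 \<in> borel_measurable borel" "\<omega>1 \<in> borel_measurable borel" "\<omega>2 \<in> borel_measurable borel"
    using cw by (auto intro: borel_measurable_continuous_onI)
  define \<kappa> where "\<kappa> = sqrt (pi / 2) ^ ?n"
  have \<kappa>0: "0 < \<kappa>" by (simp add: \<kappa>_def)
  define M where "M = (1 / (?p * m)) * ((C / \<kappa>)\<^sup>2 * ((?p * m1) * (?p * m2)))"
  have upper: "(?E a \<omega>) \<le> ennreal (?p * k) * (?I a \<omega>)"
    if a: "continuous_on UNIV a" "\<And>X. a X \<noteq> 0 \<Longrightarrow> norm X \<le> R" and w: "continuous_on UNIV \<omega>"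
      and k: "0 < k" "\<And>X. (?A \<omega> X) \<le> ennreal (k * (\<omega> X)\<^sup>2)"
    for a :: "'d phase_space \<Rightarrow> complex" and R and \<omega> :: "'d phase_space \<Rightarrow> real" and k
  proof -
    have [measurable]: "a \<in> borel_measurable borel" "\<omega> \<in> borel_measurable borel"
      using a w by (auto intro: borel_measurable_continuous_onI)
    have "(?E a \<omega>)
       = ennreal ?p * (\<integral>\<^sup>+X. ennreal ((cmod (a X))\<^sup>2) * (?A \<omega> X) \<partial>lborel)"
      by (rule gabor_matrix_energy[OF a w])
    also have "\<dots> \<le> ennreal ?p * (\<integral>\<^sup>+X. ennreal ((cmod (a X))\<^sup>2) * ennreal (k * (\<omega> X)\<^sup>2) \<partial>lborel)"
      by (rule mult_left_mono[OF nn_integral_mono[OF mult_left_mono[OF k(2)]]]) auto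
    also have "(\<integral>\<^sup>+X. ennreal ((cmod (a X))\<^sup>2) * ennreal (k * (\<omega> X)\<^sup>2) \<partial>lborel) = (\<integral>\<^sup>+X. ennreal k * ennreal ((cmod (a X) * \<omega> X)\<^sup>2) \<partial>lborel)"
      using k(1) by (intro nn_integral_cong) (simp add: power_mult_distrib ennreal_mult mult_ac)
    also have "\<dots> = ennreal k * (?I a \<omega>)" by (rule nn_integral_cmult) simp
    finally show ?thesis using k(1) by (simp add: ennreal_mult mult.assoc del: DIM_prod)
  qed
  show ?thesis
  proof (rule that[of M])
    show "0 \<le> M" unfolding M_def using m m1 m2 by simp
    fix a b :: "'d phase_space \<Rightarrow> complex" and R
    assume a: "continuous_on UNIV a" "\<And>X. a X \<noteq> 0 \<Longrightarrow> norm X \<le> R"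
      and b: "continuous_on UNIV b" "\<And>X. b X \<noteq> 0 \<Longrightarrow> norm X \<le> R"
    define f where "f = tconv 2 a b"
    have f: "continuous_on UNIV f" "\<And>X. f X \<noteq> 0 \<Longrightarrow> norm X \<le> 2 * R"
      unfolding f_def using tconv_continuous[OF a b] by blast+
    have [measurable]: "a \<in> borel_measurable borel" "b \<in> borel_measurable borel" "f \<in> borel_measurable borel"
      using a b f by (auto intro: borel_measurable_continuous_onI)
    have mm: "(\<lambda>x. gabor_matrix h (g x) (k x)) \<in> borel_measurable M'" 
      if "h \<in> borel_measurable borel" "g \<in> borel_measurable M'" "k \<in> borel_measurable M'" for h g k and M' :: "'z measure"
      using measurable_compose[OF borel_measurable_Pair[OF that(2,3)] borel_measurable_gabor_matrix[OF that(1)]] by simp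
    note [measurable] = mm
    define pa where "pa V Z = cmod (gabor_matrix a V Z) * \<omega>1 (V - Z)" for V Z
    define pb where "pb Z W = cmod (gabor_matrix b Z W) * \<omega>2 (Z - W)" for Z W
    have pa0: "0 \<le> pa V Z" "0 \<le> pb V Z" for V Z using pw by (auto simp: pa_def pb_def less_imp_le)
    define Ia where "Ia V = (\<integral>\<^sup>+Z. ennreal ((pa V Z)\<^sup>2) \<partial>lborel)" for V
    define Ib where "Ib W = (\<integral>\<^sup>+Z. ennreal ((pb Z W)\<^sup>2) \<partial>lborel)" for W
    have Iam: "Ia \<in> borel_measurable borel" "Ib \<in> borel_measurable borel"
    proof -
      have "(\<lambda>(V, Z). ennreal ((pa V Z)\<^sup>2)) \<in> borel_measurable (borel \<Otimes>\<^sub>M lborel)"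
        unfolding pa_def by (simp add: borel_prod case_prod_beta)
      then show "Ia \<in> borel_measurable borel" unfolding Ia_def by (rule lborel.borel_measurable_nn_integral)
      have "(\<lambda>(W, Z). ennreal ((pb Z W)\<^sup>2)) \<in> borel_measurable (borel \<Otimes>\<^sub>M lborel)"
        unfolding pb_def by (simp add: borel_prod case_prod_beta)
      then show "Ib \<in> borel_measurable borel" unfolding Ib_def by (rule lborel.borel_measurable_nn_integral)
    qed
    note [measurable] = Iam
    have pt: "ennreal ((cmod (gabor_matrix f V W) * \<omega>0 (V - W))\<^sup>2) \<le> ennreal ((C / \<kappa>)\<^sup>2) * (Ia V * Ib W)" for V W
    proof -
      have "\<kappa> * cmod (gabor_matrix f V W) = cmod (of_real \<kappa> * gabor_matrix f V W)" using \<kappa>0 by (simp add: norm_mult)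
      also have "of_real \<kappa> * gabor_matrix f V W = (LINT Z|lborel. gabor_matrix a V Z * gabor_matrix b Z W)"
        unfolding f_def \<kappa>_def by (rule gabor_matrix_tconv[OF a b])
      finally have "ennreal (\<kappa> * cmod (gabor_matrix f V W)) \<le> (\<integral>\<^sup>+Z. ennreal (cmod (gabor_matrix a V Z * gabor_matrix b Z W)) \<partial>lborel)"
        by (cases "integrable lborel (\<lambda>Z. gabor_matrix a V Z * gabor_matrix b Z W)")
           (auto intro: integral_norm_bound_ennreal simp: not_integrable_integral_eq)
      then have "ennreal (\<omega>0 (V - W)) * ennreal (\<kappa> * cmod (gabor_matrix f V W)) \<le> ennreal (\<omega>0 (V - W)) * (\<integral>\<^sup>+Z. ennreal (cmod (gabor_matrix a V Z * gabor_matrix b Z W)) \<partial>lborel)"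
        by (intro mult_left_mono) auto
      also have "\<dots> = (\<integral>\<^sup>+Z. ennreal (\<omega>0 (V - W)) * ennreal (cmod (gabor_matrix a V Z * gabor_matrix b Z W)) \<partial>lborel)"
        by (rule nn_integral_cmult[symmetric]) simp
      also have "\<dots> \<le> (\<integral>\<^sup>+Z. ennreal C * ennreal (pa V Z * pb Z W) \<partial>lborel)"
      proof (rule nn_integral_mono)
        fix Z
        have "\<omega>0 (V - W) \<le> C * \<omega>1 (V - Z) * \<omega>2 (Z - W)" using C(2)[of "V - Z" "Z - W"] by simp
        then have "\<omega>0 (V - W) * cmod (gabor_matrix a V Z * gabor_matrix b Z W) \<le> (C * \<omega>1 (V - Z) * \<omega>2 (Z - W)) * cmod (gabor_matrix a V Z * gabor_matrix b Z W)"
          by (intro mult_right_mono) auto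
        also have "\<dots> = C * (pa V Z * pb Z W)" by (simp add: pa_def pb_def norm_mult mult_ac)
        finally show "ennreal (\<omega>0 (V - W)) * ennreal (cmod (gabor_matrix a V Z * gabor_matrix b Z W)) \<le> ennreal C * ennreal (pa V Z * pb Z W)"
          using pw[of "V - W"] C(1) pa0 by (simp add: ennreal_leI less_imp_le flip: ennreal_mult)
      qed
      also have "\<dots> = ennreal C * (\<integral>\<^sup>+Z. ennreal (pa V Z * pb Z W) \<partial>lborel)"
        by (rule nn_integral_cmult) (simp add: pa_def pb_def)
      finally have 1: "ennreal (\<omega>0 (V - W)) * ennreal (\<kappa> * cmod (gabor_matrix f V W)) \<le> ennreal C * (\<integral>\<^sup>+Z. ennreal (pa V Z * pb Z W) \<partial>lborel)" .
      have "ennreal ((cmod (gabor_matrix f V W) * \<omega>0 (V - W))\<^sup>2) = ennreal ((1 / \<kappa>)\<^sup>2) * (ennreal (\<omega>0 (V - W)) * ennreal (\<kappa> * cmod (gabor_matrix f V W)))\<^sup>2"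
        using \<kappa>0 pw[of "V - W"] by (simp add: ennreal_power power_mult_distrib power_divide less_imp_le flip: ennreal_mult)
      also have "\<dots> \<le> ennreal ((1 / \<kappa>)\<^sup>2) * (ennreal C * (\<integral>\<^sup>+Z. ennreal (pa V Z * pb Z W) \<partial>lborel))\<^sup>2"
        by (intro mult_left_mono power_mono 1) auto
      also have "\<dots> = ennreal ((C / \<kappa>)\<^sup>2) * (\<integral>\<^sup>+Z. ennreal (pa V Z * pb Z W) \<partial>lborel)\<^sup>2"
        using C(1) by (simp add: power_mult_distrib ennreal_power mult.assoc[symmetric] power_divide flip: ennreal_mult)
      also have "\<dots> \<le> ennreal ((C / \<kappa>)\<^sup>2) * (Ia V * Ib W)"
        unfolding Ia_def Ib_def
        by (intro mult_left_mono Cauchy_Schwarz_nn_integral) (auto simp: pa0, auto simp: pa_def pb_def)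
      finally show ?thesis .
    qed
    have "(?E f \<omega>0)
       \<le> (\<integral>\<^sup>+W. (\<integral>\<^sup>+V. ennreal ((C / \<kappa>)\<^sup>2) * (Ia V * Ib W) \<partial>lborel) \<partial>lborel)"
      by (intro nn_integral_mono pt)
    also have "\<dots> = ennreal ((C / \<kappa>)\<^sup>2) * ((\<integral>\<^sup>+V. Ia V \<partial>lborel) * (\<integral>\<^sup>+W. Ib W \<partial>lborel))"
      by (simp add: nn_integral_cmult nn_integral_multc mult_ac)
    also have "(\<integral>\<^sup>+V. Ia V \<partial>lborel) = (?E a \<omega>1)"
      using lborel_Tonelli_fst[of "\<lambda>Q. ennreal ((pa (fst Q) (snd Q))\<^sup>2)"] lborel_Tonelli_snd[of "\<lambda>Q. ennreal ((pa (fst Q) (snd Q))\<^sup>2)"]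
      by (simp add: Ia_def pa_def)
    also have "(\<integral>\<^sup>+W. Ib W \<partial>lborel) = (?E b \<omega>2)"
      by (simp add: Ib_def pb_def)
    also have "ennreal ((C / \<kappa>)\<^sup>2) * ((?E a \<omega>1) *
        (?E b \<omega>2))
      \<le> ennreal ((C / \<kappa>)\<^sup>2) * ((ennreal (?p * m1) * (?I a \<omega>1)) * (ennreal (?p * m2) * (?I b \<omega>2)))"
      by (intro mult_left_mono mult_mono upper[OF a cw(2) m1] upper[OF b cw(3) m2]) auto
    finally have up: "(?E f \<omega>0) \<le> \<dots>" .
    have "ennreal (?p * m) * (?I f \<omega>0)
       = ennreal ?p * (\<integral>\<^sup>+X. ennreal m * ennreal ((cmod (f X) * \<omega>0 X)\<^sup>2) \<partial>lborel)"
      using m(1) by (simp add: nn_integral_cmult ennreal_mult mult.assoc del: DIM_prod)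
    also have "(\<integral>\<^sup>+X. ennreal m * ennreal ((cmod (f X) * \<omega>0 X)\<^sup>2) \<partial>lborel) = (\<integral>\<^sup>+X. ennreal ((cmod (f X))\<^sup>2) * ennreal (m * (\<omega>0 X)\<^sup>2) \<partial>lborel)"
      using m(1) by (intro nn_integral_cong) (simp add: power_mult_distrib ennreal_mult mult_ac)
    also have "ennreal ?p * \<dots> \<le> ennreal ?p * (\<integral>\<^sup>+X. ennreal ((cmod (f X))\<^sup>2) * (?A \<omega>0 X) \<partial>lborel)"
      by (rule mult_left_mono[OF nn_integral_mono[OF mult_left_mono[OF m(2)]]]) auto
    also have "\<dots> = (?E f \<omega>0)"
      by (rule gabor_matrix_energy[OF f cw(1), symmetric])
    finally have lo: "ennreal (?p * m) * (?I f \<omega>0) \<le> \<dots>" .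
    have "(?I f \<omega>0) = ennreal (1 / (?p * m)) * (ennreal (?p * m) * (?I f \<omega>0))"
      using m(1) p0 by (simp add: mult.assoc[symmetric] del: DIM_prod flip: ennreal_mult)
    also have "\<dots> \<le> ennreal (1 / (?p * m)) * (ennreal ((C / \<kappa>)\<^sup>2) * ((ennreal (?p * m1) * (?I a \<omega>1)) * (ennreal (?p * m2) * (?I b \<omega>2))))"
      by (intro mult_left_mono order.trans[OF lo up]) auto
    also have "\<dots> = ennreal M * ((?I a \<omega>1) * (?I b \<omega>2))"
    proof -
      have "ennreal M = ennreal (1 / (?p * m)) * (ennreal ((C / \<kappa>)\<^sup>2) * (ennreal (?p * m1) * ennreal (?p * m2)))"
      proof -
        have e: "ennreal (a * (b * (c * d))) = ennreal a * (ennreal b * (ennreal c * ennreal d))"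
          if "0 \<le> a" "0 \<le> b" "0 \<le> c" "0 \<le> d" for a b c d :: real
          using that by (simp add: ennreal_mult)
        show ?thesis unfolding M_def using m(1) m1(1) m2(1) p0 by (intro e) (simp_all del: DIM_prod)
      qed
      then show ?thesis by (simp only: mult_ac)
    qed
    finally show "(?I (tconv 2 a b) \<omega>0)
      \<le> ennreal M * ((?I a \<omega>1) * (?I b \<omega>2))"
      by (simp only: f_def)
  qed
qed

section \<open>Interpolation of trilinear forms\<close>

definition trilinear :: "('a::euclidean_space \<times> 'a \<Rightarrow> complex) \<Rightarrow> ('a \<Rightarrow> complex) \<Rightarrow> ('a \<Rightarrow> complex) \<Rightarrow> ('a \<Rightarrow> complex) \<Rightarrow> complex" where
  "trilinear K F G H = (LINT z|lborel. K z * (F (fst z - snd z) * G (snd z) * H (fst z)))"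

text \<open>With finitely many values, powers of the density are exponential sums, to which the three lines theorem applies.\<close>

definition simple_density :: "('a::euclidean_space \<Rightarrow> real) \<Rightarrow> bool" where
  "simple_density u \<longleftrightarrow> unit_density u \<and> finite (range u) \<and> bounded {X. u X \<noteq> 0}"

lemma simple_densityD:
  assumes "simple_density u"
  shows "unit_density u" "u \<in> borel_measurable borel" "\<And>X. 0 \<le> u X" "finite (range u)" "bounded {X. u X \<noteq> 0}"
  using assms by (auto simp: simple_density_def unit_density_def)

text \<open>The bound is required for simple densities only, which is what interpolation gives;
\<open>trilinear_bounded_general\<close> removes this restriction. The exponent \<open>w\<close> of \<open>H\<close> is dual to the exponent of the
target space.\<close>

definition trilinear_bounded :: "('a::euclidean_space \<times> 'a \<Rightarrow> complex) \<Rightarrow> real \<Rightarrow> real \<Rightarrow> real \<Rightarrow> real \<Rightarrow> bool" where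
  "trilinear_bounded K M x y w \<longleftrightarrow> (\<forall>F G H u v t.
     F \<in> borel_measurable borel \<and> G \<in> borel_measurable borel \<and> H \<in> borel_measurable borel \<and>
     simple_density u \<and> simple_density v \<and> simple_density t \<and>
     (\<forall>X. cmod (F X) \<le> u X powr x) \<and> (\<forall>X. cmod (G X) \<le> v X powr y) \<and> (\<forall>X. cmod (H X) \<le> t X powr w)
     \<longrightarrow> cmod (trilinear K F G H) \<le> M)"

lemma trilinear_boundedD:
  assumes "trilinear_bounded K M x y w"
    and "F \<in> borel_measurable borel" "G \<in> borel_measurable borel" "H \<in> borel_measurable borel"
     "simple_density u" "simple_density v" "simple_density t"
     "\<And>X. cmod (F X) \<le> u X powr x" "\<And>X. cmod (G X) \<le> v X powr y" "\<And>X. cmod (H X) \<le> t X powr w"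
  shows "cmod (trilinear K F G H) \<le> M"
  using assms unfolding trilinear_bounded_def by blast

lemma trilinear_integrable:
  fixes F G H :: "'a::euclidean_space \<Rightarrow> complex"
  assumes [measurable]: "K \<in> borel_measurable borel" "F \<in> borel_measurable borel" "G \<in> borel_measurable borel" "H \<in> borel_measurable borel"
    and K: "\<And>z. cmod (K z) \<le> C"
    and F: "\<And>X. cmod (F X) \<le> A" and G: "\<And>X. cmod (G X) \<le> B" and H: "\<And>X. cmod (H X) \<le> D"
    and suppG: "\<And>X. G X \<noteq> 0 \<Longrightarrow> norm X \<le> R" and suppH: "\<And>X. H X \<noteq> 0 \<Longrightarrow> norm X \<le> R"
  shows "integrable lborel (\<lambda>z. K z * (F (fst z - snd z) * G (snd z) * H (fst z)))"
proof (rule integrable_bounded_support)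
  show "(\<lambda>z. K z * (F (fst z - snd z) * G (snd z) * H (fst z))) \<in> borel_measurable borel"
    by measurable
  have "0 \<le> A" "0 \<le> B" "0 \<le> C" "0 \<le> D" using K F G H norm_ge_zero order_trans by blast+
  then show "cmod (K z * (F (fst z - snd z) * G (snd z) * H (fst z))) \<le> C * (A * B * D)" for z
    using F G H K by (simp add: norm_mult mult_mono)
  show "norm z \<le> R + R" if "K z * (F (fst z - snd z) * G (snd z) * H (fst z)) \<noteq> 0" for z
    using that suppG suppH norm_Pair_le[of "fst z" "snd z"] by fastforce
qed

text \<open>The level sets of the densities split the form into finitely many terms. The level \<open>0\<close> can be omitted as the
functions vanish there, so that the logarithms of all levels exist.\<close>

lemma trilinear_sum_expand:
  fixes \<epsilon> \<delta> \<eta> :: "'a::euclidean_space \<Rightarrow> complex" and u v t :: "'a \<Rightarrow> real"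
  assumes K[measurable]: "K \<in> borel_measurable borel" and KC: "\<And>z. cmod (K z) \<le> C"
    and m[measurable]: "\<epsilon> \<in> borel_measurable borel" "\<delta> \<in> borel_measurable borel" "\<eta> \<in> borel_measurable borel"
      "u \<in> borel_measurable borel" "v \<in> borel_measurable borel" "t \<in> borel_measurable borel"
    and fin: "finite (range u)" "finite (range v)" "finite (range t)"
    and b: "\<And>X. cmod (\<epsilon> X) \<le> 1" "\<And>X. cmod (\<delta> X) \<le> 1" "\<And>X. cmod (\<eta> X) \<le> 1"
    and z: "\<And>X. u X = 0 \<Longrightarrow> \<epsilon> X = 0" "\<And>X. v X = 0 \<Longrightarrow> \<delta> X = 0" "\<And>X. t X = 0 \<Longrightarrow> \<eta> X = 0"
    and bs: "bounded {X. v X \<noteq> 0}" "bounded {X. t X \<noteq> 0}"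
  shows "(\<Sum>(i,j,k)\<in>(range u - {0}) \<times> (range v - {0}) \<times> (range t - {0}).
      trilinear K (\<lambda>X. if u X = i then \<epsilon> X else 0) (\<lambda>X. if v X = j then \<delta> X else 0) (\<lambda>X. if t X = k then \<eta> X else 0)
        * (P i * Q j * S k))
    = trilinear K (\<lambda>X. \<epsilon> X * P (u X)) (\<lambda>X. \<delta> X * Q (v X)) (\<lambda>X. \<eta> X * S (t X))" (is "?L = _")
proof -
  obtain R1 where R1: "\<And>X. v X \<noteq> 0 \<Longrightarrow> norm X \<le> R1" using bs(1) unfolding bounded_iff by auto
  obtain R2 where R2: "\<And>X. t X \<noteq> 0 \<Longrightarrow> norm X \<le> R2" using bs(2) unfolding bounded_iff by auto
  have R1': "norm X \<le> max R1 R2" if "\<delta> X \<noteq> 0" for X using that R1 z(2) by (metis max.coboundedI1)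
  have R2': "norm X \<le> max R1 R2" if "\<eta> X \<noteq> 0" for X using that R2 z(3) by (metis max.coboundedI2)
  let ?I = "(range u - {0}) \<times> (range v - {0}) \<times> (range t - {0})"
  define T where "T = (\<lambda>(i,j,k) z. K z * ((if u (fst z - snd z) = i then \<epsilon> (fst z - snd z) else 0) *
         (if v (snd z) = j then \<delta> (snd z) else 0) * (if t (fst z) = k then \<eta> (fst z) else 0)))"
  have int: "integrable lborel (T q)" for q
  proof -
    obtain i j k where q: "q = (i,j,k)" using prod_cases3 by blast
    have "integrable lborel (\<lambda>z. K z * ((if u (fst z - snd z) = i then \<epsilon> (fst z - snd z) else 0) *
         (if v (snd z) = j then \<delta> (snd z) else 0) * (if t (fst z) = k then \<eta> (fst z) else 0)))"
      by (rule trilinear_integrable[where A=1 and B=1 and C=C and D=1 and R="max R1 R2" and F="\<lambda>X. if u X = i then \<epsilon> X else 0" and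
         G="\<lambda>X. if v X = j then \<delta> X else 0" and H="\<lambda>X. if t X = k then \<eta> X else 0"])
        (use KC b R1' R2' in \<open>auto split: if_splits\<close>)
    then show ?thesis by (simp add: T_def q)
  qed
  have "?L = (\<Sum>q\<in>?I. (LINT z|lborel. T q z * (case q of (i,j,k) \<Rightarrow> P i * Q j * S k)))"
    using int by (intro sum.cong) (auto simp: trilinear_def T_def)
  also have "\<dots> = (LINT z|lborel. (\<Sum>q\<in>?I. T q z * (case q of (i,j,k) \<Rightarrow> P i * Q j * S k)))"
    using int by (subst Bochner_Integration.integral_sum) auto
  also have "\<dots> = (LINT z|lborel. K z * ((\<epsilon> (fst z - snd z) * P (u (fst z - snd z))) * (\<delta> (snd z) * Q (v (snd z))) * (\<eta> (fst z) * S (t (fst z)))))"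
  proof (intro Bochner_Integration.integral_cong refl)
    fix z
    have one: "(\<Sum>i\<in>range f - {0}. (if f X = i then g X else 0) * h i) = g X * h (f X)"
      if "finite (range f)" "f X = 0 \<Longrightarrow> g X = 0" for f :: "'a \<Rightarrow> real" and g X and h :: "real \<Rightarrow> complex"
    proof -
      have "(\<Sum>i\<in>range f - {0}. (if f X = i then g X else 0) * h i) = (\<Sum>i\<in>range f - {0}. if i = f X then g X * h i else 0)"
        by (intro sum.cong) auto
      also have "\<dots> = g X * h (f X)"
        using that by (subst sum.delta) auto
      finally show ?thesis .
    qed
    have gen: "(\<Sum>i\<in>A. \<Sum>j\<in>B. \<Sum>k\<in>D. \<kappa> * (a i * b j * c k)) = \<kappa> * (sum a A * sum b B * sum c D)"
      for A B D :: "real set" and \<kappa> :: complex and a b c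
    proof -
      have "\<kappa> * (a i * b j * c k) = (\<kappa> * a i) * (b j * c k)" for i j k by simp
      then show ?thesis by (simp only: sum_distrib_left[symmetric] sum_distrib_right[symmetric] mult.assoc)
    qed
    have "(\<Sum>q\<in>?I. T q z * (case q of (i,j,k) \<Rightarrow> P i * Q j * S k))
      = (\<Sum>i\<in>range u - {0}. \<Sum>j\<in>range v - {0}. \<Sum>k\<in>range t - {0}. K z *
         (((if u (fst z - snd z) = i then \<epsilon> (fst z - snd z) else 0) * P i) *
         ((if v (snd z) = j then \<delta> (snd z) else 0) * Q j) * ((if t (fst z) = k then \<eta> (fst z) else 0) * S k)))"
      unfolding sum.cartesian_product by (intro sum.cong) (auto simp: T_def)
    also have "\<dots> = K z * ((\<Sum>i\<in>range u - {0}. (if u (fst z - snd z) = i then \<epsilon> (fst z - snd z) else 0) * P i) *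
       (\<Sum>j\<in>range v - {0}. (if v (snd z) = j then \<delta> (snd z) else 0) * Q j) *
       (\<Sum>k\<in>range t - {0}. (if t (fst z) = k then \<eta> (fst z) else 0) * S k))"
      by (rule gen)
    also have "\<dots> = K z * ((\<epsilon> (fst z - snd z) * P (u (fst z - snd z))) * (\<delta> (snd z) * Q (v (snd z))) * (\<eta> (fst z) * S (t (fst z))))"
      using fin z by (simp only: one)
    finally show "(\<Sum>q\<in>?I. T q z * (case q of (i,j,k) \<Rightarrow> P i * Q j * S k)) = K z * ((\<epsilon> (fst z - snd z) * P (u (fst z - snd z))) * (\<delta> (snd z) * Q (v (snd z))) * (\<eta> (fst z) * S (t (fst z))))" .
  qed
  finally show ?thesis by (simp add: trilinear_def)
qed

text \<open>Riesz-Thorin. Write \<open>F = \<epsilon> u\<^sup>x\<close> with \<open>|\<epsilon>| \<le> 1\<close> and likewise \<open>G\<close> and \<open>H\<close>. Letting the exponents move along the complexified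
segment turns the form into an exponential sum, with \<open>i\<^sup>x\<^sup>0 j\<^sup>y\<^sup>0 k\<^sup>w\<^sup>0\<close> as amplitudes. On the two boundary lines the imaginary
powers are unimodular and can be absorbed into \<open>\<epsilon>\<close>, \<open>\<delta>\<close>, \<open>\<eta>\<close>, so that the bounds at the end points apply.\<close>

lemma trilinear_bounded_convex:
  fixes K :: "'a::euclidean_space \<times> 'a \<Rightarrow> complex"
  assumes K: "K \<in> borel_measurable borel" "\<And>z. cmod (K z) \<le> C"
    and g0: "trilinear_bounded K M x0 y0 w0" and g1: "trilinear_bounded K M x1 y1 w1" and th: "0 \<le> \<theta>" "\<theta> \<le> 1"
  shows "trilinear_bounded K M ((1-\<theta>) * x0 + \<theta> * x1) ((1-\<theta>) * y0 + \<theta> * y1) ((1-\<theta>) * w0 + \<theta> * w1)"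
  unfolding trilinear_bounded_def
proof (intro allI impI, elim conjE)
  fix F G H :: "'a \<Rightarrow> complex" and u v t :: "'a \<Rightarrow> real"
  assume m: "F \<in> borel_measurable borel" "G \<in> borel_measurable borel" "H \<in> borel_measurable borel"
    and d: "simple_density u" "simple_density v" "simple_density t"
    and le: "\<forall>X. cmod (F X) \<le> u X powr ((1-\<theta>) * x0 + \<theta> * x1)" "\<forall>X. cmod (G X) \<le> v X powr ((1-\<theta>) * y0 + \<theta> * y1)"
      "\<forall>X. cmod (H X) \<le> t X powr ((1-\<theta>) * w0 + \<theta> * w1)"
  note um = simple_densityD(2)[OF d(1)] simple_densityD(2)[OF d(2)] simple_densityD(2)[OF d(3)]
  note pos = simple_densityD(3)[OF d(1)] simple_densityD(3)[OF d(2)] simple_densityD(3)[OF d(3)]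
  note fin = simple_densityD(4)[OF d(1)] simple_densityD(4)[OF d(2)] simple_densityD(4)[OF d(3)]
  note bs = simple_densityD(5)[OF d(2)] simple_densityD(5)[OF d(3)]
  note [measurable] = m um
  define ph where "ph F u a = (\<lambda>X. F X / complex_of_real (u X powr a))" for F :: "'a \<Rightarrow> complex" and u :: "'a \<Rightarrow> real" and a
  have phm: "ph F u a \<in> borel_measurable borel" if "F \<in> borel_measurable borel" "u \<in> borel_measurable borel" for F u a
    using that unfolding ph_def by measurable
  have ph1: "cmod (ph F u a X) \<le> 1" "u X = 0 \<Longrightarrow> ph F u a X = 0" "F X = ph F u a X * of_real (u X powr a)"
    if "\<And>X. 0 \<le> u X" "\<forall>X. cmod (F X) \<le> u X powr a" for F u a X
    using that(1)[of X] that(2)[rule_format, of X] unfolding ph_def by (auto simp: norm_divide divide_le_eq_1)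
  define \<epsilon> where "\<epsilon> = ph F u ((1-\<theta>) * x0 + \<theta> * x1)"
  define \<delta> where "\<delta> = ph G v ((1-\<theta>) * y0 + \<theta> * y1)"
  define \<eta> where "\<eta> = ph H t ((1-\<theta>) * w0 + \<theta> * w1)"
  note e = ph1[OF pos(1) le(1), folded \<epsilon>_def] ph1[OF pos(2) le(2), folded \<delta>_def] ph1[OF pos(3) le(3), folded \<eta>_def]
  have em[measurable]: "\<epsilon> \<in> borel_measurable borel" "\<delta> \<in> borel_measurable borel" "\<eta> \<in> borel_measurable borel"
    unfolding \<epsilon>_def \<delta>_def \<eta>_def by (intro phm m um)+
  define I where "I = (range u - {0}) \<times> (range v - {0}) \<times> (range t - {0})"
  define c where "c = (\<lambda>(i,j,k). trilinear K (\<lambda>X. if u X = i then \<epsilon> X else 0) (\<lambda>X. if v X = j then \<delta> X else 0) (\<lambda>X. if t X = k then \<eta> X else 0))"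
  \<comment> \<open>the power of a level \<open>i\<close> with exponent \<open>a0 + \<i> \<tau> a1\<close>\<close>
  define pw where "pw a0 a1 \<tau> i = complex_of_real (i powr a0) * cis (\<tau> * ((a1::real) * ln i))" for a0 a1 \<tau> i
  have expand: "(\<Sum>q\<in>I. c q * (case q of (i,j,k) \<Rightarrow> P i * Q j * S k)) = trilinear K (\<lambda>X. \<epsilon> X * P (u X)) (\<lambda>X. \<delta> X * Q (v X)) (\<lambda>X. \<eta> X * S (t X))"
    for P Q S
    using trilinear_sum_expand[OF K em um fin e(1,4,7) e(2,5,8) bs, of P Q S]
    unfolding I_def c_def by (simp add: case_prod_beta)
  have I0: "i > 0 \<and> j > 0 \<and> k > 0" if "(i,j,k) \<in> I" for i j k
    using that pos unfolding I_def by (auto simp: less_le)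
  have trm: "of_real (exp ((a * ln i + b * ln j + d * ln k))) * cis (\<tau> * (a' * ln i + b' * ln j + d' * ln k))
     = pw a a' \<tau> i * pw b b' \<tau> j * pw d d' \<tau> k" if "(i,j,k) \<in> I" for i j k a b d a' b' d' \<tau>
    using I0[OF that] by (simp add: pw_def powr_def exp_add distrib_left mult_ac flip: cis_mult)
  have edge: "cmod (\<Sum>q\<in>I. c q * (case q of (i,j,k) \<Rightarrow> pw a a' \<tau> i * pw b b' \<tau> j * pw d d' \<tau> k)) \<le> M"
    if g: "trilinear_bounded K M a b d" for a b d a' b' d' \<tau>
  proof -
    have npw: "cmod (pw a a' \<tau> i) = i powr a" if "0 \<le> i" for a a' i
      by (simp add: pw_def norm_mult)
    have pwm: "pw a a' \<tau> \<in> borel_measurable borel" for a a' unfolding pw_def by measurable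
    note [measurable] = pwm
    have bd: "cmod (g * pw a a' \<tau> h) \<le> h powr a" if "cmod g \<le> 1" "0 \<le> h" for g h a a'
      using mult_right_mono[OF that(1), of "h powr a"] by (simp add: norm_mult npw that(2))
    have "cmod (trilinear K (\<lambda>X. \<epsilon> X * pw a a' \<tau> (u X)) (\<lambda>X. \<delta> X * pw b b' \<tau> (v X)) (\<lambda>X. \<eta> X * pw d d' \<tau> (t X))) \<le> M"
      by (rule trilinear_boundedD[OF g, of _ _ _ u v t]) (use d pos e bd in auto)
    then show ?thesis unfolding expand .
  qed
  have "cmod (\<Sum>q\<in>I. c q * of_real (exp ((case q of (i,j,k) \<Rightarrow> x0 * ln i + y0 * ln j + w0 * ln k)
      + \<theta> * (case q of (i,j,k) \<Rightarrow> (x1-x0) * ln i + (y1-y0) * ln j + (w1-w0) * ln k)))) \<le> M"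
  proof (rule three_lines_exp_sum)
    show "finite I" using fin by (simp add: I_def)
    show "cmod (\<Sum>q\<in>I. c q * of_real (exp (case q of (i,j,k) \<Rightarrow> x0 * ln i + y0 * ln j + w0 * ln k))
      * cis (\<tau> * (case q of (i,j,k) \<Rightarrow> (x1-x0) * ln i + (y1-y0) * ln j + (w1-w0) * ln k))) \<le> M" (is "cmod ?s \<le> M") for \<tau>
    proof -
      have "?s = (\<Sum>q\<in>I. c q * (case q of (i,j,k) \<Rightarrow> pw x0 (x1-x0) \<tau> i * pw y0 (y1-y0) \<tau> j * pw w0 (w1-w0) \<tau> k))"
        by (intro sum.cong) (auto simp: mult.assoc trm[unfolded mult.assoc])
      then show ?thesis by (simp only: edge[OF g0])
    qed
    show "cmod (\<Sum>q\<in>I. c q * of_real (exp ((case q of (i,j,k) \<Rightarrow> x0 * ln i + y0 * ln j + w0 * ln k) + (case q of (i,j,k) \<Rightarrow> (x1-x0) * ln i + (y1-y0) * ln j + (w1-w0) * ln k)))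
      * cis (\<tau> * (case q of (i,j,k) \<Rightarrow> (x1-x0) * ln i + (y1-y0) * ln j + (w1-w0) * ln k))) \<le> M" (is "cmod ?s \<le> M") for \<tau>
    proof -
      have l: "x0 * ln i + y0 * ln j + w0 * ln k + ((x1-x0) * ln i + (y1-y0) * ln j + (w1-w0) * ln k) = x1 * ln i + y1 * ln j + w1 * ln k" for i j k
        by (simp add: algebra_simps)
      have "?s = (\<Sum>q\<in>I. c q * (case q of (i,j,k) \<Rightarrow> pw x1 (x1-x0) \<tau> i * pw y1 (y1-y0) \<tau> j * pw w1 (w1-w0) \<tau> k))"
        by (intro sum.cong) (auto simp: l mult.assoc trm[unfolded mult.assoc])
      then show ?thesis by (simp only: edge[OF g1])
    qed
  qed (use th in auto)
  also have "(\<Sum>q\<in>I. c q * of_real (exp ((case q of (i,j,k) \<Rightarrow> x0 * ln i + y0 * ln j + w0 * ln k)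
      + \<theta> * (case q of (i,j,k) \<Rightarrow> (x1-x0) * ln i + (y1-y0) * ln j + (w1-w0) * ln k))))
     = (\<Sum>q\<in>I. c q * (case q of (i,j,k) \<Rightarrow> pw ((1-\<theta>) * x0 + \<theta> * x1) 0 0 i * pw ((1-\<theta>) * y0 + \<theta> * y1) 0 0 j * pw ((1-\<theta>) * w0 + \<theta> * w1) 0 0 k))"
  proof (intro sum.cong refl)
    fix q assume "q \<in> I"
    obtain i j k where q: "q = (i,j,k)" using prod_cases3 by blast
    have "x0 * ln i + y0 * ln j + w0 * ln k + \<theta> * ((x1-x0) * ln i + (y1-y0) * ln j + (w1-w0) * ln k)
       = ((1-\<theta>) * x0 + \<theta> * x1) * ln i + ((1-\<theta>) * y0 + \<theta> * y1) * ln j + ((1-\<theta>) * w0 + \<theta> * w1) * ln k"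
      by (simp add: algebra_simps)
    then show "c q * of_real (exp ((case q of (i,j,k) \<Rightarrow> x0 * ln i + y0 * ln j + w0 * ln k)
      + \<theta> * (case q of (i,j,k) \<Rightarrow> (x1-x0) * ln i + (y1-y0) * ln j + (w1-w0) * ln k))) =
      c q * (case q of (i,j,k) \<Rightarrow> pw ((1-\<theta>) * x0 + \<theta> * x1) 0 0 i * pw ((1-\<theta>) * y0 + \<theta> * y1) 0 0 j * pw ((1-\<theta>) * w0 + \<theta> * w1) 0 0 k)"
      using trm[of i j k "(1-\<theta>) * x0 + \<theta> * x1" "(1-\<theta>) * y0 + \<theta> * y1" "(1-\<theta>) * w0 + \<theta> * w1" 0 0 0 0] \<open>q \<in> I\<close>
      by (simp add: q)
  qed
  also have "\<dots> = trilinear K F G H"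
    unfolding expand by (simp add: pw_def flip: e(3,6,9))
  finally show "cmod (trilinear K F G H) \<le> M" .
qed

section \<open>From simple densities to general ones, and duality\<close>

lemma dyadic_rounding:
  fixes a :: real assumes "0 < a"
  shows "a \<le> 2 powr real_of_int \<lceil>log 2 a\<rceil>" "2 powr real_of_int \<lceil>log 2 a\<rceil> \<le> 2 * a"
proof -
  have "a = 2 powr log 2 a" using assms by simp
  also have "\<dots> \<le> 2 powr real_of_int \<lceil>log 2 a\<rceil>" by (intro powr_mono) auto
  finally show "a \<le> 2 powr real_of_int \<lceil>log 2 a\<rceil>" .
  have "2 powr real_of_int \<lceil>log 2 a\<rceil> \<le> 2 powr (log 2 a + 1)" by (intro powr_mono) linarith+
  also have "\<dots> = 2 * a" using assms by (simp add: powr_add)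
  finally show "2 powr real_of_int \<lceil>log 2 a\<rceil> \<le> 2 * a" .
qed

text \<open>Where this holds, the dyadic logarithm of the density takes finitely many values.\<close>

definition truncated :: "nat \<Rightarrow> ('a::euclidean_space \<Rightarrow> real) \<Rightarrow> 'a \<Rightarrow> bool" where
  "truncated n u X \<longleftrightarrow> norm X \<le> real n \<and> 1 / (real n + 1) \<le> u X \<and> u X \<le> real n"

text \<open>Rounding the density up to a power of two changes it by at most the factor two; dividing by two restores
mass at most one.\<close>

lemma trunc_density:
  fixes u :: "'a::euclidean_space \<Rightarrow> real"
  assumes u: "unit_density u" and x: "0 \<le> x" "x \<le> 1"
  obtains d where "simple_density d" "\<And>X. truncated n u X \<Longrightarrow> u X powr x \<le> 2 * d X powr x"
proof
  note [measurable] = unit_densityD(1)[OF u] and u0 = unit_densityD(2)[OF u]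
  define d where "d X = (if truncated n u X then 2 powr real_of_int \<lceil>log 2 (u X)\<rceil> / 2 else 0)" for X
  have up: "u X > 0" if "truncated n u X" for X
    using that less_le_trans[of 0 "1 / (real n + 1)" "u X"] by (simp add: truncated_def)
  have tm[measurable]: "Measurable.pred borel (truncated n u)" unfolding truncated_def by measurable
  have d0: "0 \<le> d X" for X by (simp add: d_def)
  show "simple_density d"
    unfolding simple_density_def unit_density_def
  proof (intro conjI allI d0)
    show "d \<in> borel_measurable borel" unfolding d_def by measurable
    show "finite (range d)"
    proof (rule finite_subset)
      let ?S = "{\<lceil>log 2 (1 / (real n + 1))\<rceil>..\<lceil>log 2 (real n)\<rceil>}"
      show "range d \<subseteq> insert 0 ((\<lambda>k. 2 powr real_of_int k / 2) ` ?S)"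
      proof (clarify)
        fix X assume *: "d X \<notin> (\<lambda>k. 2 powr real_of_int k / 2) ` ?S"
        have "truncated n u X \<Longrightarrow> \<lceil>log 2 (u X)\<rceil> \<in> ?S"
          using up[of X] unfolding truncated_def atLeastAtMost_iff by (auto intro!: ceiling_mono simp: log_le_cancel_iff)
        then show "d X = 0" using * unfolding d_def by (metis (mono_tags, lifting) image_eqI)
      qed
    qed simp
    show "bounded {X. d X \<noteq> 0}" by (rule boundedI[of _ "real n"]) (auto simp: d_def truncated_def split: if_splits)
    have "(\<integral>\<^sup>+X. ennreal (d X) \<partial>lborel) \<le> (\<integral>\<^sup>+X. ennreal (u X) \<partial>lborel)"
      using dyadic_rounding(2)[OF up] u0 by (intro nn_integral_mono ennreal_leI) (auto simp: d_def mult.commute)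
    then show "(\<integral>\<^sup>+X. ennreal (d X) \<partial>lborel) \<le> 1" using unit_densityD(3)[OF u] by order
  qed
  show "u X powr x \<le> 2 * d X powr x" if t: "truncated n u X" for X
  proof -
    have "u X \<le> 2 * d X" using dyadic_rounding(1)[OF up[OF t]] t by (simp add: d_def)
    then have "u X powr x \<le> (2 * d X) powr x" using u0 x by (intro powr_mono2) auto
    also have "\<dots> = 2 powr x * d X powr x" using d0[of X] by (simp add: powr_mult)
    also have "\<dots> \<le> 2 powr 1 * d X powr x" using x by (intro mult_right_mono powr_mono) auto
    finally show ?thesis by simp
  qed
qed

text \<open>Approximate by truncation. Each of the three roundings costs a factor two, whence \<open>8 M\<close>.\<close>

lemma trilinear_bounded_general:
  fixes F G H :: "'a::euclidean_space \<Rightarrow> complex"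
  assumes K[measurable]: "K \<in> borel_measurable borel" and KC: "\<And>z. cmod (K z) \<le> C"
    and g: "trilinear_bounded K M x y w" and xyw: "0 \<le> x" "x \<le> 1" "0 \<le> y" "y \<le> 1" "0 \<le> w" "w \<le> 1"
    and m[measurable]: "F \<in> borel_measurable borel" "G \<in> borel_measurable borel" "H \<in> borel_measurable borel"
    and d: "unit_density u" "unit_density v" "unit_density t"
    and le: "\<And>X. cmod (F X) \<le> u X powr x" "\<And>X. cmod (G X) \<le> v X powr y" "\<And>X. cmod (H X) \<le> t X powr w"
    and int: "integrable lborel (\<lambda>z. F (fst z - snd z) * G (snd z) * H (fst z))"
  shows "cmod (trilinear K F G H) \<le> 8 * M"
proof -
  note [measurable] = unit_densityD(1)[OF d(1)] unit_densityD(1)[OF d(2)] unit_densityD(1)[OF d(3)]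
  note pos = unit_densityD(2)[OF d(1)] unit_densityD(2)[OF d(2)] unit_densityD(2)[OF d(3)]
  define cut where "cut F u n X = (if truncated n u X then F X else 0)" for F :: "'a \<Rightarrow> complex" and u :: "'a \<Rightarrow> real" and n X
  have tm[measurable]: "Measurable.pred borel (truncated n u)" if [measurable]: "u \<in> borel_measurable borel" for n and u :: "'a \<Rightarrow> real"
    unfolding truncated_def by measurable
  have cm[measurable]: "cut F u n \<in> borel_measurable borel" if [measurable]: "F \<in> borel_measurable borel" "u \<in> borel_measurable borel" for n F u
    unfolding cut_def by measurable
  have cle: "cmod (cut F u n X) \<le> cmod (F X)" for F u n X by (simp add: cut_def)
  have clim: "(\<lambda>n. cut F u n X) \<longlonglongrightarrow> F X" if "0 \<le> u X" "cmod (F X) \<le> u X powr x" for F u X x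
  proof (cases "u X = 0")
    case True
    then have "cut F u n X = F X" for n using that by (auto simp: cut_def)
    then show ?thesis by simp
  next
    case False
    then have u: "u X > 0" using that by simp
    define n0 where "n0 = nat \<lceil>norm X + u X + 1 / u X\<rceil>"
    have "truncated n u X" if "n \<ge> n0" for n
    proof -
      have n: "norm X + u X + 1 / u X \<le> real n" using that unfolding n0_def by linarith
      moreover have "0 < 1 / u X" using u by simp
      ultimately have "1 / u X \<le> real n + 1" "norm X \<le> real n" "u X \<le> real n"
        using u norm_ge_zero[of X] by linarith+
      then show ?thesis using u by (simp add: truncated_def field_simps)
    qed
    then have "\<forall>\<^sub>F n in sequentially. cut F u n X = F X"
      unfolding eventually_sequentially cut_def by auto
    then show ?thesis by (rule tendsto_eventually)
  qed
  have bound: "cmod (trilinear K (cut F u n) (cut G v n) (cut H t n)) \<le> 8 * M" for n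
  proof -
    obtain du where du: "simple_density du" "\<And>X. truncated n u X \<Longrightarrow> u X powr x \<le> 2 * du X powr x"
      by (rule trunc_density[OF d(1) xyw(1,2)]) (rule that)
    obtain dv where dv: "simple_density dv" "\<And>X. truncated n v X \<Longrightarrow> v X powr y \<le> 2 * dv X powr y"
      by (rule trunc_density[OF d(2) xyw(3,4)]) (rule that)
    obtain dt where dt: "simple_density dt" "\<And>X. truncated n t X \<Longrightarrow> t X powr w \<le> 2 * dt X powr w"
      by (rule trunc_density[OF d(3) xyw(5,6)]) (rule that)
    have half: "cmod (cut F u n X / 2) \<le> d X powr x"
      if "cmod (F X) \<le> u X powr x" "truncated n u X \<Longrightarrow> u X powr x \<le> 2 * d X powr x" for F u X d x
      using that by (auto simp: cut_def norm_divide)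
    have "cmod (trilinear K (\<lambda>X. cut F u n X / 2) (\<lambda>X. cut G v n X / 2) (\<lambda>X. cut H t n X / 2)) \<le> M"
      by (rule trilinear_boundedD[OF g, of _ _ _ du dv dt]) (use du dv dt le half in auto)
    moreover have "trilinear K (\<lambda>X. cut F u n X / 2) (\<lambda>X. cut G v n X / 2) (\<lambda>X. cut H t n X / 2)
        = trilinear K (cut F u n) (cut G v n) (cut H t n) / 8"
      unfolding trilinear_def by (simp flip: integral_divide_zero)
    ultimately show ?thesis by (simp add: norm_divide)
  qed
  have "(\<lambda>n. trilinear K (cut F u n) (cut G v n) (cut H t n)) \<longlonglongrightarrow> trilinear K F G H"
    unfolding trilinear_def
  proof (rule integral_dominated_convergence)
    show "integrable lborel (\<lambda>z. C * cmod (F (fst z - snd z) * G (snd z) * H (fst z)))"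
      using int by simp
    show "AE z in lborel. (\<lambda>n. K z * (cut F u n (fst z - snd z) * cut G v n (snd z) * cut H t n (fst z)))
        \<longlonglongrightarrow> K z * (F (fst z - snd z) * G (snd z) * H (fst z))"
      by (intro AE_I2 tendsto_intros clim[OF pos(1) le(1)] clim[OF pos(2) le(2)] clim[OF pos(3) le(3)])
    show "AE z in lborel. cmod (K z * (cut F u n (fst z - snd z) * cut G v n (snd z) * cut H t n (fst z)))
      \<le> C * cmod (F (fst z - snd z) * G (snd z) * H (fst z))" for n
      using order_trans[OF norm_ge_zero KC] unfolding norm_mult
      by (intro AE_I2 mult_mono KC cle) auto
  qed measurable
  then show ?thesis by (intro LIMSEQ_le_const2[OF tendsto_norm]) (use bound in auto)
qed

lemma mult_cnj_sgn: "z * cnj (sgn z) = of_real (cmod z)"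
proof (cases "z = 0")
  case False
  have "z * cnj (sgn z) = of_real ((cmod z)\<^sup>2) / of_real (cmod z)"
    unfolding complex_norm_square by (simp add: sgn_eq)
  also have "\<dots> = of_real (cmod z)" using False by (simp add: power2_eq_square)
  finally show ?thesis .
qed simp

text \<open>The density \<open>s\<close> is extracted from the dual bound by testing with the function for which equality holds in
Hoelder's inequality, truncated to a set \<open>E n\<close> where everything is finite. For \<open>w = 1\<close> (target exponent \<open>\<infinity>\<close>) one tests
instead with the normalised indicator of a set where \<open>|B|\<close> exceeds \<open>M\<close>.\<close>

lemma converse_Holder:
  fixes B :: "'a::euclidean_space \<Rightarrow> complex"
  assumes B[measurable]: "B \<in> borel_measurable borel" and M: "0 < M" and w: "0 \<le> w" "w \<le> 1"
    and dual: "\<And>H t D R. H \<in> borel_measurable borel \<Longrightarrow> unit_density t \<Longrightarrow> (\<And>X. cmod (H X) \<le> t X powr w) \<Longrightarrow>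
      (\<And>X. cmod (H X) \<le> D) \<Longrightarrow> (\<And>X. H X \<noteq> 0 \<Longrightarrow> norm X \<le> R) \<Longrightarrow>
      cmod (LINT X|lborel. B X * H X) \<le> M"
  obtains s where "unit_density s" "AE X in lborel. cmod (B X) \<le> M * s X powr (1 - w)"
proof (cases "w = 1")
  case True
  have "AE X in lborel. cmod (B X) \<le> M"
  proof -
    have "AE X in lborel. \<not> (M < cmod (B X) \<and> cmod (B X) \<le> real n \<and> norm X \<le> real n)" for n
    proof -
      define E where "E = {X. M < cmod (B X) \<and> cmod (B X) \<le> real n \<and> norm X \<le> real n}"
      have [measurable]: "E \<in> sets borel" unfolding E_def by measurable
      have Efin: "emeasure lborel E < \<infinity>"
        by (rule emeasure_bounded_finite) (auto simp: E_def intro!: boundedI[of _ "real n"])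
      define e where "e = measure lborel E"
      have e: "emeasure lborel E = ennreal e" using Efin by (simp add: e_def emeasure_eq_ennreal_measure less_top)
      have "e = 0"
      proof (rule ccontr)
        assume "e \<noteq> 0"
        then have e0: "e > 0" by (simp add: e_def less_le)
        define H where "H X = indicator E X * cnj (sgn (B X)) / of_real e" for X
        have BH: "B X * H X = of_real (indicator E X * cmod (B X) / e)" for X
        proof -
          show ?thesis using mult_cnj_sgn[of "B X"] by (simp add: H_def indicator_def)
        qed
        have "cmod (LINT X|lborel. B X * H X) \<le> M"
        proof (rule dual[of H "\<lambda>X. indicator E X / e" "1 / e" "real n"])
          show "H \<in> borel_measurable borel" unfolding H_def sgn_eq by measurable
          have "(\<integral>\<^sup>+ X. ennreal (indicator E X / e) \<partial>lborel) = (\<integral>\<^sup>+ X. ennreal (1 / e) * indicator E X \<partial>lborel)"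
            by (intro nn_integral_cong) (auto simp: indicator_def)
          also have "\<dots> = 1" using e0 by (simp add: nn_integral_cmult e flip: ennreal_mult)
          finally show "unit_density (\<lambda>X. indicator E X / e)" using e0 by (simp add: unit_density_def)
          show "cmod (H X) \<le> (indicator E X / e) powr w" "cmod (H X) \<le> 1 / e" for X
            using e0 True by (auto simp: H_def indicator_def norm_divide norm_mult norm_sgn divide_le_cancel)
          show "norm X \<le> real n" if "H X \<noteq> 0" for X using that by (auto simp: H_def indicator_def E_def split: if_splits)
        qed
        then have le: "(LINT X|lborel. indicator E X * cmod (B X) / e) \<le> M"
          using e0 unfolding BH integral_complex_of_real norm_of_real by linarith
        have int: "integrable lborel (\<lambda>X. indicator E X * cmod (B X))"
          by (rule integrableI_bounded_set[where A = E and B = "real n"])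
             (use Efin in \<open>auto simp: E_def indicator_def\<close>)
        have int2: "integrable lborel (\<lambda>X. indicator E X * M)" using Efin by simp
        have int3: "integrable lborel (\<lambda>X. indicator E X * (cmod (B X) - M))"
          unfolding right_diff_distrib by (intro Bochner_Integration.integrable_diff int int2)
        have "(LINT X|lborel. indicator E X * (cmod (B X) - M)) = (LINT X|lborel. indicator E X * cmod (B X)) - (LINT X|lborel. indicator E X * M)"
          unfolding right_diff_distrib by (rule Bochner_Integration.integral_diff[OF int int2])
        also have "(LINT X|lborel. indicator E X * M) = e * M" by (simp add: e_def)
        also have "(LINT X|lborel. indicator E X * cmod (B X)) - e * M \<le> 0"
          using le e0 by (simp add: divide_le_eq mult.commute)
        finally have "(LINT X|lborel. indicator E X * (cmod (B X) - M)) = 0"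
          by (intro antisym integral_nonneg_AE) (auto simp: indicator_def E_def)
        then have "AE X in lborel. indicator E X * (cmod (B X) - M) = 0"
          using integral_nonneg_eq_0_iff_AE[OF int3] by (auto simp: indicator_def E_def)
        then have "AE X in lborel. X \<notin> E"
          by eventually_elim (auto simp: indicator_def E_def)
        then have "E \<in> null_sets lborel" by (simp add: AE_iff_null_sets)
        then show False using e e0 by (auto dest: null_setsD1)
      qed
      then have "E \<in> null_sets lborel" using e by (intro null_setsI) auto
      then have "AE X in lborel. X \<notin> E" by (rule AE_not_in)
      then show ?thesis by (simp add: E_def)
    qed
    then have "AE X in lborel. \<forall>n. \<not> (M < cmod (B X) \<and> cmod (B X) \<le> real n \<and> norm X \<le> real n)"
      by (simp add: AE_all_countable)
    then show ?thesis
    proof eventually_elim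
      case (elim X)
      obtain n :: nat where "max (cmod (B X)) (norm X) \<le> real n" using real_arch_simple by blast
      then show ?case using elim by force
    qed
  qed
  moreover have "unit_gaussian X powr 0 = 1" for X :: 'a
    using unit_gaussian_pos[of X] by simp
  ultimately show ?thesis
    using True by (intro that[of unit_gaussian] unit_density_gaussian) simp
next
  case False
  define z where "z = 1 - w"
  have z: "0 < z" "z \<le> 1" using False w by (auto simp: z_def)
  define \<beta> where "\<beta> X = cmod (B X) powr (1 / z)" for X
  have [measurable]: "\<beta> \<in> borel_measurable borel" unfolding \<beta>_def by measurable
  have \<beta>0: "0 \<le> \<beta> X" for X by (simp add: \<beta>_def)
  define E where "E n = {X. cmod (B X) \<le> real n \<and> norm X \<le> real n}" for n
  have Em[measurable]: "E n \<in> sets borel" for n unfolding E_def by measurable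
  have Ele: "(\<integral>\<^sup>+X. ennreal (indicator (E n) X * \<beta> X) \<partial>lborel) \<le> ennreal (M powr (1 / z))" for n
  proof -
    have int: "integrable lborel (\<lambda>X. indicator (E n) X * \<beta> X)"
    proof (rule integrableI_bounded_set[where A = "E n" and B = "real n powr (1 / z)"])
      show "emeasure lborel (E n) < \<infinity>"
        by (rule emeasure_bounded_finite) (auto simp: E_def intro!: boundedI[of _ "real n"])
      show "AE X in lborel. X \<in> E n \<longrightarrow> norm (indicator (E n) X * \<beta> X) \<le> real n powr (1 / z)"
        using z by (auto simp: E_def \<beta>_def intro!: powr_mono2)
    qed auto
    define N where "N = (LINT X|lborel. indicator (E n) X * \<beta> X)"
    have N0: "0 \<le> N" unfolding N_def by (intro integral_nonneg_AE) (auto simp: \<beta>0)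
    have eq: "(\<integral>\<^sup>+X. ennreal (indicator (E n) X * \<beta> X) \<partial>lborel) = ennreal N"
      unfolding N_def using int by (intro nn_integral_eq_integral) (auto simp: \<beta>0)
    have "N \<le> M powr (1 / z)"
    proof (cases "N = 0")
      case True then show ?thesis by simp
    next
      case False
      then have Np: "N > 0" using N0 by simp
      define t where "t X = indicator (E n) X * \<beta> X / N" for X
      define H where "H X = cnj (sgn (B X)) * of_real (t X powr w)" for X
      have t0: "0 \<le> t X" for X using Np \<beta>0 by (simp add: t_def)
      have [measurable]: "t \<in> borel_measurable borel" unfolding t_def by measurable
      have BH: "B X * H X = of_real (N powr (- w) * (indicator (E n) X * \<beta> X))" for X
      proof -
        have "B X * H X = of_real (cmod (B X) * t X powr w)"
          by (simp add: H_def mult_cnj_sgn flip: mult.assoc)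
        also have "cmod (B X) * t X powr w = N powr (- w) * (indicator (E n) X * \<beta> X)"
        proof (cases "X \<in> E n \<and> B X \<noteq> 0")
          case True
          then have b: "cmod (B X) > 0" by simp
          have "cmod (B X) * \<beta> X powr w = cmod (B X) powr (1 + w / z)"
            using b by (simp add: \<beta>_def powr_powr powr_add)
          also have "1 + w / z = 1 / z" using z by (simp add: z_def field_simps)
          finally have "cmod (B X) * \<beta> X powr w = \<beta> X" by (simp add: \<beta>_def)
          then show ?thesis using True Np \<beta>0[of X] by (simp add: t_def powr_divide powr_minus field_simps)
        qed (auto simp: t_def \<beta>_def)
        finally show ?thesis .
      qed
      have "cmod (LINT X|lborel. B X * H X) \<le> M"
      proof (rule dual[of H t "(real n powr (1 / z) / N) powr w" "real n"])
        show "H \<in> borel_measurable borel" unfolding H_def sgn_eq by measurable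
        have "(\<integral>\<^sup>+ X. ennreal (t X) \<partial>lborel) = ennreal (1 / N) * (\<integral>\<^sup>+ X. ennreal (indicator (E n) X * \<beta> X) \<partial>lborel)"
          unfolding t_def using Np \<beta>0 by (subst nn_integral_cmult[symmetric]) (auto simp flip: ennreal_mult intro!: nn_integral_cong)
        also have "\<dots> = 1" unfolding eq using Np by (simp flip: ennreal_mult)
        finally show "unit_density t" by (simp add: unit_density_def t0)
        show H1: "cmod (H X) \<le> t X powr w" for X
          by (simp add: H_def norm_mult norm_sgn)
        show "cmod (H X) \<le> (real n powr (1 / z) / N) powr w" for X
        proof (rule order.trans[OF H1], rule powr_mono2)
          show "t X \<le> real n powr (1 / z) / N"
            using Np z by (auto simp: t_def indicator_def E_def \<beta>_def intro!: divide_right_mono powr_mono2)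
        qed (use w t0 in auto)
        show "norm X \<le> real n" if "H X \<noteq> 0" for X
          using that by (auto simp: H_def t_def indicator_def E_def split: if_splits)
      qed
      moreover have "(LINT X|lborel. B X * H X) = of_real (N powr (- w) * N)"
        unfolding BH integral_complex_of_real N_def by simp
      ultimately have "N powr (- w) * N \<le> M" using Np by (simp add: norm_mult)
      moreover have "N powr (- w) * N = N powr z" using Np by (simp add: z_def powr_diff powr_minus field_simps)
      ultimately have "(N powr z) powr (1 / z) \<le> M powr (1 / z)" using z by (intro powr_mono2) auto
      then show ?thesis using z Np by (simp add: powr_powr)
    qed
    then show ?thesis unfolding eq by (rule ennreal_leI)
  qed
  have total: "(\<integral>\<^sup>+X. ennreal (\<beta> X) \<partial>lborel) \<le> ennreal (M powr (1 / z))"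
  proof (rule LIMSEQ_le_const2)
    show "(\<lambda>n. \<integral>\<^sup>+X. ennreal (indicator (E n) X * \<beta> X) \<partial>lborel) \<longlonglongrightarrow> (\<integral>\<^sup>+X. ennreal (\<beta> X) \<partial>lborel)"
    proof (rule nn_integral_LIMSEQ)
      show "incseq (\<lambda>n X. ennreal (indicator (E n) X * \<beta> X))"
        using \<beta>0 by (auto simp: incseq_def le_fun_def E_def indicator_def intro!: ennreal_leI)
      show "(\<lambda>n. ennreal (indicator (E n) X * \<beta> X)) \<longlonglongrightarrow> ennreal (\<beta> X)" for X
      proof (rule tendsto_eventually)
        obtain n0 :: nat where "max (cmod (B X)) (norm X) \<le> real n0" using real_arch_simple by blast
        then have "\<forall>n\<ge>n0. X \<in> E n" by (auto simp: E_def intro: order.trans)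
        then show "\<forall>\<^sub>F n in sequentially. ennreal (indicator (E n) X * \<beta> X) = ennreal (\<beta> X)"
          unfolding eventually_sequentially by (intro exI[of _ n0]) simp
      qed
    qed measurable
  qed (use Ele in auto)
  define s where "s X = \<beta> X / M powr (1 / z)" for X
  show ?thesis
  proof (rule that[of s])
    have sm: "s \<in> borel_measurable borel" unfolding s_def by measurable
    have s0: "0 \<le> s X" for X by (simp add: s_def \<beta>0)
    have "(\<integral>\<^sup>+ X. ennreal (s X) \<partial>lborel) = ennreal (1 / M powr (1 / z)) * (\<integral>\<^sup>+ X. ennreal (\<beta> X) \<partial>lborel)"
      unfolding s_def using \<beta>0 by (subst nn_integral_cmult[symmetric]) (auto simp flip: ennreal_mult intro!: nn_integral_cong)
    also have "\<dots> \<le> ennreal (1 / M powr (1 / z)) * ennreal (M powr (1 / z))" by (intro mult_left_mono total) auto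
    also have "\<dots> = 1" using M by (simp flip: ennreal_mult)
    finally show "unit_density s" by (simp add: unit_density_def sm s0)
    have "cmod (B X) = M * s X powr (1 - w)" for X
      using z M by (simp add: s_def \<beta>_def powr_divide powr_powr flip: z_def)
    then show "AE X in lborel. cmod (B X) \<le> M * s X powr (1 - w)" by simp
  qed
qed

section \<open>The tetrahedron of exponents\<close>

text \<open>Lusin approximation, followed by clipping the values to the disc of radius \<open>B\<close> and cutting off outside the ball
of radius \<open>R + 1\<close>, neither of which affects the limit.\<close>

lemma continuous_bounded_approximation:
  fixes f :: "'a::euclidean_space \<Rightarrow> complex"
  assumes f: "f \<in> borel_measurable borel" and B: "\<And>x. cmod (f x) \<le> B" and R: "\<And>x. f x \<noteq> 0 \<Longrightarrow> norm x \<le> R"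
  shows "\<exists>g :: nat \<Rightarrow> 'a \<Rightarrow> complex. (\<forall>n. continuous_on UNIV (g n)) \<and> (\<forall>n x. cmod (g n x) \<le> B) \<and> (\<forall>n x. g n x \<noteq> 0 \<longrightarrow> norm x \<le> R + 1) \<and>
    (AE x in lborel. (\<lambda>n. g n x) \<longlonglongrightarrow> f x)"
proof -
  have B0: "0 \<le> B" using order_trans[OF norm_ge_zero B] .
  have "f \<in> borel_measurable lebesgue" using f by (simp add: measurable_completion)
  then have "f measurable_on UNIV"
    by (intro lebesgue_measurable_imp_measurable_on) auto
  then obtain N g where N: "negligible N" and gc: "\<And>n. continuous_on UNIV (g n)"
    and glim: "\<And>x. x \<notin> N \<Longrightarrow> (\<lambda>n. g n x) \<longlonglongrightarrow> f x"
    unfolding measurable_on_def by auto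
  \<comment> \<open>radial retraction onto the disc of radius \<open>B\<close>\<close>
  define clip where "clip z = (if B = 0 then 0 else z /\<^sub>R max 1 (cmod z / B))" for z :: complex
  have clip_c: "continuous_on UNIV clip"
  proof (cases "B = 0")
    case False
    have "max 1 (cmod z / B) \<noteq> 0" for z using max.cobounded1[of 1 "cmod z / B"] by linarith
    then show ?thesis using False unfolding clip_def by (auto intro!: continuous_intros)
  qed (simp add: clip_def)
  have clip_b: "cmod (clip z) \<le> B" for z
  proof (cases "B = 0")
    case False
    then have Bp: "B > 0" using B0 by simp
    have m: "0 < max 1 (cmod z / B)" by simp
    have "cmod z \<le> B * max 1 (cmod z / B)" using Bp by (simp add: max_def field_simps)
    then have "cmod z / max 1 (cmod z / B) \<le> B" using m by (simp only: pos_divide_le_eq)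
    then show ?thesis using Bp m by (simp add: clip_def divide_inverse mult.commute)
  qed (simp add: clip_def)
  have clip_id: "clip z = z" if "cmod z \<le> B" for z
    using that B0 by (auto simp: clip_def max_def field_simps)
  define cut where "cut x = max 0 (min 1 (R + 1 - norm x))" for x :: 'a
  have cut: "continuous_on UNIV cut" "0 \<le> cut x" "cut x \<le> 1" "cut x \<noteq> 0 \<Longrightarrow> norm x \<le> R + 1" "norm x \<le> R \<Longrightarrow> cut x = 1" for x
  proof -
    show "continuous_on UNIV cut" unfolding cut_def by (intro continuous_intros)
  qed (auto simp: cut_def max_def min_def split: if_splits)
  define h where "h n x = of_real (cut x) * clip (g n x)" for n x
  show ?thesis
  proof (intro exI[of _ h] conjI allI impI)
    show "continuous_on UNIV (h n)" for n
      unfolding h_def using continuous_on_compose2[OF clip_c gc] cut(1) by (intro continuous_intros) auto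
    show "cmod (h n x) \<le> B" for n x
      using mult_mono[OF cut(3)[of x] clip_b[of "g n x"]] cut(2)[of x] by (simp add: h_def norm_mult)
    show "h n x \<noteq> 0 \<Longrightarrow> norm x \<le> R + 1" for n x using cut(4) by (auto simp: h_def)
    have "AE x in lebesgue. x \<notin> N" using N by (simp add: AE_not_in negligible_iff_null_sets)
    then have "AE x in lborel. x \<notin> N" by (simp add: AE_completion_iff)
    then show "AE x in lborel. (\<lambda>n. h n x) \<longlonglongrightarrow> f x"
    proof eventually_elim
      case (elim x)
      have "isCont clip (f x)"
        by (rule continuous_on_eq_continuous_at[OF open_UNIV, THEN iffD1, OF clip_c, rule_format, OF UNIV_I])
      then have "(\<lambda>n. clip (g n x)) \<longlonglongrightarrow> clip (f x)" using glim[OF elim] by (rule isCont_tendsto_compose)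
      then have "(\<lambda>n. of_real (cut x) * clip (g n x)) \<longlonglongrightarrow> of_real (cut x) * clip (f x)" by (intro tendsto_intros)
      moreover have "of_real (cut x) * clip (f x) = f x"
        unfolding clip_id[OF B] using R[of x] cut(5)[of x] by (cases "f x = 0") auto
      ultimately show ?case by (simp add: h_def)
    qed
  qed
qed

text \<open>The kernel of twisted convolution after the weights have been moved from the function spaces into the operator.\<close>

definition tc_kernel :: "('d::finite phase_space \<Rightarrow> real) \<Rightarrow> ('d phase_space \<Rightarrow> real) \<Rightarrow> ('d phase_space \<Rightarrow> real) \<Rightarrow> 'd phase_space \<times> 'd phase_space \<Rightarrow> complex" where
  "tc_kernel \<omega>0 \<omega>1 \<omega>2 z = of_real (\<omega>0 (fst z) / (\<omega>1 (fst z - snd z) * \<omega>2 (snd z))) * cis (2 * sympl (fst z) (snd z))"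

lemma tc_kernel_bounded:
  fixes \<omega>0 \<omega>1 \<omega>2 :: "'d::finite phase_space \<Rightarrow> real"
  assumes w: "regular_weight N0 \<omega>0" "regular_weight N1 \<omega>1" "regular_weight N2 \<omega>2"
    and C: "\<And>X Y. \<omega>0 (X + Y) \<le> C * \<omega>1 X * \<omega>2 Y"
  shows "tc_kernel \<omega>0 \<omega>1 \<omega>2 \<in> borel_measurable borel" "cmod (tc_kernel \<omega>0 \<omega>1 \<omega>2 z) \<le> C"
proof -
  have pw: "\<And>X. 0 < \<omega>0 X" "\<And>X. 0 < \<omega>1 X" "\<And>X. 0 < \<omega>2 X" using w by (auto simp: regular_weight_def)
  have [measurable]: "\<omega>0 \<in> borel_measurable borel" "\<omega>1 \<in> borel_measurable borel" "\<omega>2 \<in> borel_measurable borel"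
    using w by (auto simp: regular_weight_def intro: borel_measurable_continuous_onI)
  show "tc_kernel \<omega>0 \<omega>1 \<omega>2 \<in> borel_measurable borel" unfolding tc_kernel_def by measurable
  have "\<omega>0 (fst z) \<le> C * (\<omega>1 (fst z - snd z) * \<omega>2 (snd z))" using C[of "fst z - snd z" "snd z"] by (simp add: mult.assoc)
  then show "cmod (tc_kernel \<omega>0 \<omega>1 \<omega>2 z) \<le> C" using pw[of "fst z"] pw[of "snd z"] pw[of "fst z - snd z"]
    by (simp add: tc_kernel_def norm_mult norm_divide pos_divide_le_eq abs_mult less_imp_le)
qed

lemma trilinear_bounded_scale:
  assumes "trilinear_bounded K M x y w" "M \<le> M'" shows "trilinear_bounded K M' x y w"
  using assms unfolding trilinear_bounded_def by (meson order_trans)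

text \<open>At these vertices one of the three functions is bounded and the other two are integrable in different variables,
so the oscillation of \<open>K\<close> is irrelevant.\<close>

lemma trilinear_bounded_vertex:
  fixes K :: "'a::euclidean_space \<times> 'a \<Rightarrow> complex"
  assumes [measurable]: "K \<in> borel_measurable borel" and K: "\<And>z. cmod (K z) \<le> C"
  shows "trilinear_bounded K C 1 0 1" "trilinear_bounded K C 0 1 1" "trilinear_bounded K C 1 1 0"
proof -
  have C0: "0 \<le> C" using order_trans[OF norm_ge_zero K] .
  have gen: "cmod (trilinear K F G H) \<le> C"
    if m[measurable]: "F \<in> borel_measurable borel" "G \<in> borel_measurable borel" "H \<in> borel_measurable borel"
      and le: "(\<integral>\<^sup>+z. ennreal (cmod (F (fst z - snd z)) * cmod (G (snd z)) * cmod (H (fst z))) \<partial>lborel) \<le> 1"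
    for F G H
  proof -
    have "ennreal (cmod (trilinear K F G H)) \<le> (\<integral>\<^sup>+z. ennreal (cmod (K z * (F (fst z - snd z) * G (snd z) * H (fst z)))) \<partial>lborel)"
      unfolding trilinear_def
      by (cases "integrable lborel (\<lambda>z. K z * (F (fst z - snd z) * G (snd z) * H (fst z)))")
         (auto intro: integral_norm_bound_ennreal simp: not_integrable_integral_eq)
    also have "\<dots> \<le> (\<integral>\<^sup>+z. ennreal C * ennreal (cmod (F (fst z - snd z)) * cmod (G (snd z)) * cmod (H (fst z))) \<partial>lborel)"
      using K C0 by (intro nn_integral_mono) (auto simp: norm_mult intro!: ennreal_leI mult_right_mono simp flip: ennreal_mult)
    also have "\<dots> = ennreal C * (\<integral>\<^sup>+z. ennreal (cmod (F (fst z - snd z)) * cmod (G (snd z)) * cmod (H (fst z))) \<partial>lborel)"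
      by (rule nn_integral_cmult) simp
    also have "\<dots> \<le> ennreal C * 1" by (intro mult_left_mono le) auto
    finally show ?thesis using C0 by simp
  qed
  have reflect: "(\<integral>\<^sup>+Y. ennreal (u (X - Y)) \<partial>lborel) \<le> 1" "(\<integral>\<^sup>+X. ennreal (u (X - Y)) \<partial>lborel) \<le> 1"
    if "unit_density u" for u and X Y :: 'a
    using unit_densityD(1,3)[OF that] nn_integral_lborel_reflect[of "\<lambda>Y. ennreal (u Y)" X]
      nn_integral_lborel_translate[of "\<lambda>X. ennreal (u X)" "- Y"] by simp_all
  \<comment> \<open>integrate first over the variable that occurs in one factor only\<close>
  have iterate: "(\<integral>\<^sup>+X. (\<integral>\<^sup>+Y. ennreal (f X Y * v X) \<partial>lborel) \<partial>lborel) \<le> 1"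
    if v: "unit_density v" and f: "\<And>X. f X \<in> borel_measurable borel" "\<And>X Y. 0 \<le> f X Y" "\<And>X. (\<integral>\<^sup>+Y. ennreal (f X Y) \<partial>lborel) \<le> 1"
    for v :: "'a \<Rightarrow> real" and f :: "'a \<Rightarrow> 'a \<Rightarrow> real"
  proof -
    have "(\<integral>\<^sup>+X. (\<integral>\<^sup>+Y. ennreal (f X Y * v X) \<partial>lborel) \<partial>lborel) \<le> (\<integral>\<^sup>+X. ennreal (v X) \<partial>lborel)"
    proof (rule nn_integral_mono)
      fix X
      have "(\<integral>\<^sup>+Y. ennreal (f X Y * v X) \<partial>lborel) = (\<integral>\<^sup>+Y. ennreal (f X Y) \<partial>lborel) * ennreal (v X)"
        using f(1,2) unit_densityD(2)[OF v] by (simp add: ennreal_mult nn_integral_multc)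
      also have "\<dots> \<le> 1 * ennreal (v X)" by (intro mult_right_mono f) auto
      finally show "(\<integral>\<^sup>+Y. ennreal (f X Y * v X) \<partial>lborel) \<le> ennreal (v X)" by simp
    qed
    then show ?thesis using unit_densityD(3)[OF v] by (rule order_trans)
  qed
  have prods: "(\<integral>\<^sup>+z. ennreal (u (fst z - snd z) * v (fst z)) \<partial>lborel) \<le> 1" "(\<integral>\<^sup>+z. ennreal (u (snd z) * v (fst z)) \<partial>lborel) \<le> 1"
    "(\<integral>\<^sup>+z. ennreal (u (fst z - snd z) * v (snd z)) \<partial>lborel) \<le> 1" if u: "unit_density u" and v: "unit_density v" for u v :: "'a \<Rightarrow> real"
  proof -
    note [measurable] = unit_densityD(1)[OF u] unit_densityD(1)[OF v]
    show "(\<integral>\<^sup>+z. ennreal (u (fst z - snd z) * v (fst z)) \<partial>lborel) \<le> 1"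
      by (subst lborel_Tonelli_fst) (simp_all add: iterate[OF v] unit_densityD[OF u] reflect[OF u])
    show "(\<integral>\<^sup>+z. ennreal (u (snd z) * v (fst z)) \<partial>lborel) \<le> 1"
      by (subst lborel_Tonelli_fst) (simp_all add: iterate[OF v] unit_densityD[OF u])
    show "(\<integral>\<^sup>+z. ennreal (u (fst z - snd z) * v (snd z)) \<partial>lborel) \<le> 1"
      by (subst lborel_Tonelli_snd) (simp_all add: iterate[OF v] unit_densityD[OF u] reflect[OF u])
  qed
  have m3: "f * g * h \<le> f' * g' * h'" if "0 \<le> f" "0 \<le> g" "0 \<le> h" "f \<le> f'" "g \<le> g'" "h \<le> h'" for f g h f' g' h' :: real
    using that by (intro mult_mono) auto
  have vertex: "trilinear_bounded K C x y w"
    if "\<And>u v t :: 'a \<Rightarrow> real. simple_density u \<Longrightarrow> simple_density v \<Longrightarrow> simple_density t \<Longrightarrow>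
      (\<integral>\<^sup>+z. ennreal (u (fst z - snd z) powr x * v (snd z) powr y * t (fst z) powr w) \<partial>lborel) \<le> 1" for x y w
    unfolding trilinear_bounded_def
  proof (intro allI impI, elim conjE)
    fix F G H :: "'a \<Rightarrow> complex" and u v t :: "'a \<Rightarrow> real"
    assume m: "F \<in> borel_measurable borel" "G \<in> borel_measurable borel" "H \<in> borel_measurable borel"
      and d: "simple_density u" "simple_density v" "simple_density t"
      and le: "\<forall>X. cmod (F X) \<le> u X powr x" "\<forall>X. cmod (G X) \<le> v X powr y" "\<forall>X. cmod (H X) \<le> t X powr w"
    have "(\<integral>\<^sup>+z. ennreal (cmod (F (fst z - snd z)) * cmod (G (snd z)) * cmod (H (fst z))) \<partial>lborel)
      \<le> (\<integral>\<^sup>+z. ennreal (u (fst z - snd z) powr x * v (snd z) powr y * t (fst z) powr w) \<partial>lborel)"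
      using le by (intro nn_integral_mono ennreal_leI m3) auto
    then show "cmod (trilinear K F G H) \<le> C" using that[OF d] by (intro gen[OF m]) (rule order_trans)
  qed
  have drop: "(\<integral>\<^sup>+z. ennreal (f z) \<partial>lborel) \<le> 1" if "(\<integral>\<^sup>+z. ennreal (g z) \<partial>lborel) \<le> 1" "\<And>z. f z \<le> g z" for f g :: "'a \<times> 'a \<Rightarrow> real"
    using that by (intro order_trans[OF nn_integral_mono that(1)] ennreal_leI) auto
  show "trilinear_bounded K C 1 0 1"
  proof (rule vertex)
    fix u v t :: "'a \<Rightarrow> real" assume d: "simple_density u" "simple_density v" "simple_density t"
    show "(\<integral>\<^sup>+z. ennreal (u (fst z - snd z) powr 1 * v (snd z) powr 0 * t (fst z) powr 1) \<partial>lborel) \<le> 1"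
      by (rule drop[OF prods(1)[OF simple_densityD(1)[OF d(1)] simple_densityD(1)[OF d(3)]]])
         (simp add: simple_densityD(3)[OF d(1)] simple_densityD(3)[OF d(3)])
  qed
  show "trilinear_bounded K C 0 1 1"
  proof (rule vertex)
    fix u v t :: "'a \<Rightarrow> real" assume d: "simple_density u" "simple_density v" "simple_density t"
    show "(\<integral>\<^sup>+z. ennreal (u (fst z - snd z) powr 0 * v (snd z) powr 1 * t (fst z) powr 1) \<partial>lborel) \<le> 1"
      by (rule drop[OF prods(2)[OF simple_densityD(1)[OF d(2)] simple_densityD(1)[OF d(3)]]])
         (simp add: simple_densityD(3)[OF d(2)] simple_densityD(3)[OF d(3)])
  qed
  show "trilinear_bounded K C 1 1 0"
  proof (rule vertex)
    fix u v t :: "'a \<Rightarrow> real" assume d: "simple_density u" "simple_density v" "simple_density t"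
    show "(\<integral>\<^sup>+z. ennreal (u (fst z - snd z) powr 1 * v (snd z) powr 1 * t (fst z) powr 0) \<partial>lborel) \<le> 1"
      by (rule drop[OF prods(3)[OF simple_densityD(1)[OF d(1)] simple_densityD(1)[OF d(2)]]])
         (simp add: simple_densityD(3)[OF d(1)] simple_densityD(3)[OF d(2)])
  qed
qed

text \<open>For continuous \<open>F\<close> and \<open>G\<close> this is \<open>tconv_L2_bound\<close> paired with \<open>H\<close>. Functions bounded by simple densities are limits
almost everywhere of continuous ones with a common bound and support.\<close>

lemma trilinear_bounded_L2:
  fixes \<omega>0 \<omega>1 \<omega>2 :: "'d::finite phase_space \<Rightarrow> real"
  assumes w: "regular_weight N0 \<omega>0" "regular_weight N1 \<omega>1" "regular_weight N2 \<omega>2"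
    and C: "0 \<le> C" "\<And>X Y. \<omega>0 (X + Y) \<le> C * \<omega>1 X * \<omega>2 Y"
  obtains M where "0 \<le> M" "trilinear_bounded (tc_kernel \<omega>0 \<omega>1 \<omega>2) M (1/2) (1/2) (1/2)"
proof -
  let ?N = "\<lambda>f :: 'd phase_space \<Rightarrow> complex. LINT X|lborel. (cmod (f X))\<^sup>2"
  let ?N2 = "\<lambda>f :: 'd phase_space \<Rightarrow> complex. \<integral>\<^sup>+X. ennreal ((cmod (f X))\<^sup>2) \<partial>lborel"
  obtain M where M: "0 \<le> M" and L2: "\<And>a b R. continuous_on UNIV a \<Longrightarrow> (\<And>X. a X \<noteq> 0 \<Longrightarrow> norm X \<le> R) \<Longrightarrow>
    continuous_on UNIV b \<Longrightarrow> (\<And>X. b X \<noteq> 0 \<Longrightarrow> norm X \<le> R) \<Longrightarrow>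
    (\<integral>\<^sup>+X. ennreal ((cmod (tconv 2 a b X) * \<omega>0 X)\<^sup>2) \<partial>lborel)
      \<le> ennreal M * ((\<integral>\<^sup>+X. ennreal ((cmod (a X) * \<omega>1 X)\<^sup>2) \<partial>lborel) * (\<integral>\<^sup>+X. ennreal ((cmod (b X) * \<omega>2 X)\<^sup>2) \<partial>lborel))"
    by (rule tconv_L2_bound[OF w C]) blast
  have cw: "continuous_on UNIV \<omega>0" "continuous_on UNIV \<omega>1" "continuous_on UNIV \<omega>2"
    and pw: "\<And>X. 0 < \<omega>0 X" "\<And>X. 0 < \<omega>1 X" "\<And>X. 0 < \<omega>2 X"
    using w by (auto simp: regular_weight_def)
  have wm[measurable]: "\<omega>0 \<in> borel_measurable borel" "\<omega>1 \<in> borel_measurable borel" "\<omega>2 \<in> borel_measurable borel"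
    using cw by (auto intro: borel_measurable_continuous_onI)
  let ?K = "tc_kernel \<omega>0 \<omega>1 \<omega>2"
  note Km[measurable] = tc_kernel_bounded(1)[OF w C(2)] and KC = tc_kernel_bounded(2)[OF w C(2)]
  let ?B = "\<lambda>f g h. M * (?N f * ?N g) * ?N h"
  have cont_case: "cmod (trilinear ?K F G H) \<le> sqrt (?B F G H)"
    if F: "continuous_on UNIV F" "\<And>X. F X \<noteq> 0 \<Longrightarrow> norm X \<le> R"
      and G: "continuous_on UNIV G" "\<And>X. G X \<noteq> 0 \<Longrightarrow> norm X \<le> R"
      and H: "H \<in> borel_measurable borel" "\<And>X. cmod (H X) \<le> D" "\<And>X. H X \<noteq> 0 \<Longrightarrow> norm X \<le> R" for F G H R D
  proof -
    note [measurable] = H(1)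
    obtain A where A: "0 \<le> A" "\<And>X. cmod (F X) \<le> A" using continuous_bounded_support_bounded[OF F] by blast
    obtain B where B: "0 \<le> B" "\<And>X. cmod (G X) \<le> B" using continuous_bounded_support_bounded[OF G] by blast
    have [measurable]: "F \<in> borel_measurable borel" "G \<in> borel_measurable borel"
      using F G by (auto intro: borel_measurable_continuous_onI)
    define a where "a X = F X / of_real (\<omega>1 X)" for X
    define b where "b X = G X / of_real (\<omega>2 X)" for X
    have a: "continuous_on UNIV a" "\<And>X. a X \<noteq> 0 \<Longrightarrow> norm X \<le> R"
      unfolding a_def using F cw pw(2) by (auto intro!: continuous_intros simp: less_imp_neq[symmetric] order.strict_implies_not_eq)
    have b: "continuous_on UNIV b" "\<And>X. b X \<noteq> 0 \<Longrightarrow> norm X \<le> R"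
      unfolding b_def using G cw pw(3) by (auto intro!: continuous_intros simp: less_imp_neq[symmetric] order.strict_implies_not_eq)
    have aw: "cmod (a X) * \<omega>1 X = cmod (F X)" "cmod (b X) * \<omega>2 X = cmod (G X)" for X
      using pw(2)[of X] pw(3)[of X] by (auto simp: a_def b_def norm_divide)
    define f where "f = tconv 2 a b"
    have fc: "continuous_on UNIV f" unfolding f_def by (rule tconv_continuous[OF a b])
    have [measurable]: "f \<in> borel_measurable borel" using fc by (rule borel_measurable_continuous_onI)
    have ti: "integrable lborel (\<lambda>z. ?K z * (F (fst z - snd z) * G (snd z) * H (fst z)))"
      by (rule trilinear_integrable[OF _ _ _ _ KC A(2) B(2) H(2) G(2) H(3)]) simp_all
    have "trilinear ?K F G H = (LINT X|lborel. of_real (\<omega>0 X) * f X * H X)"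
      unfolding trilinear_def lborel_Fubini_fst[OF ti]
    proof (rule Bochner_Integration.integral_cong[OF refl])
      fix X
      have "(LINT Y|lborel. ?K (X, Y) * (F (fst (X, Y) - snd (X, Y)) * G (snd (X, Y)) * H (fst (X, Y))))
        = (LINT Y|lborel. of_real (\<omega>0 X) * (a (X - Y) * b Y * cis (2 * sympl X Y)) * H X)"
        by (intro Bochner_Integration.integral_cong refl) (simp add: tc_kernel_def a_def b_def)
      also have "\<dots> = of_real (\<omega>0 X) * f X * H X" by (simp add: f_def tconv_def)
      finally show "(LINT Y|lborel. ?K (X, Y) * (F (fst (X, Y) - snd (X, Y)) * G (snd (X, Y)) * H (fst (X, Y)))) = of_real (\<omega>0 X) * f X * H X" .
    qed
    then have "ennreal (cmod (trilinear ?K F G H)) \<le> (\<integral>\<^sup>+X. ennreal (cmod (of_real (\<omega>0 X) * f X * H X)) \<partial>lborel)"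
      by (cases "integrable lborel (\<lambda>X. of_real (\<omega>0 X) * f X * H X)")
         (auto intro: integral_norm_bound_ennreal simp: not_integrable_integral_eq)
    also have "\<dots> = (\<integral>\<^sup>+X. ennreal ((cmod (f X) * \<omega>0 X) * cmod (H X)) \<partial>lborel)"
      using pw(1) by (intro nn_integral_cong) (simp add: norm_mult less_imp_le mult_ac)
    finally have "(ennreal (cmod (trilinear ?K F G H)))\<^sup>2 \<le> (\<integral>\<^sup>+X. ennreal ((cmod (f X) * \<omega>0 X) * cmod (H X)) \<partial>lborel)\<^sup>2"
      by (intro power_mono) auto
    also have "\<dots> \<le> (\<integral>\<^sup>+X. ennreal ((cmod (f X) * \<omega>0 X)\<^sup>2) \<partial>lborel) * (?N2 H)"
      using pw(1) by (intro Cauchy_Schwarz_nn_integral) (auto simp: less_imp_le)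
    also have "\<dots> \<le> (ennreal M * ((?N2 F) * (?N2 G))) * (?N2 H)"
      using L2[OF a b] unfolding aw f_def by (intro mult_right_mono) auto
    also have "\<dots> = ennreal (?B F G H)"
    proof -
      have sq: "(?N2 h) = ennreal (?N h)"
        if "h \<in> borel_measurable borel" "\<And>X. cmod (h X) \<le> E" "\<And>X. h X \<noteq> 0 \<Longrightarrow> norm X \<le> R" for h and E :: real
      proof (rule nn_integral_eq_integral)
        show "integrable lborel (\<lambda>X. (cmod (h X))\<^sup>2)"
          by (rule integrable_bounded_support[where B = "E\<^sup>2" and R = R]) (use that in \<open>auto intro!: power_mono\<close>)
      qed simp
      have eqs: "(?N2 F) = ennreal (?N F)"
        "(?N2 G) = ennreal (?N G)"
        "(?N2 H) = ennreal (?N H)"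
        by (rule sq[OF _ A(2) F(2)] sq[OF _ B(2) G(2)] sq[OF _ H(2) H(3)]; simp)+
      show ?thesis unfolding eqs using M by (simp add: ennreal_mult integral_nonneg_AE)
    qed
    finally have "ennreal ((cmod (trilinear ?K F G H))\<^sup>2) \<le> \<dots>" by (simp add: ennreal_power)
    moreover have "0 \<le> ?B F G H"
      using M by (intro mult_nonneg_nonneg integral_nonneg_AE) auto
    ultimately have "(cmod (trilinear ?K F G H))\<^sup>2 \<le> ?B F G H"
      by (simp only: ennreal_le_iff)
    then show ?thesis by (rule real_le_rsqrt)
  qed
  have "trilinear_bounded ?K (sqrt M) (1/2) (1/2) (1/2)"
    unfolding trilinear_bounded_def
  proof (intro allI impI, elim conjE)
    fix F G H :: "'d phase_space \<Rightarrow> complex" and u v t :: "'d phase_space \<Rightarrow> real"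
    assume m[measurable]: "F \<in> borel_measurable borel" "G \<in> borel_measurable borel" "H \<in> borel_measurable borel"
      and d: "simple_density u" "simple_density v" "simple_density t"
      and le: "\<forall>X. cmod (F X) \<le> u X powr (1/2)" "\<forall>X. cmod (G X) \<le> v X powr (1/2)" "\<forall>X. cmod (H X) \<le> t X powr (1/2)"
    have bdd: "\<exists>B. \<forall>X. cmod (h X) \<le> B" if "simple_density d" "\<forall>X. cmod (h X) \<le> d X powr (1/2)" for h and d :: "'d phase_space \<Rightarrow> real"
    proof -
      have "finite ((\<lambda>r. r powr (1/2)) ` range d)" using simple_densityD(4)[OF that(1)] by simp
      then have "\<forall>X. d X powr (1/2) \<le> Max ((\<lambda>r. r powr (1/2)) ` range d)" by (intro allI Max_ge) auto
      then show ?thesis using that by (meson order_trans)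
    qed
    have supp: "\<exists>R. \<forall>X. h X \<noteq> 0 \<longrightarrow> norm X \<le> R" if bd: "simple_density d" and "\<forall>X. cmod (h X) \<le> d X powr (1/2)" for h and d :: "'d phase_space \<Rightarrow> real"
    proof -
      obtain R where R: "\<And>X. d X \<noteq> 0 \<Longrightarrow> norm X \<le> R" using simple_densityD(5)[OF bd] unfolding bounded_iff by blast
      have "d X \<noteq> 0" if "h X \<noteq> 0" for X
        using \<open>\<forall>X. cmod (h X) \<le> d X powr (1/2)\<close>[rule_format, of X] that by auto
      then show ?thesis using R by blast
    qed
    have norm1: "(?N h) \<le> 1"
      if [measurable]: "h \<in> borel_measurable borel" and sd: "simple_density d" and hle: "\<forall>X. cmod (h X) \<le> d X powr (1/2)" for h and d :: "'d phase_space \<Rightarrow> real"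
    proof -
      have le: "(cmod (h X))\<^sup>2 \<le> d X" for X
      proof -
        have "(cmod (h X))\<^sup>2 \<le> (d X powr (1/2))\<^sup>2" by (intro power_mono hle[rule_format]) simp
        also have "\<dots> = d X" using simple_densityD(3)[OF sd, of X] by (simp add: powr_half_sqrt)
        finally show ?thesis .
      qed
      have "(?N2 h) \<le> (\<integral>\<^sup>+X. ennreal (d X) \<partial>lborel)" by (intro nn_integral_mono ennreal_leI le)
      then have l: "(?N2 h) \<le> 1" using unit_densityD(3)[OF simple_densityD(1)[OF sd]] by (rule order_trans)
      have "integrable lborel (\<lambda>X. (cmod (h X))\<^sup>2)" by (rule integrableI_nonneg) (use l in \<open>auto intro: le_less_trans\<close>)
      then have "ennreal (?N h) \<le> 1" using l by (subst (asm) nn_integral_eq_integral) auto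
      then show ?thesis by simp
    qed
    obtain A B D where A: "\<And>X. cmod (F X) \<le> A" and B: "\<And>X. cmod (G X) \<le> B" and D: "\<And>X. cmod (H X) \<le> D"
      using bdd[OF d(1) le(1)] bdd[OF d(2) le(2)] bdd[OF d(3) le(3)] by blast
    obtain R1 R2 R3 where R1: "\<And>X. F X \<noteq> 0 \<Longrightarrow> norm X \<le> R1" and R2: "\<And>X. G X \<noteq> 0 \<Longrightarrow> norm X \<le> R2" and R3: "\<And>X. H X \<noteq> 0 \<Longrightarrow> norm X \<le> R3"
      using supp[OF d(1) le(1)] supp[OF d(2) le(2)] supp[OF d(3) le(3)] by blast
    define R where "R = max (max R1 R2) R3"
    have FR: "\<And>X. F X \<noteq> 0 \<Longrightarrow> norm X \<le> R" and GR: "\<And>X. G X \<noteq> 0 \<Longrightarrow> norm X \<le> R" and HR: "\<And>X. H X \<noteq> 0 \<Longrightarrow> norm X \<le> R + 1"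
      using R1 R2 R3 unfolding R_def by (force simp: le_max_iff_disj)+
    obtain Fn where Fn: "\<And>n. continuous_on UNIV (Fn n)" "\<And>n x. cmod (Fn n x) \<le> A" "\<And>n x. Fn n x \<noteq> 0 \<Longrightarrow> norm x \<le> R + 1"
      "AE x in lborel. (\<lambda>n. Fn n x) \<longlonglongrightarrow> F x" using continuous_bounded_approximation[OF m(1), of A R] A FR by blast
    obtain Gn where Gn: "\<And>n. continuous_on UNIV (Gn n)" "\<And>n x. cmod (Gn n x) \<le> B" "\<And>n x. Gn n x \<noteq> 0 \<Longrightarrow> norm x \<le> R + 1"
      "AE x in lborel. (\<lambda>n. Gn n x) \<longlonglongrightarrow> G x" using continuous_bounded_approximation[OF m(2), of B R] B GR by blast
    have Fnm[measurable]: "Fn n \<in> borel_measurable borel" "Gn n \<in> borel_measurable borel" for n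
      using Fn Gn by (auto intro: borel_measurable_continuous_onI)
    have nonneg: "0 \<le> A" "0 \<le> B" "0 \<le> D" using A B D norm_ge_zero order_trans by blast+
    have cball: "emeasure lborel (cball (0::'d phase_space) r) < \<infinity>" for r using emeasure_lborel_cball_finite by auto
    have sqlim: "(\<lambda>n. LINT X|lborel. (cmod (hn n X))\<^sup>2) \<longlonglongrightarrow> (?N h)"
      if [measurable]: "\<And>n. hn n \<in> borel_measurable borel" "h \<in> borel_measurable borel"
        and hb: "\<And>n x. cmod (hn n x) \<le> E" "\<And>n x. hn n x \<noteq> 0 \<Longrightarrow> norm x \<le> R + 1"
        and hl: "AE x in lborel. (\<lambda>n. hn n x) \<longlonglongrightarrow> h x" for hn :: "nat \<Rightarrow> 'd phase_space \<Rightarrow> complex" and h E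
    proof (rule integral_dominated_convergence)
      show "integrable lborel (\<lambda>X::'d phase_space. E\<^sup>2 * indicator (cball 0 (R + 1)) X)" using cball by simp
      show "AE X in lborel. (\<lambda>n. (cmod (hn n X))\<^sup>2) \<longlonglongrightarrow> (cmod (h X))\<^sup>2"
        using hl by eventually_elim (intro tendsto_intros)
      show "AE X in lborel. norm ((cmod (hn n X))\<^sup>2) \<le> E\<^sup>2 * indicator (cball 0 (R + 1)) X" for n
      proof (rule AE_I2)
        fix X
        show "norm ((cmod (hn n X))\<^sup>2) \<le> E\<^sup>2 * indicator (cball 0 (R + 1)) X"
        proof (cases "hn n X = 0")
          case False
          then have "X \<in> cball 0 (R + 1)" using hb(2) by simp
          then show ?thesis using power_mono[OF hb(1)[of n X] norm_ge_zero, of 2] by simp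
        qed simp
      qed
    qed simp_all
    have "(\<lambda>n. trilinear ?K (Fn n) (Gn n) H) \<longlonglongrightarrow> trilinear ?K F G H"
      unfolding trilinear_def
    proof (rule integral_dominated_convergence)
      let ?d = "\<lambda>z::'d phase_space \<times> 'd phase_space. C * (A * B * D) * indicator (cball 0 (2 * (R + 1))) z"
      have "emeasure lborel (cball (0::'d phase_space \<times> 'd phase_space) (2 * (R + 1))) < \<infinity>" using emeasure_lborel_cball_finite by auto
      then show "integrable lborel ?d" by simp
      have "AE z in lborel. (\<lambda>n. Gn n (snd z)) \<longlonglongrightarrow> G (snd z)" by (rule AE_lborel_snd[OF Gn(4)])
      moreover have "AE z in lborel. (\<lambda>n. Fn n (fst z - snd z)) \<longlonglongrightarrow> F (fst z - snd z)" by (rule AE_lborel_fst_diff_snd[OF Fn(4)])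
      ultimately show "AE z in lborel. (\<lambda>n. ?K z * (Fn n (fst z - snd z) * Gn n (snd z) * H (fst z))) \<longlonglongrightarrow> ?K z * (F (fst z - snd z) * G (snd z) * H (fst z))"
        by eventually_elim (intro tendsto_intros)
      show "AE z in lborel. cmod (?K z * (Fn n (fst z - snd z) * Gn n (snd z) * H (fst z))) \<le> ?d z" for n
      proof (rule AE_I2)
        fix z :: "'d phase_space \<times> 'd phase_space"
        show "cmod (?K z * (Fn n (fst z - snd z) * Gn n (snd z) * H (fst z))) \<le> ?d z"
        proof (cases "Gn n (snd z) = 0 \<or> H (fst z) = 0")
          case True
          then show ?thesis using nonneg C(1) by auto
        next
          case False
          then have "norm z \<le> 2 * (R + 1)" using Gn(3)[of n "snd z"] HR[of "fst z"] norm_Pair_le[of "fst z" "snd z"] by simp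
          then show ?thesis
            using KC[of z] Fn(2)[of n "fst z - snd z"] Gn(2)[of n "snd z"] D[of "fst z"] nonneg C(1)
            by (simp add: norm_mult mult_mono)
        qed
      qed
    qed simp_all
    then have "(\<lambda>n. cmod (trilinear ?K (Fn n) (Gn n) H)) \<longlonglongrightarrow> cmod (trilinear ?K F G H)" by (rule tendsto_norm)
    moreover have "(\<lambda>n. sqrt (?B (Fn n) (Gn n) H))
      \<longlonglongrightarrow> sqrt (?B F G H)"
      by (intro tendsto_intros sqlim[OF Fnm(1) m(1) Fn(2,3,4)] sqlim[OF Fnm(2) m(2) Gn(2,3,4)])
    ultimately have "cmod (trilinear ?K F G H) \<le> sqrt (?B F G H)"
    proof (rule LIMSEQ_le)
      have "cmod (trilinear ?K (Fn n) (Gn n) H) \<le> sqrt (?B (Fn n) (Gn n) H)" for n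
        by (rule cont_case[OF Fn(1,3) Gn(1,3) m(3) D HR])
      then show "\<exists>N. \<forall>n\<ge>N. cmod (trilinear ?K (Fn n) (Gn n) H) \<le> sqrt (?B (Fn n) (Gn n) H)"
        by blast
    qed
    also have "\<dots> \<le> sqrt (M * (1 * 1) * 1)"
      using M norm1[OF m(1) d(1) le(1)] norm1[OF m(2) d(2) le(2)] norm1[OF m(3) d(3) le(3)]
      by (intro real_sqrt_le_mono mult_mono) (auto intro!: integral_nonneg_AE mult_nonneg_nonneg)
    finally show "cmod (trilinear ?K F G H) \<le> sqrt M" by simp
  qed
  then show ?thesis using that M by (metis real_sqrt_ge_zero)
qed

text \<open>Every point of the region is a convex combination of the four vertices.\<close>

lemma trilinear_bounded_region:
  fixes \<omega>0 \<omega>1 \<omega>2 :: "'d::finite phase_space \<Rightarrow> real"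
  assumes w: "regular_weight N0 \<omega>0" "regular_weight N1 \<omega>1" "regular_weight N2 \<omega>2"
    and C: "0 \<le> C" "\<And>X Y. \<omega>0 (X + Y) \<le> C * \<omega>1 X * \<omega>2 Y"
  obtains M where "0 < M" "\<And>x y w. 1 \<le> x + w \<Longrightarrow> 1 \<le> y + w \<Longrightarrow> 1 \<le> x + y \<Longrightarrow> x + y + w \<le> 2 \<Longrightarrow> trilinear_bounded (tc_kernel \<omega>0 \<omega>1 \<omega>2) M x y w"
proof -
  let ?K = "tc_kernel \<omega>0 \<omega>1 \<omega>2"
  obtain M0 where M0: "0 \<le> M0" "trilinear_bounded ?K M0 (1/2) (1/2) (1/2)" by (rule trilinear_bounded_L2[OF w C]) blast
  note Km = tc_kernel_bounded(1)[OF w C(2)] and KC = tc_kernel_bounded(2)[OF w C(2)]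
  define M where "M = max 1 (max C M0)"
  have vert: "trilinear_bounded ?K M 1 0 1" "trilinear_bounded ?K M 0 1 1" "trilinear_bounded ?K M 1 1 0" "trilinear_bounded ?K M (1/2) (1/2) (1/2)"
    using trilinear_bounded_vertex[OF Km KC] M0(2) by (auto intro: trilinear_bounded_scale simp: M_def)
  note cv = trilinear_bounded_convex[OF Km KC]
  show ?thesis
  proof (rule that[of M])
    show "0 < M" by (simp add: M_def)
    fix x y w :: real
    assume h: "1 \<le> x + w" "1 \<le> y + w" "1 \<le> x + y" "x + y + w \<le> 2"
    \<comment> \<open>barycentric coordinates with respect to the four vertices\<close>
    define a b c d where "a = x + w - 1" and "b = y + w - 1" and "c = x + y - 1" and "d = 4 - 2 * (x + y + w)"
    have n: "0 \<le> a" "0 \<le> b" "0 \<le> c" "0 \<le> d" "a + b + c + d = 1" using h by (auto simp: a_def b_def c_def d_def)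
    have xyw: "x = a + c + d / 2" "y = b + c + d / 2" "w = a + b + d / 2" by (auto simp: a_def b_def c_def d_def field_simps)
    \<comment> \<open>edges of the tetrahedron, then the segment between two points on opposite edges\<close>
    have e1: "trilinear_bounded ?K M (1 - s) s 1" if "0 \<le> s" "s \<le> 1" for s using cv[OF vert(1,2) that] by simp
    have e2: "trilinear_bounded ?K M ((1 - s) + s / 2) ((1 - s) + s / 2) (s / 2)" if "0 \<le> s" "s \<le> 1" for s using cv[OF vert(3,4) that] by simp
    define s where "s = (if a + b = 0 then 0 else b / (a + b))"
    define r where "r = (if c + d = 0 then 0 else d / (c + d))"
    have s: "0 \<le> s" "s \<le> 1" "(a + b) * s = b" "(a + b) * (1 - s) = a"
      using n by (auto simp: s_def right_diff_distrib divide_le_eq_1)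
    have r: "0 \<le> r" "r \<le> 1" "(c + d) * r = d" "(c + d) * (1 - r) = c"
      using n by (auto simp: r_def right_diff_distrib divide_le_eq_1)
    have "trilinear_bounded ?K M ((1 - (c + d)) * (1 - s) + (c + d) * ((1 - r) + r / 2)) ((1 - (c + d)) * s + (c + d) * ((1 - r) + r / 2)) ((1 - (c + d)) * 1 + (c + d) * (r / 2))"
      using n by (intro cv e1 e2 s r) auto
    moreover have "1 - (c + d) = a + b" using n by simp
    ultimately show "trilinear_bounded ?K M x y w"
      using s(3,4) r(3,4) by (simp add: distrib_left xyw) (simp add: algebra_simps)
  qed
qed

section \<open>Bilinear operators\<close>

text \<open>Distinguish whether \<open>a\<close> and \<open>b\<close> are above or below \<open>1\<close>; if both are below, \<open>max a b\<close> to the power \<open>x + y \<ge> 1\<close> is at most \<open>max a b\<close>.\<close>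

lemma powr_mult_le_sum:
  fixes a b :: real
  assumes "0 \<le> a" "0 \<le> b" "0 \<le> x" "x \<le> 1" "0 \<le> y" "y \<le> 1" "1 \<le> x + y"
  shows "a powr x * b powr y \<le> a + b + a * b"
proof (cases "a = 0 \<or> b = 0")
  case False
  then have ab: "0 < a" "0 < b" using assms by auto
  have big: "c powr z \<le> c" if "1 \<le> c" "z \<le> 1" for c z :: real
    using powr_mono[of z 1 c] that by simp
  have small: "c powr z \<le> 1" if "0 < c" "c \<le> 1" "0 \<le> z" for c z :: real
    using powr_mono'[of 0 z c] that by simp
  consider "1 \<le> a" "1 \<le> b" | "1 \<le> a" "b \<le> 1" | "a \<le> 1" "1 \<le> b" | "a \<le> 1" "b \<le> 1" by linarith
  then show ?thesis
  proof cases
    case 1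
    then have "a powr x * b powr y \<le> a * b" using assms by (intro mult_mono big) auto
    then show ?thesis using ab by simp
  next
    case 2
    then have "a powr x * b powr y \<le> a * 1" using assms ab by (intro mult_mono big small) auto
    then show ?thesis using ab by (simp add: add_nonneg_nonneg add_increasing2)
  next
    case 3
    then have "a powr x * b powr y \<le> 1 * b" using assms ab by (intro mult_mono big small) auto
    then show ?thesis using ab by (simp add: add_nonneg_nonneg add_increasing2 add_increasing)
  next
    case 4
    define m where "m = max a b"
    have m: "0 < m" "m \<le> 1" using 4 ab by (auto simp: m_def)
    have "a powr x * b powr y \<le> m powr x * m powr y"
      using assms ab by (intro mult_mono powr_mono2) (auto simp: m_def)
    also have "\<dots> = m powr (x + y)" by (simp add: powr_add)
    also have "\<dots> \<le> m powr 1" using m assms by (intro powr_mono') auto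
    also have "\<dots> \<le> a + b" using ab by (simp add: m_def)
    finally show ?thesis using ab by (simp add: add_increasing2)
  qed
qed (use assms in auto)

text \<open>The inequality \<open>powr_mult_le_sum\<close> bounds the product by \<open>u(X-Y) + v(Y) + u(X-Y) v(Y)\<close>. The first two terms are
integrable in \<open>Y\<close> for fixed \<open>X\<close>, and \<open>H\<close> restricts \<open>X\<close> to a bounded set; the last one is jointly integrable. This is how
\<open>1/p\<^sub>1 + 1/p\<^sub>2 \<ge> 1\<close> ensures convergence of the twisted convolution integral.\<close>

lemma local_integrability:
  fixes F G :: "'a::euclidean_space \<Rightarrow> complex"
  assumes [measurable]: "F \<in> borel_measurable borel" "G \<in> borel_measurable borel" and d: "unit_density u" "unit_density v"
    and xy: "0 \<le> x" "x \<le> 1" "0 \<le> y" "y \<le> 1" "1 \<le> x + y"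
    and le: "\<And>X. cmod (F X) \<le> u X powr x" "\<And>X. cmod (G X) \<le> v X powr y"
    and H[measurable]: "H \<in> borel_measurable borel" and Hb: "\<And>X. cmod (H X) \<le> D" "\<And>X. H X \<noteq> 0 \<Longrightarrow> norm X \<le> R"
  shows "integrable lborel (\<lambda>z. F (fst z - snd z) * G (snd z) * H (fst z))"
  unfolding integrable_iff_bounded
proof
  let ?J = "\<lambda>X. \<integral>\<^sup>+Y. ennreal (u (X - Y) * v Y) \<partial>lborel"
  let ?S = "\<lambda>X Y. ennreal D * (ennreal (u (X - Y)) + ennreal (v Y) + ennreal (u (X - Y) * v Y))"
  note u = unit_densityD[OF d(1)] and v = unit_densityD[OF d(2)]
  note [measurable] = u(1) v(1)
  have D0: "0 \<le> D" using order_trans[OF norm_ge_zero Hb(1)] .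
  define U where "U = (\<integral>\<^sup>+X. ennreal (u X) \<partial>lborel)"
  define V where "V = (\<integral>\<^sup>+X. ennreal (v X) \<partial>lborel)"
  have UV: "U \<le> 1" "V \<le> 1" using u v by (auto simp: U_def V_def)
  have inner: "(\<integral>\<^sup>+Y. ennreal (cmod (F (X - Y) * G Y * H X)) \<partial>lborel) \<le> ennreal D * (U + V) * indicator (cball 0 R) X + ennreal D * (?J X)" for X
  proof (cases "H X = 0")
    case False
    then have X: "norm X \<le> R" using Hb by blast
    have "(\<integral>\<^sup>+Y. ennreal (cmod (F (X - Y) * G Y * H X)) \<partial>lborel)
       \<le> (\<integral>\<^sup>+Y. ?S X Y \<partial>lborel)"
    proof (rule nn_integral_mono)
      fix Y
      have "cmod (F (X - Y)) * cmod (G Y) \<le> u (X - Y) powr x * v Y powr y" by (intro mult_mono le) auto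
      also have "\<dots> \<le> u (X - Y) + v Y + u (X - Y) * v Y" by (intro powr_mult_le_sum u(2) v(2) xy)
      finally have "cmod (H X) * (cmod (F (X - Y)) * cmod (G Y)) \<le> D * (u (X - Y) + v Y + u (X - Y) * v Y)"
        by (intro mult_mono Hb D0) auto
      then have "ennreal (cmod (F (X - Y) * G Y * H X)) \<le> ennreal (D * (u (X - Y) + v Y + u (X - Y) * v Y))"
        by (intro ennreal_leI) (simp add: norm_mult mult_ac)
      also have "\<dots> = ?S X Y"
        using D0 u(2) v(2) by (simp add: ennreal_mult ennreal_plus)
      finally show "ennreal (cmod (F (X - Y) * G Y * H X)) \<le> ?S X Y" .
    qed
    also have "\<dots> = ennreal D * ((\<integral>\<^sup>+Y. ennreal (u (X - Y)) \<partial>lborel) + V + (?J X))"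
      unfolding V_def by (simp add: nn_integral_cmult nn_integral_add)
    also have "(\<integral>\<^sup>+Y. ennreal (u (X - Y)) \<partial>lborel) = U" unfolding U_def by (rule nn_integral_lborel_reflect[of "\<lambda>X. ennreal (u X)"]) simp
    finally show ?thesis using X by (simp add: distrib_left)
  qed simp
  have "(\<integral>\<^sup>+z. ennreal (cmod (F (fst z - snd z) * G (snd z) * H (fst z))) \<partial>lborel)
     = (\<integral>\<^sup>+X. (\<integral>\<^sup>+Y. ennreal (cmod (F (X - Y) * G Y * H X)) \<partial>lborel) \<partial>lborel)"
    by (subst lborel_Tonelli_fst) simp_all
  also have "\<dots> \<le> (\<integral>\<^sup>+X. ennreal D * (U + V) * indicator (cball 0 R) X + ennreal D * (?J X) \<partial>lborel)"
    by (intro nn_integral_mono inner)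
  also have "\<dots> = ennreal D * (U + V) * emeasure lborel (cball (0::'a) R) + ennreal D * (\<integral>\<^sup>+X. (?J X) \<partial>lborel)"
  proof -
    have [measurable]: "(\<lambda>X. \<integral>\<^sup>+Y. ennreal (u (X - Y) * v Y) \<partial>lborel) \<in> borel_measurable borel"
    proof -
      have "(\<lambda>(X, Y). ennreal (u (X - Y) * v Y)) \<in> borel_measurable (borel \<Otimes>\<^sub>M lborel)"
        by (simp add: borel_prod case_prod_beta)
      then show ?thesis by (rule lborel.borel_measurable_nn_integral)
    qed
    have [measurable]: "cball (0::'a) R \<in> sets borel" by simp
    show ?thesis
      by (subst nn_integral_add) (measurable, measurable, simp add: nn_integral_cmult nn_integral_cmult_indicator)
  qed
  also have "(\<integral>\<^sup>+X. (?J X) \<partial>lborel) = U * V"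
  proof -
    have "(\<integral>\<^sup>+X. (?J X) \<partial>lborel) = (\<integral>\<^sup>+Y. (\<integral>\<^sup>+X. ennreal (u (X - Y)) * ennreal (v Y) \<partial>lborel) \<partial>lborel)"
      using lborel_Tonelli_fst[of "\<lambda>z. ennreal (u (fst z - snd z) * v (snd z))"] lborel_Tonelli_snd[of "\<lambda>z. ennreal (u (fst z - snd z) * v (snd z))"] u(2) v(2)
      by (simp add: ennreal_mult)
    also have "\<dots> = (\<integral>\<^sup>+Y. U * ennreal (v Y) \<partial>lborel)"
    proof (rule nn_integral_cong)
      fix Y
      have "(\<integral>\<^sup>+X. ennreal (u (X - Y)) \<partial>lborel) = U"
        using nn_integral_lborel_translate[of "\<lambda>X. ennreal (u X)" "- Y"] by (simp add: U_def)
      then show "(\<integral>\<^sup>+X. ennreal (u (X - Y)) * ennreal (v Y) \<partial>lborel) = U * ennreal (v Y)" by (subst nn_integral_multc) simp_all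
    qed
    also have "\<dots> = U * V" unfolding V_def by (rule nn_integral_cmult) simp
    finally show ?thesis .
  qed
  also have "ennreal D * (U + V) * emeasure lborel (cball (0::'a) R) + ennreal D * (U * V) < \<infinity>"
  proof -
    have "U < \<infinity>" "V < \<infinity>" using UV by (auto intro: le_less_trans)
    moreover have "emeasure lborel (cball (0::'a) R) < \<infinity>" using emeasure_lborel_cball_finite by auto
    ultimately show ?thesis by (simp add: ennreal_mult_less_top)
  qed
  finally show "(\<integral>\<^sup>+z. ennreal (cmod (F (fst z - snd z) * G (snd z) * H (fst z))) \<partial>lborel) < \<infinity>" .
qed simp

text \<open>The trilinear bound read as a bound for a bilinear operator: by Fubini's theorem the form is the pairing of the
operator with \<open>H\<close>, and \<open>converse_Holder\<close> removes \<open>H\<close>.\<close>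

lemma kernel_operator_bound:
  fixes K :: "'a::euclidean_space \<times> 'a \<Rightarrow> complex"
  assumes K[measurable]: "K \<in> borel_measurable borel" and KC: "\<And>z. cmod (K z) \<le> C"
    and M: "0 < M" and g: "trilinear_bounded K M x y (1 - z)"
    and xyz: "0 \<le> x" "x \<le> 1" "0 \<le> y" "y \<le> 1" "0 \<le> z" "z \<le> 1" "1 \<le> x + y"
    and m[measurable]: "F \<in> borel_measurable borel" "G \<in> borel_measurable borel" and d: "unit_density u" "unit_density v"
    and le: "\<And>X. cmod (F X) \<le> u X powr x" "\<And>X. cmod (G X) \<le> v X powr y"
  obtains s where "unit_density s" "AE X in lborel. cmod (LINT Y|lborel. K (X, Y) * (F (X - Y) * G Y)) \<le> (8 * M) * s X powr z"
proof -
  define B where "B X = (LINT Y|lborel. K (X, Y) * (F (X - Y) * G Y))" for X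
  have Bm: "B \<in> borel_measurable borel"
  proof -
    have "(\<lambda>z. K z * (F (fst z - snd z) * G (snd z))) \<in> borel_measurable borel" by measurable
    then have "(\<lambda>(X, Y). K (X, Y) * (F (X - Y) * G Y)) \<in> borel_measurable (borel \<Otimes>\<^sub>M lborel)"
      by (simp add: borel_prod case_prod_beta)
    then show ?thesis unfolding B_def by (rule lborel.borel_measurable_lebesgue_integral)
  qed
  obtain s where s: "unit_density s" "AE X in lborel. cmod (B X) \<le> (8 * M) * s X powr (1 - (1 - z))"
  proof (rule converse_Holder[OF Bm, of "8 * M" "1 - z"])
    fix H :: "'a \<Rightarrow> complex" and t :: "'a \<Rightarrow> real" and D R
    assume H[measurable]: "H \<in> borel_measurable borel" and t: "unit_density t" "\<And>X. cmod (H X) \<le> t X powr (1 - z)"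
      and Hb: "\<And>X. cmod (H X) \<le> D" "\<And>X. H X \<noteq> 0 \<Longrightarrow> norm X \<le> R"
    have int: "integrable lborel (\<lambda>z. F (fst z - snd z) * G (snd z) * H (fst z))"
      by (rule local_integrability[OF m d xyz(1,2,3,4,7) le H Hb])
    have intK: "integrable lborel (\<lambda>z. K z * (F (fst z - snd z) * G (snd z) * H (fst z)))"
    proof (rule Bochner_Integration.integrable_bound)
      show "integrable lborel (\<lambda>z. of_real C * (F (fst z - snd z) * G (snd z) * H (fst z)))" using int by simp
      show "AE z in lborel. norm (K z * (F (fst z - snd z) * G (snd z) * H (fst z))) \<le> norm (of_real C * (F (fst z - snd z) * G (snd z) * H (fst z)))"
        unfolding norm_mult[of "K _"] norm_mult[of "of_real C"]
        by (intro AE_I2 mult_right_mono norm_ge_zero) (simp add: order_trans[OF KC abs_ge_self])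
    qed simp
    have "(LINT X|lborel. B X * H X) = trilinear K F G H"
      unfolding trilinear_def lborel_Fubini_fst[OF intK]
    proof (rule Bochner_Integration.integral_cong[OF refl])
      fix X
      have "B X * H X = (LINT Y|lborel. (K (X, Y) * (F (X - Y) * G Y)) * H X)" by (simp add: B_def)
      also have "\<dots> = (LINT Y|lborel. K (X, Y) * (F (fst (X, Y) - snd (X, Y)) * G (snd (X, Y)) * H (fst (X, Y))))"
        by (intro Bochner_Integration.integral_cong refl) (simp add: mult.assoc)
      finally show "B X * H X = (LINT Y|lborel. K (X, Y) * (F (fst (X, Y) - snd (X, Y)) * G (snd (X, Y)) * H (fst (X, Y))))" .
    qed
    moreover have "cmod (trilinear K F G H) \<le> 8 * M"
      by (rule trilinear_bounded_general[OF K KC g xyz(1,2,3,4) _ _ m H d t(1) le t(2) int]) (use xyz in auto)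
    ultimately show "cmod (LINT X|lborel. B X * H X) \<le> 8 * M" by simp
  qed (use M xyz in auto)
  then show ?thesis using that by (simp add: B_def)
qed

section \<open>Schwartz functions\<close>

lemma integrable_inverse_one_plus_square: "integrable lborel (\<lambda>t::real. 1 / (1 + t\<^sup>2))"
  using integrable_inverse_1_plus_square by (simp add: set_integrable_def inverse_eq_divide)

text \<open>Comparison with a product of functions \<open>1/(1 + t\<^sup>2)\<close>, one for each coordinate.\<close>

lemma integrable_polynomial_decay:
  "integrable lborel (\<lambda>x::'a::euclidean_space. 1 / (1 + norm x) ^ (2 * DIM('a)))"
proof (rule Bochner_Integration.integrable_bound)
  show "integrable lborel (\<lambda>x::'a. \<Prod>b\<in>Basis. 1 / (1 + (x \<bullet> b)\<^sup>2))"
    by (rule lborel_integral_prod_Basis(1)[where f = "\<lambda>b t. 1 / (1 + t\<^sup>2)"]) (rule integrable_inverse_one_plus_square)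
  show "AE x in lborel. norm (1 / (1 + norm (x::'a)) ^ (2 * DIM('a))) \<le> norm (\<Prod>b\<in>Basis. 1 / (1 + (x \<bullet> b)\<^sup>2))"
  proof (rule AE_I2)
    fix x :: 'a
    have "(\<Prod>b\<in>Basis. 1 + (x \<bullet> b)\<^sup>2) \<le> (\<Prod>b\<in>(Basis::'a set). (1 + norm x)\<^sup>2)"
    proof (rule prod_mono)
      fix b :: 'a assume "b \<in> Basis"
      then have "\<bar>x \<bullet> b\<bar> \<le> norm x" by (rule Basis_le_norm)
      then have "(x \<bullet> b)\<^sup>2 \<le> (norm x)\<^sup>2" by (metis abs_ge_zero power2_abs power_mono)
      moreover have "(1 + norm x)\<^sup>2 = 1 + (norm x)\<^sup>2 + 2 * norm x" by (simp add: power2_sum)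
      ultimately show "0 \<le> 1 + (x \<bullet> b)\<^sup>2 \<and> 1 + (x \<bullet> b)\<^sup>2 \<le> (1 + norm x)\<^sup>2"
        using norm_ge_zero[of x] zero_le_power2[of "x \<bullet> b"] by (intro conjI) linarith+
    qed
    then have "(\<Prod>b\<in>Basis. 1 + (x \<bullet> b)\<^sup>2) \<le> (1 + norm x) ^ (2 * DIM('a))" by (simp add: power_mult)
    moreover have "0 < (\<Prod>b\<in>Basis. 1 + (x \<bullet> b)\<^sup>2)" by (intro prod_pos) (auto intro: add_pos_nonneg)
    ultimately have "1 / (1 + norm x) ^ (2 * DIM('a)) \<le> 1 / (\<Prod>b\<in>Basis. 1 + (x \<bullet> b)\<^sup>2)" by (intro divide_left_mono mult_pos_pos) auto
    then show "norm (1 / (1 + norm x) ^ (2 * DIM('a))) \<le> norm (\<Prod>b\<in>Basis. 1 / (1 + (x \<bullet> b)\<^sup>2))"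
      by (simp add: prod_dividef abs_prod)
  qed
qed measurable

text \<open>Membership in the Schwartz space needs control of all iterated derivatives. It suffices to exhibit a set of
differentiable, rapidly decreasing functions that is closed under partial derivatives.\<close>

lemma Schwartz_coinduct:
  fixes f :: "'a::euclidean_space \<Rightarrow> complex"
  assumes "f \<in> S"
    and diff: "\<And>f x. f \<in> S \<Longrightarrow> f differentiable (at x)"
    and decay: "\<And>f k. f \<in> S \<Longrightarrow> \<exists>C. \<forall>x. (1 + norm x) ^ k * cmod (f x) \<le> C"
    and deriv: "\<And>f b. f \<in> S \<Longrightarrow> b \<in> Basis \<Longrightarrow> (\<lambda>x. frechet_derivative f (at x) b) \<in> S"
  shows "f \<in> Schwartz"
proof -
  have "iter_deriv bs f \<in> S" if "set bs \<subseteq> Basis" for bs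
    using that by (induction bs) (auto intro: assms)
  then show ?thesis unfolding Schwartz_def using diff decay by blast
qed

lemma Schwartz_differentiable: "f \<in> Schwartz \<Longrightarrow> f differentiable (at x)"
  unfolding Schwartz_def by (auto dest!: spec[of _ "[]"])

lemma Schwartz_decay: "f \<in> Schwartz \<Longrightarrow> \<exists>C. \<forall>x. (1 + norm x) ^ k * cmod (f x) \<le> C"
  unfolding Schwartz_def by (auto dest!: spec[of _ "[]"])

lemma Schwartz_deriv:
  assumes "f \<in> Schwartz" "b \<in> Basis" shows "(\<lambda>x. frechet_derivative f (at x) b) \<in> Schwartz"
proof -
  have "iter_deriv bs (\<lambda>x. frechet_derivative f (at x) b) = iter_deriv (bs @ [b]) f" for bs
    by (induction bs) auto
  then show ?thesis using assms unfolding Schwartz_def by simp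
qed

lemma Schwartz_continuous:
  assumes "f \<in> Schwartz" shows "continuous_on UNIV f"
  using Schwartz_differentiable[OF assms]
  by (intro continuous_at_imp_continuous_on ballI differentiable_imp_continuous_within)

lemma Schwartz_measurable [measurable_dest]: "f \<in> Schwartz \<Longrightarrow> f \<in> borel_measurable borel"
  by (rule borel_measurable_continuous_onI[OF Schwartz_continuous])

text \<open>What the second factor of a convolution must satisfy for the result to be as good as the first factor.\<close>

definition rapidly_decaying :: "('a::euclidean_space \<Rightarrow> complex) set" where
  "rapidly_decaying = {\<rho>. \<rho> \<in> borel_measurable borel \<and> (\<forall>k. integrable lborel (\<lambda>Y. (1 + norm Y) ^ k * cmod (\<rho> Y)))}"

lemma rapidly_decayingI:
  fixes \<rho> :: "'a::euclidean_space \<Rightarrow> complex"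
  assumes [measurable]: "\<rho> \<in> borel_measurable borel" and dec: "\<And>k. \<exists>C. \<forall>x::'a. (1 + norm x) ^ k * cmod (\<rho> x) \<le> C"
  shows "\<rho> \<in> rapidly_decaying"
proof -
  have "integrable lborel (\<lambda>Y. (1 + norm Y) ^ k * cmod (\<rho> Y))" for k
  proof -
    obtain C where C: "\<And>x. (1 + norm x) ^ (k + 2 * DIM('a)) * cmod (\<rho> x) \<le> C" using dec by blast
    show ?thesis
    proof (rule Bochner_Integration.integrable_bound)
      show "integrable lborel (\<lambda>x::'a. C * (1 / (1 + norm x) ^ (2 * DIM('a))))"
        by (intro integrable_mult_right integrable_polynomial_decay)
      show "AE x in lborel. norm ((1 + norm x) ^ k * cmod (\<rho> x)) \<le> norm (C * (1 / (1 + norm x) ^ (2 * DIM('a))))"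
      proof (rule AE_I2)
        fix x :: 'a
        have p: "0 < (1 + norm x) ^ (2 * DIM('a))" by (simp add: add_pos_nonneg)
        have "(1 + norm x) ^ k * cmod (\<rho> x) \<le> C / (1 + norm x) ^ (2 * DIM('a))"
          using C[of x] p by (simp add: pos_le_divide_eq power_add mult_ac)
        also have "\<dots> \<le> norm (C * (1 / (1 + norm x) ^ (2 * DIM('a))))" unfolding real_norm_def by (simp only: times_divide_eq_right mult_1_right abs_ge_self)
        finally show "norm ((1 + norm x) ^ k * cmod (\<rho> x)) \<le> norm (C * (1 / (1 + norm x) ^ (2 * DIM('a))))"
          by (simp add: abs_mult)
      qed
    qed measurable
  qed
  then show ?thesis by (simp add: rapidly_decaying_def)
qed

lemma Schwartz_rapidly_decaying: "f \<in> Schwartz \<Longrightarrow> f \<in> rapidly_decaying"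
  by (intro rapidly_decayingI Schwartz_decay Schwartz_measurable)

lemma bounded_support_rapidly_decaying:
  fixes \<rho> :: "'a::euclidean_space \<Rightarrow> complex"
  assumes "\<rho> \<in> borel_measurable borel" "\<And>x. cmod (\<rho> x) \<le> B" "\<And>x. \<rho> x \<noteq> 0 \<Longrightarrow> norm x \<le> R"
  shows "\<rho> \<in> rapidly_decaying"
proof (rule rapidly_decayingI)
  fix k
  have "(1 + norm x) ^ k * cmod (\<rho> x) \<le> (1 + \<bar>R\<bar>) ^ k * \<bar>B\<bar>" for x
  proof (cases "\<rho> x = 0")
    case False
    then show ?thesis
      using assms(2,3)[of x] by (intro mult_mono power_mono) auto
  qed simp
  then show "\<exists>C. \<forall>x. (1 + norm x) ^ k * cmod (\<rho> x) \<le> C" by blast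
qed fact

lemma rapidly_decaying_mult:
  fixes \<rho> :: "'a::euclidean_space \<Rightarrow> complex"
  assumes \<rho>: "\<rho> \<in> rapidly_decaying" and q[measurable]: "q \<in> borel_measurable borel" and le: "\<And>Y. cmod (q Y) \<le> C * (1 + norm Y) ^ m"
  shows "(\<lambda>Y. q Y * \<rho> Y) \<in> rapidly_decaying"
proof -
  have [measurable]: "\<rho> \<in> borel_measurable borel" using \<rho> by (simp add: rapidly_decaying_def)
  have "integrable lborel (\<lambda>Y. (1 + norm Y) ^ k * cmod (q Y * \<rho> Y))" for k
  proof (rule Bochner_Integration.integrable_bound)
    show "integrable lborel (\<lambda>Y. C * ((1 + norm Y) ^ (k + m) * cmod (\<rho> Y)))"
      using \<rho> by (intro integrable_mult_right) (simp add: rapidly_decaying_def)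
    show "AE Y in lborel. norm ((1 + norm Y) ^ k * cmod (q Y * \<rho> Y)) \<le> norm (C * ((1 + norm Y) ^ (k + m) * cmod (\<rho> Y)))"
    proof (rule AE_I2)
      fix Y
      have e: "norm ((1 + norm Y) ^ k * cmod (q Y * \<rho> Y)) = (1 + norm Y) ^ k * (cmod (q Y) * cmod (\<rho> Y))"
        by (simp add: norm_mult abs_mult)
      have "(1 + norm Y) ^ k * (cmod (q Y) * cmod (\<rho> Y)) \<le> (1 + norm Y) ^ k * ((C * (1 + norm Y) ^ m) * cmod (\<rho> Y))"
        by (intro mult_left_mono mult_right_mono le) auto
      also have "\<dots> = C * ((1 + norm Y) ^ (k + m) * cmod (\<rho> Y))" by (simp add: power_add mult_ac)
      also have "\<dots> \<le> norm (C * ((1 + norm Y) ^ (k + m) * cmod (\<rho> Y)))" unfolding real_norm_def by (rule abs_ge_self)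
      finally show "norm ((1 + norm Y) ^ k * cmod (q Y * \<rho> Y)) \<le> norm (C * ((1 + norm Y) ^ (k + m) * cmod (\<rho> Y)))"
        unfolding e .
    qed
  qed measurable
  then show ?thesis by (simp add: rapidly_decaying_def)
qed

text \<open>Dominated convergence for the difference quotient, which the mean value theorem bounds by \<open>L\<close>.\<close>

lemma has_derivative_integral:
  fixes k :: "'a::euclidean_space \<Rightarrow> 'b::euclidean_space \<Rightarrow> complex"
  assumes d: "\<And>X Y. ((\<lambda>X. k X Y) has_derivative D X Y) (at X)"
    and L: "\<And>X Y h. cmod (D X Y h) \<le> L Y * norm h" and Li: "integrable lborel L" and L0: "\<And>Y. 0 \<le> L Y"
    and ki: "\<And>X. integrable lborel (k X)" and Dm: "\<And>X h. (\<lambda>Y. D X Y h) \<in> borel_measurable lborel"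
  shows "((\<lambda>X. LINT Y|lborel. k X Y) has_derivative (\<lambda>h. LINT Y|lborel. D X Y h)) (at X)"
proof -
  have lin: "bounded_linear (D X Y)" for X Y using d by (rule has_derivative_bounded_linear)
  have Di: "integrable lborel (\<lambda>Y. D X Y h)" for X h
  proof (rule Bochner_Integration.integrable_bound)
    show "integrable lborel (\<lambda>Y. L Y * norm h)" using Li by simp
    show "AE Y in lborel. norm (D X Y h) \<le> norm (L Y * norm h)"
      using L[of X _ h] by (intro AE_I2) (metis abs_ge_self order.trans real_norm_def)
  qed (rule Dm)
  have bl: "bounded_linear (\<lambda>h. LINT Y|lborel. D X Y h)"
  proof (rule bounded_linear_intro)
    show "(LINT Y|lborel. D X Y (h + h')) = (LINT Y|lborel. D X Y h) + (LINT Y|lborel. D X Y h')" for h h'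
      using Di by (simp add: bounded_linear.linear[OF lin] linear_add)
    show "(LINT Y|lborel. D X Y (r *\<^sub>R h)) = r *\<^sub>R (LINT Y|lborel. D X Y h)" for r h
      by (simp add: bounded_linear.linear[OF lin] linear_cmul)
    show "norm (LINT Y|lborel. D X Y h) \<le> norm h * (LINT Y|lborel. L Y)" for h
    proof -
      have "norm (LINT Y|lborel. D X Y h) \<le> (LINT Y|lborel. norm (D X Y h))" by (rule integral_norm_bound)
      also have "\<dots> \<le> (LINT Y|lborel. L Y * norm h)" using Di Li L by (intro integral_mono) auto
      finally show ?thesis by (simp add: mult.commute)
    qed
  qed
  have lip: "cmod (k X' Y - k X Y) \<le> L Y * norm (X' - X)" for X' Y
  proof (rule differentiable_bound[of UNIV "\<lambda>X. k X Y" "\<lambda>X. D X Y"])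
    show "onorm (D X Y) \<le> L Y" for X using L L0 by (intro onorm_bound) auto
  qed (use d in \<open>auto intro: has_derivative_at_withinI\<close>)
  show ?thesis
    unfolding has_derivative_at_within
  proof (intro conjI bl)
    show "((\<lambda>y. ((LINT Y|lborel. k y Y) - (LINT Y|lborel. k X Y) - (LINT Y|lborel. D X Y (y - X))) /\<^sub>R norm (y - X)) \<longlongrightarrow> 0) (at X)"
      unfolding tendsto_at_iff_sequentially comp_def
    proof (intro allI impI)
      fix S assume S: "\<forall>i. S i \<in> UNIV - {X}" "S \<longlonglongrightarrow> X"
      have eq: "((LINT Y|lborel. k (S i) Y) - (LINT Y|lborel. k X Y) - (LINT Y|lborel. D X Y (S i - X))) /\<^sub>R norm (S i - X)
        = (LINT Y|lborel. (k (S i) Y - k X Y - D X Y (S i - X)) /\<^sub>R norm (S i - X))" for i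
        using ki Di by simp
      have "(\<lambda>i. LINT Y|lborel. (k (S i) Y - k X Y - D X Y (S i - X)) /\<^sub>R norm (S i - X)) \<longlonglongrightarrow> (LINT Y|(lborel::'b measure). 0)"
      proof (rule integral_dominated_convergence)
        show "integrable lborel (\<lambda>Y. 2 * L Y)" using Li by simp
        show "(\<lambda>Y. (k (S i) Y - k X Y - D X Y (S i - X)) /\<^sub>R norm (S i - X)) \<in> borel_measurable lborel" for i
          using ki[of "S i"] ki[of X] Dm[of X "S i - X"] by measurable
        show "AE Y in lborel. (\<lambda>i. (k (S i) Y - k X Y - D X Y (S i - X)) /\<^sub>R norm (S i - X)) \<longlonglongrightarrow> 0"
        proof (rule AE_I2)
          fix Y
          have "((\<lambda>y. ((k y Y - k X Y) - D X Y (y - X)) /\<^sub>R norm (y - X)) \<longlongrightarrow> 0) (at X)"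
            using d[of Y X] unfolding has_derivative_at_within by simp
          then show "(\<lambda>i. (k (S i) Y - k X Y - D X Y (S i - X)) /\<^sub>R norm (S i - X)) \<longlonglongrightarrow> 0"
            using S unfolding tendsto_at_iff_sequentially comp_def by blast
        qed
        show "AE Y in lborel. norm ((k (S i) Y - k X Y - D X Y (S i - X)) /\<^sub>R norm (S i - X)) \<le> 2 * L Y" for i
        proof (rule AE_I2)
          fix Y
          have p: "norm (S i - X) > 0" using S by simp
          have div: "norm (v /\<^sub>R n) \<le> l" if "n > 0" "norm v \<le> l * n" for v :: complex and n l :: real
          proof -
            have "norm (v /\<^sub>R n) = norm v / n" using that by (simp add: divide_inverse mult.commute)
            then show ?thesis using that by (simp add: pos_divide_le_eq)
          qed
          have "cmod (k (S i) Y - k X Y - D X Y (S i - X)) \<le> cmod (k (S i) Y - k X Y) + cmod (D X Y (S i - X))"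
            by (rule norm_triangle_ineq4)
          also have "\<dots> \<le> 2 * L Y * norm (S i - X)" using lip[of "S i" Y] L[of X Y "S i - X"] by simp
          finally show "norm ((k (S i) Y - k X Y - D X Y (S i - X)) /\<^sub>R norm (S i - X)) \<le> 2 * L Y"
            using div[OF p] by blast
        qed
      qed simp
      then show "(\<lambda>i. ((LINT Y|lborel. k (S i) Y) - (LINT Y|lborel. k X Y) - (LINT Y|lborel. D X Y (S i - X))) /\<^sub>R norm (S i - X)) \<longlonglongrightarrow> 0"
        unfolding eq by simp
    qed
  qed
qed

lemma abs_sympl_le: "\<bar>sympl X Y\<bar> \<le> norm X * norm Y"
  unfolding sympl_eq_inner using Cauchy_Schwarz_ineq2[of "sympl_J X" Y] by simp

lemma has_derivative_sympl_left: "((\<lambda>X. sympl X Y) has_derivative (\<lambda>h. sympl h Y)) (at X)"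
proof -
  have "sympl h Y = - (sympl_J Y \<bullet> h)" for h using sympl_swap[of h Y] by (simp add: sympl_eq_inner)
  then show ?thesis by (auto intro!: derivative_eq_intros)
qed

lemma has_derivative_cis_sympl:
  "((\<lambda>X. cis (c * sympl X Y)) has_derivative (\<lambda>h. cis (c * sympl X Y) * (\<i> * of_real (c * sympl h Y)))) (at X)"
proof -
  have "((\<lambda>X. \<i> * of_real (c * sympl X Y)) has_derivative (\<lambda>h. \<i> * of_real (c * sympl h Y))) (at X)"
    by (intro has_derivative_mult_right has_derivative_of_real has_derivative_sympl_left)
  from has_derivative_compose[OF this DERIV_exp[THEN has_field_derivative_imp_has_derivative]]
  show ?thesis by (simp add: cis_conv_exp)
qed

lemma tconv_integrable:
  assumes [measurable]: "\<phi> \<in> borel_measurable borel" and b: "\<And>x. cmod (\<phi> x) \<le> C"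
    and \<rho>: "\<rho> \<in> rapidly_decaying"
  shows "integrable lborel (\<lambda>Y. \<phi> (X - Y) * \<rho> Y * cis (c * sympl X Y))"
proof (rule Bochner_Integration.integrable_bound)
  have [measurable]: "\<rho> \<in> borel_measurable borel" using \<rho> by (simp add: rapidly_decaying_def)
  have "integrable lborel (\<lambda>Y. (1 + norm Y) ^ 0 * cmod (\<rho> Y))" using \<rho> unfolding rapidly_decaying_def by blast
  then show "integrable lborel (\<lambda>Y. C * cmod (\<rho> Y))" by simp
  show "AE Y in lborel. norm (\<phi> (X - Y) * \<rho> Y * cis (c * sympl X Y)) \<le> norm (C * cmod (\<rho> Y))"
    using mult_right_mono[OF b norm_ge_zero[of "\<rho> _"]] order_trans[OF norm_ge_zero b]
    by (intro AE_I2) (simp add: norm_mult abs_mult)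
  show "(\<lambda>Y. \<phi> (X - Y) * \<rho> Y * cis (c * sympl X Y)) \<in> borel_measurable lborel" by simp
qed

lemma Schwartz_bounded: 
  assumes "\<phi> \<in> Schwartz" obtains C where "0 \<le> C" "\<And>x. cmod (\<phi> x) \<le> C"
proof -
  obtain C where "\<And>x. (1 + norm x) ^ 0 * cmod (\<phi> x) \<le> C" using Schwartz_decay[OF assms] by blast
  then have "\<And>x. cmod (\<phi> x) \<le> C" by simp
  then show ?thesis using that order_trans[OF norm_ge_zero] by blast
qed

lemma tconv_decay:
  assumes \<phi>: "\<phi> \<in> Schwartz" and \<rho>: "\<rho> \<in> rapidly_decaying"
  shows "\<exists>C. \<forall>x. (1 + norm x) ^ k * cmod (tconv c \<phi> \<rho> x) \<le> C"
proof -
  have [measurable]: "\<rho> \<in> borel_measurable borel" using \<rho> by (simp add: rapidly_decaying_def)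
  obtain C where C: "\<And>x. (1 + norm x) ^ k * cmod (\<phi> x) \<le> C" using Schwartz_decay[OF \<phi>] by blast
  obtain C0 where C0: "0 \<le> C0" "\<And>x. cmod (\<phi> x) \<le> C0" using Schwartz_bounded[OF \<phi>] by blast
  have "(1 + norm x) ^ k * cmod (tconv c \<phi> \<rho> x) \<le> (LINT Y|lborel. C * ((1 + norm Y) ^ k * cmod (\<rho> Y)))" for x
  proof -
    have i: "integrable lborel (\<lambda>Y. \<phi> (x - Y) * \<rho> Y * cis (c * sympl x Y))"
      by (rule tconv_integrable[OF Schwartz_measurable[OF \<phi>] C0(2) \<rho>])
    have "(1 + norm x) ^ k * cmod (tconv c \<phi> \<rho> x) \<le> (1 + norm x) ^ k * (LINT Y|lborel. cmod (\<phi> (x - Y) * \<rho> Y * cis (c * sympl x Y)))"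
      unfolding tconv_def by (intro mult_left_mono integral_norm_bound) auto
    also have "\<dots> = (LINT Y|lborel. (1 + norm x) ^ k * cmod (\<phi> (x - Y) * \<rho> Y * cis (c * sympl x Y)))" by simp
    also have "\<dots> \<le> (LINT Y|lborel. C * ((1 + norm Y) ^ k * cmod (\<rho> Y)))"
    proof (rule integral_mono)
      show "integrable lborel (\<lambda>Y. (1 + norm x) ^ k * cmod (\<phi> (x - Y) * \<rho> Y * cis (c * sympl x Y)))"
        using i by (intro integrable_mult_right integrable_norm)
      show "integrable lborel (\<lambda>Y. C * ((1 + norm Y) ^ k * cmod (\<rho> Y)))"
        using \<rho> by (intro integrable_mult_right) (simp add: rapidly_decaying_def)
      fix Y
      have "1 + norm x \<le> (1 + norm (x - Y)) * (1 + norm Y)"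
      proof -
        have "norm x \<le> norm (x - Y) + norm Y" using norm_triangle_ineq[of "x - Y" Y] by simp
        moreover have "0 \<le> norm (x - Y) * norm Y" by simp
        ultimately show ?thesis unfolding distrib_left distrib_right mult_1_left mult_1_right by linarith
      qed
      then have "(1 + norm x) ^ k \<le> ((1 + norm (x - Y)) * (1 + norm Y)) ^ k" by (intro power_mono) auto
      then have "(1 + norm x) ^ k * (cmod (\<phi> (x - Y)) * cmod (\<rho> Y)) \<le> ((1 + norm (x - Y)) * (1 + norm Y)) ^ k * (cmod (\<phi> (x - Y)) * cmod (\<rho> Y))"
        by (intro mult_right_mono) auto
      also have "\<dots> = ((1 + norm (x - Y)) ^ k * cmod (\<phi> (x - Y))) * ((1 + norm Y) ^ k * cmod (\<rho> Y))"
        by (simp add: power_mult_distrib mult_ac)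
      also have "\<dots> \<le> C * ((1 + norm Y) ^ k * cmod (\<rho> Y))" by (intro mult_right_mono C) auto
      finally show "(1 + norm x) ^ k * cmod (\<phi> (x - Y) * \<rho> Y * cis (c * sympl x Y)) \<le> C * ((1 + norm Y) ^ k * cmod (\<rho> Y))"
        by (simp add: norm_mult)
    qed
    finally show ?thesis .
  qed
  then show ?thesis by blast
qed

lemma rapidly_decaying_sympl:
  assumes \<rho>: "\<rho> \<in> rapidly_decaying"
  shows "(\<lambda>Y. (\<i> * of_real (c * sympl b Y)) * \<rho> Y) \<in> rapidly_decaying"
proof (rule rapidly_decaying_mult[OF \<rho>, where C = "\<bar>c\<bar> * norm b" and m = 1])
  fix Y
  have "\<bar>c\<bar> * \<bar>sympl b Y\<bar> \<le> \<bar>c\<bar> * (norm b * (1 + norm Y))"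
    using abs_sympl_le[of b Y] by (intro mult_left_mono) (auto simp: algebra_simps intro: add_increasing)
  then show "cmod (\<i> * of_real (c * sympl b Y)) \<le> \<bar>c\<bar> * norm b * (1 + norm Y) ^ 1"
    by (simp add: norm_mult abs_mult mult.assoc)
qed measurable

text \<open>Besides the derivative of \<open>\<phi>\<close> the product rule produces the derivative of the phase, a linear function of \<open>Y\<close>
that the rapidly decaying factor absorbs.\<close>

lemma tconv_has_derivative:
  fixes \<phi> \<rho> :: "'d::finite phase_space \<Rightarrow> complex"
  assumes \<phi>: "\<phi> \<in> Schwartz" and \<rho>: "\<rho> \<in> rapidly_decaying"
  obtains D where "(tconv c \<phi> \<rho> has_derivative D) (at X)"
    "\<And>b. b \<in> Basis \<Longrightarrow> D b = tconv c (\<lambda>x. frechet_derivative \<phi> (at x) b) \<rho> X + tconv c \<phi> (\<lambda>Y. (\<i> * of_real (c * sympl b Y)) * \<rho> Y) X"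
proof -
  have [measurable]: "\<rho> \<in> borel_measurable borel" using \<rho> by (simp add: rapidly_decaying_def)
  have \<phi>m[measurable]: "\<phi> \<in> borel_measurable borel" using \<phi> by (rule Schwartz_measurable)
  define \<phi>' where "\<phi>' x h = frechet_derivative \<phi> (at x) h" for x h
  have \<phi>'d: "(\<phi> has_derivative \<phi>' x) (at x)" for x
    unfolding \<phi>'_def using Schwartz_differentiable[OF \<phi>] frechet_derivative_works by blast
  have lin: "linear (\<phi>' x)" for x using has_derivative_linear[OF \<phi>'d] .
  have \<phi>'S: "(\<lambda>x. \<phi>' x b) \<in> Schwartz" if "b \<in> Basis" for b
    unfolding \<phi>'_def by (rule Schwartz_deriv[OF \<phi> that])
  have expand: "\<phi>' x h = (\<Sum>b\<in>Basis. (h \<bullet> b) *\<^sub>R \<phi>' x b)" for x h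
    by (subst euclidean_representation[of h, symmetric]) (simp add: linear_sum[OF lin] linear_cmul[OF lin])
  have "\<exists>C. \<forall>b\<in>Basis. 0 \<le> C b \<and> (\<forall>x. cmod (\<phi>' x b) \<le> C b)"
    using Schwartz_bounded[OF \<phi>'S] by (intro bchoice ballI) metis
  then obtain Cb where Cb: "\<And>b. b \<in> Basis \<Longrightarrow> 0 \<le> Cb b" "\<And>b x. b \<in> Basis \<Longrightarrow> cmod (\<phi>' x b) \<le> Cb b" by blast
  define C1 where "C1 = (\<Sum>b\<in>Basis. Cb b)"
  have C1: "0 \<le> C1" unfolding C1_def using Cb by (intro sum_nonneg) auto
  have \<phi>'b: "cmod (\<phi>' x h) \<le> C1 * norm h" for x h
  proof -
    have "cmod (\<phi>' x h) \<le> (\<Sum>b\<in>Basis. \<bar>h \<bullet> b\<bar> * cmod (\<phi>' x b))"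
      unfolding expand[of x h] by (rule order.trans[OF norm_sum]) simp
    also have "\<dots> \<le> (\<Sum>b\<in>Basis. norm h * Cb b)"
      using Cb Basis_le_norm by (intro sum_mono mult_mono) auto
    finally show ?thesis by (simp add: C1_def sum_distrib_left mult.commute)
  qed
  obtain C0 where C0: "0 \<le> C0" "\<And>x. cmod (\<phi> x) \<le> C0" using Schwartz_bounded[OF \<phi>] by blast
  define D where "D X Y h = \<phi>' (X - Y) h * \<rho> Y * cis (c * sympl X Y) + \<phi> (X - Y) * ((\<i> * of_real (c * sympl h Y)) * \<rho> Y) * cis (c * sympl X Y)" for X Y h
  have "((\<lambda>X. LINT Y|lborel. \<phi> (X - Y) * \<rho> Y * cis (c * sympl X Y)) has_derivative (\<lambda>h. LINT Y|lborel. D X Y h)) (at X)"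
  proof (rule has_derivative_integral[where L = "\<lambda>Y. C1 * cmod (\<rho> Y) + C0 * \<bar>c\<bar> * (norm Y * cmod (\<rho> Y))"])
    fix X Y :: "'d phase_space"
    have "((\<lambda>X. \<phi> (X - Y)) has_derivative (\<lambda>h. \<phi>' (X - Y) h)) (at X)"
      by (rule has_derivative_compose[OF _ \<phi>'d, of "\<lambda>X. X - Y" "\<lambda>h. h" X UNIV]) (auto intro!: derivative_eq_intros)
    then have "((\<lambda>X. \<phi> (X - Y) * \<rho> Y) has_derivative (\<lambda>h. \<phi>' (X - Y) h * \<rho> Y)) (at X)"
      by (rule has_derivative_mult_left)
    from has_derivative_mult[OF this has_derivative_cis_sympl]
    show "((\<lambda>X. \<phi> (X - Y) * \<rho> Y * cis (c * sympl X Y)) has_derivative D X Y) (at X)"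
      by (rule has_derivative_eq_rhs) (simp add: D_def fun_eq_iff algebra_simps)
  next
    fix X Y h :: "'d phase_space"
    have 1: "cmod (\<phi>' (X - Y) h * \<rho> Y * cis (c * sympl X Y)) \<le> C1 * norm h * cmod (\<rho> Y)"
      by (simp add: norm_mult mult_right_mono \<phi>'b)
    have "cmod (\<phi> (X - Y)) * (\<bar>c\<bar> * \<bar>sympl h Y\<bar> * cmod (\<rho> Y)) \<le> C0 * (\<bar>c\<bar> * (norm h * norm Y) * cmod (\<rho> Y))"
      by (intro mult_mono C0 mult_left_mono mult_right_mono abs_sympl_le) (auto simp: C0)
    then have 2: "cmod (\<phi> (X - Y) * ((\<i> * of_real (c * sympl h Y)) * \<rho> Y) * cis (c * sympl X Y)) \<le> C0 * (\<bar>c\<bar> * (norm h * norm Y) * cmod (\<rho> Y))"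
      by (simp add: norm_mult abs_mult)
    show "cmod (D X Y h) \<le> (C1 * cmod (\<rho> Y) + C0 * \<bar>c\<bar> * (norm Y * cmod (\<rho> Y))) * norm h"
      unfolding D_def using norm_triangle_le[OF add_mono[OF 1 2]] by (simp add: algebra_simps)
  next
    have r1: "integrable lborel (\<lambda>Y. cmod (\<rho> Y))"
      using \<rho> unfolding rapidly_decaying_def by (auto dest!: spec[of _ 0])
    have "integrable lborel (\<lambda>Y. (1 + norm Y) ^ 1 * cmod (\<rho> Y))" using \<rho> unfolding rapidly_decaying_def by blast
    then have "integrable lborel (\<lambda>Y. norm Y * cmod (\<rho> Y))"
      by (rule Bochner_Integration.integrable_bound) (auto intro!: mult_right_mono simp: abs_mult)
    then show "integrable lborel (\<lambda>Y. C1 * cmod (\<rho> Y) + C0 * \<bar>c\<bar> * (norm Y * cmod (\<rho> Y)))" using r1 by simp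
  next
    show "0 \<le> C1 * cmod (\<rho> Y) + C0 * \<bar>c\<bar> * (norm Y * cmod (\<rho> Y))" for Y using C1 C0 by simp
    show "integrable lborel (\<lambda>Y. \<phi> (X - Y) * \<rho> Y * cis (c * sympl X Y))" for X
      by (rule tconv_integrable[OF \<phi>m C0(2) \<rho>])
    have [measurable]: "(\<lambda>x. \<phi>' x h) \<in> borel_measurable borel" for h
      unfolding expand[of _ h] using \<phi>'S by (intro borel_measurable_sum borel_measurable_scaleR borel_measurable_const Schwartz_measurable)
    show "(\<lambda>Y. D X Y h) \<in> borel_measurable lborel" for X h
      unfolding D_def by simp
  qed
  moreover have "(LINT Y|lborel. D X Y b) = tconv c (\<lambda>x. frechet_derivative \<phi> (at x) b) \<rho> X + tconv c \<phi> (\<lambda>Y. (\<i> * of_real (c * sympl b Y)) * \<rho> Y) X"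
    if "b \<in> Basis" for b
    unfolding D_def tconv_def \<phi>'_def[symmetric]
  proof (rule Bochner_Integration.integral_add)
    show "integrable lborel (\<lambda>Y. \<phi>' (X - Y) b * \<rho> Y * cis (c * sympl X Y))"
      by (rule tconv_integrable[OF Schwartz_measurable[OF \<phi>'S[OF that]] Cb(2)[OF that] \<rho>])
    from tconv_integrable[OF \<phi>m C0(2) rapidly_decaying_sympl[OF \<rho>]]
    show "integrable lborel (\<lambda>Y. \<phi> (X - Y) * (\<i> * of_real (c * sympl b Y) * \<rho> Y) * cis (c * sympl X Y))" .
  qed
  ultimately show ?thesis using that unfolding tconv_def[abs_def] by blast
qed

text \<open>By \<open>tconv_has_derivative\<close> this set is closed under partial derivatives.\<close>

inductive_set tconv_sums :: "real \<Rightarrow> ('d::finite phase_space \<Rightarrow> complex) set" for c where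
  base: "\<phi> \<in> Schwartz \<Longrightarrow> \<rho> \<in> rapidly_decaying \<Longrightarrow> tconv c \<phi> \<rho> \<in> tconv_sums c"
| add: "f \<in> tconv_sums c \<Longrightarrow> g \<in> tconv_sums c \<Longrightarrow> (\<lambda>x. f x + g x) \<in> tconv_sums c"

lemma tconv_Schwartz:
  fixes \<phi> \<rho> :: "'d::finite phase_space \<Rightarrow> complex"
  assumes "\<phi> \<in> Schwartz" "\<rho> \<in> rapidly_decaying"
  shows "tconv c \<phi> \<rho> \<in> Schwartz"
proof (rule Schwartz_coinduct[where S = "tconv_sums c"])
  have key: "\<exists>D. (\<forall>x. (f has_derivative D x) (at x)) \<and> (\<forall>b\<in>Basis. (\<lambda>x. D x b) \<in> tconv_sums c)"
    if "f \<in> tconv_sums c" for f :: "'d phase_space \<Rightarrow> complex"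
    using that
  proof induction
    case (base \<phi> \<rho>)
    have [measurable]: "\<rho> \<in> borel_measurable borel" using base by (simp add: rapidly_decaying_def)
    let ?G = "\<lambda>b X. tconv c (\<lambda>x. frechet_derivative \<phi> (at x) b) \<rho> X + tconv c \<phi> (\<lambda>Y. (\<i> * of_real (c * sympl b Y)) * \<rho> Y) X"
    have "\<forall>X. \<exists>D. (tconv c \<phi> \<rho> has_derivative D) (at X) \<and> (\<forall>b\<in>Basis. D b = ?G b X)"
    proof
      fix X
      show "\<exists>D. (tconv c \<phi> \<rho> has_derivative D) (at X) \<and> (\<forall>b\<in>Basis. D b = ?G b X)"
        by (rule tconv_has_derivative[OF base, of c X]) blast
    qed
    from choice[OF this] obtain D where D: "\<And>X. (tconv c \<phi> \<rho> has_derivative D X) (at X)"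
      "\<And>X b. b \<in> Basis \<Longrightarrow> D X b = ?G b X" by blast
    have "(\<lambda>x. D x b) \<in> tconv_sums c" if "b \<in> Basis" for b
      unfolding D(2)[OF that] using that base by (intro tconv_sums.intros Schwartz_deriv rapidly_decaying_sympl)
    then show ?case using D(1) by blast
  next
    case (add f g)
    then obtain D E where "\<And>x. (f has_derivative D x) (at x)" "\<And>b. b\<in>Basis \<Longrightarrow> (\<lambda>x. D x b) \<in> tconv_sums c"
      "\<And>x. (g has_derivative E x) (at x)" "\<And>b. b\<in>Basis \<Longrightarrow> (\<lambda>x. E x b) \<in> tconv_sums c" by blast
    then show ?case
      by (intro exI[of _ "\<lambda>x h. D x h + E x h"]) (auto intro: has_derivative_add tconv_sums.add)
  qed
  show "tconv c \<phi> \<rho> \<in> tconv_sums c" using assms by (rule tconv_sums.base)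
  fix f :: "'d phase_space \<Rightarrow> complex" assume f: "f \<in> tconv_sums c"
  obtain D where D: "\<And>x. (f has_derivative D x) (at x)" "\<And>b. b\<in>Basis \<Longrightarrow> (\<lambda>x. D x b) \<in> tconv_sums c"
    using key[OF f] by blast
  show "f differentiable (at x)" for x using D(1) unfolding differentiable_def by blast
  show "(\<lambda>x. frechet_derivative f (at x) b) \<in> tconv_sums c" if "b \<in> Basis" for b
    using D(2)[OF that] frechet_derivative_at[OF D(1)] by simp
  show "\<exists>C. \<forall>x. (1 + norm x) ^ k * cmod (f x) \<le> C" for k
    using f
  proof induction
    case (base \<phi> \<rho>) then show ?case by (rule tconv_decay)
  next
    case (add f g)
    then obtain C C' where C: "\<And>x. (1 + norm x) ^ k * cmod (f x) \<le> C" "\<And>x. (1 + norm x) ^ k * cmod (g x) \<le> C'" by blast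
    have "(1 + norm x) ^ k * cmod (f x + g x) \<le> C + C'" for x
    proof -
      have "(1 + norm x) ^ k * cmod (f x + g x) \<le> (1 + norm x) ^ k * (cmod (f x) + cmod (g x))"
        by (intro mult_left_mono norm_triangle_ineq) auto
      then show ?thesis using C[of x] by (simp add: distrib_left)
    qed
    then show ?case by blast
  qed
qed

text \<open>Gaussians times polynomials, again a set closed under partial derivatives.\<close>

inductive_set gauss_polys :: "real \<Rightarrow> ('a::euclidean_space \<Rightarrow> complex) set" for s where
  base: "(\<lambda>x. of_real (exp (- s * (norm x)\<^sup>2))) \<in> gauss_polys s"
| coord: "f \<in> gauss_polys s \<Longrightarrow> (\<lambda>x. of_real (x \<bullet> v) * f x) \<in> gauss_polys s"
| scale: "f \<in> gauss_polys s \<Longrightarrow> (\<lambda>x. z * f x) \<in> gauss_polys s"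
| add: "f \<in> gauss_polys s \<Longrightarrow> g \<in> gauss_polys s \<Longrightarrow> (\<lambda>x. f x + g x) \<in> gauss_polys s"

lemma gauss_polys_Schwartz:
  fixes f :: "'a::euclidean_space \<Rightarrow> complex"
  assumes s: "0 < s" and "f \<in> gauss_polys s"
  shows "f \<in> Schwartz"
proof (rule Schwartz_coinduct[where S = "gauss_polys s"])
  have key: "\<exists>D. (\<forall>x. (f has_derivative D x) (at x)) \<and> (\<forall>b. (\<lambda>x. D x b) \<in> gauss_polys s)"
    if "f \<in> gauss_polys s" for f :: "'a \<Rightarrow> complex"
    using that
  proof induction
    case base
    define D :: "'a \<Rightarrow> 'a \<Rightarrow> complex" where "D x h = of_real (- 2 * s) * (of_real (x \<bullet> h) * of_real (exp (- s * (norm x)\<^sup>2)))" for x h :: 'a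
    have "((\<lambda>x. complex_of_real (exp (- s * (norm x)\<^sup>2))) has_derivative D x) (at x)" for x :: 'a
    proof -
      have "((\<lambda>x. exp (- s * (x \<bullet> x))) has_derivative (\<lambda>h. exp (- s * (x \<bullet> x)) * (- s * (x \<bullet> h + h \<bullet> x)))) (at x)"
        by (auto intro!: derivative_eq_intros simp: algebra_simps)
      then have "((\<lambda>x. complex_of_real (exp (- s * (x \<bullet> x)))) has_derivative (\<lambda>h. complex_of_real (exp (- s * (x \<bullet> x)) * (- s * (x \<bullet> h + h \<bullet> x))))) (at x)"
        by (rule has_derivative_of_real)
      then show ?thesis
        by (simp add: power2_norm_eq_inner D_def[abs_def] inner_commute algebra_simps)
    qed
    moreover have "(\<lambda>x. D x b) \<in> gauss_polys s" for b
      unfolding D_def by (intro gauss_polys.intros)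
    ultimately show ?case by blast
  next
    case (coord f v)
    then obtain D where D: "\<And>x. (f has_derivative D x) (at x)" "\<And>b. (\<lambda>x. D x b) \<in> gauss_polys s" by blast
    have "((\<lambda>x. of_real (x \<bullet> v) * f x) has_derivative (\<lambda>h. of_real (x \<bullet> v) * D x h + of_real (h \<bullet> v) * f x)) (at x)" for x
      by (intro has_derivative_mult has_derivative_of_real D) (auto intro!: derivative_eq_intros)
    then show ?case
      using coord D(2) by (intro exI[of _ "\<lambda>x h. of_real (x \<bullet> v) * D x h + of_real (h \<bullet> v) * f x"])
        (auto intro!: gauss_polys.intros)
  next
    case (scale f z)
    then obtain D where D: "\<And>x. (f has_derivative D x) (at x)" "\<And>b. (\<lambda>x. D x b) \<in> gauss_polys s" by blast
    then show ?case
      by (intro exI[of _ "\<lambda>x h. z * D x h"]) (auto intro!: gauss_polys.intros has_derivative_mult_right)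
  next
    case (add f g)
    then obtain D E where "\<And>x. (f has_derivative D x) (at x)" "\<And>b. (\<lambda>x. D x b) \<in> gauss_polys s"
      "\<And>x. (g has_derivative E x) (at x)" "\<And>b. (\<lambda>x. E x b) \<in> gauss_polys s" by blast
    then show ?case
      by (intro exI[of _ "\<lambda>x h. D x h + E x h"]) (auto intro: has_derivative_add gauss_polys.add)
  qed
  show "f \<in> gauss_polys s" by fact
  fix f :: "'a \<Rightarrow> complex" assume f: "f \<in> gauss_polys s"
  obtain D where D: "\<And>x. (f has_derivative D x) (at x)" "\<And>b. (\<lambda>x. D x b) \<in> gauss_polys s"
    using key[OF f] by blast
  show "f differentiable (at x)" for x using D(1) unfolding differentiable_def by blast
  show "(\<lambda>x. frechet_derivative f (at x) b) \<in> gauss_polys s" for b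
    using D(2)[of b] frechet_derivative_at[OF D(1)] by simp
  show "\<exists>C. \<forall>x. (1 + norm x) ^ k * cmod (f x) \<le> C" for k
    using f
  proof (induction arbitrary: k)
    case base
    have "(1 + norm x) ^ k * cmod (of_real (exp (- s * (norm x)\<^sup>2))) \<le> fact k * exp (1 + 1 / (4 * s))" for x :: 'a
    proof -
      have "(1 + norm x) ^ k \<le> fact k * exp (1 + norm x)"
        using power_div_fact_le_exp[of "1 + norm x" k] by (simp add: divide_le_eq mult.commute)
      then have "(1 + norm x) ^ k * exp (- s * (norm x)\<^sup>2) \<le> fact k * exp (1 + norm x) * exp (- s * (norm x)\<^sup>2)"
        by (intro mult_right_mono) auto
      also have "\<dots> = fact k * exp (1 + norm x + - s * (norm x)\<^sup>2)" by (simp only: exp_add mult.assoc)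
      also have "\<dots> \<le> fact k * exp (1 + 1 / (4 * s))"
      proof -
        have "0 \<le> s * (norm x - 1 / (2 * s))\<^sup>2" using s by simp
        also have "\<dots> = s * (norm x)\<^sup>2 - norm x + 1 / (4 * s)"
          using s by (simp add: power2_eq_square field_simps)
        finally show ?thesis by simp
      qed
      finally show ?thesis by simp
    qed
    then show ?case by blast
  next
    case (coord f v)
    obtain C where C: "\<And>x. (1 + norm x) ^ Suc k * cmod (f x) \<le> C" using coord.IH by blast
    have "(1 + norm x) ^ k * cmod (of_real (x \<bullet> v) * f x) \<le> norm v * C" for x
    proof -
      have "\<bar>x \<bullet> v\<bar> \<le> (1 + norm x) * norm v"
        using Cauchy_Schwarz_ineq2[of x v] by (simp add: distrib_right add_increasing)
      then have "(1 + norm x) ^ k * (\<bar>x \<bullet> v\<bar> * cmod (f x)) \<le> (1 + norm x) ^ k * (((1 + norm x) * norm v) * cmod (f x))"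
        by (intro mult_left_mono mult_right_mono) auto
      also have "\<dots> = norm v * ((1 + norm x) ^ Suc k * cmod (f x))" by (simp add: mult_ac)
      also have "\<dots> \<le> norm v * C" by (intro mult_left_mono C) auto
      finally show ?thesis by (simp add: norm_mult)
    qed
    then show ?case by blast
  next
    case (scale f z)
    obtain C where C: "\<And>x. (1 + norm x) ^ k * cmod (f x) \<le> C" using scale.IH by blast
    have "(1 + norm x) ^ k * cmod (z * f x) \<le> cmod z * C" for x
      using mult_left_mono[OF C[of x] norm_ge_zero[of z]] by (simp add: norm_mult mult_ac)
    then show ?case by blast
  next
    case (add f g)
    obtain C C' where C: "\<And>x. (1 + norm x) ^ k * cmod (f x) \<le> C" "\<And>x. (1 + norm x) ^ k * cmod (g x) \<le> C'"
      using add.IH by metis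
    have "(1 + norm x) ^ k * cmod (f x + g x) \<le> C + C'" for x
    proof -
      have "(1 + norm x) ^ k * cmod (f x + g x) \<le> (1 + norm x) ^ k * (cmod (f x) + cmod (g x))"
        by (intro mult_left_mono norm_triangle_ineq) auto
      then show ?thesis using C[of x] by (simp add: distrib_left)
    qed
    then show ?case by blast
  qed
qed

text \<open>Convolution with narrowing Gaussians. The bound by a single Gaussian, uniform in \<open>m\<close>, lies in every weighted Lebesgue space
and serves as the majorant in dominated convergence. It comes from \<open>|x| \<le> R + |Z|\<close>, which holds wherever the integrand is nonzero.\<close>

lemma gaussian_mollifier:
  fixes g :: "'d::finite phase_space \<Rightarrow> complex"
  assumes cont: "continuous_on UNIV g" and supp: "\<And>x. g x \<noteq> 0 \<Longrightarrow> norm x \<le> R"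
  obtains S C where "\<And>m. S m \<in> Schwartz" "\<And>x. (\<lambda>m::nat. S m x) \<longlonglongrightarrow> g x"
    "\<And>m x. cmod (S m x) \<le> C * exp (- (norm x)\<^sup>2 / 4)"
proof -
  let ?n = "DIM('d phase_space)"
  obtain B where B: "0 \<le> B" "\<And>x. cmod (g x) \<le> B" using continuous_bounded_support_bounded[OF cont supp] by blast
  have gm[measurable]: "g \<in> borel_measurable borel" using cont by (rule borel_measurable_continuous_onI)
  have gR: "g \<in> rapidly_decaying" by (rule bounded_support_rapidly_decaying[OF gm B(2) supp])
  define \<kappa> where "\<kappa> = 1 / sqrt pi ^ ?n"
  define \<phi> where "\<phi> m x = of_real (\<kappa> * (real m + 1) ^ ?n) * complex_of_real (exp (- (real m + 1)\<^sup>2 * (norm x)\<^sup>2))" for m :: nat and x :: "'d phase_space"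
  let ?e = "\<lambda>m::nat. 1 / (real m + 1)"
  let ?h = "\<lambda>m x Z. complex_of_real (\<kappa> * gauss Z) * g (x - ?e m *\<^sub>R Z)"
  have \<phi>S: "\<phi> m \<in> Schwartz" for m
    unfolding \<phi>_def[abs_def] by (rule gauss_polys_Schwartz[OF _ gauss_polys.scale[OF gauss_polys.base]]) simp
  define S where "S m = tconv 0 (\<phi> m) g" for m
  have Sx: "S m x = (LINT Z|lborel. ?h m x Z)" for m x
  proof -
    have [measurable]: "\<phi> m \<in> borel_measurable borel" using \<phi>S by (rule Schwartz_measurable)
    have m0: "real m + 1 > 0" by simp
    have "S m x = (LINT Y|lborel. \<phi> m (x - Y) * g Y)" by (simp add: S_def tconv_def)
    also have "\<dots> = (\<bar>- (1 / (real m + 1))\<bar> ^ ?n) *\<^sub>R (LINT Z|lborel. \<phi> m (x - (x + (- ?e m) *\<^sub>R Z)) * g (x + (- ?e m) *\<^sub>R Z))"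
      using m0 by (intro integral_lborel_affine) auto
    also have "\<dots> = (LINT Z|lborel. ?h m x Z)"
      unfolding scaleR_conv_of_real integral_mult_right_zero[symmetric]
    proof (intro Bochner_Integration.integral_cong refl)
      fix Z :: "'d phase_space"
      have "\<bar>- (1 / (real m + 1))\<bar> ^ ?n * (\<kappa> * (real m + 1) ^ ?n) = \<kappa>"
        using m0 by (simp add: power_divide del: DIM_prod)
      moreover have "(real m + 1)\<^sup>2 * (norm (?e m *\<^sub>R Z))\<^sup>2 = (norm Z)\<^sup>2"
        using m0 by (simp add: power_divide)
      moreover have "complex_of_real (\<bar>- (1 / (real m + 1))\<bar> ^ ?n) * \<phi> m (?e m *\<^sub>R Z)
          = of_real ((\<bar>- (1 / (real m + 1))\<bar> ^ ?n * (\<kappa> * (real m + 1) ^ ?n)) * exp (- ((real m + 1)\<^sup>2 * (norm (?e m *\<^sub>R Z))\<^sup>2)))"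
        by (simp only: \<phi>_def of_real_mult mult.assoc minus_mult_left)
      ultimately have "of_real (\<bar>- (1 / (real m + 1))\<bar> ^ ?n) * \<phi> m (?e m *\<^sub>R Z) = of_real (\<kappa> * gauss Z)"
        by (simp only: gauss_def)
      then show "of_real (\<bar>- (1 / (real m + 1))\<bar> ^ ?n) * (\<phi> m (x - (x + (- ?e m) *\<^sub>R Z)) * g (x + (- ?e m) *\<^sub>R Z))
         = ?h m x Z"
        by (simp add: mult.assoc[symmetric] del: DIM_prod)
    qed
    finally show ?thesis .
  qed
  have \<kappa>0: "0 < \<kappa>" by (simp add: \<kappa>_def)
  have lim: "(\<lambda>m. S m x) \<longlonglongrightarrow> g x" for x
  proof -
    have "(\<lambda>m. LINT Z|lborel. ?h m x Z) \<longlonglongrightarrow> (LINT Z|lborel. of_real (\<kappa> * gauss (Z :: 'd phase_space)) * g x)"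
    proof (rule integral_dominated_convergence)
      show "integrable lborel (\<lambda>Z::'d phase_space. \<kappa> * B * gauss Z)" by (intro integrable_mult_right integrable_gauss)
      show "AE Z in lborel. (\<lambda>m. ?h m x Z) \<longlonglongrightarrow> of_real (\<kappa> * gauss Z) * g x"
      proof (intro AE_I2 tendsto_mult tendsto_const)
        fix Z
        have "(\<lambda>m. 1 / (real m + 1)) \<longlonglongrightarrow> 0" using LIMSEQ_inverse_real_of_nat by (simp add: inverse_eq_divide add.commute)
        then have "(\<lambda>m. x - ?e m *\<^sub>R Z) \<longlonglongrightarrow> x - 0 *\<^sub>R Z" by (intro tendsto_intros)
        then have "(\<lambda>m. x - ?e m *\<^sub>R Z) \<longlonglongrightarrow> x" by simp
        then show "(\<lambda>m. g (x - ?e m *\<^sub>R Z)) \<longlonglongrightarrow> g x"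
          by (rule isCont_tendsto_compose[OF continuous_on_eq_continuous_at[OF open_UNIV, THEN iffD1, OF cont, rule_format, OF UNIV_I]])
      qed
      show "AE Z in lborel. norm (?h m x Z) \<le> \<kappa> * B * gauss Z" for m
      proof (rule AE_I2)
        fix Z
        have "(\<kappa> * gauss Z) * cmod (g (x - ?e m *\<^sub>R Z)) \<le> (\<kappa> * gauss Z) * B"
          using \<kappa>0 gauss_pos[of Z] by (intro mult_left_mono B) auto
        then show "norm (?h m x Z) \<le> \<kappa> * B * gauss Z"
          using \<kappa>0 gauss_pos[of Z] by (simp add: norm_mult abs_mult mult_ac)
      qed
    qed measurable
    moreover have "(LINT Z|lborel. of_real (\<kappa> * gauss (Z::'d phase_space)) * g x) = g x"
    proof -
      have "(LINT Z|lborel. complex_of_real (\<kappa> * gauss (Z::'d phase_space))) = of_real (\<kappa> * sqrt pi ^ ?n)"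
        unfolding integral_complex_of_real by (simp only: integral_mult_right_zero integral_gauss)
      also have "\<kappa> * sqrt pi ^ ?n = 1" by (simp add: \<kappa>_def del: DIM_prod)
      finally show ?thesis by (simp only: integral_mult_left_zero) simp
    qed
    ultimately show ?thesis unfolding Sx by (simp only:)
  qed
  define C where "C = \<kappa> * B * exp (R\<^sup>2 / 2) * (LINT Z|lborel. exp (- (1/2) * (norm (Z::'d phase_space))\<^sup>2))"
  have bound: "cmod (S m x) \<le> C * exp (- (norm x)\<^sup>2 / 4)" for m x
  proof -
    have pt: "cmod (?h m x Z) \<le> (\<kappa> * B * exp (R\<^sup>2 / 2) * exp (- (norm x)\<^sup>2 / 4)) * exp (- (1/2) * (norm Z)\<^sup>2)" for Z
    proof (cases "g (x - ?e m *\<^sub>R Z) = 0")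
      case True
      then show ?thesis using \<kappa>0 B by simp
    next
      case False
      have "norm x \<le> norm (x - ?e m *\<^sub>R Z) + norm (?e m *\<^sub>R Z)"
        using norm_triangle_ineq[of "x - ?e m *\<^sub>R Z" "?e m *\<^sub>R Z"] by simp
      also have "\<dots> \<le> R + norm Z"
        using supp[OF False] by (intro add_mono) (auto simp: divide_le_eq mult_left_le algebra_simps)
      finally have "(norm x)\<^sup>2 \<le> (R + norm Z)\<^sup>2" by (intro power_mono) auto
      also have "\<dots> \<le> 2 * R\<^sup>2 + 2 * (norm Z)\<^sup>2"
        using zero_le_power2[of "R - norm Z"] by (simp add: power2_sum power2_diff)
      finally have "- (norm Z)\<^sup>2 \<le> R\<^sup>2 / 2 + - (norm x)\<^sup>2 / 4 + - (1/2) * (norm Z)\<^sup>2" by simp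
      then have e: "gauss Z \<le> exp (R\<^sup>2 / 2) * exp (- (norm x)\<^sup>2 / 4) * exp (- (1/2) * (norm Z)\<^sup>2)"
        unfolding gauss_def exp_add[symmetric] by simp
      have "cmod (?h m x Z) = \<kappa> * (gauss Z * cmod (g (x - ?e m *\<^sub>R Z)))"
        using \<kappa>0 gauss_pos[of Z] by (simp add: norm_mult abs_mult)
      also have "\<dots> \<le> \<kappa> * ((exp (R\<^sup>2 / 2) * exp (- (norm x)\<^sup>2 / 4) * exp (- (1/2) * (norm Z)\<^sup>2)) * B)"
        using \<kappa>0 by (intro mult_left_mono mult_mono e B) auto
      finally show ?thesis by (simp add: mult_ac)
    qed
    have "cmod (S m x) \<le> (LINT Z|lborel. cmod (?h m x Z))"
      unfolding Sx by (rule integral_norm_bound)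
    also have "\<dots> \<le> (LINT (Z::'d phase_space)|lborel. (\<kappa> * B * exp (R\<^sup>2 / 2) * exp (- (norm x)\<^sup>2 / 4)) * exp (- (1/2) * (norm Z)\<^sup>2))"
    proof (rule integral_mono[OF _ _ pt])
      show i: "integrable lborel (\<lambda>Z::'d phase_space. (\<kappa> * B * exp (R\<^sup>2 / 2) * exp (- (norm x)\<^sup>2 / 4)) * exp (- (1/2) * (norm Z)\<^sup>2))"
        by (intro integrable_mult_right integrable_gaussian) simp
      show "integrable lborel (\<lambda>Z. cmod (?h m x Z))"
      proof (rule Bochner_Integration.integrable_bound[OF i])
        show "AE Z in lborel. norm (cmod (?h m x Z)) \<le> norm ((\<kappa> * B * exp (R\<^sup>2 / 2) * exp (- (norm x)\<^sup>2 / 4)) * exp (- (1/2) * (norm Z)\<^sup>2))"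
          using order.trans[OF pt abs_ge_self] by (intro AE_I2) simp
      qed measurable
    qed
    also have "\<dots> = C * exp (- (norm x)\<^sup>2 / 4)" by (simp add: C_def)
    finally show ?thesis .
  qed
  show ?thesis
    by (rule that[of S C]) (use lim bound \<phi>S gR in \<open>auto simp: S_def intro: tconv_Schwartz\<close>)
qed

section \<open>The estimate for twisted convolution\<close>

lemma Lebesgue_Borel_representative:
  fixes f :: "'a::euclidean_space \<Rightarrow> complex"
  assumes "f \<in> borel_measurable lebesgue"
  obtains F where "F \<in> borel_measurable borel" "AE x in lborel. f x = F x"
proof -
  have "(\<lambda>x. Re (f x)) \<in> borel_measurable lebesgue" "(\<lambda>x. Im (f x)) \<in> borel_measurable lebesgue" using assms by simp_all
  from this[THEN completion_ex_borel_measurable_real]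
  obtain u v where uv: "u \<in> borel_measurable lborel" "AE x in lborel. Re (f x) = u x"
    "v \<in> borel_measurable lborel" "AE x in lborel. Im (f x) = v x" by blast
  show ?thesis
  proof (rule that[of "\<lambda>x. Complex (u x) (v x)"])
    show "(\<lambda>x. Complex (u x) (v x)) \<in> borel_measurable borel" using uv by (subst borel_measurable_complex_iff) simp
    show "AE x in lborel. f x = Complex (u x) (v x)" using uv(2,4) by eventually_elim (simp add: complex_eq_iff)
  qed
qed

text \<open>The function may be changed on a null set so that the bound by the density holds everywhere.\<close>

lemma in_Lball_Borel_representative:
  fixes f :: "'a::euclidean_space \<Rightarrow> complex"
  assumes "in_Lball x r f" and r: "0 < r"
  obtains F u where "F \<in> borel_measurable borel" "AE X in lborel. f X = F X" "unit_density u" "\<And>X. cmod (F X) \<le> r * u X powr x"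
proof -
  obtain u0 where fm: "f \<in> borel_measurable lebesgue" and u0: "u0 \<in> borel_measurable lebesgue" "\<And>X. 0 \<le> u0 X"
    "(\<integral>\<^sup>+X. ennreal (u0 X) \<partial>lebesgue) \<le> 1" "AE X in lebesgue. cmod (f X) \<le> r * u0 X powr x"
    using assms(1) unfolding in_Lball_def by blast
  obtain F0 where F0[measurable]: "F0 \<in> borel_measurable borel" and fF: "AE X in lborel. f X = F0 X"
    using Lebesgue_Borel_representative[OF fm] by blast
  obtain u1 where u1: "u1 \<in> borel_measurable lborel" "AE X in lborel. u0 X = u1 X"
    using completion_ex_borel_measurable_real[OF u0(1)] by blast
  define u where "u X = max 0 (u1 X)" for X
  have um[measurable]: "u \<in> borel_measurable borel" using u1(1) unfolding u_def by simp
  have uu: "AE X in lborel. u0 X = u X" using u1(2)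
  proof eventually_elim
    case (elim X)
    then show ?case using u0(2)[of X] by (simp add: u_def max_def)
  qed
  define F where "F X = (if cmod (F0 X) \<le> r * u X powr x then F0 X else 0)" for X
  show ?thesis
  proof (rule that[of F u])
    show "F \<in> borel_measurable borel" unfolding F_def by measurable
    have "AE X in lborel. cmod (f X) \<le> r * u0 X powr x" using u0(4) by (simp add: AE_completion_iff)
    then show "AE X in lborel. f X = F X" using fF uu by eventually_elim (simp add: F_def)
    have upos: "0 \<le> u X" for X by (simp add: u_def)
    have "(\<integral>\<^sup>+X. ennreal (u X) \<partial>lborel) = (\<integral>\<^sup>+X. ennreal (u X) \<partial>lebesgue)" by (simp add: nn_integral_completion)
    also have "\<dots> = (\<integral>\<^sup>+X. ennreal (u0 X) \<partial>lebesgue)"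
      using uu by (intro nn_integral_cong_AE) (auto simp: AE_completion_iff elim: eventually_mono)
    finally show "unit_density u" using u0(3) um upos by (simp add: unit_density_def)
    show "cmod (F X) \<le> r * u X powr x" for X using r by (simp add: F_def upos)
  qed
qed

lemma integral_lebesgue_cong_Borel:
  fixes f g :: "'a::euclidean_space \<Rightarrow> complex"
  assumes "AE x in lborel. f x = g x" "g \<in> borel_measurable borel"
  shows "(LINT x|lebesgue. f x) = (LINT x|lborel. g x)" "integrable lebesgue f \<longleftrightarrow> integrable lborel g"
    "f \<in> borel_measurable lebesgue"
proof -
  have ae: "AE x in lebesgue. f x = g x" using assms(1) by (rule AE_completion)
  then have ae': "AE x in lebesgue. g x = f x" by (auto elim: eventually_mono)
  have gm: "g \<in> borel_measurable lebesgue" using assms(2) by (simp add: measurable_completion)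
  show fm: "f \<in> borel_measurable lebesgue" by (rule borel_measurable_AE[OF gm ae'])
  show "(LINT x|lebesgue. f x) = (LINT x|lborel. g x)"
    using integral_cong_AE[OF fm gm ae] integral_completion[of g lborel] assms(2) by simp
  show "integrable lebesgue f \<longleftrightarrow> integrable lborel g"
    using integrable_cong_AE[OF fm gm ae] integrable_completion[of g lborel] assms(2) by simp
qed

lemma exp_sympl_eq_cis: "exp (2 * \<i> * of_real (sympl X Y)) = cis (2 * sympl X Y)"
  by (simp add: cis_conv_exp mult_ac)

definition tc_const :: "'d::finite itself \<Rightarrow> complex" where
  "tc_const _ = of_real ((2 / pi) powr (real CARD('d) / 2))"

lemma twisted_conv_integrand_cong:
  fixes a b A B :: "'d::finite phase_space \<Rightarrow> complex"
  assumes "AE X in lborel. a X = A X" "AE X in lborel. b X = B X"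
  shows "AE Y in lborel. a (X - Y) * b Y * exp (2 * \<i> * of_real (sympl X Y)) = A (X - Y) * B Y * cis (2 * sympl X Y)"
  using AE_lborel_reflect[OF assms(1), of X] assms(2) by eventually_elim (simp add: exp_sympl_eq_cis)

lemma twisted_conv_eq_tconv:
  fixes a b A B :: "'d::finite phase_space \<Rightarrow> complex"
  assumes ae: "AE X in lborel. a X = A X" "AE X in lborel. b X = B X"
    and [measurable]: "A \<in> borel_measurable borel" "B \<in> borel_measurable borel"
  shows "twisted_conv a b X = tc_const TYPE('d) * tconv 2 A B X"
  unfolding twisted_conv_def tconv_def tc_const_def
  by (subst integral_lebesgue_cong_Borel(1)[OF twisted_conv_integrand_cong[OF ae]]) simp_all

lemma tconv_measurable:
  assumes [measurable]: "A \<in> borel_measurable borel" "B \<in> borel_measurable borel"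
  shows "tconv c A B \<in> borel_measurable borel"
proof -
  have "(\<lambda>z. A (fst z - snd z) * B (snd z) * cis (c * sympl (fst z) (snd z))) \<in> borel_measurable borel" by measurable
  then have "(\<lambda>(X, Y). A (X - Y) * B Y * cis (c * sympl X Y)) \<in> borel_measurable (borel \<Otimes>\<^sub>M lborel)"
    by (simp add: borel_prod case_prod_beta)
  then show ?thesis unfolding tconv_def[abs_def] by (rule lborel.borel_measurable_lebesgue_integral)
qed

text \<open>Replaces the three weights by equivalent regular ones. The inequalities point in the directions in which an estimate with the
regular weights implies one with the given weights.\<close>

lemma regular_weights_submultiplicative:
  fixes \<omega>0 \<omega>1 \<omega>2 :: "'a::euclidean_space \<Rightarrow> real"
  assumes mod: "poly_moderate \<omega>0" "poly_moderate \<omega>1" "poly_moderate \<omega>2"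
    and C: "\<And>X Y. \<omega>0 (X + Y) \<le> C * \<omega>1 X * \<omega>2 Y"
  obtains v0 v1 v2 N0 N1 N2 c0 C' where "regular_weight N0 v0" "regular_weight N1 v1" "regular_weight N2 v2"
    "1 \<le> c0" "\<And>X. \<omega>0 X \<le> c0 * v0 X" "\<And>X. v1 X \<le> \<omega>1 X" "\<And>X. v2 X \<le> \<omega>2 X"
    "0 \<le> C'" "\<And>X Y. v0 (X + Y) \<le> C' * v1 X * v2 Y"
proof -
  obtain v0 N0 c0 where v0: "regular_weight N0 v0" "1 \<le> c0" "\<And>X. v0 X \<le> \<omega>0 X" "\<And>X. \<omega>0 X \<le> c0 * v0 X"
    by (rule regular_weight_exists[OF mod(1)]) (rule that)
  obtain v1 N1 c1 where v1: "regular_weight N1 v1" "1 \<le> c1" "\<And>X. v1 X \<le> \<omega>1 X" "\<And>X. \<omega>1 X \<le> c1 * v1 X"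
    by (rule regular_weight_exists[OF mod(2)]) (rule that)
  obtain v2 N2 c2 where v2: "regular_weight N2 v2" "1 \<le> c2" "\<And>X. v2 X \<le> \<omega>2 X" "\<And>X. \<omega>2 X \<le> c2 * v2 X"
    by (rule regular_weight_exists[OF mod(3)]) (rule that)
  have wp: "\<And>X. 0 < \<omega>0 X" "\<And>X. 0 < \<omega>1 X" "\<And>X. 0 < \<omega>2 X" using mod by (auto simp: poly_moderate_def)
  have vp: "\<And>X. 0 < v1 X" using v1(1) by (auto simp: regular_weight_def)
  have "0 \<le> max C 0 * c1 * c2" using v1(2) v2(2) by simp
  moreover have "v0 (X + Y) \<le> max C 0 * c1 * c2 * v1 X * v2 Y" for X Y
  proof -
    have "v0 (X + Y) \<le> C * (\<omega>1 X * \<omega>2 Y)" using v0(3)[of "X + Y"] C[of X Y] by (simp add: mult.assoc)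
    also have "\<dots> \<le> max C 0 * (\<omega>1 X * \<omega>2 Y)" using wp[of X] wp[of Y] by (intro mult_right_mono) auto
    also have "\<dots> \<le> max C 0 * ((c1 * v1 X) * (c2 * v2 Y))"
      using wp[of X] wp[of Y] v1(4)[of X] v2(4)[of Y] v1(2) vp[of X] by (intro mult_left_mono mult_mono) (auto simp: less_imp_le)
    finally show ?thesis by (simp add: mult_ac)
  qed
  ultimately show ?thesis by (rule that[OF v0(1) v1(1) v2(1) v0(2,4) v1(3) v2(3)])
qed

text \<open>Divide the functions by bounds for their norms and move the weights into the kernel; then \<open>kernel_operator_bound\<close> applies with the
trilinear bound of \<open>trilinear_bounded_region\<close>.\<close>

lemma twisted_conv_estimate:
  fixes \<omega>0 \<omega>1 \<omega>2 :: "'d::finite phase_space \<Rightarrow> real" and p p1 p2 :: ereal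
  defines "x \<equiv> real_of_ereal (1 / p1)" and "y \<equiv> real_of_ereal (1 / p2)" and "z \<equiv> real_of_ereal (1 / p)"
  assumes mod: "poly_moderate \<omega>0" "poly_moderate \<omega>1" "poly_moderate \<omega>2"
    and Cex: "\<exists>C. \<forall>X1 X2. \<omega>0 (X1 + X2) \<le> C * \<omega>1 X1 * \<omega>2 X2"
    and p: "1 \<le> p" "1 \<le> p1" "1 \<le> p2"
    and region: "z \<le> x" "z \<le> y" "1 \<le> x + y" "x + y \<le> 1 + z"
  obtains M where "0 < M"
    "\<And>a1 a2. a1 \<in> Lp_space p1 \<omega>1 \<Longrightarrow> a2 \<in> Lp_space p2 \<omega>2 \<Longrightarrow>
       twisted_conv a1 a2 \<in> Lp_space p \<omega>0 \<and> Lp_norm p \<omega>0 (twisted_conv a1 a2) \<le> M * Lp_norm p1 \<omega>1 a1 * Lp_norm p2 \<omega>2 a2"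
    "\<And>a1 a2. a1 \<in> Lp_space p1 \<omega>1 \<Longrightarrow> a2 \<in> Lp_space p2 \<omega>2 \<Longrightarrow>
       AE X in lebesgue. integrable lebesgue (\<lambda>Y. a1 (X - Y) * a2 Y * exp (2 * \<i> * of_real (sympl X Y)))"
proof -
  obtain C where C: "\<And>X Y. \<omega>0 (X + Y) \<le> C * \<omega>1 X * \<omega>2 Y" using Cex by blast
  obtain v0 v1 v2 N0 N1 N2 c0 C' where v: "regular_weight N0 v0" "regular_weight N1 v1" "regular_weight N2 v2"
    and v0: "1 \<le> c0" "\<And>X. \<omega>0 X \<le> c0 * v0 X" and v1: "\<And>X. v1 X \<le> \<omega>1 X" and v2: "\<And>X. v2 X \<le> \<omega>2 X"
    and C'0: "0 \<le> C'" and C': "\<And>X Y. v0 (X + Y) \<le> C' * v1 X * v2 Y"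
    by (rule regular_weights_submultiplicative[OF mod C]) (rule that)
  have wm: "\<omega>0 \<in> borel_measurable lebesgue" "\<omega>1 \<in> borel_measurable lebesgue" "\<omega>2 \<in> borel_measurable lebesgue"
    and wp: "\<And>X. 0 < \<omega>0 X" "\<And>X. 0 < \<omega>1 X" "\<And>X. 0 < \<omega>2 X"
    using mod by (auto simp: poly_moderate_def)
  have vp: "\<And>X. 0 < v0 X" "\<And>X. 0 < v1 X" "\<And>X. 0 < v2 X" and vc: "continuous_on UNIV v0" "continuous_on UNIV v1" "continuous_on UNIV v2"
    using v by (auto simp: regular_weight_def)
  have vm[measurable]: "v0 \<in> borel_measurable borel" "v1 \<in> borel_measurable borel" "v2 \<in> borel_measurable borel"
    using vc by (auto intro: borel_measurable_continuous_onI)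
  let ?K = "tc_kernel v0 v1 v2"
  note Km[measurable] = tc_kernel_bounded(1)[OF v C'] and KC = tc_kernel_bounded(2)[OF v C']
  obtain M0 where M0: "0 < M0" and trilinear: "\<And>x y w. 1 \<le> x + w \<Longrightarrow> 1 \<le> y + w \<Longrightarrow> 1 \<le> x + y \<Longrightarrow> x + y + w \<le> 2 \<Longrightarrow> trilinear_bounded ?K M0 x y w"
    by (rule trilinear_bounded_region[OF v C'0 C']) blast
  have xyz: "0 \<le> x" "x \<le> 1" "0 \<le> y" "y \<le> 1" "0 \<le> z" "z \<le> 1"
    using Lp_exponent_bounds p unfolding x_def y_def z_def by auto
  have g: "trilinear_bounded ?K M0 x y (1 - z)" using region by (intro trilinear) auto
  define \<kappa> where "\<kappa> = (2 / pi) powr (real CARD('d) / 2)"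
  have \<kappa>: "0 < \<kappa>" by (simp add: \<kappa>_def)
  define M where "M = c0 * (\<kappa> * (8 * M0))"
  have Mp: "0 < M" using v0(1) \<kappa> M0 by (simp add: M_def)
  \<comment> \<open>pass to the regular weight and choose Borel representatives\<close>
  have rep: "\<exists>A u. A \<in> borel_measurable borel \<and> (AE X in lborel. a X = A X) \<and> unit_density u \<and> (\<forall>X. cmod (A X) * v X \<le> r * u X powr real_of_ereal (1 / q))"
    if a: "a \<in> Lp_space q \<omega>" "Lp_norm q \<omega> a \<le> r" and r: "0 < r" and q: "1 \<le> q"
      and w: "\<omega> \<in> borel_measurable lebesgue" "\<And>X. 0 < \<omega> X" and v: "v \<in> borel_measurable borel" "\<And>X. 0 < v X" "\<And>X. v X \<le> \<omega> X"
    for a q \<omega> r and v :: "'d phase_space \<Rightarrow> real"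
  proof -
    have vl: "v \<in> borel_measurable lebesgue" using v(1) by (simp add: measurable_completion)
    have "a \<in> Lp_space q v \<and> Lp_norm q v a \<le> r"
    proof -
      have ae: "AE X in lebesgue. cmod (a X) * v X \<le> 1 * (cmod (a X) * \<omega> X)"
        unfolding mult_1_left by (intro AE_I2 mult_left_mono v(3) norm_ge_zero)
      from Lp_space_bounded_mult[OF q w vl v(2) a(1) Lp_space_measurable[OF a(1)] zero_less_one ae] a(2)
      show ?thesis by simp
    qed
    then have "in_Lball (real_of_ereal (1 / q)) r (\<lambda>t. a t * of_real (v t))"
      using Lp_ball_iff[OF q vl v(2) r] by blast
    then obtain F u where F[measurable]: "F \<in> borel_measurable borel" and ae: "AE X in lborel. a X * of_real (v X) = F X"
      and u: "unit_density u" and le: "\<And>X. cmod (F X) \<le> r * u X powr real_of_ereal (1 / q)"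
      by (rule in_Lball_Borel_representative[OF _ r]) (rule that)
    note [measurable] = v(1)
    have v0: "v X \<noteq> 0" for X using v(2)[of X] by simp
    have "(\<lambda>X. F X / of_real (v X)) \<in> borel_measurable borel" by measurable
    moreover have "AE X in lborel. a X = F X / of_real (v X)" using ae by eventually_elim (metis nonzero_mult_div_cancel_right of_real_eq_0_iff v0)
    moreover have "cmod (F X / of_real (v X)) * v X = cmod (F X)" for X using v(2)[of X] by (simp add: norm_divide)
    ultimately show ?thesis using u le by (intro exI[of _ "\<lambda>X. F X / of_real (v X)"] exI[of _ u]) auto
  qed
  have core: "twisted_conv a1 a2 \<in> Lp_space p \<omega>0 \<and> Lp_norm p \<omega>0 (twisted_conv a1 a2) \<le> M * r1 * r2 \<and>
     (AE X in lebesgue. integrable lebesgue (\<lambda>Y. a1 (X - Y) * a2 Y * exp (2 * \<i> * of_real (sympl X Y))))"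
    if a: "a1 \<in> Lp_space p1 \<omega>1" "Lp_norm p1 \<omega>1 a1 \<le> r1" "a2 \<in> Lp_space p2 \<omega>2" "Lp_norm p2 \<omega>2 a2 \<le> r2" and r: "0 < r1" "0 < r2" for a1 a2 r1 r2
  proof -
    obtain A1 u1 where A1[measurable]: "A1 \<in> borel_measurable borel" and ae1: "AE X in lborel. a1 X = A1 X" and u1: "unit_density u1" "\<And>X. cmod (A1 X) * v1 X \<le> r1 * u1 X powr x"
      using rep[OF a(1,2) r(1) p(2) wm(2) wp(2) vm(2) vp(2) v1] unfolding x_def by blast
    obtain A2 u2 where A2[measurable]: "A2 \<in> borel_measurable borel" and ae2: "AE X in lborel. a2 X = A2 X" and u2: "unit_density u2" "\<And>X. cmod (A2 X) * v2 X \<le> r2 * u2 X powr y"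
      using rep[OF a(3,4) r(2) p(3) wm(3) wp(3) vm(3) vp(3) v2] unfolding y_def by blast
    define F where "F X = A1 X * of_real (v1 X / r1)" for X
    define G where "G X = A2 X * of_real (v2 X / r2)" for X
    have Fm: "F \<in> borel_measurable borel" "G \<in> borel_measurable borel" unfolding F_def G_def by measurable
    have Fb: "cmod (F X) \<le> u1 X powr x" "cmod (G X) \<le> u2 X powr y" for X
      using u1(2)[of X] u2(2)[of X] r vp(2)[of X] vp(3)[of X]
      by (auto simp: F_def G_def norm_mult norm_divide pos_divide_le_eq mult.commute[of _ r1] mult.commute[of _ r2])
    obtain s where s: "unit_density s" "AE X in lborel. cmod (LINT Y|lborel. ?K (X, Y) * (F (X - Y) * G Y)) \<le> (8 * M0) * s X powr z"
      by (rule kernel_operator_bound[OF Km KC M0 g xyz(1,2,3,4,5,6) region(3) Fm u1(1) u2(1) Fb]) (rule that)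
    have Kint: "?K (X, Y) * (F (X - Y) * G Y) = of_real (v0 X / (r1 * r2)) * (A1 (X - Y) * A2 Y * cis (2 * sympl X Y))" for X Y
      using vp(2)[of "X - Y"] vp(3)[of Y] r by (simp add: tc_kernel_def F_def G_def)
    have tw: "twisted_conv a1 a2 X = of_real \<kappa> * tconv 2 A1 A2 X" for X
      using twisted_conv_eq_tconv[OF ae1 ae2 A1 A2] by (simp add: tc_const_def \<kappa>_def)
    have twm: "twisted_conv a1 a2 \<in> borel_measurable lebesgue"
      unfolding tw[abs_def] using tconv_measurable[OF A1 A2] by (intro measurable_completion) simp
    have bound: "AE X in lebesgue. cmod (twisted_conv a1 a2 X * of_real (\<omega>0 X)) \<le> (M * r1 * r2) * s X powr z"
    proof (rule AE_completion)
      show "AE X in lborel. cmod (twisted_conv a1 a2 X * of_real (\<omega>0 X)) \<le> (M * r1 * r2) * s X powr z"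
        using s(2)
      proof eventually_elim
        case (elim X)
        have "(LINT Y|lborel. ?K (X, Y) * (F (X - Y) * G Y)) = of_real (v0 X / (r1 * r2)) * tconv 2 A1 A2 X"
          unfolding Kint tconv_def by simp
        then have "(v0 X / (r1 * r2)) * cmod (tconv 2 A1 A2 X) \<le> (8 * M0) * s X powr z"
          using elim vp(1)[of X] r by (simp add: norm_mult norm_divide abs_mult)
        then have 1: "v0 X * cmod (tconv 2 A1 A2 X) \<le> (8 * M0) * s X powr z * (r1 * r2)"
          using r by (simp add: pos_divide_le_eq)
        have "cmod (twisted_conv a1 a2 X * of_real (\<omega>0 X)) = \<kappa> * cmod (tconv 2 A1 A2 X) * \<omega>0 X"
          using \<kappa> wp(1)[of X] by (simp add: tw norm_mult less_imp_le)
        also have "\<dots> \<le> \<kappa> * cmod (tconv 2 A1 A2 X) * (c0 * v0 X)"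
          using \<kappa> v0(2)[of X] by (intro mult_left_mono) auto
        also have "\<dots> = (c0 * \<kappa>) * (v0 X * cmod (tconv 2 A1 A2 X))" by (simp add: mult_ac)
        also have "\<dots> \<le> (c0 * \<kappa>) * ((8 * M0) * s X powr z * (r1 * r2))"
          using \<kappa> v0(1) by (intro mult_left_mono 1) auto
        finally show ?case by (simp add: M_def mult_ac)
      qed
    qed
    have "in_Lball z (M * r1 * r2) (\<lambda>X. twisted_conv a1 a2 X * of_real (\<omega>0 X))"
      unfolding in_Lball_def
    proof (intro conjI exI[of _ s])
      show "(\<lambda>X. twisted_conv a1 a2 X * of_real (\<omega>0 X)) \<in> borel_measurable lebesgue" using twm wm(1) by measurable
      show "(\<integral>\<^sup>+X. ennreal (s X) \<partial>lebesgue) \<le> 1" using unit_densityD(3)[OF s(1)] by (simp add: nn_integral_completion)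
    qed (use unit_densityD[OF s(1)] bound in \<open>auto intro: measurable_completion\<close>)
    then have 1: "twisted_conv a1 a2 \<in> Lp_space p \<omega>0 \<and> Lp_norm p \<omega>0 (twisted_conv a1 a2) \<le> M * r1 * r2"
      using Lp_ball_iff[OF p(1) wm(1) wp(1), of "M * r1 * r2"] Mp r unfolding z_def by simp
    \<comment> \<open>almost every section over each ball is integrable\<close>
    have "AE X in lborel. norm X \<le> real n \<longrightarrow> integrable lborel (\<lambda>Y. F (X - Y) * G Y)" for n :: nat
    proof -
      have "integrable lborel (\<lambda>z. F (fst z - snd z) * G (snd z) * indicator (cball 0 (real n)) (fst z))"
        by (rule local_integrability[OF Fm u1(1) u2(1) xyz(1,2,3,4) region(3) Fb, where D = 1 and R = "real n"])
           (auto simp: indicator_def split: if_splits)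
      from lborel_AE_integrable_fst[OF this] show ?thesis by eventually_elim auto
    qed
    then have "AE X in lborel. \<forall>n::nat. norm X \<le> real n \<longrightarrow> integrable lborel (\<lambda>Y. F (X - Y) * G Y)" unfolding AE_all_countable by blast
    then have "AE X in lborel. integrable lebesgue (\<lambda>Y. a1 (X - Y) * a2 Y * exp (2 * \<i> * of_real (sympl X Y)))"
    proof eventually_elim
      case (elim X)
      obtain n :: nat where "norm X \<le> real n" using real_arch_simple by blast
      then have FG: "integrable lborel (\<lambda>Y. F (X - Y) * G Y)" using elim by blast
      have i: "integrable lborel (\<lambda>Y. of_real (C' * (r1 * r2) / v0 X) * (F (X - Y) * G Y))"
        by (rule integrable_mult_right[OF FG])
      have "integrable lborel (\<lambda>Y. A1 (X - Y) * A2 Y * cis (2 * sympl X Y))"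
      proof (rule Bochner_Integration.integrable_bound[OF i])
        show "AE Y in lborel. norm (A1 (X - Y) * A2 Y * cis (2 * sympl X Y)) \<le> norm (of_real (C' * (r1 * r2) / v0 X) * (F (X - Y) * G Y))"
        proof (rule AE_I2)
          fix Y
          have "A1 (X - Y) * A2 Y * cis (2 * sympl X Y) = of_real ((r1 * r2) / v0 X) * (?K (X, Y) * (F (X - Y) * G Y))"
            unfolding Kint using vp(1)[of X] r by simp
          then have "norm (A1 (X - Y) * A2 Y * cis (2 * sympl X Y)) = (r1 * r2) / v0 X * (cmod (?K (X, Y)) * cmod (F (X - Y) * G Y))"
            using vp(1)[of X] r by (simp add: norm_mult norm_divide abs_mult)
          also have "\<dots> \<le> (r1 * r2) / v0 X * (C' * cmod (F (X - Y) * G Y))"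
            using vp(1)[of X] r KC[of "(X, Y)"] by (intro mult_left_mono mult_right_mono) auto
          also have "\<dots> = norm (of_real (C' * (r1 * r2) / v0 X) * (F (X - Y) * G Y))"
            using vp(1)[of X] r C'0 by (simp add: norm_mult norm_divide abs_mult)
          finally show "norm (A1 (X - Y) * A2 Y * cis (2 * sympl X Y)) \<le> norm (of_real (C' * (r1 * r2) / v0 X) * (F (X - Y) * G Y))" .
        qed
      qed simp
      then show ?case
        using integral_lebesgue_cong_Borel(2)[OF twisted_conv_integrand_cong[OF ae1 ae2, of X]] by simp
    qed
    then show ?thesis using 1 AE_completion by blast
  qed
  show ?thesis
  proof (rule that[OF Mp])
    fix a1 a2 assume a: "a1 \<in> Lp_space p1 \<omega>1" "a2 \<in> Lp_space p2 \<omega>2"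
    define n1 n2 where "n1 = Lp_norm p1 \<omega>1 a1" and "n2 = Lp_norm p2 \<omega>2 a2"
    have n: "0 \<le> n1" "0 \<le> n2" using Lp_norm_nonneg p by (auto simp: n1_def n2_def)
    have *: "twisted_conv a1 a2 \<in> Lp_space p \<omega>0 \<and> Lp_norm p \<omega>0 (twisted_conv a1 a2) \<le> M * (n1 + e) * (n2 + e) \<and>
     (AE X in lebesgue. integrable lebesgue (\<lambda>Y. a1 (X - Y) * a2 Y * exp (2 * \<i> * of_real (sympl X Y))))" if "0 < e" for e
      using a n that by (intro core) (auto simp: n1_def n2_def)
    have "Lp_norm p \<omega>0 (twisted_conv a1 a2) \<le> M * n1 * n2"
    proof (rule tendsto_lowerbound)
      show "((\<lambda>e. M * (n1 + e) * (n2 + e)) \<longlongrightarrow> M * n1 * n2) (at_right 0)" by (auto intro!: tendsto_eq_intros)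
      show "\<forall>\<^sub>F e in at_right 0. Lp_norm p \<omega>0 (twisted_conv a1 a2) \<le> M * (n1 + e) * (n2 + e)"
        using * by (auto simp: eventually_at_right_field intro!: exI[of _ 1])
    qed simp
    then show "twisted_conv a1 a2 \<in> Lp_space p \<omega>0 \<and> Lp_norm p \<omega>0 (twisted_conv a1 a2) \<le> M * Lp_norm p1 \<omega>1 a1 * Lp_norm p2 \<omega>2 a2"
      using *[of 1] by (simp add: n1_def n2_def)
    show "AE X in lebesgue. integrable lebesgue (\<lambda>Y. a1 (X - Y) * a2 Y * exp (2 * \<i> * of_real (sympl X Y)))"
      using *[of 1] by simp
  qed
qed

section \<open>Norm and weak* topologies\<close>

text \<open>Convergence may be tested on a subbase, since finite intersections and unions preserve eventual membership.\<close>

lemma limitin_topology_generated_by: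
  assumes a: "a \<in> topspace (topology_generated_by S)"
    and ev: "\<And>U. U \<in> S \<Longrightarrow> a \<in> U \<Longrightarrow> \<forall>\<^sub>F n in F. s n \<in> U"
  shows "limitin (topology_generated_by S) s a F"
  unfolding limitin_def
proof (intro conjI a allI impI, elim conjE)
  fix U assume U: "openin (topology_generated_by S) U" and aU: "a \<in> U"
  have "generate_topology_on S U" using U by (simp add: openin_topology_generated_by_iff)
  then have "a \<in> U \<longrightarrow> (\<forall>\<^sub>F n in F. s n \<in> U)"
  proof induction
    case (Int A B)
    then show ?case by (auto intro: eventually_conj)
  next
    case (UN K)
    show ?case
    proof
      assume "a \<in> \<Union>K"
      then obtain k where k: "k \<in> K" "a \<in> k" by blast
      then have "\<forall>\<^sub>F n in F. s n \<in> k" using UN.IH by blast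
      then show "\<forall>\<^sub>F n in F. s n \<in> \<Union>K" by eventually_elim (use k in blast)
    qed
  qed (use ev in auto)
  then show "\<forall>\<^sub>F n in F. s n \<in> U" using aU by simp
qed

lemma Lp_topology_topspace [simp]:
  assumes "1 \<le> p" shows "topspace (Lp_topology p \<omega>) = Lp_space p \<omega>"
proof
  show "topspace (Lp_topology p \<omega>) \<subseteq> Lp_space p \<omega>"
    unfolding Lp_topology_def topology_generated_by_topspace by auto
  show "Lp_space p \<omega> \<subseteq> topspace (Lp_topology p \<omega>)"
  proof
    fix f assume f: "f \<in> Lp_space p \<omega>"
    have "f \<in> {g \<in> Lp_space p \<omega>. Lp_norm p \<omega> (\<lambda>x. g x - f x) < 1}"
      using f Lp_space_0(2)[OF assms, of \<omega>] by simp
    moreover have "{g \<in> Lp_space p \<omega>. Lp_norm p \<omega> (\<lambda>x. g x - f x) < 1} \<in>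
        {{g \<in> Lp_space p \<omega>. Lp_norm p \<omega> (\<lambda>x. g x - f x) < r} | f r. f \<in> Lp_space p \<omega> \<and> 0 < r}"
      using f zero_less_one by blast
    ultimately show "f \<in> topspace (Lp_topology p \<omega>)"
      unfolding Lp_topology_def topology_generated_by_topspace by blast
  qed
qed

lemma openin_Lp_ball:
  assumes "f \<in> Lp_space p \<omega>" "0 < r"
  shows "openin (Lp_topology p \<omega>) {g \<in> Lp_space p \<omega>. Lp_norm p \<omega> (\<lambda>x. g x - f x) < r}"
  unfolding Lp_topology_def by (rule topology_generated_by_Basis) (use assms in blast)

text \<open>By definition only the balls around all centres together generate the topology; by the triangle inequality the
balls around the limit suffice.\<close>

lemma limitin_Lp_topology:
  fixes a :: "'a::euclidean_space \<Rightarrow> complex"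
  assumes p: "1 \<le> p" and w: "\<omega> \<in> borel_measurable lebesgue" "\<And>x. 0 < \<omega> x"
    and a: "a \<in> Lp_space p \<omega>" and s: "\<And>n. s n \<in> Lp_space p \<omega>"
  shows "limitin (Lp_topology p \<omega>) s a sequentially \<longleftrightarrow> (\<lambda>n. Lp_norm p \<omega> (\<lambda>x. s n x - a x)) \<longlonglongrightarrow> 0"
proof
  assume lim: "limitin (Lp_topology p \<omega>) s a sequentially"
  show "(\<lambda>n. Lp_norm p \<omega> (\<lambda>x. s n x - a x)) \<longlonglongrightarrow> 0"
  proof (rule order_tendstoI)
    fix e :: real assume "e < 0"
    then show "\<forall>\<^sub>F n in sequentially. e < Lp_norm p \<omega> (\<lambda>x. s n x - a x)"
      using Lp_norm_nonneg[OF p] by (intro always_eventually allI) (rule less_le_trans)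
  next
    fix e :: real assume "0 < e"
    then show "\<forall>\<^sub>F n in sequentially. Lp_norm p \<omega> (\<lambda>x. s n x - a x) < e"
      using lim openin_Lp_ball[OF a \<open>0 < e\<close>] a Lp_space_0(2)[OF p, of \<omega>] unfolding limitin_def
      by (auto elim!: allE[of _ "{g \<in> Lp_space p \<omega>. Lp_norm p \<omega> (\<lambda>x. g x - a x) < e}"] eventually_mono)
  qed
next
  assume lim: "(\<lambda>n. Lp_norm p \<omega> (\<lambda>x. s n x - a x)) \<longlonglongrightarrow> 0"
  show "limitin (Lp_topology p \<omega>) s a sequentially"
    unfolding Lp_topology_def
  proof (rule limitin_topology_generated_by)
    show "a \<in> topspace (topology_generated_by {{g \<in> Lp_space p \<omega>. Lp_norm p \<omega> (\<lambda>x. g x - f x) < r} | f r. f \<in> Lp_space p \<omega> \<and> 0 < r})"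
      using Lp_topology_topspace[OF p, of \<omega>] a unfolding Lp_topology_def by simp
    fix U assume "U \<in> {{g \<in> Lp_space p \<omega>. Lp_norm p \<omega> (\<lambda>x. g x - f x) < r} | f r. f \<in> Lp_space p \<omega> \<and> 0 < r}" and aU: "a \<in> U"
    then obtain f r where U: "U = {g \<in> Lp_space p \<omega>. Lp_norm p \<omega> (\<lambda>x. g x - f x) < r}" and f: "f \<in> Lp_space p \<omega>" by blast
    have "0 < r - Lp_norm p \<omega> (\<lambda>x. a x - f x)" using aU U by simp
    with lim have "\<forall>\<^sub>F n in sequentially. Lp_norm p \<omega> (\<lambda>x. s n x - a x) < r - Lp_norm p \<omega> (\<lambda>x. a x - f x)"
      by (rule order_tendstoD)
    then show "\<forall>\<^sub>F n in sequentially. s n \<in> U"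
    proof eventually_elim
      case (elim n)
      then show ?case using Lp_norm_diff_triangle[OF p w s[of n] a f] s U by simp
    qed
  qed
qed

lemma weak_star_topspace [simp]: "topspace (weak_star_topology \<omega>) = Lp_space \<infinity> \<omega>"
proof
  show "topspace (weak_star_topology \<omega>) \<subseteq> Lp_space \<infinity> \<omega>"
    unfolding weak_star_topology_def topology_generated_by_topspace by auto
  have "(\<lambda>x. 0) \<in> Lp_space 1 (\<lambda>x. 1 / \<omega> x)" by (rule Lp_space_0(1)) simp
  then have "{f \<in> Lp_space \<infinity> \<omega>. (LINT x|lebesgue. f x * (\<lambda>x. 0) x) \<in> UNIV} \<in> {{f \<in> Lp_space \<infinity> \<omega>. (LINT x|lebesgue. f x * g x) \<in> U} | g U.
        g \<in> Lp_space 1 (\<lambda>x. 1 / \<omega> x) \<and> open U}" using open_UNIV by blast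
  then show "Lp_space \<infinity> \<omega> \<subseteq> topspace (weak_star_topology \<omega>)"
    unfolding weak_star_topology_def topology_generated_by_topspace by auto
qed

lemma openin_weak_star:
  assumes "g \<in> Lp_space 1 (\<lambda>x. 1 / \<omega> x)" "open U"
  shows "openin (weak_star_topology \<omega>) {f \<in> Lp_space \<infinity> \<omega>. (LINT x|lebesgue. f x * g x) \<in> U}"
  unfolding weak_star_topology_def by (rule topology_generated_by_Basis) (use assms in blast)

lemma limitin_weak_star:
  assumes "a \<in> Lp_space \<infinity> \<omega>" and s: "\<And>n. s n \<in> Lp_space \<infinity> \<omega>"
    and lim: "\<And>g. g \<in> Lp_space 1 (\<lambda>x. 1 / \<omega> x) \<Longrightarrow> (\<lambda>n. LINT x|lebesgue. s n x * g x) \<longlonglongrightarrow> (LINT x|lebesgue. a x * g x)"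
  shows "limitin (weak_star_topology \<omega>) s a sequentially"
  unfolding weak_star_topology_def
proof (rule limitin_topology_generated_by)
  show "a \<in> topspace (topology_generated_by {{f \<in> Lp_space \<infinity> \<omega>. (LINT x|lebesgue. f x * g x) \<in> U} | g U.
        g \<in> Lp_space 1 (\<lambda>x. 1 / \<omega> x) \<and> open U})"
    using weak_star_topspace[of \<omega>] assms(1) unfolding weak_star_topology_def by simp
  fix V assume "V \<in> {{f \<in> Lp_space \<infinity> \<omega>. (LINT x|lebesgue. f x * g x) \<in> U} | g U. g \<in> Lp_space 1 (\<lambda>x. 1 / \<omega> x) \<and> open U}" and aV: "a \<in> V"
  then obtain g U where V: "V = {f \<in> Lp_space \<infinity> \<omega>. (LINT x|lebesgue. f x * g x) \<in> U}" and g: "g \<in> Lp_space 1 (\<lambda>x. 1 / \<omega> x)" and U: "open U" by blast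
  have "\<forall>\<^sub>F n in sequentially. (LINT x|lebesgue. s n x * g x) \<in> U"
    using topological_tendstoD[OF lim[OF g] U] aV V by simp
  then show "\<forall>\<^sub>F n in sequentially. s n \<in> V" unfolding V by eventually_elim (use s in simp)
qed

lemma limitin_weak_star_integral:
  assumes lim: "limitin (weak_star_topology \<omega>) s a sequentially" and g: "g \<in> Lp_space 1 (\<lambda>x. 1 / \<omega> x)"
  shows "(\<lambda>n. LINT x|lebesgue. s n x * g x) \<longlonglongrightarrow> (LINT x|lebesgue. a x * g x)"
proof (rule topological_tendstoI)
  fix U assume U: "open U" "(LINT x|lebesgue. a x * g x) \<in> U"
  have "a \<in> Lp_space \<infinity> \<omega>" using lim by (auto simp: limitin_def)
  then have "\<forall>\<^sub>F n in sequentially. s n \<in> {f \<in> Lp_space \<infinity> \<omega>. (LINT x|lebesgue. f x * g x) \<in> U}"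
    using lim openin_weak_star[OF g U(1)] U(2) unfolding limitin_def by blast
  then show "\<forall>\<^sub>F n in sequentially. (LINT x|lebesgue. s n x * g x) \<in> U" by eventually_elim simp
qed

lemma Linfty_bound:
  fixes a :: "'a::euclidean_space \<Rightarrow> complex"
  assumes "\<omega> \<in> borel_measurable lebesgue" "\<And>x. 0 < \<omega> x" "a \<in> Lp_space \<infinity> \<omega>"
  obtains B where "0 < B" "AE x in lebesgue. cmod (a x) * \<omega> x \<le> B"
proof -
  define r where "r = Lp_norm \<infinity> \<omega> a + 1"
  have r: "0 < r" using Lp_norm_nonneg[of \<infinity> \<omega> a] by (simp add: r_def)
  have "in_Lball (real_of_ereal (1 / \<infinity>)) r (\<lambda>t. a t * of_real (\<omega> t))"
    using Lp_ball_iff[OF _ assms(1,2) r, of \<infinity> a] assms(3) by (simp add: r_def)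
  then obtain u where "AE t in lebesgue. cmod (a t * of_real (\<omega> t)) \<le> r * u t powr 0"
    unfolding in_Lball_def by auto
  then have "AE t in lebesgue. cmod (a t) * \<omega> t \<le> r"
  proof eventually_elim
    case (elim t)
    have "r * u t powr 0 \<le> r" using r by simp
    then show ?case using elim assms(2)[of t] by (simp add: norm_mult less_imp_le)
  qed
  then show ?thesis using that r by blast
qed

lemma pairing_integrable:
  fixes a :: "'a::euclidean_space \<Rightarrow> complex"
  assumes w: "\<omega> \<in> borel_measurable lebesgue" "\<And>x. 0 < \<omega> x" and a: "a \<in> Lp_space \<infinity> \<omega>" and g: "g \<in> Lp_space 1 (\<lambda>x. 1 / \<omega> x)"
  shows "integrable lebesgue (\<lambda>x. a x * g x)" "integrable lebesgue (\<lambda>x. cmod (g x) / \<omega> x)"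
proof -
  obtain B where B: "0 < B" "AE x in lebesgue. cmod (a x) * \<omega> x \<le> B" by (rule Linfty_bound[OF w a])
  have gm: "g \<in> borel_measurable lebesgue" and am: "a \<in> borel_measurable lebesgue"
    using a g by (auto intro: Lp_space_measurable)
  have "integrable lebesgue (\<lambda>x. cmod (g x * of_real (1 / \<omega> x)) powr 1)"
    using g by (simp add: Lp_space_def one_ereal_def)
  then show gi: "integrable lebesgue (\<lambda>x. cmod (g x) / \<omega> x)"
    using w(2) by (simp add: norm_mult norm_divide less_imp_le)
  show "integrable lebesgue (\<lambda>x. a x * g x)"
  proof (rule Bochner_Integration.integrable_bound)
    show "integrable lebesgue (\<lambda>x. B * (cmod (g x) / \<omega> x))" by (rule integrable_mult_right[OF gi])
    show "(\<lambda>x. a x * g x) \<in> borel_measurable lebesgue" using am gm by simp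
    show "AE x in lebesgue. norm (a x * g x) \<le> norm (B * (cmod (g x) / \<omega> x))"
      using B(2)
    proof eventually_elim
      case (elim x)
      have "cmod (a x) \<le> B / \<omega> x" using elim w(2)[of x] by (simp add: pos_le_divide_eq)
      then have "cmod (a x) * cmod (g x) \<le> B / \<omega> x * cmod (g x)" by (rule mult_right_mono) simp
      then show ?case using B(1) w(2)[of x] by (simp add: norm_mult abs_mult less_imp_le)
    qed
  qed
qed

text \<open>Test with \<open>g = conj(sgn (a - b)) \<omega>\<close> times a Gaussian, for which the pairing with \<open>a - b\<close> is the integral of a function that is
positive wherever \<open>a\<close> and \<open>b\<close> differ.\<close>

lemma weak_star_separates:
  fixes a b :: "'a::euclidean_space \<Rightarrow> complex"
  assumes w: "\<omega> \<in> borel_measurable lebesgue" "\<And>x. 0 < \<omega> x" and a: "a \<in> Lp_space \<infinity> \<omega>" and b: "b \<in> Lp_space \<infinity> \<omega>"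
    and eq: "\<And>g. g \<in> Lp_space 1 (\<lambda>x. 1 / \<omega> x) \<Longrightarrow> (LINT x|lebesgue. a x * g x) = (LINT x|lebesgue. b x * g x)"
  shows "AE x in lebesgue. a x = b x"
proof -
  define d where "d x = a x - b x" for x
  have d: "d \<in> Lp_space \<infinity> \<omega>" unfolding d_def[abs_def] by (rule Lp_norm_diff(1)[OF _ w a b]) simp
  have [measurable]: "d \<in> borel_measurable lebesgue" "\<omega> \<in> borel_measurable lebesgue" using Lp_space_measurable[OF d] w by auto
  define G where "G = (unit_gaussian :: 'a \<Rightarrow> real)"
  have [measurable]: "G \<in> borel_measurable lebesgue" unfolding G_def by (intro measurable_completion) simp
  have Gp: "0 < G x" for x by (simp add: G_def unit_gaussian_pos)
  have Gi: "integrable lebesgue G"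
  proof -
    have "integrable lborel (unit_gaussian :: 'a \<Rightarrow> real)"
      by (rule integrableI_nonneg) (auto simp: nn_integral_unit_gaussian less_imp_le[OF unit_gaussian_pos])
    then show ?thesis unfolding G_def by (simp add: integrable_completion)
  qed
  define g where "g x = cnj (sgn (d x)) * of_real (G x * \<omega> x)" for x
  have [measurable]: "g \<in> borel_measurable lebesgue" unfolding g_def sgn_eq by measurable
  have g: "g \<in> Lp_space 1 (\<lambda>x. 1 / \<omega> x)"
  proof -
    have "integrable lebesgue (\<lambda>x. cmod (g x * of_real (1 / \<omega> x)) powr 1)"
    proof (rule Bochner_Integration.integrable_bound[OF Gi])
      show "AE x in lebesgue. norm (cmod (g x * of_real (1 / \<omega> x)) powr 1) \<le> norm (G x)"
      proof (rule AE_I2)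
        fix x
        show "norm (cmod (g x * of_real (1 / \<omega> x)) powr 1) \<le> norm (G x)"
          using Gp[of x] w(2)[of x] by (simp add: g_def norm_mult norm_divide norm_sgn)
      qed
    qed measurable
    then show ?thesis by (simp add: Lp_space_def one_ereal_def)
  qed
  have "(LINT x|lebesgue. d x * g x) = (LINT x|lebesgue. a x * g x) - (LINT x|lebesgue. b x * g x)"
    unfolding d_def left_diff_distrib
    by (rule Bochner_Integration.integral_diff[OF pairing_integrable(1)[OF w a g] pairing_integrable(1)[OF w b g]])
  then have "(LINT x|lebesgue. d x * g x) = 0" using eq[OF g] by simp
  moreover have dg: "d x * g x = of_real (cmod (d x) * (G x * \<omega> x))" for x
    unfolding g_def mult.assoc[symmetric] mult_cnj_sgn by simp
  ultimately have "(LINT x|lebesgue. complex_of_real (cmod (d x) * (G x * \<omega> x))) = 0" by (simp only: dg)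
  then have 0: "(LINT x|lebesgue. cmod (d x) * (G x * \<omega> x)) = 0" by (simp only: integral_complex_of_real of_real_eq_0_iff)
  have "integrable lebesgue (\<lambda>x. d x * g x)" by (rule pairing_integrable(1)[OF w d g])
  then have "integrable lebesgue (\<lambda>x. cmod (d x) * (G x * \<omega> x))" unfolding dg by (simp only: complex_of_real_integrable_eq)
  from integral_nonneg_eq_0_iff_AE[OF this] 0 have "AE x in lebesgue. cmod (d x) * (G x * \<omega> x) = 0"
    using Gp w(2) by (auto simp: less_imp_le)
  then show ?thesis
  proof eventually_elim
    case (elim x)
    then show ?case using Gp[of x] w(2)[of x] by (simp add: d_def)
  qed
qed

lemma weak_star_dominated_convergence:
  fixes a :: "'a::euclidean_space \<Rightarrow> complex"
  assumes w: "\<omega> \<in> borel_measurable lebesgue" "\<And>x. 0 < \<omega> x"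
    and D: "D \<in> Lp_space \<infinity> \<omega>" and a: "a \<in> Lp_space \<infinity> \<omega>" and s: "\<And>n. s n \<in> Lp_space \<infinity> \<omega>"
    and lim: "AE x in lebesgue. (\<lambda>n. s n x) \<longlonglongrightarrow> a x" and dom: "\<And>n. AE x in lebesgue. cmod (s n x) \<le> cmod (D x)"
  shows "limitin (weak_star_topology \<omega>) s a sequentially"
proof (rule limitin_weak_star[OF a s])
  fix g :: "'a \<Rightarrow> complex" assume g: "g \<in> Lp_space 1 (\<lambda>x. 1 / \<omega> x)"
  show "(\<lambda>n. LINT x|lebesgue. s n x * g x) \<longlonglongrightarrow> (LINT x|lebesgue. a x * g x)"
  proof (rule integral_dominated_convergence)
    show "integrable lebesgue (\<lambda>x. cmod (D x * g x))" using pairing_integrable(1)[OF w D g] by simp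
    show "(\<lambda>x. a x * g x) \<in> borel_measurable lebesgue" "(\<lambda>x. s n x * g x) \<in> borel_measurable lebesgue" for n
      using Lp_space_measurable[OF a] Lp_space_measurable[OF s] Lp_space_measurable[OF g] by simp_all
    show "AE x in lebesgue. (\<lambda>n. s n x * g x) \<longlonglongrightarrow> a x * g x" using lim by eventually_elim (intro tendsto_intros)
    show "AE x in lebesgue. norm (s n x * g x) \<le> cmod (D x * g x)" for n
      using dom[of n] by eventually_elim (simp add: norm_mult mult_right_mono)
  qed
qed

lemma Lp_space_mono:
  fixes a :: "'a::euclidean_space \<Rightarrow> complex"
  assumes p: "1 \<le> p" and w: "\<omega> \<in> borel_measurable lebesgue" "\<And>x. 0 < \<omega> x"
    and D: "D \<in> Lp_space p \<omega>" and a: "a \<in> borel_measurable lebesgue" and le: "AE x in lebesgue. cmod (a x) \<le> cmod (D x)"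
  shows "a \<in> Lp_space p \<omega>"
  by (rule Lp_space_bounded_mult(1)[OF p w w D a zero_less_one])
     (use le w(2) in \<open>auto elim!: eventually_mono intro!: mult_right_mono simp: less_imp_le\<close>)

lemma Schwartz_in_Lp_space:
  fixes \<omega> :: "'a::euclidean_space \<Rightarrow> real"
  assumes p: "1 \<le> p" and mod: "poly_moderate \<omega>" and a: "a \<in> Schwartz"
  shows "a \<in> Lp_space p \<omega>"
proof -
  have wm: "\<omega> \<in> borel_measurable lebesgue" and wp: "\<And>x. 0 < \<omega> x" using mod by (auto simp: poly_moderate_def)
  obtain v N c where v: "regular_weight N v" "1 \<le> c" "\<And>x. v x \<le> \<omega> x" "\<And>x. \<omega> x \<le> c * v x"
    by (rule regular_weight_exists[OF mod]) (rule that)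
  have vp: "0 < v x" for x using v(1) by (simp add: regular_weight_def)
  define k where "k = 2 * DIM('a)"
  obtain C where C: "\<And>x. (1 + norm x) ^ (N + k) * cmod (a x) \<le> C" using Schwartz_decay[OF a] by blast
  have C0: "0 \<le> C" using order_trans[OF norm_ge_zero[of "a 0"], of C] C[of 0] by simp
  define M where "M = c * v 0 * C + 1"
  have M: "0 < M" unfolding M_def using v(2) vp[of 0] C0 by (intro add_nonneg_pos) auto
  have bound: "cmod (a x * of_real (\<omega> x)) \<le> M * (1 / (1 + norm x) ^ k)" for x
  proof -
    have pk: "0 < (1 + norm x) ^ k" by (simp add: add_pos_nonneg)
    have "\<omega> x \<le> c * ((1 + norm x) ^ N * v 0)"
    proof -
      have "v x \<le> (1 + norm x) ^ N * v 0" using v(1) unfolding regular_weight_def by (metis add_0)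
      then show ?thesis using v(4)[of x] v(2) by (meson mult_left_mono order_trans zero_le_one)
    qed
    then have "(1 + norm x) ^ k * (cmod (a x) * \<omega> x) \<le> (1 + norm x) ^ k * (cmod (a x) * (c * ((1 + norm x) ^ N * v 0)))"
      by (intro mult_left_mono) auto
    also have "\<dots> = (c * v 0) * ((1 + norm x) ^ (N + k) * cmod (a x))" by (simp add: power_add mult_ac)
    also have "\<dots> \<le> (c * v 0) * C" using v(2) vp[of 0] by (intro mult_left_mono C) auto
    also have "\<dots> \<le> M" by (simp add: M_def)
    finally have "cmod (a x) * \<omega> x \<le> M / (1 + norm x) ^ k" using pk by (simp add: pos_le_divide_eq mult.commute)
    then show ?thesis using wp[of x] by (simp add: norm_mult less_imp_le)
  qed
  have am[measurable]: "a \<in> borel_measurable lebesgue" using Schwartz_measurable[OF a] by (simp add: measurable_completion)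
  have Fm[measurable]: "(\<lambda>x. cmod (a x * of_real (\<omega> x))) \<in> borel_measurable lebesgue" using wm by measurable
  have inv1: "1 / (1 + norm x) ^ k \<le> 1" for x :: 'a by (simp add: divide_le_eq_1 one_le_power add_pos_nonneg)
  show ?thesis
    using p
  proof (cases rule: Lp_exponent_cases)
    case 1
    have "esssup lebesgue (\<lambda>x. ereal (cmod (a x * of_real (\<omega> x)))) \<le> ereal M"
    proof (intro esssup_I AE_I2)
      fix x :: 'a
      have "M * (1 / (1 + norm x) ^ k) \<le> M * 1" using M by (intro mult_left_mono inv1) auto
      then show "ereal (cmod (a x * of_real (\<omega> x))) \<le> ereal M" using bound[of x] by simp
    qed (rule borel_measurable_ereal[OF Fm])
    then show ?thesis using 1 am by (auto simp: Lp_space_def intro: le_less_trans)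
  next
    case (2 q)
    have q: "0 < q" using 2 by simp
    have "integrable lebesgue (\<lambda>x. cmod (a x * of_real (\<omega> x)) powr q)"
    proof (rule Bochner_Integration.integrable_bound)
      have "integrable lborel (\<lambda>x::'a. M powr q * (1 / (1 + norm x) ^ k))"
        unfolding k_def by (intro integrable_mult_right integrable_polynomial_decay)
      then show "integrable lebesgue (\<lambda>x::'a. M powr q * (1 / (1 + norm x) ^ k))" by (subst integrable_completion) auto
      show "AE x in lebesgue. norm (cmod (a x * of_real (\<omega> x)) powr q) \<le> norm (M powr q * (1 / (1 + norm x) ^ k))"
      proof (rule AE_I2)
        fix x :: 'a
        have pk: "0 < (1 + norm x) ^ k" by (simp add: add_pos_nonneg)
        have "cmod (a x * of_real (\<omega> x)) powr q \<le> (M * (1 / (1 + norm x) ^ k)) powr q"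
          using q by (intro powr_mono2 bound) auto
        also have "\<dots> = M powr q * (1 / (1 + norm x) ^ k) powr q" by (simp only: powr_mult)
        also have "(1 / (1 + norm x) ^ k) powr q \<le> (1 / (1 + norm x) ^ k) powr 1"
          using 2 pk inv1[of x] by (intro powr_mono') auto
        also have "(1 / (1 + norm x) ^ k) powr 1 = 1 / (1 + norm x) ^ k" using pk by simp
        finally show "norm (cmod (a x * of_real (\<omega> x)) powr q) \<le> norm (M powr q * (1 / (1 + norm x) ^ k))"
          using M by (simp add: mult_left_mono)
      qed
    qed measurable
    then show ?thesis using 2 am by (simp add: Lp_space_def)
  qed
qed

lemma gaussian_in_Lp_space:
  fixes \<omega> :: "'a::euclidean_space \<Rightarrow> real"
  assumes "1 \<le> p" "poly_moderate \<omega>"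
  shows "(\<lambda>x. of_real (C * exp (- (norm x)\<^sup>2 / 4))) \<in> Lp_space p \<omega>"
proof (rule Schwartz_in_Lp_space[OF assms])
  have "(\<lambda>x. of_real C * of_real (exp (- (1/4) * (norm x)\<^sup>2))) \<in> Schwartz"
    by (rule gauss_polys_Schwartz[OF _ gauss_polys.scale[OF gauss_polys.base]]) simp
  then show "(\<lambda>x. of_real (C * exp (- (norm x)\<^sup>2 / 4))) \<in> Schwartz" by simp
qed

section \<open>Uniqueness of continuous extensions\<close>

text \<open>Density of the Schwartz functions in a form that serves norm and weak* topologies at once. Three limits are taken:
mollification reaches continuous functions with bounded support, from these Lusin approximation reaches bounded functions with
bounded support, and truncation reaches everything.\<close>

lemma dominated_density:
  fixes \<omega> :: "'d::finite phase_space \<Rightarrow> real"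
  assumes p: "1 \<le> p" and mod: "poly_moderate \<omega>"
    and Schw: "\<And>a. a \<in> Schwartz \<Longrightarrow> Q a"
    and lim: "\<And>s a D. (\<And>n::nat. Q (s n)) \<Longrightarrow> (\<And>n. s n \<in> Lp_space p \<omega>) \<Longrightarrow> a \<in> Lp_space p \<omega> \<Longrightarrow> D \<in> Lp_space p \<omega> \<Longrightarrow>
      AE x in lebesgue. (\<lambda>n. s n x) \<longlonglongrightarrow> a x \<Longrightarrow> (\<And>n. AE x in lebesgue. cmod (s n x) \<le> cmod (D x)) \<Longrightarrow> Q a"
    and a: "a \<in> Lp_space p \<omega>"
  shows "Q a"
proof -
  have w: "\<omega> \<in> borel_measurable lebesgue" "\<And>x. 0 < \<omega> x" using mod by (auto simp: poly_moderate_def)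
  define D where "D C x = complex_of_real (C * exp (- (norm x)\<^sup>2 / 4))" for C and x :: "'d phase_space"
  have D: "D C \<in> Lp_space p \<omega>" for C unfolding D_def[abs_def] by (rule gaussian_in_Lp_space[OF p mod])
  have inLp: "f \<in> Lp_space p \<omega>" if "f \<in> borel_measurable borel" "\<And>x. cmod (f x) \<le> cmod (D C x)" for f C
    by (rule Lp_space_mono[OF p w D[of C]]) (use that in \<open>auto intro: measurable_completion\<close>)
  have 1: "Q g \<and> g \<in> Lp_space p \<omega>" if g: "continuous_on UNIV g" "\<And>x. g x \<noteq> 0 \<Longrightarrow> norm x \<le> R" for g R
  proof -
    obtain S C where S: "\<And>m::nat. S m \<in> Schwartz" "\<And>x. (\<lambda>m. S m x) \<longlonglongrightarrow> g x" "\<And>m x. cmod (S m x) \<le> C * exp (- (norm x)\<^sup>2 / 4)"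
      by (rule gaussian_mollifier[OF g(1)]) (erule g(2), rule that)
    have dom: "cmod (S m x) \<le> cmod (D C x)" for m x
      using S(3)[of m x] unfolding D_def norm_of_real by linarith
    have "cmod (g x) \<le> cmod (D C x)" for x
      by (rule LIMSEQ_le_const2[OF tendsto_norm[OF S(2)]]) (use dom in auto)
    then have gL: "g \<in> Lp_space p \<omega>" by (rule inLp[OF borel_measurable_continuous_onI[OF g(1)]])
    have "Q g"
      by (rule lim[of S g "D C"]) (use S dom D gL Schw Schwartz_in_Lp_space[OF p mod] in auto)
    then show ?thesis using gL by simp
  qed
  have 2: "Q f \<and> f \<in> Lp_space p \<omega>" if f: "f \<in> borel_measurable borel" "\<And>x. cmod (f x) \<le> B" "\<And>x. f x \<noteq> 0 \<Longrightarrow> norm x \<le> R" for f B R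
  proof -
    obtain g :: "nat \<Rightarrow> 'd phase_space \<Rightarrow> complex" where g: "\<forall>n. continuous_on UNIV (g n)" "\<forall>n x. cmod (g n x) \<le> B" "\<forall>n x. g n x \<noteq> 0 \<longrightarrow> norm x \<le> R + 1"
      "AE x in lborel. (\<lambda>n. g n x) \<longlonglongrightarrow> f x"
      using continuous_bounded_approximation[of f B R] f by blast
    have B0: "0 \<le> B" using order_trans[OF norm_ge_zero f(2)] .
    define C where "C = B * exp ((R + 1)\<^sup>2 / 4)"
    have DB: "B \<le> cmod (D C x)" if "norm x \<le> R + 1" for x
    proof -
      have "(norm x)\<^sup>2 \<le> (R + 1)\<^sup>2" using that by (intro power_mono) auto
      then have "1 \<le> exp ((R + 1)\<^sup>2 / 4 + - (norm x)\<^sup>2 / 4)" by simp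
      then have "B * 1 \<le> B * (exp ((R + 1)\<^sup>2 / 4) * exp (- (norm x)\<^sup>2 / 4))"
        unfolding exp_add[symmetric] using B0 by (rule mult_left_mono)
      then show ?thesis using B0 by (simp add: D_def C_def norm_mult abs_mult mult.assoc)
    qed
    have gd: "cmod (g n x) \<le> cmod (D C x)" for n x
      using DB[of x] g(2)[rule_format, of n x] g(3)[rule_format, of n x] order_trans[of "cmod (g n x)" B] by (cases "g n x = 0") auto
    have fd: "cmod (f x) \<le> cmod (D C x)" for x
      using DB[of x] f(2)[of x] f(3)[of x] by (cases "f x = 0") auto
    have fL: "f \<in> Lp_space p \<omega>" by (rule inLp[OF f(1) fd])
    have "Q f"
    proof (rule lim[of g f "D C"])
      show "Q (g n)" "g n \<in> Lp_space p \<omega>" for n using 1[of "g n" "R + 1"] g(1,3) by auto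
      show "AE x in lebesgue. (\<lambda>n. g n x) \<longlonglongrightarrow> f x" using g(4) by (rule AE_completion)
    qed (use fL D gd in auto)
    then show ?thesis using fL by simp
  qed
  obtain A where A[measurable]: "A \<in> borel_measurable borel" and ae: "AE x in lborel. a x = A x"
    by (rule Lebesgue_Borel_representative[OF Lp_space_measurable[OF a]])
  define s where "s n x = (if cmod (A x) \<le> real n \<and> norm x \<le> real n then A x else 0)" for n :: nat and x
  have ae': "AE x in lebesgue. a x = A x" using ae by (rule AE_completion)
  show "Q a"
  proof (rule lim[of s a a])
    have "s n \<in> borel_measurable borel" for n unfolding s_def by measurable
    then have *: "Q (s n) \<and> s n \<in> Lp_space p \<omega>" for n
      by (rule 2[where B = "real n" and R = "real n"]) (auto simp: s_def split: if_splits)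
    then show "Q (s n)" "s n \<in> Lp_space p \<omega>" for n by auto
    show "AE x in lebesgue. cmod (s n x) \<le> cmod (a x)" for n using ae' by eventually_elim (simp add: s_def)
    show "AE x in lebesgue. (\<lambda>n. s n x) \<longlonglongrightarrow> a x"
      using ae'
    proof eventually_elim
      case (elim x)
      obtain n0 :: nat where "max (cmod (A x)) (norm x) \<le> real n0" using real_arch_simple by blast
      then have "\<forall>n\<ge>n0. s n x = a x" using elim by (auto simp: s_def)
      then show ?case by (intro tendsto_eventually) (auto simp: eventually_sequentially)
    qed
  qed (use a in auto)
qed

text \<open>Limits in the seminorm topology determine values up to null sets, because functions at distance zero agree almost
everywhere.\<close>

lemma unique_norm_extension:
  fixes \<omega> \<omega>0 :: "'d::finite phase_space \<Rightarrow> real"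
  assumes q: "1 \<le> q" "q \<noteq> \<infinity>" and mod: "poly_moderate \<omega>" and p: "1 \<le> p" and mod0: "poly_moderate \<omega>0"
    and \<Phi>: "continuous_map (Lp_topology q \<omega>) (Lp_topology p \<omega>0) \<Phi>" and \<Psi>: "continuous_map (Lp_topology q \<omega>) (Lp_topology p \<omega>0) \<Psi>"
    and eq: "\<And>a. a \<in> Schwartz \<Longrightarrow> AE X in lebesgue. \<Phi> a X = \<Psi> a X" and a: "a \<in> Lp_space q \<omega>"
  shows "AE X in lebesgue. \<Phi> a X = \<Psi> a X"
proof (rule dominated_density[OF q(1) mod _ _ a])
  have w: "\<omega> \<in> borel_measurable lebesgue" "\<And>x. 0 < \<omega> x" and w0: "\<omega>0 \<in> borel_measurable lebesgue" "\<And>x. 0 < \<omega>0 x"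
    using mod mod0 by (auto simp: poly_moderate_def)
  have mem: "\<Phi> a \<in> Lp_space p \<omega>0" "\<Psi> a \<in> Lp_space p \<omega>0" if "a \<in> Lp_space q \<omega>" for a
    using that continuous_map_funspace[OF \<Phi>] continuous_map_funspace[OF \<Psi>] q p by auto
  fix s a D
  assume Qs: "\<And>n::nat. AE X in lebesgue. \<Phi> (s n) X = \<Psi> (s n) X" and s: "\<And>n. s n \<in> Lp_space q \<omega>" and a: "a \<in> Lp_space q \<omega>"
    and D: "D \<in> Lp_space q \<omega>" and lim: "AE x in lebesgue. (\<lambda>n. s n x) \<longlonglongrightarrow> a x" and dom: "\<And>n. AE x in lebesgue. cmod (s n x) \<le> cmod (D x)"
  have "(\<lambda>n. Lp_norm q \<omega> (\<lambda>x. s n x - a x)) \<longlonglongrightarrow> 0"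
    by (rule Lp_dominated_convergence[OF q w(1) D Lp_space_measurable[OF s] Lp_space_measurable[OF a] lim dom])
  then have sa: "limitin (Lp_topology q \<omega>) s a sequentially" using limitin_Lp_topology[OF q(1) w a s] by simp
  have lP: "(\<lambda>n. Lp_norm p \<omega>0 (\<lambda>x. \<Phi> (s n) x - \<Phi> a x)) \<longlonglongrightarrow> 0"
    using limitin_Lp_topology[OF p w0 mem(1)[OF a] mem(1)[OF s]] continuous_map_limit[OF \<Phi> sa] by (simp add: comp_def)
  have lQ: "(\<lambda>n. Lp_norm p \<omega>0 (\<lambda>x. \<Psi> (s n) x - \<Psi> a x)) \<longlonglongrightarrow> 0"
    using limitin_Lp_topology[OF p w0 mem(2)[OF a] mem(2)[OF s]] continuous_map_limit[OF \<Psi> sa] by (simp add: comp_def)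
  have le: "Lp_norm p \<omega>0 (\<lambda>x. \<Phi> a x - \<Psi> a x) \<le> Lp_norm p \<omega>0 (\<lambda>x. \<Phi> (s n) x - \<Phi> a x) + Lp_norm p \<omega>0 (\<lambda>x. \<Psi> (s n) x - \<Psi> a x)" for n
  proof -
    have z: "Lp_norm p \<omega>0 (\<lambda>x. \<Phi> (s n) x - \<Psi> (s n) x) = 0"
      using Qs[of n] by (subst Lp_norm_eq_0[OF p w0 Lp_norm_diff(1)[OF p w0 mem[OF s]]]) simp
    have "Lp_norm p \<omega>0 (\<lambda>x. \<Phi> a x - \<Psi> a x) \<le> Lp_norm p \<omega>0 (\<lambda>x. \<Phi> a x - \<Phi> (s n) x) + Lp_norm p \<omega>0 (\<lambda>x. \<Phi> (s n) x - \<Psi> a x)"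
      by (rule Lp_norm_diff_triangle[OF p w0 mem(1)[OF a] mem(1)[OF s] mem(2)[OF a]])
    also have "Lp_norm p \<omega>0 (\<lambda>x. \<Phi> (s n) x - \<Psi> a x) \<le> Lp_norm p \<omega>0 (\<lambda>x. \<Phi> (s n) x - \<Psi> (s n) x) + Lp_norm p \<omega>0 (\<lambda>x. \<Psi> (s n) x - \<Psi> a x)"
      by (rule Lp_norm_diff_triangle[OF p w0 mem(1)[OF s] mem(2)[OF s] mem(2)[OF a]])
    finally show ?thesis using z by (simp add: Lp_norm_swap[of p \<omega>0 "\<Phi> a" "\<Phi> (s n)"])
  qed
  have "Lp_norm p \<omega>0 (\<lambda>x. \<Phi> a x - \<Psi> a x) \<le> 0 + 0"
    by (rule LIMSEQ_le_const[OF tendsto_add[OF lP lQ]]) (use le in blast)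
  then have "Lp_norm p \<omega>0 (\<lambda>x. \<Phi> a x - \<Psi> a x) = 0" using Lp_norm_nonneg[OF p, of \<omega>0 "\<lambda>x. \<Phi> a x - \<Psi> a x"] by simp
  then show "AE X in lebesgue. \<Phi> a X = \<Psi> a X"
    by (subst (asm) Lp_norm_eq_0[OF p w0 Lp_norm_diff(1)[OF p w0 mem[OF a]]]) simp
qed (rule eq)

lemma unique_weak_star_extension:
  fixes \<omega> \<omega>0 :: "'d::finite phase_space \<Rightarrow> real"
  assumes mod: "poly_moderate \<omega>" and mod0: "poly_moderate \<omega>0"
    and \<Phi>: "continuous_map (weak_star_topology \<omega>) (weak_star_topology \<omega>0) \<Phi>" and \<Psi>: "continuous_map (weak_star_topology \<omega>) (weak_star_topology \<omega>0) \<Psi>"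
    and eq: "\<And>a. a \<in> Schwartz \<Longrightarrow> AE X in lebesgue. \<Phi> a X = \<Psi> a X" and a: "a \<in> Lp_space \<infinity> \<omega>"
  shows "AE X in lebesgue. \<Phi> a X = \<Psi> a X"
proof (rule dominated_density[OF _ mod _ _ a])
  have w: "\<omega> \<in> borel_measurable lebesgue" "\<And>x. 0 < \<omega> x" and w0: "\<omega>0 \<in> borel_measurable lebesgue" "\<And>x. 0 < \<omega>0 x"
    using mod mod0 by (auto simp: poly_moderate_def)
  have mem: "\<Phi> a \<in> Lp_space \<infinity> \<omega>0" "\<Psi> a \<in> Lp_space \<infinity> \<omega>0" if "a \<in> Lp_space \<infinity> \<omega>" for a
    using that continuous_map_funspace[OF \<Phi>] continuous_map_funspace[OF \<Psi>] by auto
  fix s a D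
  assume Qs: "\<And>n::nat. AE X in lebesgue. \<Phi> (s n) X = \<Psi> (s n) X" and s: "\<And>n. s n \<in> Lp_space \<infinity> \<omega>" and a: "a \<in> Lp_space \<infinity> \<omega>"
    and D: "D \<in> Lp_space \<infinity> \<omega>" and lim: "AE x in lebesgue. (\<lambda>n. s n x) \<longlonglongrightarrow> a x" and dom: "\<And>n. AE x in lebesgue. cmod (s n x) \<le> cmod (D x)"
  have sa: "limitin (weak_star_topology \<omega>) s a sequentially"
    by (rule weak_star_dominated_convergence[OF w D a s lim dom])
  show "AE X in lebesgue. \<Phi> a X = \<Psi> a X"
  proof (rule weak_star_separates[OF w0 mem[OF a]])
    fix g :: "'d phase_space \<Rightarrow> complex" assume g: "g \<in> Lp_space 1 (\<lambda>x. 1 / \<omega>0 x)"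
    have l1: "(\<lambda>n. LINT x|lebesgue. \<Phi> (s n) x * g x) \<longlonglongrightarrow> (LINT x|lebesgue. \<Phi> a x * g x)"
      using limitin_weak_star_integral[OF continuous_map_limit[OF \<Phi> sa] g] by (simp add: comp_def)
    have l2: "(\<lambda>n. LINT x|lebesgue. \<Psi> (s n) x * g x) \<longlonglongrightarrow> (LINT x|lebesgue. \<Psi> a x * g x)"
      using limitin_weak_star_integral[OF continuous_map_limit[OF \<Psi> sa] g] by (simp add: comp_def)
    have "(LINT x|lebesgue. \<Phi> (s n) x * g x) = (LINT x|lebesgue. \<Psi> (s n) x * g x)" for n
    proof (rule integral_cong_AE)
      show "(\<lambda>x. \<Phi> (s n) x * g x) \<in> borel_measurable lebesgue" "(\<lambda>x. \<Psi> (s n) x * g x) \<in> borel_measurable lebesgue"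
        using mem[OF s, THEN Lp_space_measurable] Lp_space_measurable[OF g] by simp_all
      show "AE x in lebesgue. \<Phi> (s n) x * g x = \<Psi> (s n) x * g x" using Qs[of n] by eventually_elim simp
    qed
    then show "(LINT x|lebesgue. \<Phi> a x * g x) = (LINT x|lebesgue. \<Psi> a x * g x)"
      using LIMSEQ_unique[OF l1] l2 by simp
  qed
qed (use eq in auto)

section \<open>Continuity of twisted convolution\<close>

text \<open>Fubini's theorem, with \<open>h(Z) = \<integral> A(X-Z) exp(i c \<sigma>(X,Z)) g(X) dX\<close>. Absolute convergence follows from
\<open>1/\<omega>\<^sub>1(Z) \<le> C \<omega>\<^sub>2(X-Z) / \<omega>\<^sub>0(X)\<close>. The frequency \<open>c\<close> is left free so that the statement serves both arguments
of the twisted convolution.\<close>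

lemma weak_star_adjoint:
  fixes \<omega>0 \<omega>1 \<omega>2 :: "'d::finite phase_space \<Rightarrow> real"
  assumes mod: "poly_moderate \<omega>0" "poly_moderate \<omega>1" "poly_moderate \<omega>2"
    and C: "\<And>X1 X2. \<omega>0 (X1 + X2) \<le> C * \<omega>1 X1 * \<omega>2 X2"
    and A: "A \<in> Lp_space 1 \<omega>2" and g: "g \<in> Lp_space 1 (\<lambda>x. 1 / \<omega>0 x)"
  obtains h where "h \<in> Lp_space 1 (\<lambda>x. 1 / \<omega>1 x)"
    "\<And>B. B \<in> Lp_space \<infinity> \<omega>1 \<Longrightarrow> (LINT X|lebesgue. (LINT Z|lebesgue. B Z * A (X - Z) * cis (c * sympl X Z)) * g X) = (LINT Z|lebesgue. B Z * h Z)"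
proof -
  let ?L = "\<lambda>B X. LINT Z|lebesgue. B Z * A (X - Z) * cis (c * sympl X Z)"
  obtain v0 v1 v2 N0 N1 N2 c0 C' where v: "regular_weight N0 v0" "regular_weight N1 v1" "regular_weight N2 v2"
    and v0: "1 \<le> c0" "\<And>X. \<omega>0 X \<le> c0 * v0 X" and v1: "\<And>X. v1 X \<le> \<omega>1 X" and v2: "\<And>X. v2 X \<le> \<omega>2 X"
    and C'0: "0 \<le> C'" and C': "\<And>X Y. v0 (X + Y) \<le> C' * v1 X * v2 Y"
    by (rule regular_weights_submultiplicative[OF mod C]) (rule that)
  have wm: "\<omega>0 \<in> borel_measurable lebesgue" "\<omega>1 \<in> borel_measurable lebesgue" "\<omega>2 \<in> borel_measurable lebesgue"
    and wp: "\<And>X. 0 < \<omega>0 X" "\<And>X. 0 < \<omega>1 X" "\<And>X. 0 < \<omega>2 X"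
    using mod by (auto simp: poly_moderate_def)
  have vp: "\<And>X. 0 < v0 X" "\<And>X. 0 < v1 X" "\<And>X. 0 < v2 X" and vc: "continuous_on UNIV v0" "continuous_on UNIV v1" "continuous_on UNIV v2"
    using v by (auto simp: regular_weight_def)
  have vm[measurable]: "v0 \<in> borel_measurable borel" "v1 \<in> borel_measurable borel" "v2 \<in> borel_measurable borel"
    using vc by (auto intro: borel_measurable_continuous_onI)
  obtain A' where A'[measurable]: "A' \<in> borel_measurable borel" and aeA: "AE X in lborel. A X = A' X"
    by (rule Lebesgue_Borel_representative[OF Lp_space_measurable[OF A]])
  obtain G where G[measurable]: "G \<in> borel_measurable borel" and aeG: "AE X in lborel. g X = G X"
    by (rule Lebesgue_Borel_representative[OF Lp_space_measurable[OF g]])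
  let ?A = "\<lambda>X. ennreal (cmod (A' X) * v2 X)" and ?G = "\<lambda>X. ennreal (cmod (G X) / v0 X)"
  let ?L' = "\<lambda>B X. LINT Z|lborel. B Z * A' (X - Z) * cis (c * sympl X Z)"
  have IA: "(\<integral>\<^sup>+X. ennreal (cmod (A' X) * v2 X) \<partial>lborel) < \<infinity>"
  proof -
    have "integrable lebesgue (\<lambda>X. cmod (A X * of_real (\<omega>2 X)) powr 1)" using A by (simp add: Lp_space_def one_ereal_def)
    then have "(\<integral>\<^sup>+X. ennreal (cmod (A X) * \<omega>2 X) \<partial>lebesgue) < \<infinity>"
      using wp(3) unfolding integrable_iff_bounded by (simp add: norm_mult less_imp_le)
    moreover have "(\<integral>\<^sup>+X. ennreal (cmod (A' X) * v2 X) \<partial>lebesgue) \<le> (\<integral>\<^sup>+X. ennreal (cmod (A X) * \<omega>2 X) \<partial>lebesgue)"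
      using AE_completion[OF aeA] v2 by (intro nn_integral_mono_AE) (auto elim!: eventually_mono intro!: ennreal_leI mult_left_mono)
    ultimately show ?thesis by (simp add: nn_integral_completion)
  qed
  have IG: "(\<integral>\<^sup>+X. ?G X \<partial>lborel) < \<infinity>"
  proof -
    have "integrable lebesgue (\<lambda>X. cmod (g X * of_real (1 / \<omega>0 X)) powr 1)" using g by (simp add: Lp_space_def one_ereal_def)
    then have i: "integrable lebesgue (\<lambda>X. c0 * (cmod (g X) / \<omega>0 X))"
      using wp(1) by (intro integrable_mult_right) (simp add: norm_mult norm_divide less_imp_le)
    then have "(\<integral>\<^sup>+X. ennreal (c0 * (cmod (g X) / \<omega>0 X)) \<partial>lebesgue) < \<infinity>"
      using wp(1) v0(1) unfolding integrable_iff_bounded by (simp add: abs_mult less_imp_le)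
    moreover have "(\<integral>\<^sup>+X. ?G X \<partial>lebesgue) \<le> (\<integral>\<^sup>+X. ennreal (c0 * (cmod (g X) / \<omega>0 X)) \<partial>lebesgue)"
    proof (rule nn_integral_mono_AE)
      show "AE X in lebesgue. ?G X \<le> ennreal (c0 * (cmod (g X) / \<omega>0 X))"
        using AE_completion[OF aeG]
      proof eventually_elim
        case (elim X)
        have "1 / v0 X \<le> c0 / \<omega>0 X" using v0(2)[of X] vp(1)[of X] wp(1)[of X] by (simp add: field_simps)
        from mult_left_mono[OF this norm_ge_zero[of "g X"]] show ?case using elim by (intro ennreal_leI) (simp add: mult.commute)
      qed
    qed
    ultimately show ?thesis by (simp add: nn_integral_completion)
  qed
  have dom: "cmod (A' (X - Z)) * cmod (G X) / v1 Z \<le> C' * ((cmod (A' (X - Z)) * v2 (X - Z)) * (cmod (G X) / v0 X))" for X Z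
  proof -
    have "v0 X \<le> C' * v1 Z * v2 (X - Z)" using C'[of Z "X - Z"] by simp
    then have "1 / v1 Z \<le> C' * v2 (X - Z) / v0 X" using vp(1)[of X] vp(2)[of Z] by (simp add: field_simps)
    from mult_left_mono[OF this, of "cmod (A' (X - Z)) * cmod (G X)"] show ?thesis by (simp add: mult_ac)
  qed
  have fin: "(\<integral>\<^sup>+z. ennreal (cmod (A' (fst z - snd z)) * cmod (G (fst z)) / v1 (snd z)) \<partial>lborel) < \<infinity>"
  proof -
    have "(\<integral>\<^sup>+z. ennreal (cmod (A' (fst z - snd z)) * cmod (G (fst z)) / v1 (snd z)) \<partial>lborel)
      \<le> (\<integral>\<^sup>+z. ennreal C' * (ennreal (cmod (A' (fst z - snd z)) * v2 (fst z - snd z)) * ennreal (cmod (G (fst z)) / v0 (fst z))) \<partial>lborel)"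
      using dom C'0 vp by (intro nn_integral_mono) (simp add: less_imp_le ennreal_leI flip: ennreal_mult)
    also have "\<dots> = (\<integral>\<^sup>+X. (\<integral>\<^sup>+Z. (ennreal C' * ?G X) * ?A (X - Z) \<partial>lborel) \<partial>lborel)"
      by (subst lborel_Tonelli_fst) (simp_all add: mult_ac)
    also have "\<dots> = (\<integral>\<^sup>+X. (ennreal C' * ?G X) * (\<integral>\<^sup>+Z. ?A Z \<partial>lborel) \<partial>lborel)"
    proof (rule nn_integral_cong)
      fix X
      show "(\<integral>\<^sup>+Z. (ennreal C' * ?G X) * ?A (X - Z) \<partial>lborel)
        = (ennreal C' * ?G X) * (\<integral>\<^sup>+Z. ?A Z \<partial>lborel)"
        by (subst nn_integral_cmult) (simp_all add: nn_integral_lborel_reflect[of "\<lambda>Z. ?A Z" X])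
    qed
    also have "\<dots> = ennreal C' * (\<integral>\<^sup>+X. ?G X \<partial>lborel) * (\<integral>\<^sup>+Z. ?A Z \<partial>lborel)"
      by (simp add: nn_integral_multc nn_integral_cmult)
    also have "\<dots> < \<infinity>" using IA IG by (simp add: ennreal_mult_less_top)
    finally show ?thesis .
  qed
  define k where "k z = A' (fst z - snd z) * cis (c * sympl (fst z) (snd z)) * G (fst z)" for z
  have km[measurable]: "k \<in> borel_measurable borel" unfolding k_def by measurable
  define h where "h Z = (LINT X|lborel. k (X, Z))" for Z
  have k1: "integrable lborel (\<lambda>z. k z * of_real (1 / v1 (snd z)))"
    unfolding integrable_iff_bounded
  proof
    have "(\<integral>\<^sup>+z. ennreal (norm (k z * of_real (1 / v1 (snd z)))) \<partial>lborel) = (\<integral>\<^sup>+z. ennreal (cmod (A' (fst z - snd z)) * cmod (G (fst z)) / v1 (snd z)) \<partial>lborel)"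
      using vp(2) by (intro nn_integral_cong) (simp add: k_def norm_mult norm_divide less_imp_le)
    then show "(\<integral>\<^sup>+z. ennreal (norm (k z * of_real (1 / v1 (snd z)))) \<partial>lborel) < \<infinity>" using fin by simp
  qed measurable
  have hint: "integrable lborel (\<lambda>Z. h Z * of_real (1 / v1 Z))"
    using lborel_integrable_snd[OF k1] by (simp add: h_def)
  have hm[measurable]: "h \<in> borel_measurable borel"
  proof -
    have "(\<lambda>Z. (h Z * of_real (1 / v1 Z)) * of_real (v1 Z)) \<in> borel_measurable borel"
      using borel_measurable_integrable[OF hint] by measurable
    moreover have "(h Z * of_real (1 / v1 Z)) * of_real (v1 Z) = h Z" for Z using vp(2)[of Z] by simp
    ultimately show ?thesis by simp
  qed
  show ?thesis
  proof (rule that[of h])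
    have "integrable lebesgue (\<lambda>Z. cmod (h Z * of_real (1 / \<omega>1 Z)) powr 1)"
    proof (rule Bochner_Integration.integrable_bound)
      show "integrable lebesgue (\<lambda>Z. h Z * of_real (1 / v1 Z))" using hint by (subst integrable_completion) auto
      show "(\<lambda>Z. cmod (h Z * of_real (1 / \<omega>1 Z)) powr 1) \<in> borel_measurable lebesgue"
        using wm(2) measurable_completion[of h lborel borel] by simp
      show "AE Z in lebesgue. norm (cmod (h Z * of_real (1 / \<omega>1 Z)) powr 1) \<le> norm (h Z * of_real (1 / v1 Z))"
      proof (rule AE_I2)
        fix Z
        have "1 / \<omega>1 Z \<le> 1 / v1 Z" using v1[of Z] vp(2)[of Z] by (intro divide_left_mono) (auto intro: mult_pos_pos wp)
        from mult_left_mono[OF this norm_ge_zero[of "h Z"]]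
        show "norm (cmod (h Z * of_real (1 / \<omega>1 Z)) powr 1) \<le> norm (h Z * of_real (1 / v1 Z))"
          using vp(2)[of Z] wp(2)[of Z] by (simp add: norm_mult norm_divide)
      qed
    qed
    then show "h \<in> Lp_space 1 (\<lambda>x. 1 / \<omega>1 x)"
      using measurable_completion[of h lborel borel] by (simp add: Lp_space_def one_ereal_def)
    fix B assume B: "B \<in> Lp_space \<infinity> \<omega>1"
    obtain b where b: "0 < b" "AE X in lebesgue. cmod (B X) * \<omega>1 X \<le> b" by (rule Linfty_bound[OF wm(2) wp(2) B])
    obtain B0 where B0[measurable]: "B0 \<in> borel_measurable borel" and aeB0: "AE X in lborel. B X = B0 X"
      by (rule Lebesgue_Borel_representative[OF Lp_space_measurable[OF B]])
    define B' where "B' X = (if cmod (B0 X) * v1 X \<le> b then B0 X else 0)" for X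
    have B'[measurable]: "B' \<in> borel_measurable borel" unfolding B'_def by measurable
    have B'b: "cmod (B' X) \<le> b / v1 X" for X using b(1) vp(2)[of X] by (simp add: B'_def pos_le_divide_eq)
    have "AE X in lborel. cmod (B X) * \<omega>1 X \<le> b" using b(2) by (simp add: AE_completion_iff)
    then have aeB: "AE X in lborel. B X = B' X"
      using aeB0
    proof eventually_elim
      case (elim X)
      have "cmod (B X) * v1 X \<le> cmod (B X) * \<omega>1 X" by (intro mult_left_mono v1) auto
      then show ?case using elim by (simp add: B'_def)
    qed
    have inner: "(?L B X) = (?L' B' X)" for X
    proof (rule integral_lebesgue_cong_Borel(1))
      show "AE Z in lborel. B Z * A (X - Z) * cis (c * sympl X Z) = B' Z * A' (X - Z) * cis (c * sympl X Z)"
        using aeB AE_lborel_reflect[OF aeA, of X] by eventually_elim simp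
    qed simp
    have "(LINT X|lebesgue. (?L B X) * g X)
       = (LINT X|lborel. (?L' B' X) * G X)"
      unfolding inner
    proof (rule integral_lebesgue_cong_Borel(1))
      show "AE X in lborel. (?L' B' X) * g X = (?L' B' X) * G X"
        using aeG by eventually_elim simp
      have "(\<lambda>z. B' (snd z) * A' (fst z - snd z) * cis (c * sympl (fst z) (snd z))) \<in> borel_measurable borel" by measurable
      then have "(\<lambda>(X, Z). B' Z * A' (X - Z) * cis (c * sympl X Z)) \<in> borel_measurable (borel \<Otimes>\<^sub>M lborel)"
        by (simp add: borel_prod case_prod_beta)
      from lborel.borel_measurable_lebesgue_integral[OF this]
      show "(\<lambda>X. (?L' B' X) * G X) \<in> borel_measurable borel" by simp
    qed
    also have "\<dots> = (LINT X|lborel. LINT Z|lborel. B' Z * k (X, Z))"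
      by (intro Bochner_Integration.integral_cong refl) (simp add: k_def mult.assoc flip: integral_mult_left_zero)
    also have "\<dots> = (LINT Z|lborel. LINT X|lborel. B' Z * k (X, Z))"
    proof -
      have "integrable lborel (\<lambda>z. B' (snd z) * k z)"
      proof (rule Bochner_Integration.integrable_bound)
        show "integrable lborel (\<lambda>z. of_real b * (k z * of_real (1 / v1 (snd z))))" using k1 by (rule integrable_mult_right)
        show "AE z in lborel. norm (B' (snd z) * k z) \<le> norm (of_real b * (k z * of_real (1 / v1 (snd z))))"
        proof (rule AE_I2)
          fix z
          have "cmod (B' (snd z)) * cmod (k z) \<le> b / v1 (snd z) * cmod (k z)" by (intro mult_right_mono B'b) auto
          then show "norm (B' (snd z) * k z) \<le> norm (of_real b * (k z * of_real (1 / v1 (snd z))))"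
            using b(1) vp(2)[of "snd z"] by (simp add: norm_mult norm_divide abs_mult)
        qed
      qed simp
      from lborel_Fubini_fst[OF this] lborel_Fubini_snd[OF this] show ?thesis by simp
    qed
    also have "\<dots> = (LINT Z|lborel. B' Z * h Z)" by (simp add: h_def)
    also have "\<dots> = (LINT Z|lebesgue. B Z * h Z)"
    proof (rule integral_lebesgue_cong_Borel(1)[symmetric])
      show "AE Z in lborel. B Z * h Z = B' Z * h Z" using aeB by eventually_elim simp
    qed simp
    finally show "(LINT X|lebesgue. (?L B X) * g X) = (LINT Z|lebesgue. B Z * h Z)" .
  qed
qed

lemma twisted_conv_Schwartz:
  fixes a1 a2 :: "'d::finite phase_space \<Rightarrow> complex"
  assumes a: "a1 \<in> Schwartz" "a2 \<in> Schwartz"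
  shows "twisted_conv a1 a2 \<in> Schwartz"
proof -
  have [measurable]: "a1 \<in> borel_measurable borel" "a2 \<in> borel_measurable borel" using a by (auto intro: Schwartz_measurable)
  have "(\<lambda>Y. tc_const TYPE('d) * a2 Y) \<in> rapidly_decaying"
    by (rule rapidly_decaying_mult[OF Schwartz_rapidly_decaying[OF a(2)], where C = "cmod (tc_const TYPE('d))" and m = 0]) auto
  from tconv_Schwartz[OF a(1) this, of 2] have "tconv 2 a1 (\<lambda>Y. tc_const TYPE('d) * a2 Y) \<in> Schwartz" .
  moreover have "twisted_conv a1 a2 = tconv 2 a1 (\<lambda>Y. tc_const TYPE('d) * a2 Y)"
  proof
    fix X
    have "twisted_conv a1 a2 X = tc_const TYPE('d) * tconv 2 a1 a2 X" by (rule twisted_conv_eq_tconv) auto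
    also have "\<dots> = tconv 2 a1 (\<lambda>Y. tc_const TYPE('d) * a2 Y) X"
      unfolding tconv_def integral_mult_right_zero[symmetric] by (simp add: mult_ac)
    finally show "twisted_conv a1 a2 X = tconv 2 a1 (\<lambda>Y. tc_const TYPE('d) * a2 Y) X" .
  qed
  ultimately show ?thesis by simp
qed

text \<open>With \<open>1/p' = 1 - 1/p\<close> the hypothesis on the maximum contains \<open>1 \<le> 1/p\<^sub>1 + 1/p\<^sub>2\<close>. If \<open>p\<^sub>1\<close> is infinite, this forces \<open>p\<^sub>2 = 1\<close>.\<close>

lemma exponent_region:
  fixes p p' p1 p2 :: ereal
  assumes p: "1 \<le> p" "1 \<le> p1" "1 \<le> p2" "1 \<le> p'" and conj: "1 / p + 1 / p' = 1" and le: "p1 \<le> p" "p2 \<le> p"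
    and lower: "max (1 / p) (1 / p') \<le> 1 / p1 + 1 / p2 - 1 / p" and upper: "1 / p1 + 1 / p2 - 1 / p \<le> 1"
  defines "x \<equiv> real_of_ereal (1 / p1)" and "y \<equiv> real_of_ereal (1 / p2)" and "z \<equiv> real_of_ereal (1 / p)"
  shows "z \<le> x" "z \<le> y" "1 \<le> x + y" "x + y \<le> 1 + z" and "p1 = \<infinity> \<Longrightarrow> p2 = 1 \<and> p = \<infinity>" "p2 = \<infinity> \<Longrightarrow> p1 = 1 \<and> p = \<infinity>"
proof -
  have e: "1 / q = ereal (real_of_ereal (1 / q))" if "1 \<le> q" for q :: ereal
    using that by (cases rule: Lp_exponent_cases) (auto simp: one_ereal_def divide_ereal_def inverse_eq_divide)
  define w where "w = real_of_ereal (1 / p')"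
  have E: "1 / p = ereal z" "1 / p1 = ereal x" "1 / p2 = ereal y" "1 / p' = ereal w"
    unfolding x_def y_def z_def w_def by (rule e[OF p(1)] e[OF p(2)] e[OF p(3)] e[OF p(4)])+
  have zw: "z + w = 1" using conj unfolding E by (simp add: one_ereal_def)
  have "w \<le> x + y - z" using lower unfolding E by simp
  then show xy: "1 \<le> x + y" using zw by simp
  show "x + y \<le> 1 + z" using upper unfolding E by (simp add: one_ereal_def)
  have inv: "real_of_ereal (1 / b) \<le> real_of_ereal (1 / a)" if "1 \<le> a" "a \<le> b" for a b :: ereal
  proof -
    have "1 \<le> b" using that by (rule order_trans)
    then show ?thesis using that
      by (cases a; cases b) (auto simp: one_ereal_def divide_ereal_def inverse_eq_divide frac_le)
  qed
  show "z \<le> x" "z \<le> y" unfolding x_def y_def z_def by (rule inv[OF p(2) le(1)] inv[OF p(3) le(2)])+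
  have one: "a = 1" if "1 \<le> a" "1 \<le> real_of_ereal (1 / a)" for a :: ereal
    using that(1) that(2) by (cases rule: Lp_exponent_cases) (auto simp: one_ereal_def)
  show "p2 = 1 \<and> p = \<infinity>" if "p1 = \<infinity>"
    using one[OF p(3)] xy le that by (simp add: x_def y_def)
  show "p1 = 1 \<and> p = \<infinity>" if "p2 = \<infinity>"
    using one[OF p(2)] xy le that by (simp add: x_def y_def)
qed

lemma twisted_conv_diff:
  fixes a1 a2 b1 b2 :: "'d::finite phase_space \<Rightarrow> complex"
  assumes "integrable lebesgue (\<lambda>Y. b1 (X - Y) * b2 Y * exp (2 * \<i> * of_real (sympl X Y)))"
    "integrable lebesgue (\<lambda>Y. a1 (X - Y) * b2 Y * exp (2 * \<i> * of_real (sympl X Y)))"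
    "integrable lebesgue (\<lambda>Y. a1 (X - Y) * a2 Y * exp (2 * \<i> * of_real (sympl X Y)))"
  shows "twisted_conv b1 b2 X - twisted_conv a1 a2 X = twisted_conv (\<lambda>Y. b1 Y - a1 Y) b2 X + twisted_conv a1 (\<lambda>Y. b2 Y - a2 Y) X"
  using assms unfolding twisted_conv_def
  by (simp add: left_diff_distrib right_diff_distrib)

text \<open>A bounded bilinear map is continuous. Bilinearity is needed only in the form of the usual splitting of a difference
of products, and only almost everywhere, as an integral operator provides it.\<close>

lemma continuous_map_Lp_bilinear:
  fixes T :: "('a::euclidean_space \<Rightarrow> complex) \<Rightarrow> ('a \<Rightarrow> complex) \<Rightarrow> 'a \<Rightarrow> complex"
  assumes p: "1 \<le> p" "1 \<le> p1" "1 \<le> p2"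
    and w0: "\<omega>0 \<in> borel_measurable lebesgue" "\<And>x. 0 < \<omega>0 x"
    and w1: "\<omega>1 \<in> borel_measurable lebesgue" "\<And>x. 0 < \<omega>1 x"
    and w2: "\<omega>2 \<in> borel_measurable lebesgue" "\<And>x. 0 < \<omega>2 x"
    and M: "0 < M" and mem: "\<And>a b. a \<in> Lp_space p1 \<omega>1 \<Longrightarrow> b \<in> Lp_space p2 \<omega>2 \<Longrightarrow> T a b \<in> Lp_space p \<omega>0"
    and bound: "\<And>a b. a \<in> Lp_space p1 \<omega>1 \<Longrightarrow> b \<in> Lp_space p2 \<omega>2 \<Longrightarrow> Lp_norm p \<omega>0 (T a b) \<le> M * Lp_norm p1 \<omega>1 a * Lp_norm p2 \<omega>2 b"
    and diff: "\<And>a b a' b'. a \<in> Lp_space p1 \<omega>1 \<Longrightarrow> b \<in> Lp_space p2 \<omega>2 \<Longrightarrow> a' \<in> Lp_space p1 \<omega>1 \<Longrightarrow> b' \<in> Lp_space p2 \<omega>2 \<Longrightarrow>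
      AE x in lebesgue. T a' b' x - T a b x = T (\<lambda>x. a' x - a x) b' x + T a (\<lambda>x. b' x - b x) x"
  shows "continuous_map (prod_topology (Lp_topology p1 \<omega>1) (Lp_topology p2 \<omega>2)) (Lp_topology p \<omega>0) (\<lambda>(a, b). T a b)"
proof -
  have est: "Lp_norm p \<omega>0 (\<lambda>x. T a' b' x - T a b x) \<le> M * Lp_norm p1 \<omega>1 (\<lambda>x. a' x - a x) * Lp_norm p2 \<omega>2 b' + M * Lp_norm p1 \<omega>1 a * Lp_norm p2 \<omega>2 (\<lambda>x. b' x - b x)"
    if a: "a \<in> Lp_space p1 \<omega>1" "a' \<in> Lp_space p1 \<omega>1" and b: "b \<in> Lp_space p2 \<omega>2" "b' \<in> Lp_space p2 \<omega>2" for a b a' b'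
  proof -
    have da: "(\<lambda>x. a' x - a x) \<in> Lp_space p1 \<omega>1" by (rule Lp_norm_diff(1)[OF p(2) w1 a(2,1)])
    have db: "(\<lambda>x. b' x - b x) \<in> Lp_space p2 \<omega>2" by (rule Lp_norm_diff(1)[OF p(3) w2 b(2,1)])
    let ?s = "\<lambda>x. T (\<lambda>x. a' x - a x) b' x + T a (\<lambda>x. b' x - b x) x"
    have s: "?s \<in> Lp_space p \<omega>0" by (rule Lp_norm_triangle(1)[OF p(1) w0 mem[OF da b(2)] mem[OF a(1) db]])
    have "Lp_norm p \<omega>0 (\<lambda>x. T a' b' x - T a b x) \<le> 1 * Lp_norm p \<omega>0 ?s"
    proof (rule Lp_space_bounded_mult(2)[OF p(1) w0 w0 s])
      show "(\<lambda>x. T a' b' x - T a b x) \<in> borel_measurable lebesgue"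
        by (rule Lp_space_measurable[OF Lp_norm_diff(1)[OF p(1) w0 mem[OF a(2) b(2)] mem[OF a(1) b(1)]]])
      show "AE x in lebesgue. cmod (T a' b' x - T a b x) * \<omega>0 x \<le> 1 * (cmod (?s x) * \<omega>0 x)"
        using diff[OF a(1) b(1) a(2) b(2)] by eventually_elim simp
    qed simp
    also have "Lp_norm p \<omega>0 ?s \<le> Lp_norm p \<omega>0 (T (\<lambda>x. a' x - a x) b') + Lp_norm p \<omega>0 (T a (\<lambda>x. b' x - b x))"
      by (rule Lp_norm_triangle(2)[OF p(1) w0 mem[OF da b(2)] mem[OF a(1) db]])
    finally show ?thesis using bound[OF da b(2)] bound[OF a(1) db] by simp
  qed
  show ?thesis
    unfolding Lp_topology_def[of p]
  proof (rule continuous_on_generated_topo)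
    fix U assume "U \<in> {{g \<in> Lp_space p \<omega>0. Lp_norm p \<omega>0 (\<lambda>x. g x - f x) < r} | f r. f \<in> Lp_space p \<omega>0 \<and> 0 < r}"
    then obtain f r where U: "U = {g \<in> Lp_space p \<omega>0. Lp_norm p \<omega>0 (\<lambda>x. g x - f x) < r}" and f: "f \<in> Lp_space p \<omega>0" by blast
    show "openin (prod_topology (Lp_topology p1 \<omega>1) (Lp_topology p2 \<omega>2)) ((\<lambda>(a, b). T a b) -` U \<inter> topspace (prod_topology (Lp_topology p1 \<omega>1) (Lp_topology p2 \<omega>2)))"
      unfolding openin_prod_topology_alt
    proof (intro allI impI)
      fix a b assume "(a, b) \<in> (\<lambda>(a, b). T a b) -` U \<inter> topspace (prod_topology (Lp_topology p1 \<omega>1) (Lp_topology p2 \<omega>2))"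
      then have ab: "a \<in> Lp_space p1 \<omega>1" "b \<in> Lp_space p2 \<omega>2" and lt: "Lp_norm p \<omega>0 (\<lambda>x. T a b x - f x) < r" using p by (auto simp: U)
      define d where "d = r - Lp_norm p \<omega>0 (\<lambda>x. T a b x - f x)"
      define n1 n2 where "n1 = Lp_norm p1 \<omega>1 a" and "n2 = Lp_norm p2 \<omega>2 b"
      have n: "0 \<le> n1" "0 \<le> n2" using Lp_norm_nonneg p by (auto simp: n1_def n2_def)
      have d: "0 < d" using lt by (simp add: d_def)
      define K where "K = M * (n1 + n2 + 1)"
      have K: "0 < K" unfolding K_def using M n by (intro mult_pos_pos) auto
      define e where "e = min 1 (d / (2 * K))"
      have e: "0 < e" "e \<le> 1" "e * K < d"
      proof -
        show "0 < e" "e \<le> 1" using d K by (auto simp: e_def)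
        have "e * K \<le> d / (2 * K) * K" using K by (intro mult_right_mono) (auto simp: e_def)
        also have "\<dots> = d / 2" using K by simp
        finally show "e * K < d" using d by simp
      qed
      let ?U = "{g \<in> Lp_space p1 \<omega>1. Lp_norm p1 \<omega>1 (\<lambda>x. g x - a x) < e}" and ?V = "{g \<in> Lp_space p2 \<omega>2. Lp_norm p2 \<omega>2 (\<lambda>x. g x - b x) < e}"
      have sub: "T a' b' \<in> U" if ab': "a' \<in> ?U" "b' \<in> ?V" for a' b'
      proof -
        have m: "a' \<in> Lp_space p1 \<omega>1" "b' \<in> Lp_space p2 \<omega>2" and l: "Lp_norm p1 \<omega>1 (\<lambda>x. a' x - a x) \<le> e" "Lp_norm p2 \<omega>2 (\<lambda>x. b' x - b x) \<le> e" using ab' by auto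
        have "Lp_norm p2 \<omega>2 (\<lambda>x. (b' x - b x) + b x) \<le> Lp_norm p2 \<omega>2 (\<lambda>x. b' x - b x) + n2"
          unfolding n2_def by (rule Lp_norm_triangle(2)[OF p(3) w2 Lp_norm_diff(1)[OF p(3) w2 m(2) ab(2)] ab(2)])
        then have nb: "Lp_norm p2 \<omega>2 b' \<le> 1 + n2" using l(2) e(2) by simp
        have "Lp_norm p \<omega>0 (\<lambda>x. T a' b' x - T a b x) \<le> M * Lp_norm p1 \<omega>1 (\<lambda>x. a' x - a x) * Lp_norm p2 \<omega>2 b' + M * n1 * Lp_norm p2 \<omega>2 (\<lambda>x. b' x - b x)"
          unfolding n1_def by (rule est[OF ab(1) m(1) ab(2) m(2)])
        also have "\<dots> \<le> M * e * (1 + n2) + M * n1 * e"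
          using M n e(1) l nb Lp_norm_nonneg[OF p(2)] Lp_norm_nonneg[OF p(3)] by (intro add_mono mult_mono) auto
        also have "\<dots> = e * K" by (simp add: K_def algebra_simps)
        finally have "Lp_norm p \<omega>0 (\<lambda>x. T a' b' x - T a b x) < d" using e(3) by simp
        then have "Lp_norm p \<omega>0 (\<lambda>x. T a' b' x - f x) < r"
          using Lp_norm_diff_triangle[OF p(1) w0 mem[OF m] mem[OF ab] f] by (simp add: d_def)
        then show ?thesis using mem[OF m] by (simp add: U)
      qed
      show "\<exists>U' V. openin (Lp_topology p1 \<omega>1) U' \<and> openin (Lp_topology p2 \<omega>2) V \<and> a \<in> U' \<and> b \<in> V \<and>
          U' \<times> V \<subseteq> (\<lambda>(a, b). T a b) -` U \<inter> topspace (prod_topology (Lp_topology p1 \<omega>1) (Lp_topology p2 \<omega>2))"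
      proof (intro exI conjI)
        show "openin (Lp_topology p1 \<omega>1) ?U" "openin (Lp_topology p2 \<omega>2) ?V" using ab e(1) by (auto intro: openin_Lp_ball)
        show "a \<in> ?U" "b \<in> ?V" using ab e(1) Lp_space_0(2)[OF p(2), of \<omega>1] Lp_space_0(2)[OF p(3), of \<omega>2] by auto
        show "?U \<times> ?V \<subseteq> (\<lambda>(a, b). T a b) -` U \<inter> topspace (prod_topology (Lp_topology p1 \<omega>1) (Lp_topology p2 \<omega>2))"
          using sub p by auto
      qed
    qed
  next
    have "\<Union> {{g \<in> Lp_space p \<omega>0. Lp_norm p \<omega>0 (\<lambda>x. g x - f x) < r} | f r. f \<in> Lp_space p \<omega>0 \<and> 0 < r} = Lp_space p \<omega>0"
      using Lp_topology_topspace[OF p(1), of \<omega>0] unfolding Lp_topology_def topology_generated_by_topspace .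
    then show "(\<lambda>(a, b). T a b) ` topspace (prod_topology (Lp_topology p1 \<omega>1) (Lp_topology p2 \<omega>2)) \<subseteq>
      \<Union> {{g \<in> Lp_space p \<omega>0. Lp_norm p \<omega>0 (\<lambda>x. g x - f x) < r} | f r. f \<in> Lp_space p \<omega>0 \<and> 0 < r}"
      using p mem by auto
  qed
qed

text \<open>The preimage of a subbasic set given by \<open>g\<close> is the subbasic set given by the image \<open>h\<close> of \<open>g\<close> under the adjoint.\<close>

lemma continuous_map_weak_star_adjoint:
  assumes mem: "\<And>B. B \<in> Lp_space \<infinity> \<omega>1 \<Longrightarrow> \<Phi> B \<in> Lp_space \<infinity> \<omega>0"
    and adj: "\<And>g. g \<in> Lp_space 1 (\<lambda>x. 1 / \<omega>0 x) \<Longrightarrow>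
      \<exists>h\<in>Lp_space 1 (\<lambda>x. 1 / \<omega>1 x). \<forall>B\<in>Lp_space \<infinity> \<omega>1. (LINT x|lebesgue. \<Phi> B x * g x) = (LINT x|lebesgue. B x * h x)"
  shows "continuous_map (weak_star_topology \<omega>1) (weak_star_topology \<omega>0) \<Phi>"
  unfolding weak_star_topology_def[of \<omega>0]
proof (rule continuous_on_generated_topo)
  fix V assume "V \<in> {{f \<in> Lp_space \<infinity> \<omega>0. (LINT x|lebesgue. f x * g x) \<in> U} | g U. g \<in> Lp_space 1 (\<lambda>x. 1 / \<omega>0 x) \<and> open U}"
  then obtain g U where V: "V = {f \<in> Lp_space \<infinity> \<omega>0. (LINT x|lebesgue. f x * g x) \<in> U}" and g: "g \<in> Lp_space 1 (\<lambda>x. 1 / \<omega>0 x)" and U: "open U" by blast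
  obtain h where h: "h \<in> Lp_space 1 (\<lambda>x. 1 / \<omega>1 x)" "\<forall>B\<in>Lp_space \<infinity> \<omega>1. (LINT x|lebesgue. \<Phi> B x * g x) = (LINT x|lebesgue. B x * h x)"
    using adj[OF g] by blast
  have "\<Phi> -` V \<inter> topspace (weak_star_topology \<omega>1) = {f \<in> Lp_space \<infinity> \<omega>1. (LINT x|lebesgue. f x * h x) \<in> U}"
    using h(2) mem by (auto simp: V)
  then show "openin (weak_star_topology \<omega>1) (\<Phi> -` V \<inter> topspace (weak_star_topology \<omega>1))"
    using openin_weak_star[OF h(1) U] by simp
next
  have "\<Union> {{f \<in> Lp_space \<infinity> \<omega>0. (LINT x|lebesgue. f x * g x) \<in> U} | g U. g \<in> Lp_space 1 (\<lambda>x. 1 / \<omega>0 x) \<and> open U} = Lp_space \<infinity> \<omega>0"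
    using weak_star_topspace[of \<omega>0] unfolding weak_star_topology_def topology_generated_by_topspace .
  then show "\<Phi> ` topspace (weak_star_topology \<omega>1) \<subseteq> \<Union> {{f \<in> Lp_space \<infinity> \<omega>0. (LINT x|lebesgue. f x * g x) \<in> U} | g U. g \<in> Lp_space 1 (\<lambda>x. 1 / \<omega>0 x) \<and> open U}"
    using mem by auto
qed

lemma integral_lebesgue_reflect:
  fixes f :: "'a::euclidean_space \<Rightarrow> complex"
  assumes "f \<in> borel_measurable lebesgue"
  shows "(LINT Y|lebesgue. f Y) = (LINT Z|lebesgue. f (X - Z))"
proof -
  obtain F where F[measurable]: "F \<in> borel_measurable borel" and ae: "AE x in lborel. f x = F x"
    by (rule Lebesgue_Borel_representative[OF assms])
  have "(LINT Y|lebesgue. f Y) = (LINT Y|lborel. F Y)" by (rule integral_lebesgue_cong_Borel(1)[OF ae F])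
  also have "\<dots> = (LINT Z|lborel. F (X - Z))" by (rule integral_lborel_reflect[symmetric]) simp
  also have "\<dots> = (LINT Z|lebesgue. f (X - Z))"
    by (rule integral_lebesgue_cong_Borel(1)[symmetric]) (use AE_lborel_reflect[OF ae] in simp_all)
  finally show ?thesis .
qed

lemma L1_space_scale:
  assumes "h \<in> Lp_space 1 \<omega>" shows "(\<lambda>x. c * h x) \<in> Lp_space 1 \<omega>"
proof -
  have "h \<in> borel_measurable lebesgue" by (rule Lp_space_measurable[OF assms])
  moreover have "integrable lebesgue (\<lambda>x. cmod (h x * of_real (\<omega> x)))" using assms by (simp add: Lp_space_def one_ereal_def)
  then have "integrable lebesgue (\<lambda>x. cmod c * cmod (h x * of_real (\<omega> x)))" by (rule integrable_mult_right)
  ultimately show ?thesis by (simp add: Lp_space_def one_ereal_def norm_mult mult.assoc)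
qed

lemma twisted_conv_right_weak_star_continuous:
  fixes \<omega>0 \<omega>1 \<omega>2 :: "'d::finite phase_space \<Rightarrow> real"
  assumes mod: "poly_moderate \<omega>0" "poly_moderate \<omega>1" "poly_moderate \<omega>2"
    and C: "\<And>X1 X2. \<omega>0 (X1 + X2) \<le> C * \<omega>1 X1 * \<omega>2 X2"
    and mem: "\<And>A B. A \<in> Lp_space 1 \<omega>1 \<Longrightarrow> B \<in> Lp_space \<infinity> \<omega>2 \<Longrightarrow> twisted_conv A B \<in> Lp_space \<infinity> \<omega>0"
    and A: "A \<in> Lp_space 1 \<omega>1"
  shows "continuous_map (weak_star_topology \<omega>2) (weak_star_topology \<omega>0) (\<lambda>B. twisted_conv A B)"
proof (rule continuous_map_weak_star_adjoint[OF mem[OF A]])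
  fix g assume g: "g \<in> Lp_space 1 (\<lambda>x. 1 / \<omega>0 x)"
  have C': "\<omega>0 (X1 + X2) \<le> C * \<omega>2 X1 * \<omega>1 X2" for X1 X2 using C[of X2 X1] by (simp add: add.commute mult_ac)
  obtain h where h: "h \<in> Lp_space 1 (\<lambda>x. 1 / \<omega>2 x)"
    "\<And>B. B \<in> Lp_space \<infinity> \<omega>2 \<Longrightarrow> (LINT X|lebesgue. (LINT Z|lebesgue. B Z * A (X - Z) * cis (2 * sympl X Z)) * g X) = (LINT Z|lebesgue. B Z * h Z)"
    by (rule weak_star_adjoint[OF mod(1) mod(3) mod(2) C' A g]) (rule that)
  let ?c = "tc_const TYPE('d)"
  have tw: "twisted_conv A B X = ?c * (LINT Z|lebesgue. B Z * A (X - Z) * cis (2 * sympl X Z))" for B :: "'d phase_space \<Rightarrow> complex" and X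
    unfolding twisted_conv_def tc_const_def exp_sympl_eq_cis by (simp add: mult_ac)
  have "(LINT X|lebesgue. twisted_conv A B X * g X) = (LINT Z|lebesgue. B Z * (?c * h Z))" if "B \<in> Lp_space \<infinity> \<omega>2" for B
  proof -
    have "(LINT X|lebesgue. twisted_conv A B X * g X) = ?c * (LINT X|lebesgue. (LINT Z|lebesgue. B Z * A (X - Z) * cis (2 * sympl X Z)) * g X)"
      unfolding tw mult.assoc by (rule integral_mult_right_zero)
    also have "\<dots> = ?c * (LINT Z|lebesgue. B Z * h Z)" by (simp only: h(2)[OF that])
    also have "\<dots> = (LINT Z|lebesgue. B Z * (?c * h Z))"
      unfolding integral_mult_right_zero[symmetric] by (simp add: mult_ac)
    finally show ?thesis .
  qed
  note eq = this
  show "\<exists>h\<in>Lp_space 1 (\<lambda>x. 1 / \<omega>2 x). \<forall>B\<in>Lp_space \<infinity> \<omega>2. (LINT X|lebesgue. twisted_conv A B X * g X) = (LINT Z|lebesgue. B Z * h Z)"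
    by (rule bexI[of _ "\<lambda>Z. ?c * h Z"]) (intro ballI eq, assumption, rule L1_space_scale[OF h(1)])
qed

text \<open>The substitution \<open>Z = X - Y\<close> brings the left argument to the form treated by \<open>weak_star_adjoint\<close> and reverses the sign of
the phase, since \<open>\<sigma>(X, X - Z) = - \<sigma>(X, Z)\<close>.\<close>

lemma twisted_conv_left_weak_star_continuous:
  fixes \<omega>0 \<omega>1 \<omega>2 :: "'d::finite phase_space \<Rightarrow> real"
  assumes mod: "poly_moderate \<omega>0" "poly_moderate \<omega>1" "poly_moderate \<omega>2"
    and C: "\<And>X1 X2. \<omega>0 (X1 + X2) \<le> C * \<omega>1 X1 * \<omega>2 X2"
    and mem: "\<And>A B. A \<in> Lp_space \<infinity> \<omega>1 \<Longrightarrow> B \<in> Lp_space 1 \<omega>2 \<Longrightarrow> twisted_conv A B \<in> Lp_space \<infinity> \<omega>0"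
    and A: "A \<in> Lp_space 1 \<omega>2"
  shows "continuous_map (weak_star_topology \<omega>1) (weak_star_topology \<omega>0) (\<lambda>B. twisted_conv B A)"
proof (rule continuous_map_weak_star_adjoint[OF mem[OF _ A]])
  fix g assume g: "g \<in> Lp_space 1 (\<lambda>x. 1 / \<omega>0 x)"
  obtain h where h: "h \<in> Lp_space 1 (\<lambda>x. 1 / \<omega>1 x)"
    "\<And>B. B \<in> Lp_space \<infinity> \<omega>1 \<Longrightarrow> (LINT X|lebesgue. (LINT Z|lebesgue. B Z * A (X - Z) * cis (- 2 * sympl X Z)) * g X) = (LINT Z|lebesgue. B Z * h Z)"
    by (rule weak_star_adjoint[OF mod C A g]) (rule that)
  let ?c = "tc_const TYPE('d)"
  have "(LINT X|lebesgue. twisted_conv B A X * g X) = (LINT Z|lebesgue. B Z * (?c * h Z))" if B: "B \<in> Lp_space \<infinity> \<omega>1" for B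
  proof -
    have tw: "twisted_conv B A X = ?c * (LINT Z|lebesgue. B Z * A (X - Z) * cis (- 2 * sympl X Z))" for X
    proof -
      have m: "(\<lambda>Y. B (X - Y) * A Y * cis (2 * sympl X Y)) \<in> borel_measurable lebesgue"
      proof -
        obtain A' where [measurable]: "A' \<in> borel_measurable borel" and aeA: "AE X in lborel. A X = A' X"
          by (rule Lebesgue_Borel_representative[OF Lp_space_measurable[OF A]])
        obtain B' where [measurable]: "B' \<in> borel_measurable borel" and aeB: "AE X in lborel. B X = B' X"
          by (rule Lebesgue_Borel_representative[OF Lp_space_measurable[OF B]])
        show ?thesis
          by (rule integral_lebesgue_cong_Borel(3)[OF twisted_conv_integrand_cong[OF aeB aeA, of X, unfolded exp_sympl_eq_cis]]) simp
      qed
      have s: "sympl X (X - Z) = - sympl X Z" for Z by (simp add: sympl_def inner_diff_left inner_diff_right inner_commute)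
      have "twisted_conv B A X = ?c * (LINT Y|lebesgue. B (X - Y) * A Y * cis (2 * sympl X Y))"
        unfolding twisted_conv_def tc_const_def exp_sympl_eq_cis ..
      also have "\<dots> = ?c * (LINT Z|lebesgue. B Z * A (X - Z) * cis (- 2 * sympl X Z))"
        unfolding integral_lebesgue_reflect[OF m, of X] by (simp add: s)
      finally show ?thesis .
    qed
    have "(LINT X|lebesgue. twisted_conv B A X * g X) = ?c * (LINT X|lebesgue. (LINT Z|lebesgue. B Z * A (X - Z) * cis (- 2 * sympl X Z)) * g X)"
      unfolding tw mult.assoc by (rule integral_mult_right_zero)
    also have "\<dots> = ?c * (LINT Z|lebesgue. B Z * h Z)" by (simp only: h(2)[OF that])
    also have "\<dots> = (LINT Z|lebesgue. B Z * (?c * h Z))"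
      unfolding integral_mult_right_zero[symmetric] by (simp add: mult_ac)
    finally show ?thesis .
  qed
  note eq = this
  show "\<exists>h\<in>Lp_space 1 (\<lambda>x. 1 / \<omega>1 x). \<forall>B\<in>Lp_space \<infinity> \<omega>1. (LINT X|lebesgue. twisted_conv B A X * g X) = (LINT Z|lebesgue. B Z * h Z)"
    by (rule bexI[of _ "\<lambda>Z. ?c * h Z"]) (intro ballI eq, assumption, rule L1_space_scale[OF h(1)])
qed

text \<open>Extend the identity first in the second argument, with a Schwartz function in the first, and then in the
first argument with an arbitrary function in the second. Each step uses weak* continuity if the exponent of the varying argument is infinite and
norm continuity if not.\<close>

lemma twisted_conv_extension_unique:
  fixes \<omega>0 \<omega>1 \<omega>2 :: "'d::finite phase_space \<Rightarrow> real"
  assumes mod: "poly_moderate \<omega>0" "poly_moderate \<omega>1" "poly_moderate \<omega>2"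
    and p: "1 \<le> p" "1 \<le> p1" "1 \<le> p2"
    and T: "twisted_conv_extension p1 p2 p \<omega>1 \<omega>2 \<omega>0 T" "twisted_conv_extension p1 p2 p \<omega>1 \<omega>2 \<omega>0 T'"
    and a: "a1 \<in> Lp_space p1 \<omega>1" "a2 \<in> Lp_space p2 \<omega>2"
  shows "AE X in lebesgue. T' (a1, a2) X = T (a1, a2) X"
proof -
  have S: "AE X in lebesgue. T' (a1, a2) X = T (a1, a2) X" if "a1 \<in> Schwartz" "a2 \<in> Schwartz" for a1 a2
  proof -
    have "AE X in lebesgue. T (a1, a2) X = twisted_conv a1 a2 X" "AE X in lebesgue. T' (a1, a2) X = twisted_conv a1 a2 X"
      by (rule T(1)[unfolded twisted_conv_extension_def, THEN conjunct1, rule_format, OF that] T(2)[unfolded twisted_conv_extension_def, THEN conjunct1, rule_format, OF that])+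
    then show ?thesis by eventually_elim simp
  qed
  have cont: "continuous_map (prod_topology (Lp_topology p1 \<omega>1) (Lp_topology p2 \<omega>2)) (Lp_topology p \<omega>0) U" if "twisted_conv_extension p1 p2 p \<omega>1 \<omega>2 \<omega>0 U" for U
    by (rule that[unfolded twisted_conv_extension_def, THEN conjunct2, THEN conjunct1])
  have ws1: "continuous_map (weak_star_topology \<omega>1) (weak_star_topology \<omega>0) (\<lambda>a1. U (a1, a2))"
    if "twisted_conv_extension p1 p2 p \<omega>1 \<omega>2 \<omega>0 U" "p1 = \<infinity>" "a2 \<in> Lp_space p2 \<omega>2" for U a2
    by (rule that(1)[unfolded twisted_conv_extension_def, THEN conjunct2, THEN conjunct2, THEN conjunct1, rule_format, OF that(2,3)])
  have ws2: "continuous_map (weak_star_topology \<omega>2) (weak_star_topology \<omega>0) (\<lambda>a2. U (a1, a2))"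
    if "twisted_conv_extension p1 p2 p \<omega>1 \<omega>2 \<omega>0 U" "p2 = \<infinity>" "a1 \<in> Lp_space p1 \<omega>1" for U a1
    by (rule that(1)[unfolded twisted_conv_extension_def, THEN conjunct2, THEN conjunct2, THEN conjunct2, rule_format, OF that(2,3)])
  have n1: "continuous_map (Lp_topology p1 \<omega>1) (Lp_topology p \<omega>0) (\<lambda>a1. U (a1, a2))" if "twisted_conv_extension p1 p2 p \<omega>1 \<omega>2 \<omega>0 U" "a2 \<in> Lp_space p2 \<omega>2" for U a2
    using continuous_map_compose[OF continuous_map_pairedI[OF continuous_map_id continuous_map_const[THEN iffD2]] cont[OF that(1)], of a2] that(2) p(3)
    by (simp add: comp_def)
  have n2: "continuous_map (Lp_topology p2 \<omega>2) (Lp_topology p \<omega>0) (\<lambda>a2. U (a1, a2))" if "twisted_conv_extension p1 p2 p \<omega>1 \<omega>2 \<omega>0 U" "a1 \<in> Lp_space p1 \<omega>1" for U a1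
    using continuous_map_compose[OF continuous_map_pairedI[OF continuous_map_const[THEN iffD2] continuous_map_id] cont[OF that(1)], of a1] that(2) p(2)
    by (simp add: comp_def)
  have 2: "AE X in lebesgue. T' (b1, b2) X = T (b1, b2) X" if b: "b1 \<in> Schwartz" "b2 \<in> Lp_space p2 \<omega>2" for b1 b2
  proof -
    have b1: "b1 \<in> Lp_space p1 \<omega>1" by (rule Schwartz_in_Lp_space[OF p(2) mod(2) b(1)])
    show ?thesis
    proof (cases "p2 = \<infinity>")
      case True
      show ?thesis
        by (rule unique_weak_star_extension[OF mod(3,1) ws2[OF T(2) True b1] ws2[OF T(1) True b1] S[OF b(1)]])
           (use b(2) True in simp_all)
    next
      case False
      show ?thesis
        by (rule unique_norm_extension[OF p(3) False mod(3) p(1) mod(1) n2[OF T(2) b1] n2[OF T(1) b1] S[OF b(1)] b(2)])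
    qed
  qed
  show ?thesis
  proof (cases "p1 = \<infinity>")
    case True
    show ?thesis
      by (rule unique_weak_star_extension[OF mod(2,1) ws1[OF T(2) True a(2)] ws1[OF T(1) True a(2)] 2[OF _ a(2)]])
         (use a(1) True in simp_all)
  next
    case False
    show ?thesis
      by (rule unique_norm_extension[OF p(2) False mod(2) p(1) mod(1) n1[OF T(2) a(2)] n1[OF T(1) a(2)] 2[OF _ a(2)] a(1)])
  qed
qed

theorem theorem3p4:
  fixes \<omega>0 \<omega>1 \<omega>2 :: "'d::finite phase_space \<Rightarrow> real"
    and p p' p1 p2 :: ereal
  assumes "poly_moderate \<omega>0" "poly_moderate \<omega>1" "poly_moderate \<omega>2"
    and "\<exists>C. \<forall>X1 X2. \<omega>0 (X1 + X2) \<le> C * \<omega>1 X1 * \<omega>2 X2"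
    and "1 \<le> p" "1 \<le> p1" "1 \<le> p2"
    and "1 \<le> p'" "1 / p + 1 / p' = 1"
    and "p1 \<le> p" "p2 \<le> p"
    and "max (1 / p) (1 / p') \<le> 1 / p1 + 1 / p2 - 1 / p"
    and "1 / p1 + 1 / p2 - 1 / p \<le> 1"
  shows "(\<forall>a1 \<in> Schwartz. \<forall>a2 \<in> Schwartz.
            twisted_conv a1 a2 \<in> (Schwartz :: ('d phase_space \<Rightarrow> complex) set)) \<and>
         (\<exists>T. twisted_conv_extension p1 p2 p \<omega>1 \<omega>2 \<omega>0 T \<and>
            (\<forall>T'. twisted_conv_extension p1 p2 p \<omega>1 \<omega>2 \<omega>0 T' \<longrightarrow>
               (\<forall>a1 \<in> Lp_space p1 \<omega>1. \<forall>a2 \<in> Lp_space p2 \<omega>2.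
                  AE X in lebesgue. T' (a1, a2) X = T (a1, a2) X)) \<and>
            (\<exists>C. \<forall>a1 \<in> Lp_space p1 \<omega>1. \<forall>a2 \<in> Lp_space p2 \<omega>2.
               Lp_norm p \<omega>0 (T (a1, a2)) \<le> C * Lp_norm p1 \<omega>1 a1 * Lp_norm p2 \<omega>2 a2))"
proof -
  note mod = assms(1-3) and p = assms(5-7)
  note region = exponent_region[OF assms(5-13)]
  have w: "\<omega>0 \<in> borel_measurable lebesgue" "\<And>x. 0 < \<omega>0 x" "\<omega>1 \<in> borel_measurable lebesgue" "\<And>x. 0 < \<omega>1 x"
    "\<omega>2 \<in> borel_measurable lebesgue" "\<And>x. 0 < \<omega>2 x"
    using mod by (auto simp: poly_moderate_def)
  obtain C where C: "\<And>X1 X2. \<omega>0 (X1 + X2) \<le> C * \<omega>1 X1 * \<omega>2 X2" using assms(4) by blast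
  obtain M where M: "0 < M"
    and est: "\<And>a1 a2. a1 \<in> Lp_space p1 \<omega>1 \<Longrightarrow> a2 \<in> Lp_space p2 \<omega>2 \<Longrightarrow>
       twisted_conv a1 a2 \<in> Lp_space p \<omega>0 \<and> Lp_norm p \<omega>0 (twisted_conv a1 a2) \<le> M * Lp_norm p1 \<omega>1 a1 * Lp_norm p2 \<omega>2 a2"
    and int: "\<And>a1 a2. a1 \<in> Lp_space p1 \<omega>1 \<Longrightarrow> a2 \<in> Lp_space p2 \<omega>2 \<Longrightarrow>
       AE X in lebesgue. integrable lebesgue (\<lambda>Y. a1 (X - Y) * a2 Y * exp (2 * \<i> * of_real (sympl X Y)))"
    by (rule twisted_conv_estimate[OF mod assms(4) p region(1-4)]) (rule that)
  define T where "T = (\<lambda>(a1, a2). twisted_conv a1 a2 :: 'd phase_space \<Rightarrow> complex)"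
  have T: "T (a1, a2) = twisted_conv a1 a2" for a1 a2 by (simp add: T_def)
  have cont: "continuous_map (prod_topology (Lp_topology p1 \<omega>1) (Lp_topology p2 \<omega>2)) (Lp_topology p \<omega>0) T"
    unfolding T_def
  proof (rule continuous_map_Lp_bilinear[OF p w M])
    fix a b a' b' assume m: "a \<in> Lp_space p1 \<omega>1" "b \<in> Lp_space p2 \<omega>2" "a' \<in> Lp_space p1 \<omega>1" "b' \<in> Lp_space p2 \<omega>2"
    show "AE x in lebesgue. twisted_conv a' b' x - twisted_conv a b x = twisted_conv (\<lambda>x. a' x - a x) b' x + twisted_conv a (\<lambda>x. b' x - b x) x"
      using int[OF m(3,4)] int[OF m(1,4)] int[OF m(1,2)] by eventually_elim (rule twisted_conv_diff)
  qed (use est in blast)+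
  have ws1: "continuous_map (weak_star_topology \<omega>1) (weak_star_topology \<omega>0) (\<lambda>a1. twisted_conv a1 a2)"
    if "p1 = \<infinity>" "a2 \<in> Lp_space p2 \<omega>2" for a2
    by (rule twisted_conv_left_weak_star_continuous[OF mod C]) (use est region(5)[OF that(1)] that in auto)
  have ws2: "continuous_map (weak_star_topology \<omega>2) (weak_star_topology \<omega>0) (\<lambda>a2. twisted_conv a1 a2)"
    if "p2 = \<infinity>" "a1 \<in> Lp_space p1 \<omega>1" for a1
    by (rule twisted_conv_right_weak_star_continuous[OF mod C]) (use est region(6)[OF that(1)] that in auto)
  have ext: "twisted_conv_extension p1 p2 p \<omega>1 \<omega>2 \<omega>0 T"
    unfolding twisted_conv_extension_def T using cont ws1 ws2 by simp
  show ?thesis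
  proof (intro conjI exI[of _ T] ballI allI impI)
    show "AE X in lebesgue. T' (a1, a2) X = T (a1, a2) X"
      if "twisted_conv_extension p1 p2 p \<omega>1 \<omega>2 \<omega>0 T'" "a1 \<in> Lp_space p1 \<omega>1" "a2 \<in> Lp_space p2 \<omega>2" for T' a1 a2
      by (rule twisted_conv_extension_unique[OF mod p ext that])
    show "\<exists>C. \<forall>a1\<in>Lp_space p1 \<omega>1. \<forall>a2\<in>Lp_space p2 \<omega>2. Lp_norm p \<omega>0 (T (a1, a2)) \<le> C * Lp_norm p1 \<omega>1 a1 * Lp_norm p2 \<omega>2 a2"
      unfolding T using est by blast
  qed (use twisted_conv_Schwartz ext in auto)
qed

end
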